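(* Let $m>0$. There is a constant $C>0$ (independent of $w$ and $f$) such that the following holds. Let $w\in\mathcal{KS}$ be a weight on $\mathbb{R}^3$ and let $f\in H^{1/2}(\mathbb{R}^3;\mathbb{C}^4)$. Then the solution $u:\mathbb{R}^{3+1}\to\mathbb{C}^4$ of the Dirac equation $$-i\partial_t u+\mathcal{D}u+m\beta u=0,\qquad u(x,0)=f(x),$$ satisfies $$u\in C([0,\infty);H^{1/2}(\mathbb{R}^3;\mathbb{C}^4))$$ and $$\|u\|_{L^2_{x,t}(w)}\le C\,\|w\|_{\mathcal{KS}}^{1/2}\,\|f\|_{H^{1/2}}.$$
   Context: Dirac operator: $\mathcal{D}=-i\sum_{j=1}^3\alpha_j\partial_j$, with the $4\times4$ Dirac matrices $$\alpha_j=\begin{pmatrix}0&\sigma_j\\ \sigma_j&0\end{pmatrix},\quad \beta=\begin{pmatrix}I_2&0\\0&-I_2\end{pmatrix},\quad \sigma_1=\begin{pmatrix}0&1\\1&0\end{pmatrix},\ \sigma_2=\begin{pmatrix}0&-i\\ i&0\end{pmatrix},\ \sigma_3=\begin{pmatrix}1&0\\0&-1\end{pmatrix}.$$ The solution: $u(\cdot,t)=e^{-it(\mathcal{D}+m\beta)}f$, i.e. on the Fourier side in $x$, $\widehat{u}(\xi,t)=\exp\!\big(-it(\sum_{j=1}^3\alpha_j\xi_j+m\beta)\big)\widehat{f}(\xi)$ (matrix exponential), for $t\in\mathbb{R}$. Kerman–Sawyer class: a weight is a locally integrable function $w:\mathbb{R}^3\to[0,\infty]$. One writes $w\in\mathcal{KS}$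 if $$\|w\|_{\mathcal{KS}}:=\sup_Q\left(\int_Q w(x)\,dx\right)^{-1}\int_Q\int_Q\frac{w(x)w(y)}{|x-y|}\,dx\,dy<\infty,$$ where the supremum is over all dyadic cubes $Q\subset\mathbb{R}^3$ (cubes with $\int_Q w=0$ contribute $0$). Norms: $\|u\|_{L^2_{x,t}(w)}=\left(\int_{\mathbb{R}}\int_{\mathbb{R}^3}|u(x,t)|^2\,w(x)\,dx\,dt\right)^{1/2}$. $H^{1/2}$ is the usual inhomogeneous Sobolev space on $\mathbb{R}^3$, with norm $\|f\|_{H^{1/2}}=\|\langle D\rangle^{1/2}f\|_{L^2}$, where $\langle D\rangle=\sqrt{1-\Delta}$ is the Fourier multiplier with symbol $\langle\xi\rangle=\sqrt{1+|\xi|^2}$. The constant $C$ may depend on the fixed mass $m$. *)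

theory Defs
  imports "HOL-Analysis.Analysis"
begin

definition pauli :: "3 \<Rightarrow> complex^2^2" where
  "pauli j =
    (if j = 1 then vector [vector [0, 1], vector [1, 0]]
     else if j = 2 then vector [vector [0, -\<i>], vector [\<i>, 0]]
     else vector [vector [1, 0], vector [0, -1]])"

definition block_matrix ::
    "complex^2^2 \<Rightarrow> complex^2^2 \<Rightarrow> complex^2^2 \<Rightarrow> complex^2^2 \<Rightarrow> complex^4^4" where
  "block_matrix A B C D = vector
    [vector [A$1$1, A$1$2, B$1$1, B$1$2],
     vector [A$2$1, A$2$2, B$2$1, B$2$2],
     vector [C$1$1, C$1$2, D$1$1, D$1$2],
     vector [C$2$1, C$2$2, D$2$1, D$2$2]]"

definition dirac_alpha :: "3 \<Rightarrow> complex^4^4" where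
  "dirac_alpha j = block_matrix 0 (pauli j) (pauli j) 0"

definition dirac_beta :: "complex^4^4" where
  "dirac_beta = block_matrix (mat 1) 0 0 (- mat 1)"

definition dirac_symbol :: "real \<Rightarrow> real^3 \<Rightarrow> complex^4^4" where
  "dirac_symbol m \<xi> = (\<Sum>j\<in>UNIV. (\<xi> $ j) *\<^sub>R dirac_alpha j) + m *\<^sub>R dirac_beta"

text \<open>
  The multiplication \<open>*\<close> on \<open>complex^4^4\<close> is entrywise, so matrix powers and the
  matrix exponential are built from the matrix product \<open>**\<close>.
\<close>

primrec matrix_pow :: "complex^4^4 \<Rightarrow> nat \<Rightarrow> complex^4^4" where
  "matrix_pow A 0 = mat 1"
| "matrix_pow A (Suc n) = A ** matrix_pow A n"

definition matrix_exp :: "complex^4^4 \<Rightarrow> complex^4^4" where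
  "matrix_exp A = (\<Sum>n. inverse (fact n) *\<^sub>R matrix_pow A n)"

definition dirac_propagator :: "real \<Rightarrow> real \<Rightarrow> real^3 \<Rightarrow> complex^4^4" where
  "dirac_propagator m t \<xi> =
    matrix_exp (\<chi> i j. - \<i> * complex_of_real t * dirac_symbol m \<xi> $ i $ j)"

definition L2 :: "(real^3 \<Rightarrow> complex^4) set" where
  "L2 = {f \<in> borel_measurable lebesgue. integrable lebesgue (\<lambda>x. (norm (f x))\<^sup>2)}"

definition L2_norm :: "(real^3 \<Rightarrow> complex^4) \<Rightarrow> real" where
  "L2_norm f = sqrt (LINT x|lebesgue. (norm (f x))\<^sup>2)"

definition truncated_fourier :: "real \<Rightarrow> (real^3 \<Rightarrow> complex^4) \<Rightarrow> real^3 \<Rightarrow> complex^4" where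
  "truncated_fourier R f \<xi> =
    (2 * pi) powr (-3/2) *\<^sub>R
      (LINT x:cball 0 R|lebesgue. exp (- \<i> * complex_of_real (x \<bullet> \<xi>)) *s f x)"

text \<open>
  \<open>F\<close> is (a representative of) the unitary Fourier transform of \<open>f\<close>, the limit in the mean
  of the truncated Fourier integrals.
\<close>

definition has_fourier :: "(real^3 \<Rightarrow> complex^4) \<Rightarrow> (real^3 \<Rightarrow> complex^4) \<Rightarrow> bool" where
  "has_fourier f F \<longleftrightarrow> f \<in> L2 \<and> F \<in> L2 \<and>
    ((\<lambda>R. \<integral>\<^sup>+\<xi>. ennreal ((norm (F \<xi> - truncated_fourier R f \<xi>))\<^sup>2) \<partial>lebesgue) \<longlongrightarrow> 0) at_top"

text \<open>
  \<open>fourier_multiplier a f g\<close> states that \<open>f\<close> lies in the \<open>L\<^sup>2\<close> domain of the multiplier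
  \<open>a(D)\<close> with matrix-valued symbol \<open>a\<close> and that \<open>g = a(D) f\<close> almost everywhere.
\<close>

definition fourier_multiplier ::
    "(real^3 \<Rightarrow> complex^4^4) \<Rightarrow> (real^3 \<Rightarrow> complex^4) \<Rightarrow> (real^3 \<Rightarrow> complex^4) \<Rightarrow> bool" where
  "fourier_multiplier a f g \<longleftrightarrow>
    (\<exists>F G. has_fourier f F \<and> has_fourier g G \<and> (AE \<xi> in lebesgue. G \<xi> = a \<xi> *v F \<xi>))"

definition japanese :: "real^3 \<Rightarrow> real" where
  "japanese \<xi> = sqrt (1 + (norm \<xi>)\<^sup>2)"

definition half_bessel :: "(real^3 \<Rightarrow> complex^4) \<Rightarrow> (real^3 \<Rightarrow> complex^4) \<Rightarrow> bool" where
  "half_bessel = fourier_multiplier (\<lambda>\<xi>. mat (complex_of_real (japanese \<xi> powr (1/2))))"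

definition H_half :: "(real^3 \<Rightarrow> complex^4) set" where
  "H_half = {f. \<exists>g. half_bessel f g}"

text \<open>
  The function \<open>g\<close> chosen below is unique up to null sets, so the norm does not depend on the
  choice.
\<close>

definition H_half_norm :: "(real^3 \<Rightarrow> complex^4) \<Rightarrow> real" where
  "H_half_norm f = L2_norm (SOME g. half_bessel f g)"

definition continuous_into_H_half :: "real set \<Rightarrow> (real \<Rightarrow> real^3 \<Rightarrow> complex^4) \<Rightarrow> bool" where
  "continuous_into_H_half T u \<longleftrightarrow>
    (\<forall>t\<in>T. u t \<in> H_half \<and> ((\<lambda>s. H_half_norm (\<lambda>x. u s x - u t x)) \<longlongrightarrow> 0) (at t within T))"

text \<open>
  \<open>u t\<close> is the spatial profile at time \<open>t\<close>, obtained from the datum \<open>f\<close> by the Dirac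
  propagator. With the Fourier kernel \<open>exp (- i x \<bullet> \<xi>)\<close> used above, \<open>-i \<Sum>\<^sub>j \<alpha>\<^sub>j \<partial>\<^sub>j + m \<beta>\<close>
  has symbol \<open>dirac_symbol m\<close>.
\<close>

definition dirac_solution ::
    "real \<Rightarrow> (real^3 \<Rightarrow> complex^4) \<Rightarrow> (real \<Rightarrow> real^3 \<Rightarrow> complex^4) \<Rightarrow> bool" where
  "dirac_solution m f u \<longleftrightarrow> (\<forall>t. fourier_multiplier (dirac_propagator m t) f (u t))"

definition weight :: "(real^3 \<Rightarrow> ennreal) \<Rightarrow> bool" where
  "weight w \<longleftrightarrow> w \<in> borel_measurable lebesgue \<and>
    (\<forall>K. compact K \<longrightarrow> (\<integral>\<^sup>+x\<in>K. w x \<partial>lebesgue) < \<infinity>)"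

definition dyadic_cube :: "int \<Rightarrow> int^3 \<Rightarrow> (real^3) set" where
  "dyadic_cube k n =
    {x. \<forall>i. 2 powi k * real_of_int (n $ i) \<le> x $ i \<and> x $ i < 2 powi k * (real_of_int (n $ i) + 1)}"

text \<open>
  On the diagonal the kernel is \<open>inverse 0 = \<infinity>\<close> in \<open>ennreal\<close>; the diagonal is a null set.
\<close>

definition KS_norm :: "(real^3 \<Rightarrow> ennreal) \<Rightarrow> ennreal" where
  "KS_norm w = (SUP (k, n)\<in>UNIV. let Q = dyadic_cube k n in
    if (\<integral>\<^sup>+x\<in>Q. w x \<partial>lebesgue) = 0 then 0
    else inverse (\<integral>\<^sup>+x\<in>Q. w x \<partial>lebesgue) *
      (\<integral>\<^sup>+x\<in>Q. (\<integral>\<^sup>+y\<in>Q. w x * w y * inverse (ennreal (norm (x - y))) \<partial>lebesgue) \<partial>lebesgue))"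

definition KS :: "(real^3 \<Rightarrow> ennreal) set" where
  "KS = {w. weight w \<and> KS_norm w < \<infinity>}"

definition ennsqrt :: "ennreal \<Rightarrow> ennreal" where
  "ennsqrt a = (if a = \<infinity> then \<infinity> else ennreal (sqrt (enn2real a)))"

text \<open>
  The inner integral only depends on the classes of the \<open>u t\<close> modulo null sets. For a Dirac solution,
  \<open>L\<^sup>2\<close>-continuity in time and Fatou's lemma make it lower semicontinuous in \<open>t\<close>, so no joint
  measurability of \<open>u\<close> is needed.
\<close>

definition weighted_L2_norm :: "(real^3 \<Rightarrow> ennreal) \<Rightarrow> (real \<Rightarrow> real^3 \<Rightarrow> complex^4) \<Rightarrow> ennreal" where
  "weighted_L2_norm w u =
    ennsqrt (\<integral>\<^sup>+t. (\<integral>\<^sup>+x. ennreal ((norm (u t x))\<^sup>2) * w x \<partial>lebesgue) \<partial>lebesgue)"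

end

theory Submission
  imports Defs "HOL-Probability.Characteristic_Functions"
begin

text \<open>
  The symbol \<open>S(\<xi>) = \<Sum>\<^sub>j \<xi>\<^sub>j \<alpha>\<^sub>j + m \<beta>\<close>
  satisfies \<open>S\<^sup>2 = \<lambda>\<^sup>2\<close> with the energy
  \<open>\<lambda>(\<xi>) = sqrt (|\<xi>|\<^sup>2 + m\<^sup>2)\<close>, so the propagator splits
  into two scalar phases \<open>exp (\<plusminus> i t \<lambda>)\<close> times spectral
  projections (\<open>dirac_propagator_eq\<close>). Every component of the solution is a sum of
  two scalar half-waves. Existence is surjectivity of the Fourier transform on
  \<open>L\<^sup>2\<close> (\<open>has_fourier_surj\<close>), and continuity in the Sobolev norm
  is dominated convergence on the Fourier side (\<open>dirac_solution_continuous\<close>). Since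
  \<open>\<lambda>\<close> is at most \<open>max 1 m\<close> times
  \<open>\<langle>\<xi>\<rangle>\<close>, the weighted bound reduces to the estimate of
  \<open>\<integral>\<integral> |v|\<^sup>2 w dx dt\<close> by the Kerman--Sawyer norm times
  \<open>\<integral> \<lambda> |h|\<^sup>2 d\<xi>\<close>, for a half-wave \<open>v\<close> whose
  datum has Fourier transform \<open>h\<close>.

  This estimate is proved by duality (\<open>local_smoothing\<close>). The space-time integral
  \<open>I\<close> over a time window is the pairing of \<open>h\<close> with the space-time
  Fourier transform \<open>J\<close> of \<open>v w\<close> on the mass shell
  \<open>\<tau> = \<lambda>(\<xi>)\<close>, and it is enough to bound
  \<open>\<integral> |J|\<^sup>2 / \<lambda> d\<xi>\<close> by a multiple of \<open>I\<close>
  (\<open>dual_estimate\<close>). Expanding the square, the integral over \<open>\<xi>\<close> is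
  the Fourier transform at \<open>x - y\<close> of a radial function. In dimension three it is at
  most \<open>2 pi / |x - y|\<close> times the \<open>L\<^sup>1\<close> norm of the profile in the
  variable \<open>|\<xi>|\<^sup>2 = \<tau>\<^sup>2 - m\<^sup>2\<close>
  (\<open>radial_fourier_bound\<close>), and the weight \<open>1 / \<lambda>\<close> is what turns
  this into an integral over \<open>\<tau>\<close>. There remains, for each frequency
  \<open>\<tau>\<close>, the Newtonian energy of \<open>\<psi> w\<close>, where
  \<open>\<psi>\<close> is the modulus of the Fourier transform of \<open>v\<close> in time.

  The Kerman--Sawyer condition is this energy inequality for the indicator functions
  \<open>\<psi>\<close> of dyadic cubes; it implies the inequality for all \<open>\<psi>\<close>
  (\<open>weighted_energy\<close>). Indeed \<open>1 / |x - y|\<close> is at most twice the sum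
  over scales \<open>k\<close> of \<open>2 powi (- k)\<close> times the indicator of pairs in
  neighbouring cubes of side \<open>2 powi k\<close> (\<open>kernel_le_near\<close>). As energies
  are quadratic, neighbouring cubes can be replaced by equal ones, which leaves sums of squares of
  masses over the dyadic tree. Bounding them is a Carleson embedding theorem
  (\<open>carleson_tree\<close>), proved with a Bellman function, and the condition on cubes is
  the Carleson condition.

  The smoothing estimate is carried out for bounded weights of bounded support and data with
  bounded, boundedly supported transforms, where every integral converges absolutely; the general
  case follows from Fatou's lemma (\<open>weighted_estimate\<close>). The Fourier transform
  defined by limits in the mean is treated by Gaussian regularization:
  \<open>regularized_parseval\<close> yields Bessel's inequality and Parseval's identity, the
  latter yields \<open>inversion\<close>, and completeness of \<open>L\<^sup>2\<close> yields
  surjectivity.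
\<close>

section \<open>Square-integrable functions\<close>

definition square_integrable :: "'x measure \<Rightarrow> ('x \<Rightarrow> 'b::euclidean_space) \<Rightarrow> bool" where
  "square_integrable M f \<longleftrightarrow> f \<in> borel_measurable M \<and> integrable M (\<lambda>x. (norm (f x))\<^sup>2)"

definition l2norm :: "'x measure \<Rightarrow> ('x \<Rightarrow> 'b::euclidean_space) \<Rightarrow> real" where
  "l2norm M f = sqrt (LINT x|M. (norm (f x))\<^sup>2)"

lemma l2norm_nonneg[simp]: "0 \<le> l2norm M f"
  by (simp add: l2norm_def)

lemma l2norm_sq: "(l2norm M f)\<^sup>2 = (LINT x|M. (norm (f x))\<^sup>2)"
  by (simp add: l2norm_def)

lemma square_integrable_iff_nn_integral:
  assumes "f \<in> borel_measurable M"
  shows "square_integrable M f \<longleftrightarrow> (\<integral>\<^sup>+x. ennreal ((norm (f x))\<^sup>2) \<partial>M) < \<infinity>"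
  using assms by (auto simp: square_integrable_def integrable_iff_bounded)

lemma nn_integral_eq_l2norm: "square_integrable M f \<Longrightarrow> (\<integral>\<^sup>+x. ennreal ((norm (f x))\<^sup>2) \<partial>M) = ennreal ((l2norm M f)\<^sup>2)"
  by (simp add: square_integrable_def l2norm_sq nn_integral_eq_integral)

lemma norm_sq_split:
  fixes a b :: "'b::euclidean_space" assumes "d > 0"
  shows "(norm (a + b))\<^sup>2 \<le> (1 + d) * (norm a)\<^sup>2 + (1 + 1/d) * (norm b)\<^sup>2"
proof -
  have "(norm (a + b))\<^sup>2 \<le> (norm a + norm b)\<^sup>2"
    by (intro power_mono norm_triangle_ineq) auto
  also have "\<dots> \<le> (1 + d) * (norm a)\<^sup>2 + (1 + 1/d) * (norm b)\<^sup>2"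
  proof -
    have "0 \<le> (d * norm a - norm b)\<^sup>2 / d" using assms by simp
    also have "\<dots> = d * (norm a)\<^sup>2 + (norm b)\<^sup>2 / d - 2 * norm a * norm b"
      using assms by (simp add: power2_eq_square field_simps)
    finally show ?thesis by (simp add: power2_eq_square algebra_simps)
  qed
  finally show ?thesis .
qed

lemma norm_sq_split2:
  fixes a b :: "'b::euclidean_space"
  shows "(norm (a + b))\<^sup>2 \<le> 2 * (norm a)\<^sup>2 + 2 * (norm b)\<^sup>2"
  using norm_sq_split[of 1 a b] by simp

lemma square_integrable_add:
  assumes "square_integrable M f" "square_integrable M g" shows "square_integrable M (\<lambda>x. f x + g x)"
proof -
  have [measurable]: "f \<in> borel_measurable M" "g \<in> borel_measurable M"
    using assms by (auto simp: square_integrable_def)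
  have "integrable M (\<lambda>x. 2 * (norm (f x))\<^sup>2 + 2 * (norm (g x))\<^sup>2)"
    using assms by (auto simp: square_integrable_def)
  then have "integrable M (\<lambda>x. (norm (f x + g x))\<^sup>2)"
    by (rule Bochner_Integration.integrable_bound) (auto intro!: AE_I2 order_trans[OF norm_sq_split2] simp: )
  then show ?thesis by (simp add: square_integrable_def)
qed

lemma square_integrable_scaleR: "square_integrable M f \<Longrightarrow> square_integrable M (\<lambda>x. c *\<^sub>R f x)"
  by (auto simp: square_integrable_def power_mult_distrib)

lemma l2norm_scaleR: "l2norm M (\<lambda>x. c *\<^sub>R f x) = \<bar>c\<bar> * l2norm M f"
  by (simp add: l2norm_def power_mult_distrib real_sqrt_mult)

lemma square_integrable_uminus: "square_integrable M f \<Longrightarrow> square_integrable M (\<lambda>x. - f x)"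
  by (auto simp: square_integrable_def)

lemma square_integrable_diff: "square_integrable M f \<Longrightarrow> square_integrable M g \<Longrightarrow> square_integrable M (\<lambda>x. f x - g x)"
  using square_integrable_add[of M f "\<lambda>x. - g x"] square_integrable_uminus[of M g] by simp

lemma square_integrable_zero[simp]: "square_integrable M (\<lambda>x. 0)"
  by (simp add: square_integrable_def)

lemma square_integrable_sum: "(\<And>i. i \<in> I \<Longrightarrow> square_integrable M (f i)) \<Longrightarrow> square_integrable M (\<lambda>x. \<Sum>i\<in>I. f i x)"
  by (induction I rule: infinite_finite_induct) (auto intro: square_integrable_add)

lemma l2norm_commute: "l2norm M (\<lambda>x. f x - g x) = l2norm M (\<lambda>x. g x - f x)"
  by (simp add: l2norm_def norm_minus_commute)

text \<open>
  The bound \<open>norm_sq_split\<close>, integrated, gives Minkowski's inequality once its free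
  parameter is the quotient of the two norms. Adding \<open>e\<close> to both norms keeps that
  quotient defined.
\<close>

lemma l2norm_triangle:
  assumes f: "square_integrable M f" and g: "square_integrable M g"
  shows "l2norm M (\<lambda>x. f x + g x) \<le> l2norm M f + l2norm M g"
proof -
  have sp: "(l2norm M (\<lambda>x. f x + g x))\<^sup>2 \<le> (1 + d) * (l2norm M f)\<^sup>2 + (1 + 1/d) * (l2norm M g)\<^sup>2" if "d > 0" for d
  proof -
    have "(LINT x|M. (norm (f x + g x))\<^sup>2) \<le> (LINT x|M. (1 + d) * (norm (f x))\<^sup>2 + (1 + 1/d) * (norm (g x))\<^sup>2)"
      using square_integrable_add[OF f g] f g that
      by (intro integral_mono norm_sq_split) (auto simp: square_integrable_def)
    also have "\<dots> = (1 + d) * (l2norm M f)\<^sup>2 + (1 + 1/d) * (l2norm M g)\<^sup>2"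
      using f g by (simp add: l2norm_sq square_integrable_def)
    finally show ?thesis by (simp add: l2norm_sq)
  qed
  have key: "(l2norm M (\<lambda>x. f x + g x))\<^sup>2 \<le> (l2norm M f + e + (l2norm M g + e))\<^sup>2" if "e > 0" for e
  proof -
    define a b where "a = l2norm M f + e" and "b = l2norm M g + e"
    have ab: "a > 0" "b > 0" using that by (auto simp: a_def b_def intro: add_nonneg_pos)
    have "(l2norm M (\<lambda>x. f x + g x))\<^sup>2 \<le> (1 + b/a) * (l2norm M f)\<^sup>2 + (1 + 1/(b/a)) * (l2norm M g)\<^sup>2"
      using ab by (intro sp) auto
    also have "\<dots> \<le> (1 + b/a) * a\<^sup>2 + (1 + 1/(b/a)) * b\<^sup>2"
      using ab that by (intro add_mono mult_left_mono power_mono) (auto simp: a_def b_def)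
    also have "\<dots> = (a + b)\<^sup>2" using ab by (simp add: field_simps power2_eq_square)
    finally show ?thesis by (simp add: a_def b_def)
  qed
  have "l2norm M (\<lambda>x. f x + g x) \<le> l2norm M f + l2norm M g + 2 * e" if "e > 0" for e
    using power2_le_imp_le[OF key[OF that]] that by (simp add: add_nonneg_nonneg)
  from this[of "e / 2" for e] have "l2norm M (\<lambda>x. f x + g x) \<le> l2norm M f + l2norm M g + e" if "e > 0" for e
    using that by auto
  then show ?thesis by (rule field_le_epsilon)
qed

lemma l2norm_triangle_diff:
  assumes "square_integrable M f" "square_integrable M g" "square_integrable M h"
  shows "l2norm M (\<lambda>x. f x - h x) \<le> l2norm M (\<lambda>x. f x - g x) + l2norm M (\<lambda>x. g x - h x)"
  using l2norm_triangle[OF square_integrable_diff[OF assms(1,2)] square_integrable_diff[OF assms(2,3)]] by simp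

lemma l2norm_diff_abs:
  assumes "square_integrable M f" "square_integrable M g"
  shows "\<bar>l2norm M f - l2norm M g\<bar> \<le> l2norm M (\<lambda>x. f x - g x)"
  using l2norm_triangle_diff[of M f g "\<lambda>_. 0"] l2norm_triangle_diff[of M g f "\<lambda>_. 0"] assms
    l2norm_commute[of M f g] by simp

lemma l2norm_cong_AE:
  assumes "AE x in M. f x = g x" "f \<in> borel_measurable M" "g \<in> borel_measurable M"
  shows "l2norm M f = l2norm M g"
proof -
  have "(LINT x|M. (norm (f x))\<^sup>2) = (LINT x|M. (norm (g x))\<^sup>2)"
  proof (rule integral_cong_AE)
    show "AE x in M. (norm (f x))\<^sup>2 = (norm (g x))\<^sup>2"
      using assms(1) by eventually_elim simp
  qed (use assms(2,3) in measurable)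
  then show ?thesis by (simp only: l2norm_def)
qed

lemma square_integrable_cong_AE:
  assumes "AE x in M. f x = g x" "square_integrable M f" "g \<in> borel_measurable M"
  shows "square_integrable M g"
proof -
  have [measurable]: "f \<in> borel_measurable M" using assms(2) by (simp add: square_integrable_def)
  have "integrable M (\<lambda>x. (norm (g x))\<^sup>2)"
  proof (rule Bochner_Integration.integrable_cong_AE_imp)
    show "integrable M (\<lambda>x. (norm (f x))\<^sup>2)" using assms(2) by (simp add: square_integrable_def)
    show "AE x in M. (norm (f x))\<^sup>2 = (norm (g x))\<^sup>2"
      using assms(1) by eventually_elim simp
  qed (use assms(3) in measurable)
  then show ?thesis using assms(3) by (simp add: square_integrable_def)
qed

lemma l2norm_eq_0_AE:
  assumes "square_integrable M f" "l2norm M f = 0" shows "AE x in M. f x = 0"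
proof -
  have "(LINT x|M. (norm (f x))\<^sup>2) = 0" using assms by (simp add: l2norm_def)
  then show ?thesis using assms
    by (subst (asm) integral_nonneg_eq_0_iff_AE) (auto simp: square_integrable_def)
qed

lemma square_integrable_mono:
  assumes "square_integrable M g" "f \<in> borel_measurable M" "\<And>x. norm (f x) \<le> norm (g x)"
  shows "square_integrable M f"
proof -
  have "integrable M (\<lambda>x. (norm (f x))\<^sup>2)"
  proof (rule Bochner_Integration.integrable_bound)
    show "integrable M (\<lambda>x. (norm (g x))\<^sup>2)" using assms(1) by (simp add: square_integrable_def)
    show "AE x in M. norm ((norm (f x))\<^sup>2) \<le> norm ((norm (g x))\<^sup>2)"
      by (rule AE_I2) (use power_mono[OF assms(3) norm_ge_zero] in simp)
  qed (use assms(2) in measurable)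
  then show ?thesis using assms(2) by (simp add: square_integrable_def)
qed

lemma l2norm_mono:
  assumes "square_integrable M g" "f \<in> borel_measurable M" "\<And>x. norm (f x) \<le> norm (g x)"
  shows "l2norm M f \<le> l2norm M g"
proof -
  have "square_integrable M f" by (rule square_integrable_mono[OF assms])
  then have "(LINT x|M. (norm (f x))\<^sup>2) \<le> (LINT x|M. (norm (g x))\<^sup>2)"
    using assms(1) by (intro integral_mono power_mono assms(3)) (simp_all add: square_integrable_def)
  then show ?thesis by (simp add: l2norm_def)
qed

lemma l2norm_dominated:
  fixes f :: "nat \<Rightarrow> 'x \<Rightarrow> 'b::euclidean_space"
  assumes "\<And>n. f n \<in> borel_measurable M" "g \<in> borel_measurable M" "square_integrable M (h :: 'x \<Rightarrow> 'c::euclidean_space)"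
    and "AE x in M. (\<lambda>n. f n x) \<longlonglongrightarrow> g x" "\<And>n x. norm (f n x - g x) \<le> norm (h x)"
  shows "(\<lambda>n. l2norm M (\<lambda>x. f n x - g x)) \<longlonglongrightarrow> 0"
proof -
  have "(\<lambda>n. LINT x|M. (norm (f n x - g x))\<^sup>2) \<longlonglongrightarrow> (LINT x|M. 0)"
  proof (rule integral_dominated_convergence)
    show "integrable M (\<lambda>x. (norm (h x))\<^sup>2)" using assms by (simp add: square_integrable_def)
    show "AE x in M. (\<lambda>n. (norm (f n x - g x))\<^sup>2) \<longlonglongrightarrow> 0"
      using assms(4)
    proof eventually_elim
      case (elim x)
      have "(\<lambda>n. (norm (f n x - g x))\<^sup>2) \<longlonglongrightarrow> (norm (g x - g x))\<^sup>2"
        by (intro tendsto_intros elim)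
      then show ?case by simp
    qed
    show "AE x in M. norm ((norm (f n x - g x))\<^sup>2) \<le> (norm (h x))\<^sup>2" for n
      by (rule AE_I2) (use power_mono[OF assms(5) norm_ge_zero] in simp)
    show "(\<lambda>x. (norm (f n x - g x))\<^sup>2) \<in> borel_measurable M" for n
      using assms(1,2) by measurable
  qed simp
  then have "(\<lambda>n. sqrt (LINT x|M. (norm (f n x - g x))\<^sup>2)) \<longlonglongrightarrow> sqrt 0"
    by (intro tendsto_real_sqrt) simp
  then show ?thesis by (simp add: l2norm_def)
qed

text \<open>
  Riesz--Fischer. The increments have summable norms, so by monotone convergence their absolute
  sum is square integrable and the sequence converges almost everywhere; Fatou's lemma turns this
  into convergence in the mean. Geometric decay of the increments is no loss, since a convergent
  choice of approximations can always be thinned out.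
\<close>

lemma L2_complete:
  fixes f :: "nat \<Rightarrow> 'x \<Rightarrow> 'b::euclidean_space"
  assumes f: "\<And>n. square_integrable M (f n)" and cau: "\<And>n. l2norm M (\<lambda>x. f (Suc n) x - f n x) \<le> (1/2)^n"
  shows "\<exists>g. square_integrable M g \<and> (\<lambda>n. l2norm M (\<lambda>x. f n x - g x)) \<longlonglongrightarrow> 0"
proof -
  have [measurable]: "f n \<in> borel_measurable M" for n using f by (auto simp: square_integrable_def)
  define d where "d n x = norm (f (Suc n) x - f n x)" for n x
  have [measurable]: "d n \<in> borel_measurable M" for n unfolding d_def by measurable
  have sqd: "square_integrable M (d n)" for n
    using square_integrable_diff[OF f f, of "Suc n" n] unfolding d_def square_integrable_def by auto
  have nd: "l2norm M (d n) \<le> (1/2)^n" for n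
    using cau[of n] by (simp add: d_def l2norm_def)
  define S where "S N x = (\<Sum>n<N. d n x)" for N x
  have sqS: "square_integrable M (S N)" for N unfolding S_def by (intro square_integrable_sum sqd)
  have nS: "l2norm M (S N) \<le> 2" for N
  proof -
    have "l2norm M (S N) \<le> (\<Sum>n<N. (1/2)^n)"
    proof (induction N)
      case 0 then show ?case by (simp add: S_def l2norm_def)
    next
      case (Suc N)
      have "l2norm M (S (Suc N)) = l2norm M (\<lambda>x. S N x + d N x)"
        by (rule arg_cong[of _ _ "l2norm M"]) (simp add: S_def fun_eq_iff)
      also have "\<dots> \<le> l2norm M (S N) + l2norm M (d N)" by (intro l2norm_triangle sqS sqd)
      finally show ?case using Suc nd[of N] by simp
    qed
    also have "\<dots> \<le> 2" by (simp add: sum_gp_strict)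
    finally show ?thesis .
  qed
  have [measurable]: "S N \<in> borel_measurable M" for N using sqS by (auto simp: square_integrable_def)
  have Smono: "incseq (\<lambda>N. ennreal ((S N x)\<^sup>2))" for x
    by (rule incseq_SucI) (auto simp: S_def d_def intro!: ennreal_leI power_mono sum_nonneg)
  have "(\<integral>\<^sup>+x. (SUP N. ennreal ((S N x)\<^sup>2)) \<partial>M) = (SUP N. \<integral>\<^sup>+x. ennreal ((S N x)\<^sup>2) \<partial>M)"
    using Smono by (intro nn_integral_monotone_convergence_SUP) (auto simp: incseq_def le_fun_def)
  also have "\<dots> \<le> 4"
  proof (rule SUP_least)
    fix N
    have "(\<integral>\<^sup>+x. ennreal ((S N x)\<^sup>2) \<partial>M) = ennreal ((l2norm M (S N))\<^sup>2)"
      using nn_integral_eq_l2norm[OF sqS[of N]] by (simp )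
    also have "\<dots> \<le> ennreal (2\<^sup>2)" by (intro ennreal_leI power_mono nS) auto
    finally show "(\<integral>\<^sup>+x. ennreal ((S N x)\<^sup>2) \<partial>M) \<le> 4" by simp
  qed
  finally have "(\<integral>\<^sup>+x. (SUP N. ennreal ((S N x)\<^sup>2)) \<partial>M) < \<infinity>"
    by (simp add: order_le_less_trans)
  then have "AE x in M. (SUP N. ennreal ((S N x)\<^sup>2)) \<noteq> \<infinity>"
    by (intro nn_integral_noteq_infinite) auto
  then have conv: "AE x in M. summable (\<lambda>n. d n x)"
  proof eventually_elim
    case (elim x)
    then obtain B where B: "(SUP N. ennreal ((S N x)\<^sup>2)) = ennreal B" "B \<ge> 0"
      by (metis ennreal_cases infinity_ennreal_def)
    have "S N x \<le> sqrt B" for N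
    proof -
      have "ennreal ((S N x)\<^sup>2) \<le> ennreal B" unfolding B(1)[symmetric] by (rule SUP_upper) simp
      then have "(S N x)\<^sup>2 \<le> B" using B(2) by (simp add: ennreal_le_iff)
      then show ?thesis by (rule real_le_rsqrt)
    qed
    then show ?case
      by (intro summableI_nonneg_bounded[of _ "sqrt B"]) (auto simp: S_def d_def)
  qed
  define g where "g x = lim (\<lambda>n. f n x)" for x
  have [measurable]: "g \<in> borel_measurable M" unfolding g_def by measurable
  have lim: "AE x in M. (\<lambda>n. f n x) \<longlonglongrightarrow> g x"
    using conv
  proof eventually_elim
    case (elim x)
    then have "summable (\<lambda>n. f (Suc n) x - f n x)"
      unfolding d_def by (rule summable_norm_cancel)
    then have "convergent (\<lambda>N. \<Sum>n<N. f (Suc n) x - f n x)"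
      by (simp add: summable_iff_convergent)
    then have "convergent (\<lambda>N. f N x - f 0 x)"
      by (subst (asm) sum_lessThan_telescope)
    then have "convergent (\<lambda>N. f N x)" using convergent_diff_const_right_iff by blast
    then show ?case unfolding g_def by (simp add: convergent_LIMSEQ_iff)
  qed
  have tail: "l2norm M (\<lambda>x. f (n + k) x - f n x) \<le> 2 * (1/2)^n" for n k
  proof -
    have "l2norm M (\<lambda>x. f (n + k) x - f n x) \<le> (\<Sum>j<k. (1/2)^(n + j))"
    proof (induction k)
      case 0 then show ?case by (simp add: l2norm_def)
    next
      case (Suc k)
      have "l2norm M (\<lambda>x. f (n + Suc k) x - f n x) \<le> l2norm M (\<lambda>x. f (n + Suc k) x - f (n + k) x) + l2norm M (\<lambda>x. f (n + k) x - f n x)"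
        by (intro l2norm_triangle_diff f)
      then show ?case using Suc cau[of "n + k"] by simp
    qed
    also have "\<dots> = (1/2)^n * (\<Sum>j<k. (1/2)^j)" by (simp add: power_add sum_distrib_left)
    also have "\<dots> \<le> (1/2)^n * 2" by (intro mult_left_mono) (auto simp: sum_gp_strict)
    finally show ?thesis by simp
  qed
  have fat: "(\<integral>\<^sup>+x. ennreal ((norm (f n x - g x))\<^sup>2) \<partial>M) \<le> ennreal ((2 * (1/2)^n)\<^sup>2)" for n
  proof -
    have "(\<integral>\<^sup>+x. ennreal ((norm (f n x - g x))\<^sup>2) \<partial>M) = (\<integral>\<^sup>+x. liminf (\<lambda>k. ennreal ((norm (f n x - f (k + n) x))\<^sup>2)) \<partial>M)"
      using lim
    proof (intro nn_integral_cong_AE, eventually_elim)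
      case (elim x)
      have *: "(\<lambda>k. ennreal ((norm (f n x - f (k + n) x))\<^sup>2)) \<longlonglongrightarrow> ennreal ((norm (f n x - g x))\<^sup>2)"
        by (intro tendsto_intros tendsto_ennrealI LIMSEQ_ignore_initial_segment elim)
      show ?case by (rule lim_imp_Liminf[OF sequentially_bot *, symmetric])
    qed
    also have "\<dots> \<le> liminf (\<lambda>k. \<integral>\<^sup>+x. ennreal ((norm (f n x - f (k + n) x))\<^sup>2) \<partial>M)"
      by (intro nn_integral_liminf) auto
    also have "\<dots> \<le> liminf (\<lambda>k::nat. ennreal ((2 * (1/2)^n)\<^sup>2))"
    proof (intro Liminf_mono always_eventually allI)
      fix k
      show "(\<integral>\<^sup>+x. ennreal ((norm (f n x - f (k + n) x))\<^sup>2) \<partial>M) \<le> ennreal ((2 * (1/2)^n)\<^sup>2)"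
        using power_mono[OF tail[of n k] l2norm_nonneg, of 2] l2norm_commute[of M "f n" "f (k + n)"]
        by (subst nn_integral_eq_l2norm[OF square_integrable_diff[OF f f]]) (auto intro!: ennreal_leI simp: add.commute)
    qed
    also have "\<dots> = ennreal ((2 * (1/2)^n)\<^sup>2)" by (simp add: Liminf_const)
    finally show ?thesis .
  qed
  have sqfg: "square_integrable M (\<lambda>x. f n x - g x)" for n
    by (subst square_integrable_iff_nn_integral) (use fat[of n] in \<open>auto intro: order_le_less_trans\<close>)
  have "square_integrable M (\<lambda>x. f 0 x - (f 0 x - g x))" by (intro square_integrable_diff f sqfg)
  then have "square_integrable M g" by simp
  moreover have "(\<lambda>n. l2norm M (\<lambda>x. f n x - g x)) \<longlonglongrightarrow> 0"
  proof (rule Lim_null_comparison)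
    show "\<forall>\<^sub>F n in sequentially. norm (l2norm M (\<lambda>x. f n x - g x)) \<le> 2 * (1/2)^n"
    proof (intro always_eventually allI)
      fix n
      have *: "(l2norm M (\<lambda>x. f n x - g x))\<^sup>2 \<le> (2 * (1/2)^n)\<^sup>2"
        using fat[of n] unfolding nn_integral_eq_l2norm[OF sqfg] by (subst (asm) ennreal_le_iff) auto
      have "l2norm M (\<lambda>x. f n x - g x) \<le> 2 * (1/2)^n"
        by (rule power2_le_imp_le[OF *]) simp
      then show "norm (l2norm M (\<lambda>x. f n x - g x)) \<le> 2 * (1/2)^n" by simp
    qed
    show "(\<lambda>n. 2 * (1/2)^n :: real) \<longlonglongrightarrow> 0"
      by (intro tendsto_mult_right_zero LIMSEQ_realpow_zero) auto
  qed
  ultimately show ?thesis by blast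
qed

section \<open>The Carleson embedding theorem on a tree\<close>

text \<open>
  One step of the Bellman induction. Raising the denominator from \<open>D\<close> to
  \<open>D'\<close> gains \<open>4 A v\<^sup>2 (1/D - 1/D')\<close>, where
  \<open>1/D - 1/D' = m\<^sup>2 / (p A D D')\<close>; as long as both denominators are at most
  \<open>2 m\<close>, this pays for the new term \<open>v\<^sup>2 / p\<close>.
\<close>

lemma bellman_step:
  fixes m v D D' X A p :: real
  assumes "0 \<le> v" "v\<^sup>2 \<le> m * X'" "m \<le> D" "D' = D + m\<^sup>2 / (p * A)" "D' \<le> 2 * m" "p > 0" "A > 0"
    "0 \<le> m"
  shows "v\<^sup>2 / p + 4 * A * (X - v\<^sup>2 / D) \<le> 4 * A * (X - v\<^sup>2 / D')"
proof (cases "m = 0")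
  case True
  then show ?thesis using assms by simp
next
  case False
  then have m: "m > 0" using assms by simp
  have D: "D > 0" "D' > 0" using m assms by (auto intro: add_pos_nonneg)
  have DD: "D * D' \<le> 4 * m\<^sup>2"
  proof -
    have "0 \<le> m\<^sup>2 / (p * A)" using assms by simp
    then have "D \<le> D'" using assms by linarith
    then have "D * D' \<le> (2 * m) * (2 * m)" using assms D by (intro mult_mono) linarith+
    then show ?thesis by (simp add: power2_eq_square)
  qed
  have "1 / D - 1 / D' = (D' - D) / (D * D')" using D by (simp add: field_simps)
  also have "D' - D = m\<^sup>2 / (p * A)" using assms by simp
  finally have e: "1 / D - 1 / D' = m\<^sup>2 / (p * A) / (D * D')" .
  have "1 / p \<le> 4 * A * (m\<^sup>2 / (p * A) / (D * D'))"
  proof -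
    have "1 \<le> 4 * m\<^sup>2 / (D * D')" using DD D by (simp add: field_simps)
    then have "1 / p \<le> (4 * m\<^sup>2 / (D * D')) / p" using assms by (intro divide_right_mono) auto
    also have "\<dots> = 4 * A * (m\<^sup>2 / (p * A) / (D * D'))" using assms(6,7) by simp
    finally show ?thesis .
  qed
  then have "v\<^sup>2 * (1 / p) \<le> v\<^sup>2 * (4 * A * (1 / D - 1 / D'))"
    unfolding e by (intro mult_left_mono) auto
  then show ?thesis by (simp add: algebra_simps)
qed

text \<open>
  Cauchy--Schwarz for \<open>v = (v / sqrt d) * sqrt d\<close>. Since \<open>x / 0 = 0\<close>,
  indices with \<open>d i = 0\<close> are harmless only when \<open>v i\<close> vanishes there
  too.
\<close>

lemma sedrakyan:
  fixes v d :: "'i \<Rightarrow> real"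
  assumes "\<And>i. i \<in> I \<Longrightarrow> 0 \<le> d i" "\<And>i. i \<in> I \<Longrightarrow> d i = 0 \<Longrightarrow> v i = 0"
  shows "(\<Sum>i\<in>I. v i)\<^sup>2 / (\<Sum>i\<in>I. d i) \<le> (\<Sum>i\<in>I. (v i)\<^sup>2 / d i)"
proof (cases "(\<Sum>i\<in>I. d i) = 0")
  case True
  then show ?thesis using assms by (simp add: sum_nonneg)
next
  case False
  then have pos: "0 < (\<Sum>i\<in>I. d i)" using assms(1) by (simp add: order_less_le sum_nonneg)
  have "(\<Sum>i\<in>I. v i)\<^sup>2 = (\<Sum>i\<in>I. (v i / sqrt (d i)) * sqrt (d i))\<^sup>2"
    using assms by (intro arg_cong[of _ _ "\<lambda>x. x\<^sup>2"] sum.cong) auto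
  also have "\<dots> \<le> (\<Sum>i\<in>I. (v i / sqrt (d i))\<^sup>2) * (\<Sum>i\<in>I. (sqrt (d i))\<^sup>2)"
    by (rule Cauchy_Schwarz_ineq_sum)
  also have "\<dots> = (\<Sum>i\<in>I. (v i)\<^sup>2 / d i) * (\<Sum>i\<in>I. d i)"
    using assms(1) by (simp add: power_divide)
  finally show ?thesis using pos by (simp add: divide_le_eq)
qed

text \<open>
  The sum of \<open>a\<close> over the descendants of \<open>q\<close> down to generation
  \<open>N\<close>. The truncation makes the sum meaningful before any bound for it is known.
\<close>

primrec tree_sum :: "('q \<Rightarrow> 'q set) \<Rightarrow> ('q \<Rightarrow> real) \<Rightarrow> nat \<Rightarrow> 'q \<Rightarrow> real" where
  "tree_sum ch a 0 q = a q"
| "tree_sum ch a (Suc N) q = a q + (\<Sum>r\<in>ch q. tree_sum ch a N r)"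

text \<open>
  Carleson's embedding theorem. For a measure \<open>\<sigma>\<close> and a density
  \<open>f\<close>, the values \<open>m q\<close>, \<open>v q\<close> and \<open>X q\<close> play
  the roles of the integrals of \<open>1\<close>, \<open>f\<close> and \<open>f\<^sup>2\<close>
  over \<open>q\<close>. The right-hand side is the Bellman function
  \<open>4 A (X - v\<^sup>2 / (m + S / A))\<close> with \<open>S\<close> the truncated sum for
  \<open>f = 1\<close>: it is superadditive over the children by \<open>sedrakyan\<close>, and
  \<open>bellman_step\<close> accounts for the term at the parent. The Carleson condition
  \<open>test\<close> keeps the denominator at most \<open>2 m\<close>.
\<close>

lemma carleson_tree:
  fixes m v X p :: "'q \<Rightarrow> real"
  assumes m: "\<And>q. m q = (\<Sum>r\<in>ch q. m r)" and v: "\<And>q. v q = (\<Sum>r\<in>ch q. v r)"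
    and X: "\<And>q. X q = (\<Sum>r\<in>ch q. X r)"
    and m0: "\<And>q. 0 \<le> m q" and v0: "\<And>q. 0 \<le> v q" and X0: "\<And>q. 0 \<le> X q" and p0: "\<And>q. 0 < p q"
    and cs: "\<And>q. (v q)\<^sup>2 \<le> m q * X q" and A: "A > 0"
    and test: "\<And>N q. tree_sum ch (\<lambda>q. (m q)\<^sup>2 / p q) N q \<le> A * m q"
  shows "tree_sum ch (\<lambda>q. (v q)\<^sup>2 / p q) N q
    \<le> 4 * A * (X q - (v q)\<^sup>2 / (m q + tree_sum ch (\<lambda>q. (m q)\<^sup>2 / p q) N q / A))"
proof -
  let ?S = "tree_sum ch (\<lambda>q. (m q)\<^sup>2 / p q)" and ?T = "tree_sum ch (\<lambda>q. (v q)\<^sup>2 / p q)"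
  have vm: "v q = 0" if "m q = 0" for q using cs[of q] that by simp
  have S0: "0 \<le> ?S N q" for N q
    by (induction N arbitrary: q) (auto simp: less_imp_le[OF p0] intro!: add_nonneg_nonneg sum_nonneg)
  have SA: "?S N q / A \<le> m q" for N q using test[of N q] A by (simp add: divide_le_eq mult.commute)
  show ?thesis
  proof (induction N arbitrary: q)
    case 0
    have "(v q)\<^sup>2 / p q + 4 * A * (X q - (v q)\<^sup>2 / m q) \<le> 4 * A * (X q - (v q)\<^sup>2 / (m q + ?S 0 q / A))"
      using SA[of 0 q] A p0 m0 v0 cs
      by (intro bellman_step[where m = "m q" and X' = "X q"]) (auto simp: field_simps)
    moreover have "0 \<le> 4 * A * (X q - (v q)\<^sup>2 / m q)"
    proof -
      have "(v q)\<^sup>2 / m q \<le> X q"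
      using cs[of q] m0[of q] X0[of q] by (cases "m q = 0") (auto simp: divide_le_eq mult.commute)
      then show ?thesis using A by simp
    qed
    ultimately show ?case unfolding tree_sum.simps(1) by linarith
  next
    case (Suc N)
    let ?d = "\<lambda>r. m r + ?S N r / A"
    have d0: "0 \<le> ?d r" for r using m0 S0 A by simp
    have dv: "v r = 0" if "?d r = 0" for r
    proof -
      have "0 \<le> ?S N r / A" using S0 A by simp
      then have "m r = 0" using that m0[of r] by linarith
      then show ?thesis by (rule vm)
    qed
    have D: "(\<Sum>r\<in>ch q. ?d r) = m q + (\<Sum>r\<in>ch q. ?S N r) / A"
      by (simp add: sum.distrib m[of q, symmetric] sum_divide_distrib)
    have "?T (Suc N) q \<le> (v q)\<^sup>2 / p q + (\<Sum>r\<in>ch q. 4 * A * (X r - (v r)\<^sup>2 / ?d r))"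
      by (auto intro!: sum_mono Suc)
    also have "\<dots> = (v q)\<^sup>2 / p q + 4 * A * (X q - (\<Sum>r\<in>ch q. (v r)\<^sup>2 / ?d r))"
      by (simp add: sum_distrib_left[symmetric] sum_subtractf X[of q, symmetric])
    also have "\<dots> \<le> (v q)\<^sup>2 / p q + 4 * A * (X q - (v q)\<^sup>2 / (m q + (\<Sum>r\<in>ch q. ?S N r) / A))"
      using sedrakyan[of "ch q" ?d v, OF d0 dv] A unfolding D v[of q, symmetric] by simp
    also have "\<dots> \<le> 4 * A * (X q - (v q)\<^sup>2 / (m q + ?S (Suc N) q / A))"
    proof (intro bellman_step[where m = "m q" and X' = "X q"])
      show "m q \<le> m q + (\<Sum>r\<in>ch q. ?S N r) / A" using A S0 by (simp add: sum_nonneg)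
      show "m q + ?S (Suc N) q / A = m q + (\<Sum>r\<in>ch q. ?S N r) / A + (m q)\<^sup>2 / (p q * A)"
        using A p0[of q] by (simp add: add_divide_distrib)
      show "m q + ?S (Suc N) q / A \<le> 2 * m q" using SA[of "Suc N" q] by simp
    qed (use p0 A cs v0 m0 in auto)
    finally show ?case .
  qed
qed

section \<open>Dyadic cubes\<close>

definition cube_index :: "int \<Rightarrow> real^3 \<Rightarrow> int^3" where
  "cube_index k x = (\<chi> i. \<lfloor>x $ i / 2 powi k\<rfloor>)"

definition cube_children :: "int \<times> (int^3) \<Rightarrow> (int \<times> (int^3)) set" where
  "cube_children = (\<lambda>(k, n). {(k - 1, n') |n'. \<forall>i. n' $ i div 2 = n $ i})"

lemma dyadic_cube_iff: "x \<in> dyadic_cube k n \<longleftrightarrow> cube_index k x = n"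
proof -
  have p: "(2::real) powi k > 0" by simp
  have "(2 powi k * real_of_int (n $ i) \<le> x $ i \<and> x $ i < 2 powi k * (real_of_int (n $ i) + 1))
      \<longleftrightarrow> \<lfloor>x $ i / 2 powi k\<rfloor> = n $ i" for i
    by (simp add: floor_eq_iff pos_le_divide_eq[OF p] pos_divide_less_eq[OF p] mult.commute)
  then show ?thesis by (simp add: dyadic_cube_def cube_index_def vec_eq_iff)
qed

lemma finite_cube_children: "finite (cube_children q)"
proof -
  obtain k n where q: "q = (k, n)" by force
  have "cube_children q \<subseteq> (\<lambda>n'. (k - 1, n')) ` {n'::int^3. \<forall>i. n' $ i \<in> {2 * n $ i .. 2 * n $ i + 1}}"
  proof -
    have "n' $ i \<in> {2 * n $ i .. 2 * n $ i + 1}" if "n' $ i div 2 = n $ i" for n' :: "int^3" and i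
      using that by (auto; presburger)
    then show ?thesis unfolding q cube_children_def by auto
  qed
  moreover have "finite {n'::int^3. \<forall>i. n' $ i \<in> {2 * n $ i .. 2 * n $ i + 1}}"
  proof -
    have "{n'::int^3. \<forall>i. n' $ i \<in> {2 * n $ i .. 2 * n $ i + 1}}
        = vec_lambda ` (PiE UNIV (\<lambda>i. {2 * n $ i .. 2 * n $ i + 1}))"
      by (auto simp: image_iff PiE_UNIV_domain intro!: bexI[of _ "vec_nth _"])
    then show ?thesis by (simp add: finite_PiE)
  qed
  ultimately show ?thesis by (meson finite_imageI finite_subset)
qed

lemma cube_index_parent: "cube_index k x $ i = cube_index (k - 1) x $ i div 2"
proof -
  have "\<lfloor>x $ i / 2 powi k\<rfloor> = \<lfloor>x $ i / 2 powi (k - 1) / of_int 2\<rfloor>"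
    by (simp add: power_int_diff)
  then show ?thesis unfolding cube_index_def using floor_divide_real_eq_div[of 2 "x $ i / 2 powi (k - 1)"] by simp
qed

lemma dyadic_cube_children: "dyadic_cube k n = (\<Union>r\<in>cube_children (k, n). dyadic_cube (fst r) (snd r))"
proof -
  have "x \<in> dyadic_cube k n \<longleftrightarrow> (\<exists>r\<in>cube_children (k, n). x \<in> dyadic_cube (fst r) (snd r))" for x
  proof -
    have "x \<in> dyadic_cube k n \<longleftrightarrow> (\<forall>i. cube_index (k - 1) x $ i div 2 = n $ i)"
      by (simp add: dyadic_cube_iff vec_eq_iff[of "cube_index k x"] cube_index_parent[of k])
    also have "\<dots> \<longleftrightarrow> (k - 1, cube_index (k - 1) x) \<in> cube_children (k, n)" by (simp add: cube_children_def)
    also have "\<dots> \<longleftrightarrow> (\<exists>r\<in>cube_children (k, n). x \<in> dyadic_cube (fst r) (snd r))"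
      by (auto simp: cube_children_def dyadic_cube_iff)
    finally show ?thesis .
  qed
  then show ?thesis by blast
qed

lemma dyadic_cube_disjoint: "n \<noteq> n' \<Longrightarrow> dyadic_cube k n \<inter> dyadic_cube k n' = {}"
  by (auto simp: dyadic_cube_iff)

lemma disjoint_family_cube_children: "disjoint_family_on (\<lambda>r. dyadic_cube (fst r) (snd r)) (cube_children q)"
  by (auto simp: disjoint_family_on_def cube_children_def dyadic_cube_iff split: prod.splits)

lemma measurable_cube_index[measurable]: "cube_index k \<in> borel \<rightarrow>\<^sub>M count_space UNIV"
proof -
  have "{x. cube_index k x = n} \<in> sets borel" for n
  proof -
    have "{x. cube_index k x = n} = (\<Inter>i. {x \<in> space borel. \<lfloor>x $ i / 2 powi k\<rfloor> = n $ i})"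
      by (auto simp: cube_index_def vec_eq_iff)
    also have "\<dots> \<in> sets borel" by measurable
    finally show ?thesis .
  qed
  then show ?thesis by (subst measurable_count_space_eq2_countable) (auto simp: vimage_def)
qed

lemma sets_dyadic_cube[measurable, simp]: "dyadic_cube k n \<in> sets borel"
proof -
  have "dyadic_cube k n = cube_index k -` {n} \<inter> space borel" by (auto simp: dyadic_cube_iff)
  also have "\<dots> \<in> sets borel" by measurable
  finally show ?thesis .
qed

lemma dyadic_cube_diff:
  assumes "x \<in> dyadic_cube k n" "y \<in> dyadic_cube k n"
  shows "norm (x - y) \<le> 2 * 2 powi k"
proof -
  have "\<bar>(x - y) $ i\<bar> \<le> 2 powi k" for i
  proof -
    have "2 powi k * real_of_int (n $ i) \<le> x $ i \<and> x $ i < 2 powi k * (real_of_int (n $ i) + 1)"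
     "2 powi k * real_of_int (n $ i) \<le> y $ i \<and> y $ i < 2 powi k * (real_of_int (n $ i) + 1)"
      using assms by (auto simp: dyadic_cube_def)
    then show ?thesis by (simp add: algebra_simps abs_le_iff)
  qed
  then have i: "((x - y) $ i)\<^sup>2 \<le> (2 powi k)\<^sup>2" for i
    by (metis abs_ge_zero power2_abs power_mono)
  have "(norm (x - y))\<^sup>2 = (\<Sum>i\<in>UNIV. ((x - y) $ i)\<^sup>2)"
    by (simp add: norm_vec_def L2_set_def sum_nonneg)
  also have "\<dots> \<le> (\<Sum>i\<in>(UNIV::3 set). (2 powi k)\<^sup>2)"
    by (intro sum_mono i)
  also have "\<dots> \<le> (2 * 2 powi k)\<^sup>2" by (simp add: power_mult_distrib)
  finally show ?thesis by (rule power2_le_imp_le) simp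
qed

definition cube_at :: "int \<Rightarrow> real^3 \<Rightarrow> (real^3) set" where
  "cube_at k x = dyadic_cube k (cube_index k x)"

lemma mem_cube_at: "y \<in> cube_at k x \<longleftrightarrow> cube_index k y = cube_index k x"
  by (simp add: cube_at_def dyadic_cube_iff)

lemma cube_at_eq: "x \<in> dyadic_cube k n \<Longrightarrow> cube_at k x = dyadic_cube k n"
  by (simp add: cube_at_def dyadic_cube_iff)

lemma cube_index_nested: "cube_index (k - int j) x = cube_index (k - int j) y \<Longrightarrow> cube_index k x = cube_index k y"
proof (induction j)
  case (Suc j)
  have "cube_index (k - int j) x = cube_index (k - int j) y"
    using Suc.prems by (simp add: vec_eq_iff[of "cube_index (k - int j) x"] cube_index_parent[of "k - int j"] diff_diff_eq add.commute)
  then show ?case by (rule Suc.IH)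
qed simp

lemma measurable_cube_at[measurable]:
  assumes [simp]: "sets M = sets borel"
  shows "(\<lambda>x. emeasure M (cube_at k x)) \<in> borel_measurable borel"
  unfolding cube_at_def by measurable

lemma nn_integral_children:
  assumes M: "sets M = sets borel" and f[measurable]: "f \<in> borel_measurable borel"
  shows "(\<integral>\<^sup>+x\<in>dyadic_cube k n. f x \<partial>M) = (\<Sum>r\<in>cube_children (k, n). \<integral>\<^sup>+x\<in>dyadic_cube (fst r) (snd r). f x \<partial>M)"
proof -
  have [measurable_cong]: "sets M = sets borel" by fact
  have "indicator (dyadic_cube k n) x = (\<Sum>r\<in>cube_children (k, n). indicator (dyadic_cube (fst r) (snd r)) x :: ennreal)" for x
    unfolding dyadic_cube_children[of k n]
    by (intro indicator_UN_disjoint finite_cube_children disjoint_family_cube_children)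
  then have "(\<integral>\<^sup>+x\<in>dyadic_cube k n. f x \<partial>M) = (\<integral>\<^sup>+x. (\<Sum>r\<in>cube_children (k, n). f x * indicator (dyadic_cube (fst r) (snd r)) x) \<partial>M)"
    by (simp add: sum_distrib_left)
  also have "\<dots> = (\<Sum>r\<in>cube_children (k, n). \<integral>\<^sup>+x\<in>dyadic_cube (fst r) (snd r). f x \<partial>M)"
    by (rule nn_integral_sum) measurable
  finally show ?thesis .
qed

lemma emeasure_children:
  assumes M: "sets M = sets borel"
  shows "emeasure M (dyadic_cube k n) = (\<Sum>r\<in>cube_children (k, n). emeasure M (dyadic_cube (fst r) (snd r)))"
  using nn_integral_children[OF M, of "\<lambda>_. 1" k n] M by simp

lemma measure_children:
  assumes M: "sets M = sets borel" and fin: "\<And>k n. emeasure M (dyadic_cube k n) < \<infinity>"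
  shows "measure M (dyadic_cube k n) = (\<Sum>r\<in>cube_children (k, n). measure M (dyadic_cube (fst r) (snd r)))"
proof -
  have "emeasure M (dyadic_cube k n) = ennreal (measure M (dyadic_cube k n))" for k n
    using fin[of k n] by (intro emeasure_eq_ennreal_measure) auto
  then have "ennreal (measure M (dyadic_cube k n)) = (\<Sum>r\<in>cube_children (k, n). ennreal (measure M (dyadic_cube (fst r) (snd r))))"
    using emeasure_children[OF M, of k n] by simp
  also have "\<dots> = ennreal (\<Sum>r\<in>cube_children (k, n). measure M (dyadic_cube (fst r) (snd r)))"
    by (intro sum_ennreal) simp
  finally show ?thesis by (subst (asm) ennreal_inj) (auto intro: sum_nonneg)
qed

section \<open>Dyadic square sums and the testing condition\<close>

definition cube_square :: "(real^3) measure \<Rightarrow> int \<times> (int^3) \<Rightarrow> real" where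
  "cube_square M q = (measure M (dyadic_cube (fst q) (snd q)))\<^sup>2 / 2 powi (fst q)"

text \<open>
  The square of the mass of a cube is the integral over the cube of the mass of the cube of that
  generation around \<open>x\<close>; in this form square sums can be compared with integrals of a
  kernel.
\<close>

lemma tree_sum_eq_integral:
  assumes M: "sets M = sets borel" and fin: "\<And>k n. emeasure M (dyadic_cube k n) < \<infinity>"
  shows "ennreal (tree_sum cube_children (cube_square M) N (k, n))
    = (\<Sum>j\<le>N. \<integral>\<^sup>+x\<in>dyadic_cube k n. ennreal (2 powi (int j - k)) * emeasure M (cube_at (k - int j) x) \<partial>M)"
proof -
  have [measurable_cong]: "sets M = sets borel" by fact
  have a0: "ennreal (cube_square M (k, n))
    = (\<integral>\<^sup>+x\<in>dyadic_cube k n. ennreal (2 powi (- k)) * emeasure M (cube_at k x) \<partial>M)" for k n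
  proof -
    have "(\<integral>\<^sup>+x\<in>dyadic_cube k n. ennreal (2 powi (- k)) * emeasure M (cube_at k x) \<partial>M)
      = (\<integral>\<^sup>+x. ennreal (2 powi (- k)) * emeasure M (dyadic_cube k n) * indicator (dyadic_cube k n) x \<partial>M)"
      by (intro nn_integral_cong) (auto simp: cube_at_eq split: split_indicator)
    also have "\<dots> = ennreal (2 powi (- k)) * emeasure M (dyadic_cube k n) * emeasure M (dyadic_cube k n)"
      using M by (simp add: nn_integral_cmult_indicator)
    also have "emeasure M (dyadic_cube k n) = ennreal (measure M (dyadic_cube k n))"
      using fin[of k n] by (intro emeasure_eq_ennreal_measure) auto
    finally show ?thesis
      by (simp add: cube_square_def power2_eq_square ennreal_mult[symmetric] power_int_minus divide_inverse mult_ac)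
  qed
  have tn: "0 \<le> tree_sum cube_children (cube_square M) N q" for N q
    by (induction N arbitrary: q) (auto simp: cube_square_def intro!: add_nonneg_nonneg sum_nonneg)
  show ?thesis
  proof (induction N arbitrary: k n)
    case 0
    then show ?case using a0 by simp
  next
    case (Suc N)
    have "ennreal (tree_sum cube_children (cube_square M) (Suc N) (k, n))
       = ennreal (cube_square M (k, n)) + (\<Sum>r\<in>cube_children (k, n). ennreal (tree_sum cube_children (cube_square M) N r))"
      by (simp add: ennreal_plus sum_nonneg tn sum_ennreal cube_square_def)
    also have "(\<Sum>r\<in>cube_children (k, n). ennreal (tree_sum cube_children (cube_square M) N r))
       = (\<Sum>r\<in>cube_children (k, n). \<Sum>j\<le>N. \<integral>\<^sup>+x\<in>dyadic_cube (fst r) (snd r).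
            ennreal (2 powi (int (Suc j) - k)) * emeasure M (cube_at (k - int (Suc j)) x) \<partial>M)"
    proof (rule sum.cong)
      fix r assume "r \<in> cube_children (k, n)"
      then obtain n' where r: "r = (k - 1, n')" by (auto simp: cube_children_def)
      have e: "int j - (k - 1) = int (Suc j) - k" "k - 1 - int j = k - int (Suc j)" for j by auto
      show "ennreal (tree_sum cube_children (cube_square M) N r) = (\<Sum>j\<le>N. \<integral>\<^sup>+x\<in>dyadic_cube (fst r) (snd r).
            ennreal (2 powi (int (Suc j) - k)) * emeasure M (cube_at (k - int (Suc j)) x) \<partial>M)"
        unfolding r fst_conv snd_conv Suc e ..
    qed simp
    also have "\<dots> = (\<Sum>j\<le>N. \<integral>\<^sup>+x\<in>dyadic_cube k n.
            ennreal (2 powi (int (Suc j) - k)) * emeasure M (cube_at (k - int (Suc j)) x) \<partial>M)"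
      by (subst sum.swap, intro sum.cong refl nn_integral_children[OF M, symmetric]) (use M in measurable)
    finally show ?case unfolding a0 sum.atMost_Suc_shift by simp
  qed
qed

lemma geometric_cut: "(\<Sum>j\<le>N. if 2 ^ j \<le> (B::real) then 2 ^ j else 0) \<le> 2 * B" if "0 \<le> B"
proof (induction N)
  case 0 then show ?case using that by (cases "1 \<le> B") simp_all
next
  case (Suc N)
  show ?case
  proof (cases "2 ^ Suc N \<le> B")
    case True
    have le: "2 ^ j \<le> B" if "j \<le> Suc N" for j
      using power_increasing[OF that, of "2::real"] True by linarith
    have "(\<Sum>j\<le>Suc N. if 2 ^ j \<le> B then 2 ^ j else 0) = (\<Sum>j\<le>Suc N. 2 ^ j :: real)"
      using le by (intro sum.cong) auto
    also have "\<dots> \<le> 2 * 2 ^ Suc N"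
      unfolding lessThan_Suc_atMost[symmetric] by (subst sum_gp_strict) simp
    finally show ?thesis using True by linarith
  next
    case False
    then show ?thesis using Suc by simp
  qed
qed

abbreviation newton_kernel :: "'a::real_normed_vector \<Rightarrow> 'a \<Rightarrow> ennreal" where
  "newton_kernel x y \<equiv> inverse (ennreal (norm (x - y)))"

text \<open>
  Points in a common cube of side \<open>2 powi l\<close> have distance at most
  \<open>2 * 2 powi l\<close>. The cubes containing both points therefore contribute a geometric
  series which is dominated by its last term, and that term is comparable to
  \<open>1 / norm (x - y)\<close>.
\<close>

lemma cube_at_kernel_le:
  assumes "x \<in> dyadic_cube k n"
  shows "(\<Sum>j\<le>N. ennreal (2 powi (int j - k)) * indicator (cube_at (k - int j) x) y)
     \<le> 4 * newton_kernel x y * indicator (dyadic_cube k n) y"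
proof (cases "x = y")
  case True
  then show ?thesis using assms by (simp add: ennreal_mult_top)
next
  case False
  let ?B = "2 * 2 powi k / norm (x - y)"
  have np: "norm (x - y) > 0" using False by simp
  show ?thesis
  proof (cases "y \<in> dyadic_cube k n")
    case True
    have "(\<Sum>j\<le>N. ennreal (2 powi (int j - k)) * indicator (cube_at (k - int j) x) y)
       \<le> (\<Sum>j\<le>N. ennreal (2 powi (-k) * (if 2 ^ j \<le> ?B then 2 ^ j else 0)))"
    proof (rule sum_mono)
      fix j
      show "ennreal (2 powi (int j - k)) * indicator (cube_at (k - int j) x) y
         \<le> ennreal (2 powi (-k) * (if 2 ^ j \<le> ?B then 2 ^ j else 0))"
      proof (cases "y \<in> cube_at (k - int j) x")
        case True
        then have "norm (x - y) \<le> 2 * 2 powi (k - int j)"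
          by (intro dyadic_cube_diff[of _ _ "cube_index (k - int j) x"]) (auto simp: mem_cube_at dyadic_cube_iff)
        also have "\<dots> = 2 * 2 powi k / 2 ^ j" by (simp add: power_int_diff)
        finally have "2 ^ j \<le> ?B" using np by (simp add: field_simps)
        moreover have "2 powi (int j - k) = 2 powi (-k) * (2::real) ^ j"
          by (simp add: power_int_diff power_int_minus field_simps)
        ultimately show ?thesis using True by simp
      qed simp
    qed
    also have "\<dots> = ennreal (2 powi (-k) * (\<Sum>j\<le>N. if 2 ^ j \<le> ?B then 2 ^ j else 0))"
      by (subst sum_ennreal) (auto simp: sum_distrib_left)
    also have "\<dots> \<le> ennreal (2 powi (-k) * (2 * ?B))"
      by (intro ennreal_leI mult_left_mono geometric_cut) auto
    also have "2 powi (-k) * (2 * ?B) = 4 * inverse (norm (x - y))"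
      by (simp add: power_int_minus field_simps)
    also have "ennreal \<dots> = 4 * newton_kernel x y"
      using np by (simp add: ennreal_mult inverse_ennreal)
    finally show ?thesis using True by simp
  next
    case False
    have "y \<notin> cube_at (k - int j) x" for j
      using False assms cube_index_nested[of k j y x] by (auto simp: mem_cube_at dyadic_cube_iff)
    then show ?thesis by simp
  qed
qed

lemma sigma_finite_dyadic:
  assumes M: "sets M = sets borel" and fin: "\<And>k n. emeasure M (dyadic_cube k n) < \<infinity>"
  shows "sigma_finite_measure M"
proof
  show "\<exists>A. countable A \<and> A \<subseteq> sets M \<and> \<Union>A = space M \<and> (\<forall>a\<in>A. emeasure M a \<noteq> \<infinity>)"
  proof (intro exI[of _ "range (dyadic_cube 0)"] conjI)
    show "\<Union>(range (dyadic_cube 0)) = space M"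
      using sets_eq_imp_space_eq[OF M] by (auto simp: dyadic_cube_iff)
  qed (use M fin in \<open>auto simp: less_top[symmetric] order_less_imp_not_eq\<close>)
qed

text \<open>
  The testing condition on Newtonian energies of cubes is a Carleson condition for the dyadic
  tree.
\<close>

lemma tree_sum_test:
  assumes M: "sets M = sets borel" and fin: "\<And>k n. emeasure M (dyadic_cube k n) < \<infinity>"
    and K: "0 \<le> K" and test: "\<And>k n. (\<integral>\<^sup>+x\<in>dyadic_cube k n. (\<integral>\<^sup>+y\<in>dyadic_cube k n. newton_kernel x y \<partial>M) \<partial>M)
      \<le> ennreal K * emeasure M (dyadic_cube k n)"
  shows "tree_sum cube_children (cube_square M) N (k, n) \<le> 4 * K * measure M (dyadic_cube k n)"
proof -
  have [measurable_cong]: "sets M = sets borel" by fact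
  have [measurable]: "{y \<in> space borel. y \<in> cube_at l x} \<in> sets borel" for l x
    unfolding cube_at_def by simp
  have dm[simp]: "cube_at l x \<in> sets M" for l x using M by (simp add: cube_at_def)
  have "ennreal (tree_sum cube_children (cube_square M) N (k, n))
    = (\<integral>\<^sup>+x\<in>dyadic_cube k n. (\<Sum>j\<le>N. ennreal (2 powi (int j - k)) * emeasure M (cube_at (k - int j) x)) \<partial>M)"
    unfolding tree_sum_eq_integral[OF M fin] sum_distrib_right
    by (rule nn_integral_sum[symmetric]) (use M in measurable)
  also have "\<dots> \<le> (\<integral>\<^sup>+x\<in>dyadic_cube k n. 4 * (\<integral>\<^sup>+y\<in>dyadic_cube k n. newton_kernel x y \<partial>M) \<partial>M)"
  proof (intro nn_integral_mono)
    fix x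
    have "(\<Sum>j\<le>N. ennreal (2 powi (int j - k)) * emeasure M (cube_at (k - int j) x))
       \<le> 4 * (\<integral>\<^sup>+y\<in>dyadic_cube k n. newton_kernel x y \<partial>M)" if x: "x \<in> dyadic_cube k n"
    proof -
      have "(\<Sum>j\<le>N. ennreal (2 powi (int j - k)) * emeasure M (cube_at (k - int j) x))
        = (\<integral>\<^sup>+y. (\<Sum>j\<le>N. ennreal (2 powi (int j - k)) * indicator (cube_at (k - int j) x) y) \<partial>M)"
        by (subst nn_integral_sum) (auto simp: nn_integral_cmult_indicator)
      also have "\<dots> \<le> (\<integral>\<^sup>+y. 4 * newton_kernel x y * indicator (dyadic_cube k n) y \<partial>M)"
        by (intro nn_integral_mono cube_at_kernel_le x)
      also have "\<dots> = 4 * (\<integral>\<^sup>+y\<in>dyadic_cube k n. newton_kernel x y \<partial>M)"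
        unfolding mult.assoc by (rule nn_integral_cmult) (use M in measurable)
      finally show ?thesis .
    qed
    then show "(\<Sum>j\<le>N. ennreal (2 powi (int j - k)) * emeasure M (cube_at (k - int j) x)) * indicator (dyadic_cube k n) x
       \<le> 4 * (\<integral>\<^sup>+y\<in>dyadic_cube k n. newton_kernel x y \<partial>M) * indicator (dyadic_cube k n) x"
      by (auto split: split_indicator)
  qed
  also have "\<dots> \<le> 4 * (ennreal K * emeasure M (dyadic_cube k n))"
  proof -
    have "sigma_finite_measure M" by (rule sigma_finite_dyadic[OF M fin])
    then interpret sigma_finite_measure M .
    have "(\<integral>\<^sup>+x\<in>dyadic_cube k n. 4 * (\<integral>\<^sup>+y\<in>dyadic_cube k n. newton_kernel x y \<partial>M) \<partial>M)
      = 4 * (\<integral>\<^sup>+x\<in>dyadic_cube k n. (\<integral>\<^sup>+y\<in>dyadic_cube k n. newton_kernel x y \<partial>M) \<partial>M)"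
      unfolding mult.assoc by (rule nn_integral_cmult) measurable
    then show ?thesis using test[of k n] by (simp add: mult_left_mono)
  qed
  also have "\<dots> = ennreal (4 * K * measure M (dyadic_cube k n))"
    using fin[of k n] K by (subst emeasure_eq_ennreal_measure) (auto simp: ennreal_mult mult.assoc)
  finally show ?thesis using K by (subst (asm) ennreal_le_iff) auto
qed

section \<open>Newtonian energy and dyadic square sums\<close>

definition neighbours :: "(int^3) set" where "neighbours = {e. \<forall>i. e $ i \<in> {-1..1}}"

lemma finite_neighbours: "finite neighbours" and card_neighbours: "card neighbours \<le> 27"
proof -
  have e: "neighbours = vec_lambda ` (PiE UNIV (\<lambda>i. {-1..1}))"
    by (auto simp: neighbours_def image_iff PiE_UNIV_domain intro!: bexI[of _ "vec_nth _"])
  show "finite neighbours" unfolding e by (simp add: finite_PiE)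
  have "card neighbours \<le> card (PiE (UNIV::3 set) (\<lambda>i. {-1..1::int}))"
    unfolding e by (rule card_image_le) (simp add: finite_PiE)
  also have "\<dots> = 27" by (simp add: card_PiE)
  finally show "card neighbours \<le> 27" .
qed

lemma nn_integral_cube_index:
  fixes g :: "int^3 \<Rightarrow> ennreal"
  assumes M: "sets M = sets borel"
  shows "(\<integral>\<^sup>+x. g (cube_index l x) \<partial>M) = (\<integral>\<^sup>+n. g n * emeasure M (dyadic_cube l n) \<partial>count_space UNIV)"
proof -
  have [measurable_cong]: "sets M = sets borel" by fact
  have "g (cube_index l x) = (\<integral>\<^sup>+n. g n * indicator (dyadic_cube l n) x \<partial>count_space UNIV)" for x
  proof -
    have "(\<integral>\<^sup>+n. g n * indicator (dyadic_cube l n) x \<partial>count_space UNIV)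
       = (\<integral>\<^sup>+n. g (cube_index l x) * indicator {cube_index l x} n \<partial>count_space UNIV)"
      by (intro nn_integral_cong) (auto simp: dyadic_cube_iff split: split_indicator)
    also have "\<dots> = g (cube_index l x)" by (simp add: nn_integral_cmult_indicator)
    finally show ?thesis by simp
  qed
  then have "(\<integral>\<^sup>+x. g (cube_index l x) \<partial>M) = (\<integral>\<^sup>+x. \<integral>\<^sup>+n. g n * indicator (dyadic_cube l n) x \<partial>count_space UNIV \<partial>M)"
    by simp
  also have "\<dots> = (\<integral>\<^sup>+n. \<integral>\<^sup>+x. g n * indicator (dyadic_cube l n) x \<partial>M \<partial>count_space UNIV)"
    by (rule nn_integral_count_space_nn_integral) simp_all
  also have "\<dots> = (\<integral>\<^sup>+n. g n * emeasure M (dyadic_cube l n) \<partial>count_space UNIV)"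
    using M by (simp add: nn_integral_cmult_indicator)
  finally show ?thesis .
qed

lemma mult_le_squares: "a * b \<le> a * a + b * (b::ennreal)"
proof (cases "a \<le> b")
  case True
  then have "a * b \<le> b * b" by (intro mult_right_mono) auto
  then show ?thesis by (simp add: add_increasing)
next
  case False
  then have "a * b \<le> a * a" by (intro mult_left_mono) auto
  then show ?thesis by (simp add: add_increasing2)
qed

text \<open>
  After \<open>a b \<le> a\<^sup>2 + b\<^sup>2\<close> and a shift of the summation index, masses
  of pairs of neighbouring cubes are controlled by masses of single cubes. Energies being
  quadratic, this lets one dyadic grid capture pairs of close points that the grid separates.
\<close>

lemma shifted_cubes:
  assumes M: "sets M = sets borel"
  shows "(\<integral>\<^sup>+x. emeasure M (dyadic_cube l (cube_index l x + e)) \<partial>M) \<le> 2 * (\<integral>\<^sup>+x. emeasure M (cube_at l x) \<partial>M)"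
proof -
  let ?q = "\<lambda>n. emeasure M (dyadic_cube l n)"
  have "(\<integral>\<^sup>+x. emeasure M (dyadic_cube l (cube_index l x + e)) \<partial>M) = (\<integral>\<^sup>+n. ?q (n + e) * ?q n \<partial>count_space UNIV)"
    using nn_integral_cube_index[OF M, of "\<lambda>n. ?q (n + e)" l] by simp
  also have "\<dots> \<le> (\<integral>\<^sup>+n. ?q (n + e) * ?q (n + e) + ?q n * ?q n \<partial>count_space UNIV)"
    by (intro nn_integral_mono mult_le_squares)
  also have "\<dots> = (\<integral>\<^sup>+n. ?q (n + e) * ?q (n + e) \<partial>count_space UNIV) + (\<integral>\<^sup>+n. ?q n * ?q n \<partial>count_space UNIV)"
    by (rule nn_integral_add) auto
  also have "(\<integral>\<^sup>+n. ?q (n + e) * ?q (n + e) \<partial>count_space UNIV) = (\<integral>\<^sup>+n. ?q n * ?q n \<partial>count_space UNIV)"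
    by (rule nn_integral_bij_count_space[of "\<lambda>n. n + e" UNIV UNIV "\<lambda>n. ?q n * ?q n"])
       (auto intro!: bij_betwI[of _ _ _ "\<lambda>n. n - e"])
  also have "(\<integral>\<^sup>+n. ?q n * ?q n \<partial>count_space UNIV) = (\<integral>\<^sup>+x. emeasure M (cube_at l x) \<partial>M)"
    using nn_integral_cube_index[OF M, of ?q l] by (simp add: cube_at_def)
  finally show ?thesis by (simp add: mult_2)
qed

lemma near_pairs:
  assumes M: "sets M = sets borel"
  shows "(\<integral>\<^sup>+x. \<integral>\<^sup>+y. indicator {z. cube_index l z - cube_index l x \<in> neighbours} y \<partial>M \<partial>M) \<le> 54 * (\<integral>\<^sup>+x. emeasure M (cube_at l x) \<partial>M)"
proof -
  have [measurable_cong]: "sets M = sets borel" by fact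
  have "(\<integral>\<^sup>+y. indicator {z. cube_index l z - cube_index l x \<in> neighbours} y \<partial>M) = (\<Sum>e\<in>neighbours. emeasure M (dyadic_cube l (cube_index l x + e)))" for x
  proof -
    have "indicator {z. cube_index l z - cube_index l x \<in> neighbours} y = (\<Sum>e\<in>neighbours. indicator (dyadic_cube l (cube_index l x + e)) y :: ennreal)" for y
    proof -
      have "{z. cube_index l z - cube_index l x \<in> neighbours} = (\<Union>e\<in>neighbours. dyadic_cube l (cube_index l x + e))"
        by (auto simp: dyadic_cube_iff intro: bexI[of _ "cube_index l _ - cube_index l x"])
      then show ?thesis
        by (simp add: indicator_UN_disjoint finite_neighbours disjoint_family_on_def dyadic_cube_disjoint)
    qed
    then show ?thesis using M by (simp add: nn_integral_sum)
  qed
  then have "(\<integral>\<^sup>+x. \<integral>\<^sup>+y. indicator {z. cube_index l z - cube_index l x \<in> neighbours} y \<partial>M \<partial>M)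
     = (\<Sum>e\<in>neighbours. \<integral>\<^sup>+x. emeasure M (dyadic_cube l (cube_index l x + e)) \<partial>M)"
    by (simp add: nn_integral_sum)
  also have "\<dots> \<le> (\<Sum>e\<in>neighbours. 2 * (\<integral>\<^sup>+x. emeasure M (cube_at l x) \<partial>M))"
    by (intro sum_mono shifted_cubes M)
  also have "\<dots> = of_nat (card neighbours) * (2 * (\<integral>\<^sup>+x. emeasure M (cube_at l x) \<partial>M))"
    by simp
  also have "\<dots> \<le> of_nat 27 * (2 * (\<integral>\<^sup>+x. emeasure M (cube_at l x) \<partial>M))"
    by (intro mult_right_mono) (use card_neighbours in \<open>auto simp: of_nat_mono\<close>)
  also have "\<dots> = 54 * (\<integral>\<^sup>+x. emeasure M (cube_at l x) \<partial>M)"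
    by (simp add: mult.assoc[symmetric])
  finally show ?thesis .
qed

text \<open>
  If \<open>norm (x - y)\<close> lies between half of \<open>2 powi l\<close> and
  \<open>2 powi l\<close>, then \<open>x\<close> and \<open>y\<close> are in equal or adjacent
  cubes of side \<open>2 powi l\<close>, so the single summand of that scale is already large
  enough.
\<close>

lemma kernel_le_near:
  assumes "x \<noteq> y" "norm (x - y) \<le> 2 powi L"
  shows "newton_kernel x y
    \<le> (\<Sum>j. 2 * ennreal (2 powi (int j - L)) * indicator {z. cube_index (L - int j) z - cube_index (L - int j) x \<in> neighbours} y)"
proof -
  define r where "r = norm (x - y)"
  have r0: "r > 0" using assms by (simp add: r_def)
  (* The first scale that falls below the distance r comes just after the wanted one. *)
  define P where "P j \<longleftrightarrow> r > 2 powi (L - int j)" for j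
  have "\<exists>j. P j"
  proof -
    obtain j where "(1/2)^j < r / 2 powi L" using real_arch_pow_inv[of "r / 2 powi L" "1/2"] r0 by auto
    then have "2 powi (L - int j) < r" by (simp add: power_int_diff field_simps power_divide)
    then show ?thesis unfolding P_def by blast
  qed
  then obtain j0 where "P j0" by blast
  moreover have "\<not> P 0" using assms by (simp add: P_def r_def)
  ultimately obtain j where j: "\<And>i. i \<le> j \<Longrightarrow> \<not> P i" "P (Suc j)"
    using ex_least_nat_less[of P j0] by blast
  have le: "r \<le> 2 powi (L - int j)" using j(1)[of j] by (simp add: P_def)
  have gt: "2 powi (L - int j) / 2 < r" using j(2) by (simp add: P_def power_int_diff power_int_add mult.commute)
  have near: "cube_index (L - int j) y - cube_index (L - int j) x \<in> neighbours"
  proof -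
    have "\<lfloor>y $ i / 2 powi (L - int j)\<rfloor> - \<lfloor>x $ i / 2 powi (L - int j)\<rfloor> \<in> {-1..1}" for i
    proof -
      have "\<bar>(x - y) $ i\<bar> \<le> 2 powi (L - int j)" using le component_le_norm_cart[of "x - y" i] by (simp add: r_def)
      then have "\<bar>x $ i / 2 powi (L - int j) - y $ i / 2 powi (L - int j)\<bar> \<le> 1"
        by (simp add: diff_divide_distrib[symmetric] abs_divide)
      then show ?thesis by (simp; linarith)
    qed
    then show ?thesis by (simp add: neighbours_def cube_index_def)
  qed
  have "inverse (ennreal r) = ennreal (inverse r)" using r0 by (simp add: inverse_ennreal)
  also have "\<dots> \<le> ennreal (2 * 2 powi (int j - L))"
  proof (rule ennreal_leI)
    have "2 powi (int j - L) = inverse (2 powi (L - int j) :: real)"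
      by (simp add: power_int_minus[symmetric])
    moreover have "inverse r \<le> 2 * inverse (2 powi (L - int j))" using gt r0 by (simp add: field_simps)
    ultimately show "inverse r \<le> 2 * 2 powi (int j - L)" by simp
  qed
  also have "\<dots> = (\<Sum>i\<in>{j}. 2 * ennreal (2 powi (int i - L)) * indicator {z. cube_index (L - int i) z - cube_index (L - int i) x \<in> neighbours} y)"
    using near by (simp add: ennreal_mult)
  also have "\<dots> \<le> (\<Sum>i. 2 * ennreal (2 powi (int i - L)) * indicator {z. cube_index (L - int i) z - cube_index (L - int i) x \<in> neighbours} y)"
    by (rule sum_le_suminf) auto
  finally show ?thesis by (simp add: r_def)
qed

text \<open>
  Integrate \<open>kernel_le_near\<close> and apply \<open>near_pairs\<close> at every scale;
  \<open>108 = 2 * 54\<close>. Points have measure zero, so the diagonal, where the kernel is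
  infinite, does not contribute.
\<close>

lemma energy_le_squares:
  assumes M: "sets M = sets borel" and fin: "\<And>k n. emeasure M (dyadic_cube k n) < \<infinity>"
    and pt: "\<And>x. emeasure M {x} = 0" and supp: "AE x in M. norm x \<le> 2 powi (L - 1)"
  shows "(\<integral>\<^sup>+x. \<integral>\<^sup>+y. newton_kernel x y \<partial>M \<partial>M)
     \<le> 108 * (\<Sum>j. \<integral>\<^sup>+x. ennreal (2 powi (int j - L)) * emeasure M (cube_at (L - int j) x) \<partial>M)"
proof -
  have [measurable_cong]: "sets M = sets borel" by fact
  interpret sigma_finite_measure M by (rule sigma_finite_dyadic[OF M fin])
  have ms: "{z. cube_index l z - cube_index l x \<in> neighbours} \<in> sets M" for l x
  proof -
    have "{z \<in> space borel. cube_index l z - cube_index l x \<in> neighbours} \<in> sets borel" by measurable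
    then show ?thesis using M by simp
  qed
  have ms2: "(\<lambda>x. emeasure M {z. cube_index l z - cube_index l x \<in> neighbours}) \<in> borel_measurable M" for l
    using measurable_compose[OF measurable_cube_index, of "\<lambda>n. emeasure M {z. cube_index l z - n \<in> neighbours}" borel l] M
    by (simp cong: measurable_cong_sets)
  have "AE x in M. AE y in M. x \<noteq> y \<and> norm (x - y) \<le> 2 powi L"
    using supp
  proof eventually_elim
    case (elim x)
    have "AE y in M. y \<notin> {x}" using pt[of x] M by (intro AE_not_in) (auto simp: null_sets_def)
    then show ?case using supp
    proof eventually_elim
      case (elim y)
      have "norm (x - y) \<le> 2 powi (L - 1) + 2 powi (L - 1)"
        using norm_triangle_ineq4[of x y] elim \<open>norm x \<le> 2 powi (L - 1)\<close> by linarith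
      also have "\<dots> = 2 powi L" by (simp add: power_int_diff)
      finally show ?case using elim by auto
    qed
  qed
  then have "(\<integral>\<^sup>+x. \<integral>\<^sup>+y. newton_kernel x y \<partial>M \<partial>M)
    \<le> (\<integral>\<^sup>+x. \<integral>\<^sup>+y. (\<Sum>j. 2 * ennreal (2 powi (int j - L)) * indicator {z. cube_index (L - int j) z - cube_index (L - int j) x \<in> neighbours} y) \<partial>M \<partial>M)"
  proof (intro nn_integral_mono_AE, eventually_elim)
    case (elim x)
    show ?case
      by (intro nn_integral_mono_AE) (use elim in \<open>eventually_elim, auto intro!: kernel_le_near\<close>)
  qed
  also have "\<dots> = (\<integral>\<^sup>+x. (\<Sum>j. 2 * ennreal (2 powi (int j - L)) * emeasure M {z. cube_index (L - int j) z - cube_index (L - int j) x \<in> neighbours}) \<partial>M)"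
    using ms by (subst nn_integral_suminf) (auto simp: nn_integral_cmult_indicator)
  also have "\<dots> = (\<Sum>j. 2 * ennreal (2 powi (int j - L)) * (\<integral>\<^sup>+x. emeasure M {z. cube_index (L - int j) z - cube_index (L - int j) x \<in> neighbours} \<partial>M))"
    using ms2 by (subst nn_integral_suminf) (auto simp: nn_integral_cmult)
  also have "\<dots> \<le> (\<Sum>j. 2 * ennreal (2 powi (int j - L)) * (54 * (\<integral>\<^sup>+x. emeasure M (cube_at (L - int j) x) \<partial>M)))"
    using near_pairs[OF M] ms by (intro suminf_le mult_left_mono) auto
  also have "\<dots> = (\<Sum>j. 108 * (\<integral>\<^sup>+x. ennreal (2 powi (int j - L)) * emeasure M (cube_at (L - int j) x) \<partial>M))"
  proof (intro arg_cong[of _ _ suminf] ext)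
    fix j
    have "(\<integral>\<^sup>+x. ennreal (2 powi (int j - L)) * emeasure M (cube_at (L - int j) x) \<partial>M)
      = ennreal (2 powi (int j - L)) * (\<integral>\<^sup>+x. emeasure M (cube_at (L - int j) x) \<partial>M)"
      by (rule nn_integral_cmult) (use M in measurable)
    then show "2 * ennreal (2 powi (int j - L)) * (54 * (\<integral>\<^sup>+x. emeasure M (cube_at (L - int j) x) \<partial>M))
       = 108 * (\<integral>\<^sup>+x. ennreal (2 powi (int j - L)) * emeasure M (cube_at (L - int j) x) \<partial>M)"
      by (simp add: mult_ac)
  qed
  finally show ?thesis by simp
qed

section \<open>The Kerman--Sawyer energy inequality\<close>

lemma measure_density_square:
  assumes M: "sets M = sets borel" and [measurable]: "\<phi> \<in> borel_measurable borel" and Q[measurable]: "Q \<in> sets borel"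
    and fin: "emeasure M Q < \<infinity>" "emeasure (density M (\<lambda>x. ennreal (\<phi> x))) Q < \<infinity>"
      "emeasure (density M (\<lambda>x. ennreal ((\<phi> x)\<^sup>2))) Q < \<infinity>" and nn: "\<And>x. 0 \<le> \<phi> x"
  shows "(measure (density M (\<lambda>x. ennreal (\<phi> x))) Q)\<^sup>2
    \<le> measure M Q * measure (density M (\<lambda>x. ennreal ((\<phi> x)\<^sup>2))) Q"
proof -
  have [measurable_cong]: "sets M = sets borel" by fact
  have "(\<integral>\<^sup>+x. indicator Q x * (ennreal (\<phi> x) * indicator Q x) \<partial>M)\<^sup>2
     \<le> (\<integral>\<^sup>+x. (indicator Q x)\<^sup>2 \<partial>M) * (\<integral>\<^sup>+x. (ennreal (\<phi> x) * indicator Q x)\<^sup>2 \<partial>M)"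
    by (rule Cauchy_Schwarz_nn_integral) measurable
  also have "(\<integral>\<^sup>+x. indicator Q x * (ennreal (\<phi> x) * indicator Q x) \<partial>M) = emeasure (density M (\<lambda>x. ennreal (\<phi> x))) Q"
    using M by (subst emeasure_density) (auto intro!: nn_integral_cong split: split_indicator)
  also have "(\<integral>\<^sup>+x. (indicator Q x)\<^sup>2 \<partial>M) = (\<integral>\<^sup>+x. indicator Q x \<partial>M)"
    by (intro nn_integral_cong) (auto split: split_indicator)
  also have "\<dots> = emeasure M Q" using M by simp
  also have "(\<integral>\<^sup>+x. (ennreal (\<phi> x) * indicator Q x)\<^sup>2 \<partial>M) = emeasure (density M (\<lambda>x. ennreal ((\<phi> x)\<^sup>2))) Q"
    using M nn by (subst emeasure_density) (auto intro!: nn_integral_cong simp: ennreal_power split: split_indicator)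
  finally show ?thesis
    using fin by (simp add: emeasure_eq_ennreal_measure less_top[symmetric] ennreal_mult[symmetric] ennreal_power)
qed

text \<open>
  Carleson embedding for the measures with densities \<open>1\<close>, \<open>\<phi>\<close> and
  \<open>\<phi>\<^sup>2\<close> with respect to \<open>M\<close>. The testing condition enters
  with constant \<open>4 K\<close>, the embedding adds a factor 4, and
  \<open>1728 = 108 * 16\<close>. Bounded support of \<open>\<phi>\<close> makes finitely many
  trees exhaust the energy.
\<close>

lemma carleson_energy:
  fixes \<phi> :: "real^3 \<Rightarrow> real"
  assumes M: "sets M = sets borel" and fin: "\<And>k n. emeasure M (dyadic_cube k n) < \<infinity>"
    and pt: "\<And>x. emeasure M {x} = 0" and K: "0 < K"
    and test: "\<And>k n. (\<integral>\<^sup>+x\<in>dyadic_cube k n. (\<integral>\<^sup>+y\<in>dyadic_cube k n. newton_kernel x y \<partial>M) \<partial>M)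
      \<le> ennreal K * emeasure M (dyadic_cube k n)"
    and phi[measurable]: "\<phi> \<in> borel_measurable borel" and nn: "\<And>x. 0 \<le> \<phi> x" and bd: "\<And>x. \<phi> x \<le> B"
    and supp: "\<And>x. r < norm x \<Longrightarrow> \<phi> x = 0"
  defines "N \<equiv> density M (\<lambda>x. ennreal (\<phi> x))"
  shows "(\<integral>\<^sup>+x. \<integral>\<^sup>+y. newton_kernel x y \<partial>N \<partial>N) \<le> ennreal (1728 * K) * (\<integral>\<^sup>+x. ennreal ((\<phi> x)\<^sup>2) \<partial>M)"
proof -
  have [measurable_cong]: "sets M = sets borel" by fact
  define Y where "Y = density M (\<lambda>x. ennreal ((\<phi> x)\<^sup>2))"
  have sN[measurable_cong]: "sets N = sets borel" and sY[measurable_cong]: "sets Y = sets borel" using M by (simp_all add: N_def Y_def)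
  have finD: "emeasure (density M (\<lambda>x. ennreal (g x))) (dyadic_cube k n) < \<infinity>"
    if [measurable]: "g \<in> borel_measurable borel" and g: "\<And>x. g x \<le> b" for g b k n
  proof -
    have "emeasure (density M (\<lambda>x. ennreal (g x))) (dyadic_cube k n) = (\<integral>\<^sup>+x\<in>dyadic_cube k n. ennreal (g x) \<partial>M)"
      using M by (intro emeasure_density) auto
    also have "\<dots> \<le> (\<integral>\<^sup>+x\<in>dyadic_cube k n. ennreal b \<partial>M)"
      by (intro nn_integral_mono mult_right_mono ennreal_leI g) auto
    also have "\<dots> = ennreal b * emeasure M (dyadic_cube k n)" using M by (simp add: nn_integral_cmult_indicator)
    also have "\<dots> < \<infinity>" using fin[of k n] by (simp add: ennreal_mult_less_top)
    finally show ?thesis .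
  qed
  have finN: "emeasure N (dyadic_cube k n) < \<infinity>" for k n unfolding N_def by (rule finD[OF phi bd])
  have finY: "emeasure Y (dyadic_cube k n) < \<infinity>" for k n unfolding Y_def
    by (rule finD[where b = "B\<^sup>2"]) (auto intro!: power_mono nn bd)
  have ptN: "emeasure N {x} = 0" for x
  proof -
    have "{x} \<in> null_sets M" using pt[of x] M by (simp add: null_sets_def)
    then have "AE y in M. y \<notin> {x}" by (rule AE_not_in)
    then have "AE y in M. y \<in> {x} \<longrightarrow> ennreal (\<phi> y) = 0" by eventually_elim auto
    then have "{x} \<in> null_sets N" unfolding N_def using M by (subst null_sets_density_iff) auto
    then show ?thesis by (simp add: null_sets_def)
  qed
  obtain l :: nat where l: "r < 2 ^ l" using real_arch_pow[of 2 r] by auto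
  define L where "L = int l + 1"
  have supN: "AE x in N. norm x \<le> 2 powi (L - 1)"
    unfolding N_def
  proof (subst AE_density)
    show "AE x in M. 0 < ennreal (\<phi> x) \<longrightarrow> norm x \<le> 2 powi (L - 1)"
    proof (intro AE_I2 impI)
      fix x assume "0 < ennreal (\<phi> x)"
      then have "\<not> r < norm x" using supp[of x] by auto
      then show "norm x \<le> 2 powi (L - 1)" using l by (simp add: L_def)
    qed
  qed (use M in measurable)
  let ?cub = "\<lambda>q. dyadic_cube (fst q) (snd q)"
  have tree: "tree_sum cube_children (cube_square N) n q \<le> 16 * K * measure Y (?cub q)" for n q
  proof -
    have "tree_sum cube_children (\<lambda>q. (measure N (?cub q))\<^sup>2 / 2 powi (fst q)) n q
      \<le> 4 * (4 * K) * (measure Y (?cub q) - (measure N (?cub q))\<^sup>2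
        / (measure M (?cub q) + tree_sum cube_children (\<lambda>q. (measure M (?cub q))\<^sup>2 / 2 powi (fst q)) n q / (4 * K)))"
    proof (rule carleson_tree)
      show "(measure N (?cub q))\<^sup>2 \<le> measure M (?cub q) * measure Y (?cub q)" for q
        using finN[of "fst q" "snd q"] finY[of "fst q" "snd q"] fin[of "fst q" "snd q"] unfolding N_def Y_def
        by (intro measure_density_square M nn phi) auto
      show "tree_sum cube_children (\<lambda>q. (measure M (?cub q))\<^sup>2 / 2 powi (fst q)) N q \<le> 4 * K * measure M (?cub q)" for N q
        using tree_sum_test[OF M fin _ test, of N "fst q" "snd q"] K by (simp add: cube_square_def[abs_def])
      show "measure M (?cub q) = (\<Sum>r\<in>cube_children q. measure M (?cub r))" for q
        using measure_children[OF M fin, of "fst q" "snd q"] by simp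
      show "measure N (?cub q) = (\<Sum>r\<in>cube_children q. measure N (?cub r))" for q
        using measure_children[OF sN finN, of "fst q" "snd q"] by simp
      show "measure Y (?cub q) = (\<Sum>r\<in>cube_children q. measure Y (?cub r))" for q
        using measure_children[OF sY finY, of "fst q" "snd q"] by simp
    qed (use K in auto)
    also have "\<dots> \<le> 4 * (4 * K) * measure Y (?cub q)"
    proof -
      have "0 \<le> tree_sum cube_children (\<lambda>q. (measure M (?cub q))\<^sup>2 / 2 powi (fst q)) n q"
        by (induction n arbitrary: q) (auto intro!: add_nonneg_nonneg sum_nonneg)
      then show ?thesis using K by (intro mult_left_mono) auto
    qed
    finally show ?thesis by (simp add: cube_square_def[abs_def])
  qed
  (* These eight cubes of side 2 powi L are the ones that meet at the origin; they cover the
     support. *)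
  define tops where "tops = {n::int^3. \<forall>i. n $ i \<in> {-1..0}}"
  have ftops: "finite tops"
  proof -
    have "tops \<subseteq> neighbours" by (auto simp: tops_def neighbours_def) (meson order_trans zero_le_one)
    then show ?thesis using finite_neighbours finite_subset by blast
  qed
  have topN: "AE x in N. cube_index L x \<in> tops"
    using supN
  proof eventually_elim
    case (elim x)
    have "\<lfloor>x $ i / 2 powi L\<rfloor> \<in> {-1..0}" for i
    proof -
      have "\<bar>x $ i\<bar> \<le> 2 powi (L - 1)" using elim component_le_norm_cart[of x i] by linarith
      then have "\<bar>x $ i\<bar> < 2 powi L" by (rule order_le_less_trans) (simp add: power_int_diff)
      then have "-1 \<le> x $ i / 2 powi L" "x $ i / 2 powi L < 1"
        by (auto simp: field_simps)
      then have "-1 \<le> \<lfloor>x $ i / 2 powi L\<rfloor>" "\<lfloor>x $ i / 2 powi L\<rfloor> < 1"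
        by (auto simp: le_floor_iff floor_less_iff)
      then show ?thesis by simp
    qed
    then show ?case by (simp add: tops_def cube_index_def)
  qed
  have part: "(\<Sum>j<n. \<integral>\<^sup>+x. ennreal (2 powi (int j - L)) * emeasure N (cube_at (L - int j) x) \<partial>N)
     \<le> ennreal (16 * K) * (\<integral>\<^sup>+x. ennreal ((\<phi> x)\<^sup>2) \<partial>M)" for n
  proof -
    let ?c = "\<lambda>j x. ennreal (2 powi (int j - L)) * emeasure N (cube_at (L - int j) x)"
    have c[measurable]: "?c j \<in> borel_measurable borel" for j using sN by measurable
    have "(\<Sum>j<n. \<integral>\<^sup>+x. ?c j x \<partial>N) \<le> (\<Sum>j\<le>n. \<integral>\<^sup>+x. ?c j x \<partial>N)"
      by (intro sum_mono2) auto
    also have "\<dots> = (\<Sum>j\<le>n. \<Sum>t\<in>tops. \<integral>\<^sup>+x\<in>dyadic_cube L t. ?c j x \<partial>N)"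
    proof (intro sum.cong refl)
      fix j
      have "(\<integral>\<^sup>+x. ?c j x \<partial>N) = (\<integral>\<^sup>+x. (\<Sum>t\<in>tops. ?c j x * indicator (dyadic_cube L t) x) \<partial>N)"
        using topN
      proof (intro nn_integral_cong_AE, eventually_elim)
        case (elim x)
        have "(\<Sum>t\<in>tops. indicator (dyadic_cube L t) x) = (indicator (\<Union>t\<in>tops. dyadic_cube L t) x :: ennreal)"
          by (intro indicator_UN_disjoint[symmetric] ftops) (auto simp: disjoint_family_on_def dyadic_cube_disjoint)
        also have "\<dots> = 1" using elim by (auto simp: dyadic_cube_iff)
        finally show ?case by (simp add: sum_distrib_left[symmetric])
      qed
      also have "\<dots> = (\<Sum>t\<in>tops. \<integral>\<^sup>+x\<in>dyadic_cube L t. ?c j x \<partial>N)"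
        by (rule nn_integral_sum) measurable
      finally show "(\<integral>\<^sup>+x. ?c j x \<partial>N) = (\<Sum>t\<in>tops. \<integral>\<^sup>+x\<in>dyadic_cube L t. ?c j x \<partial>N)" .
    qed
    also have "\<dots> = (\<Sum>t\<in>tops. ennreal (tree_sum cube_children (cube_square N) n (L, t)))"
      by (subst sum.swap) (simp only: tree_sum_eq_integral[OF sN finN])
    also have "\<dots> \<le> (\<Sum>t\<in>tops. ennreal (16 * K * measure Y (dyadic_cube L t)))"
      using tree[of n "(L, _)"] by (intro sum_mono ennreal_leI) simp
    also have "\<dots> = (\<Sum>t\<in>tops. ennreal (16 * K) * emeasure Y (dyadic_cube L t))"
      using finY K by (intro sum.cong refl, subst emeasure_eq_ennreal_measure) (auto simp: ennreal_mult less_top[symmetric])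
    also have "\<dots> = ennreal (16 * K) * (\<Sum>t\<in>tops. emeasure Y (dyadic_cube L t))"
      by (rule sum_distrib_left[symmetric])
    also have "(\<Sum>t\<in>tops. emeasure Y (dyadic_cube L t)) = emeasure Y (\<Union>t\<in>tops. dyadic_cube L t)"
    proof (rule sum_emeasure[OF _ _ ftops])
      show "dyadic_cube L ` tops \<subseteq> sets Y" by (auto simp: sY)
      show "disjoint_family_on (dyadic_cube L) tops"
        by (simp add: disjoint_family_on_def dyadic_cube_disjoint)
    qed
    also have "ennreal (16 * K) * emeasure Y (\<Union>t\<in>tops. dyadic_cube L t) \<le> ennreal (16 * K) * emeasure Y (space Y)"
      by (intro mult_left_mono emeasure_space) auto
    also have "emeasure Y (space Y) = (\<integral>\<^sup>+x. ennreal ((\<phi> x)\<^sup>2) \<partial>M)"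
      unfolding Y_def using M by (subst emeasure_density) (auto intro!: nn_integral_cong)
    finally show ?thesis .
  qed
  have "(\<integral>\<^sup>+x. \<integral>\<^sup>+y. newton_kernel x y \<partial>N \<partial>N)
     \<le> 108 * (\<Sum>j. \<integral>\<^sup>+x. ennreal (2 powi (int j - L)) * emeasure N (cube_at (L - int j) x) \<partial>N)"
    by (rule energy_le_squares[OF sN finN ptN supN])
  also have "\<dots> \<le> 108 * (ennreal (16 * K) * (\<integral>\<^sup>+x. ennreal ((\<phi> x)\<^sup>2) \<partial>M))"
    by (intro mult_left_mono) (auto simp: suminf_eq_SUP intro!: SUP_least part)
  also have "\<dots> = ennreal (1728 * K) * (\<integral>\<^sup>+x. ennreal ((\<phi> x)\<^sup>2) \<partial>M)"
    using K by (simp add: ennreal_mult mult.assoc[symmetric])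
  finally show ?thesis .
qed

text \<open>
  The testing condition is not inherited by a smaller weight \<open>W\<close>, but the energy
  inequality is: apply it to \<open>w\<close> and \<open>\<phi> = \<psi> W / w\<close>. Then
  \<open>\<phi> w = \<psi> W\<close>, which preserves the energy, while
  \<open>\<phi> \<le> \<psi>\<close> gives \<open>\<phi>\<^sup>2 w \<le> \<psi>\<^sup>2 W\<close>.
\<close>

lemma weighted_energy:
  fixes w W \<psi> :: "real^3 \<Rightarrow> real"
  assumes w[measurable]: "w \<in> borel_measurable borel" and w0: "\<And>x. 0 \<le> w x"
    and fin: "\<And>k n. (\<integral>\<^sup>+x\<in>dyadic_cube k n. w x \<partial>lborel) < \<infinity>" and K: "0 < K"
    and test: "\<And>k n. (\<integral>\<^sup>+x\<in>dyadic_cube k n. (\<integral>\<^sup>+y\<in>dyadic_cube k n. w x * w y * newton_kernel x y \<partial>lborel) \<partial>lborel)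
      \<le> ennreal K * (\<integral>\<^sup>+x\<in>dyadic_cube k n. w x \<partial>lborel)"
    and W[measurable]: "W \<in> borel_measurable borel" and W0: "\<And>x. 0 \<le> W x" and Ww: "\<And>x. W x \<le> w x"
    and Wr: "\<And>x. r < norm x \<Longrightarrow> W x = 0"
    and psi[measurable]: "\<psi> \<in> borel_measurable borel" and nn: "\<And>x. 0 \<le> \<psi> x" and bd: "\<And>x. \<psi> x \<le> B"
  shows "(\<integral>\<^sup>+x. \<integral>\<^sup>+y. ennreal (\<psi> x * W x) * ennreal (\<psi> y * W y) * newton_kernel x y \<partial>lborel \<partial>lborel)
    \<le> ennreal (1728 * K) * (\<integral>\<^sup>+x. ennreal ((\<psi> x)\<^sup>2 * W x) \<partial>lborel)"
proof -
  define M where "M = density lborel (\<lambda>x. ennreal (w x))"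
  define \<phi> where "\<phi> x = \<psi> x * W x / w x" for x
  define N where "N = density M (\<lambda>x. ennreal (\<phi> x))"
  have [measurable]: "\<phi> \<in> borel_measurable borel" unfolding \<phi>_def by measurable
  have sM: "sets M = sets borel" by (simp add: M_def)
  have ph0: "0 \<le> \<phi> x" for x using w0 W0 nn by (simp add: \<phi>_def)
  have W00: "W x = 0" if "w x = 0" for x using that W0[of x] Ww[of x] by simp
  have phw: "w x * \<phi> x = \<psi> x * W x" for x using W00[of x] by (simp add: \<phi>_def)
  have N: "N = density lborel (\<lambda>x. ennreal (\<psi> x * W x))"
    unfolding N_def M_def
    by (subst density_density_eq) (auto intro!: density_cong simp: phw ennreal_mult[symmetric] w0 ph0)
  have phpsi: "\<phi> x \<le> \<psi> x" for x
  proof (cases "w x = 0")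
    case True then show ?thesis using nn by (simp add: \<phi>_def)
  next
    case False
    then have "w x > 0" using w0[of x] by simp
    then show ?thesis using Ww[of x] nn[of x] unfolding \<phi>_def
      by (simp add: divide_le_eq mult_left_mono)
  qed
  have energy: "(\<integral>\<^sup>+x. \<integral>\<^sup>+y. newton_kernel x y \<partial>N \<partial>N) \<le> ennreal (1728 * K) * (\<integral>\<^sup>+x. ennreal ((\<phi> x)\<^sup>2) \<partial>M)"
    unfolding N_def
  proof (rule carleson_energy[OF sM])
    show "emeasure M (dyadic_cube k n) < \<infinity>" for k n
      using fin[of k n] unfolding M_def by (subst emeasure_density) auto
    show "emeasure M {x} = 0" for x
    proof -
      have "AE y in lborel. y \<noteq> x" by (rule AE_lborel_singleton)
      then have "AE y in lborel. y \<in> {x} \<longrightarrow> ennreal (w y) = 0" by eventually_elim simp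
      then have "{x} \<in> null_sets M" unfolding M_def by (subst null_sets_density_iff) simp_all
      then show ?thesis by (simp add: null_sets_def)
    qed
    show "(\<integral>\<^sup>+x\<in>dyadic_cube k n. (\<integral>\<^sup>+y\<in>dyadic_cube k n. newton_kernel x y \<partial>M) \<partial>M)
      \<le> ennreal K * emeasure M (dyadic_cube k n)" for k n
    proof -
      have "(\<integral>\<^sup>+x\<in>dyadic_cube k n. (\<integral>\<^sup>+y\<in>dyadic_cube k n. newton_kernel x y \<partial>M) \<partial>M)
         = (\<integral>\<^sup>+x\<in>dyadic_cube k n. (\<integral>\<^sup>+y\<in>dyadic_cube k n. w x * w y * newton_kernel x y \<partial>lborel) \<partial>lborel)"
        unfolding M_def
        by (simp add: nn_integral_density nn_integral_cmult[symmetric] ennreal_mult w0 mult_ac)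
      also have "\<dots> \<le> ennreal K * (\<integral>\<^sup>+x\<in>dyadic_cube k n. w x \<partial>lborel)" by (rule test)
      also have "(\<integral>\<^sup>+x\<in>dyadic_cube k n. w x \<partial>lborel) = emeasure M (dyadic_cube k n)"
        unfolding M_def by (subst emeasure_density) auto
      finally show ?thesis .
    qed
    show "\<phi> x \<le> B" for x using phpsi[of x] bd[of x] by linarith
    show "\<phi> x = 0" if "r < norm x" for x using Wr[OF that] by (simp add: \<phi>_def)
  qed (use K ph0 in auto)
  have e: "w x * (\<phi> x)\<^sup>2 = \<phi> x * (\<psi> x * W x)" for x
    by (simp add: phw[symmetric] power2_eq_square)
  have "(\<integral>\<^sup>+x. ennreal ((\<phi> x)\<^sup>2) \<partial>M) = (\<integral>\<^sup>+x. ennreal (\<phi> x * (\<psi> x * W x)) \<partial>lborel)"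
    unfolding M_def
    by (subst nn_integral_density)
       (auto intro!: nn_integral_cong simp: ennreal_mult[symmetric] w0 e)
  also have "\<dots> \<le> (\<integral>\<^sup>+x. ennreal ((\<psi> x)\<^sup>2 * W x) \<partial>lborel)"
  proof (intro nn_integral_mono ennreal_leI)
    fix x
    have "\<phi> x * (\<psi> x * W x) \<le> \<psi> x * (\<psi> x * W x)" using phpsi nn W0 by (intro mult_right_mono) auto
    then show "\<phi> x * (\<psi> x * W x) \<le> (\<psi> x)\<^sup>2 * W x" by (simp add: power2_eq_square mult_ac)
  qed
  finally have "ennreal (1728 * K) * (\<integral>\<^sup>+x. ennreal ((\<phi> x)\<^sup>2) \<partial>M)
      \<le> ennreal (1728 * K) * (\<integral>\<^sup>+x. ennreal ((\<psi> x)\<^sup>2 * W x) \<partial>lborel)"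
    by (rule mult_left_mono) simp
  moreover have "(\<integral>\<^sup>+x. \<integral>\<^sup>+y. newton_kernel x y \<partial>N \<partial>N)
     = (\<integral>\<^sup>+x. \<integral>\<^sup>+y. ennreal (\<psi> x * W x) * ennreal (\<psi> y * W y) * newton_kernel x y \<partial>lborel \<partial>lborel)"
    unfolding N by (simp add: nn_integral_density nn_integral_cmult[symmetric] mult_ac)
  ultimately show ?thesis using energy by simp
qed

section \<open>Gaussian integrals\<close>

lemma integrable_lborel_prod:
  fixes f :: "'a::euclidean_space \<Rightarrow> complex" and g :: "'b::euclidean_space \<Rightarrow> complex"
  assumes f: "integrable lborel f" and g: "integrable lborel g"
  shows "integrable lborel (\<lambda>p. f (fst p) * g (snd p))"
proof -
  have [measurable]: "f \<in> borel_measurable borel" "g \<in> borel_measurable borel"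
    using f g by auto
  have "integrable (lborel \<Otimes>\<^sub>M lborel) (\<lambda>(x, y). f x * g y)"
  proof (rule lborel_pair.Fubini_integrable)
    show "(\<lambda>(x, y). f x * g y) \<in> borel_measurable (lborel \<Otimes>\<^sub>M lborel)" by measurable
    have "integrable lborel (\<lambda>x. norm (f x) * (LINT y|lborel. norm (g y)))"
      using f by (intro integrable_mult_left integrable_norm)
    then show "integrable lborel (\<lambda>x. LINT y|lborel. norm (case (x, y) of (x, y) \<Rightarrow> f x * g y))"
      by (simp add: norm_mult)
    show "AE x in lborel. integrable lborel (\<lambda>y. case (x, y) of (x, y) \<Rightarrow> f x * g y)"
      using g by (intro AE_I2) simp
  qed
  then show ?thesis by (simp add: lborel_prod case_prod_beta')
qed

lemma integral_lborel_prod: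
  fixes f :: "'a::euclidean_space \<Rightarrow> complex" and g :: "'b::euclidean_space \<Rightarrow> complex"
  assumes f: "integrable lborel f" and g: "integrable lborel g"
  shows "(LINT p|lborel. f (fst p) * g (snd p)) = (LINT x|lborel. f x) * (LINT y|lborel. g y)"
proof -
  have "integrable (lborel \<Otimes>\<^sub>M lborel) (\<lambda>p. f (fst p) * g (snd p))"
    using integrable_lborel_prod[OF f g] by (simp add: lborel_prod)
  from lborel_pair.integral_fst'[OF this]
  have "(LINT p|lborel. f (fst p) * g (snd p)) = (LINT x|lborel. LINT y|lborel. f x * g y)"
    by (simp add: lborel_prod)
  then show ?thesis by simp
qed

lemma Fubini_lborel:
  fixes F :: "'a::euclidean_space \<times> 'b::euclidean_space \<Rightarrow> 'c::euclidean_space"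
  assumes "integrable lborel F"
  shows "(LINT x|lborel. LINT y|lborel. F (x, y)) = (LINT y|lborel. LINT x|lborel. F (x, y))"
    and "(LINT x|lborel. LINT y|lborel. F (x, y)) = (LINT p|lborel. F p)"
proof -
  have i: "integrable (lborel \<Otimes>\<^sub>M lborel) F" using assms by (simp add: lborel_prod)
  show "(LINT x|lborel. LINT y|lborel. F (x, y)) = (LINT p|lborel. F p)"
    using lborel_pair.integral_fst'[OF i] by (simp add: lborel_prod)
  show "(LINT x|lborel. LINT y|lborel. F (x, y)) = (LINT y|lborel. LINT x|lborel. F (x, y))"
    using lborel_pair.Fubini_integral[of "\<lambda>x y. F (x, y)"] i by (simp add: case_prod_beta)
qed

text \<open>
  This is the characteristic function of the standard normal distribution after rescaling.
\<close>

lemma gaussian_fourier_1d: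
  fixes z s :: real assumes s: "s > 0"
  shows "(LINT x|lborel. exp (\<i> * complex_of_real (z * x)) * complex_of_real (exp (- (s * x)\<^sup>2 / 2)))
      = complex_of_real (sqrt (2 * pi) / s * exp (- (z / s)\<^sup>2 / 2))"
    and "integrable lborel (\<lambda>x::real. exp (\<i> * complex_of_real (z * x)) * complex_of_real (exp (- (s * x)\<^sup>2 / 2)))"
proof -
  have "char std_normal_distribution z = complex_of_real (exp (- z\<^sup>2 / 2))" for z
    by (simp add: char_std_normal_distribution)
  moreover have "char std_normal_distribution z
    = (LINT x|lborel. std_normal_density x *\<^sub>R exp (\<i> * complex_of_real (z * x)))" for z
    unfolding char_def by (subst integral_density) auto
  ultimately have c: "(LINT x|lborel. std_normal_density x *\<^sub>R exp (\<i> * complex_of_real (z * x))) = complex_of_real (exp (- z\<^sup>2 / 2))" for z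
    by simp
  have "(LINT x|lborel. std_normal_density x *\<^sub>R exp (\<i> * complex_of_real (z / s * x)))
     = s *\<^sub>R (LINT x|lborel. std_normal_density (s * x) *\<^sub>R exp (\<i> * complex_of_real (z / s * (s * x))))"
    using s by (subst lborel_integral_real_affine[where c = s and t = 0]) auto
  also have "\<dots> = (LINT x|lborel. (s / sqrt (2 * pi)) *\<^sub>R (exp (\<i> * complex_of_real (z * x)) * complex_of_real (exp (- (s * x)\<^sup>2 / 2))))"
    using s by (subst integral_scaleR_right[symmetric])
      (auto intro!: Bochner_Integration.integral_cong simp: std_normal_density_def scaleR_conv_of_real field_simps)
  also have "\<dots> = (s / sqrt (2 * pi)) *\<^sub>R (LINT x|lborel. exp (\<i> * complex_of_real (z * x)) * complex_of_real (exp (- (s * x)\<^sup>2 / 2)))"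
    by (rule integral_scaleR_right)
  finally have "(s / sqrt (2 * pi)) *\<^sub>R (LINT x|lborel. exp (\<i> * complex_of_real (z * x)) * complex_of_real (exp (- (s * x)\<^sup>2 / 2)))
     = complex_of_real (exp (- (z / s)\<^sup>2 / 2))"
    unfolding c by simp
  then have "(sqrt (2 * pi) / s) *\<^sub>R (s / sqrt (2 * pi)) *\<^sub>R (LINT x|lborel. exp (\<i> * complex_of_real (z * x)) * complex_of_real (exp (- (s * x)\<^sup>2 / 2)))
     = (sqrt (2 * pi) / s) *\<^sub>R complex_of_real (exp (- (z / s)\<^sup>2 / 2))"
    by simp
  then show "(LINT x|lborel. exp (\<i> * complex_of_real (z * x)) * complex_of_real (exp (- (s * x)\<^sup>2 / 2)))
      = complex_of_real (sqrt (2 * pi) / s * exp (- (z / s)\<^sup>2 / 2))"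
    using s by (simp add: scaleR_conv_of_real)
  have "integrable lborel (\<lambda>x. std_normal_density (0 + s * x))"
    using s by (intro lborel_integrable_real_affine integrable_normal_density) auto
  then have "integrable lborel (\<lambda>x. sqrt (2 * pi) * std_normal_density (s * x))"
    by (intro integrable_mult_right) simp
  then have "integrable lborel (\<lambda>x. exp (- (s * x)\<^sup>2 / 2))"
    by (simp add: std_normal_density_def)
  then show "integrable lborel (\<lambda>x::real. exp (\<i> * complex_of_real (z * x)) * complex_of_real (exp (- (s * x)\<^sup>2 / 2)))"
    by (rule Bochner_Integration.integrable_bound) (auto simp: norm_mult)
qed

text \<open>
  Lebesgue measure on a Euclidean space is the image of a product of lines.
\<close>

lemma lborel_integral_prod_Basis:
  fixes f :: "'a::euclidean_space \<Rightarrow> real \<Rightarrow> complex"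
  assumes "\<And>b. b \<in> Basis \<Longrightarrow> integrable lborel (f b)"
  shows "(LINT x|lborel. (\<Prod>b\<in>Basis. f b (x \<bullet> b))) = (\<Prod>b\<in>(Basis::'a set). (LINT t|lborel. f b t))"
    and "integrable (lborel :: 'a measure) (\<lambda>x. \<Prod>b\<in>Basis. f b (x \<bullet> b))"
proof -
  interpret product_sigma_finite "\<lambda>b::'a. lborel :: real measure" ..
  have [measurable]: "b \<in> Basis \<Longrightarrow> f b \<in> borel_measurable borel" for b using assms[of b] by auto
  have T[measurable]: "(\<lambda>g. \<Sum>b\<in>Basis. g b *\<^sub>R b) \<in> (\<Pi>\<^sub>M b\<in>(Basis::'a set). lborel) \<rightarrow>\<^sub>M (borel :: 'a measure)"
    by measurable
  have fm[measurable]: "(\<lambda>x. \<Prod>b\<in>Basis. f b (x \<bullet> b)) \<in> borel_measurable borel" by measurable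
  have e: "(\<Prod>b\<in>Basis. f b ((\<Sum>b\<in>Basis. g b *\<^sub>R b) \<bullet> b)) = (\<Prod>b\<in>(Basis::'a set). f b (g b))" for g
    by (intro prod.cong) (auto simp: inner_sum_left inner_Basis if_distrib cong: if_cong)
  show "(LINT x|lborel. (\<Prod>b\<in>Basis. f b (x \<bullet> b))) = (\<Prod>b\<in>(Basis::'a set). (LINT t|lborel. f b t))"
    by (subst lborel_eq, subst integral_distr[OF T fm])
       (simp add: e product_integral_prod[OF finite_Basis assms])
  have "integrable (\<Pi>\<^sub>M b\<in>(Basis::'a set). lborel) (\<lambda>g. \<Prod>b\<in>Basis. f b ((\<Sum>b\<in>Basis. g b *\<^sub>R b) \<bullet> b))"
    unfolding e by (rule product_integrable_prod[OF finite_Basis assms])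
  then show "integrable (lborel :: 'a measure) (\<lambda>x. \<Prod>b\<in>Basis. f b (x \<bullet> b))"
    by (subst lborel_eq, subst integrable_distr_eq[OF T fm])
qed

lemma norm_sq_Basis: "(norm (x::'a::euclidean_space))\<^sup>2 = (\<Sum>b\<in>Basis. (x \<bullet> b)\<^sup>2)"
  by (simp add: norm_eq_sqrt_inner euclidean_inner[of x x] power2_eq_square sum_nonneg)

lemma gaussian_fourier:
  fixes z :: "'a::euclidean_space" and s :: real assumes s: "s > 0"
  shows "(LINT x|lborel. exp (\<i> * complex_of_real (z \<bullet> x)) * complex_of_real (exp (- s\<^sup>2 * (norm x)\<^sup>2 / 2)))
      = complex_of_real ((sqrt (2 * pi) / s) ^ DIM('a) * exp (- (norm z)\<^sup>2 / (2 * s\<^sup>2)))" (is ?A)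
    and "integrable (lborel :: 'a measure) (\<lambda>x. exp (- s\<^sup>2 * (norm x)\<^sup>2 / 2))" (is ?B)
    and "(LINT x|lborel. exp (- s\<^sup>2 * (norm (x::'a))\<^sup>2 / 2)) = (sqrt (2 * pi) / s) ^ DIM('a)" (is ?C)
proof -
  let ?f = "\<lambda>z b x. exp (\<i> * complex_of_real ((z \<bullet> b) * x)) * complex_of_real (exp (- (s * x)\<^sup>2 / 2))"
  have e: "exp (\<i> * complex_of_real (z \<bullet> x)) * complex_of_real (exp (- s\<^sup>2 * (norm x)\<^sup>2 / 2))
     = (\<Prod>b\<in>Basis. ?f z b (x \<bullet> b))" for x z :: 'a
  proof -
    have "(\<Prod>b\<in>Basis. exp (\<i> * complex_of_real ((z \<bullet> b) * (x \<bullet> b)))) = exp (\<i> * complex_of_real (z \<bullet> x))"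
      by (simp add: exp_sum[symmetric] euclidean_inner[of z x] sum_distrib_left)
    moreover have "(\<Prod>b\<in>Basis. exp (- (s * (x \<bullet> b))\<^sup>2 / 2)) = exp (- s\<^sup>2 * (norm x)\<^sup>2 / 2)"
      by (simp add: exp_sum[symmetric] norm_sq_Basis[of x] sum_distrib_left sum_negf sum_divide_distrib power_mult_distrib)
    ultimately show ?thesis by (simp add: prod.distrib of_real_prod[symmetric] del: of_real_prod)
  qed
  have A: "(LINT x|lborel. exp (\<i> * complex_of_real (z \<bullet> x)) * complex_of_real (exp (- s\<^sup>2 * (norm x)\<^sup>2 / 2)))
      = complex_of_real ((sqrt (2 * pi) / s) ^ DIM('a) * exp (- (norm z)\<^sup>2 / (2 * s\<^sup>2)))" for z :: 'a
  proof -
    have "(LINT x|lborel. exp (\<i> * complex_of_real (z \<bullet> x)) * complex_of_real (exp (- s\<^sup>2 * (norm x)\<^sup>2 / 2)))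
      = (\<Prod>b\<in>Basis. complex_of_real (sqrt (2 * pi) / s * exp (- ((z \<bullet> b) / s)\<^sup>2 / 2)))"
      unfolding e by (subst lborel_integral_prod_Basis(1)[OF gaussian_fourier_1d(2)[OF s]])
        (simp only: gaussian_fourier_1d(1)[OF s])
    also have "\<dots> = complex_of_real ((sqrt (2 * pi) / s) ^ DIM('a) * (\<Prod>b\<in>Basis. exp (- ((z \<bullet> b) / s)\<^sup>2 / 2)))"
      unfolding of_real_prod[symmetric] prod.distrib prod_constant ..
    also have "(\<Prod>b\<in>Basis. exp (- ((z \<bullet> b) / s)\<^sup>2 / 2)) = exp (- (norm z)\<^sup>2 / (2 * s\<^sup>2))"
      by (simp add: exp_sum[symmetric] norm_sq_Basis[of z] sum_negf sum_divide_distrib power_divide mult.commute)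
    finally show ?thesis .
  qed
  show ?A by (rule A)
  have "integrable (lborel :: 'a measure) (\<lambda>x. exp (\<i> * complex_of_real (0 \<bullet> x)) * complex_of_real (exp (- s\<^sup>2 * (norm x)\<^sup>2 / 2)))"
    unfolding e by (rule lborel_integral_prod_Basis(2)[OF gaussian_fourier_1d(2)[OF s]])
  then have "integrable (lborel :: 'a measure) (\<lambda>x. complex_of_real (exp (- s\<^sup>2 * (norm x)\<^sup>2 / 2)))" by simp
  then show B: ?B by (rule Bochner_Integration.integrable_bound) auto
  have "complex_of_real (LINT x|lborel. exp (- s\<^sup>2 * (norm (x::'a))\<^sup>2 / 2)) = complex_of_real ((sqrt (2 * pi) / s) ^ DIM('a))"
    using A[of 0] by (simp del: of_real_power)
  then show ?C unfolding of_real_eq_iff .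
qed

section \<open>Bessel's inequality\<close>

abbreviation fourier_kernel :: "'a::real_inner \<Rightarrow> 'a \<Rightarrow> complex" where
  "fourier_kernel x \<xi> \<equiv> exp (- \<i> * complex_of_real (x \<bullet> \<xi>))"

definition fourier_integral :: "('a::euclidean_space \<Rightarrow> complex) \<Rightarrow> 'a \<Rightarrow> complex" where
  "fourier_integral f \<xi> = (LINT x|lborel. fourier_kernel x \<xi> * f x)"

lemma norm_expi[simp]: "norm (exp (- (\<i> * complex_of_real t))) = 1" "norm (exp (\<i> * complex_of_real t)) = 1"
  using norm_exp_i_times[of t] norm_exp_i_times[of "- t"] by simp_all

lemma cnj_measurable[measurable]: "cnj \<in> borel \<rightarrow>\<^sub>M borel"
  by (intro borel_measurable_continuous_onI continuous_intros)

lemma fourier_integral_measurable[measurable]: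
  assumes [measurable]: "f \<in> borel_measurable borel" shows "fourier_integral f \<in> borel_measurable borel"
  unfolding fourier_integral_def by measurable

lemma integrable_fourier_integral_kernel:
  assumes "integrable lborel f"
  shows "integrable lborel (\<lambda>x. fourier_kernel x \<xi> * f x)"
proof (rule Bochner_Integration.integrable_bound[OF assms])
  have [measurable]: "f \<in> borel_measurable borel" using assms by auto
  show "(\<lambda>x. fourier_kernel x \<xi> * f x) \<in> borel_measurable lborel" by measurable
qed (simp add: norm_mult)

lemma fourier_integral_diff:
  assumes "integrable lborel f" "integrable lborel g"
  shows "fourier_integral (\<lambda>x. f x - g x) \<xi> = fourier_integral f \<xi> - fourier_integral g \<xi>"
  unfolding fourier_integral_def using integrable_fourier_integral_kernel[OF assms(1)] integrable_fourier_integral_kernel[OF assms(2)]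
  by (simp add: right_diff_distrib)

text \<open>
  The Fourier transform of the damping factor
  \<open>exp (- s\<^sup>2 |\<xi>|\<^sup>2 / 2)\<close>. As \<open>s\<close> tends to 0 it
  concentrates at the origin while its integral stays \<open>(2 pi) ^ DIM('a)\<close>.
\<close>

definition gauss_kernel :: "real \<Rightarrow> 'a::euclidean_space \<Rightarrow> real" where
  "gauss_kernel s z = (sqrt (2 * pi) / s) ^ DIM('a) * exp (- (norm z)\<^sup>2 / (2 * s\<^sup>2))"

lemma gauss_kernel_nonneg: "s > 0 \<Longrightarrow> 0 \<le> gauss_kernel s z" by (simp add: gauss_kernel_def)

lemma gauss_kernel_measurable[measurable]: "gauss_kernel s \<in> borel_measurable borel"
  unfolding gauss_kernel_def by measurable

lemma nn_integral_gauss_kernel: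
  fixes x :: "'a::euclidean_space"
  assumes s: "s > 0"
  shows "(\<integral>\<^sup>+y. ennreal (gauss_kernel s (x - y)) \<partial>lborel) = ennreal ((2 * pi) ^ DIM('a))"
proof -
  have i: "integrable lborel (\<lambda>z::'a. exp (- (1/s)\<^sup>2 * (norm z)\<^sup>2 / 2))"
    and v: "(LINT z|lborel. exp (- (1/s)\<^sup>2 * (norm (z::'a))\<^sup>2 / 2)) = (sqrt (2 * pi) / (1/s)) ^ DIM('a)"
    using gaussian_fourier[of "1/s"] s by auto
  have e: "gauss_kernel s z = (sqrt (2 * pi) / s) ^ DIM('a) * exp (- (1/s)\<^sup>2 * (norm z)\<^sup>2 / 2)" for z :: 'a
    by (simp add: gauss_kernel_def power_divide field_simps)
  have "(\<integral>\<^sup>+y. ennreal (gauss_kernel s (x - y)) \<partial>lborel) = (\<integral>\<^sup>+y. ennreal (gauss_kernel s (y - x)) \<partial>lborel)"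
    by (simp add: gauss_kernel_def norm_minus_commute)
  also have "\<dots> = (\<integral>\<^sup>+z. ennreal (gauss_kernel s (z - x)) \<partial>distr lborel borel ((+) x))"
    by (simp add: lborel_distr_plus)
  also have "\<dots> = (\<integral>\<^sup>+z. ennreal (gauss_kernel s (z::'a)) \<partial>lborel)"
    by (subst nn_integral_distr) auto
  also have "\<dots> = ennreal (LINT z|lborel. gauss_kernel s (z::'a))"
    unfolding e using i s by (intro nn_integral_eq_integral integrable_mult_right) auto
  also have "(LINT z|lborel. gauss_kernel s (z::'a)) = (2 * pi) ^ DIM('a)"
  proof -
    have "(sqrt (2 * pi) / s) * (sqrt (2 * pi) / (1 / s)) = 2 * pi" using s by simp
    then show ?thesis unfolding e integral_mult_right_zero v by (simp only: power_mult_distrib[symmetric])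
  qed
  finally show ?thesis .
qed

text \<open>
  The damping factor makes the integral over frequency and two copies of space absolutely
  convergent, so that the frequency integral can be carried out first.
\<close>

lemma regularized_parseval:
  fixes f :: "'a::euclidean_space \<Rightarrow> complex"
  assumes f: "integrable lborel f" and s: "s > 0"
  shows "(LINT \<xi>|lborel. complex_of_real ((norm (fourier_integral f \<xi>))\<^sup>2 * exp (- s\<^sup>2 * (norm \<xi>)\<^sup>2 / 2)))
     = (LINT p|lborel. f (fst p) * cnj (f (snd p)) * complex_of_real (gauss_kernel s (fst p - snd p)))"
   and "integrable lborel (\<lambda>p. f (fst p) * cnj (f (snd p)) * complex_of_real (gauss_kernel s (fst p - snd p)))"
proof -
  have [measurable]: "f \<in> borel_measurable borel" using f by auto
  let ?g = "\<lambda>\<xi>::'a. complex_of_real (exp (- s\<^sup>2 * (norm \<xi>)\<^sup>2 / 2))"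
  (* The integrand with the two factors of the squared transform written as separate integrals. *)
  define H where "H = (\<lambda>q::'a \<times> ('a \<times> 'a). f (fst (snd q)) * cnj (f (snd (snd q))) *
      (exp (\<i> * complex_of_real (- (fst (snd q) - snd (snd q)) \<bullet> fst q)) * ?g (fst q)))"
  have cf: "integrable lborel (\<lambda>x. cnj (f x))" using f by simp
  have P: "integrable lborel (\<lambda>p. f (fst p) * cnj (f (snd p)))"
    by (rule integrable_lborel_prod[OF f cf])
  have g: "integrable lborel ?g" using gaussian_fourier(2)[OF s] by (intro integrable_of_real)
  have H: "integrable lborel H"
    unfolding H_def
  proof (rule Bochner_Integration.integrable_bound[OF integrable_lborel_prod[OF g P]])
    show "(\<lambda>q::'a \<times> ('a \<times> 'a). f (fst (snd q)) * cnj (f (snd (snd q))) *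
      (exp (\<i> * complex_of_real (- (fst (snd q) - snd (snd q)) \<bullet> fst q)) * ?g (fst q))) \<in> borel_measurable lborel"
      unfolding measurable_lborel2 borel_prod[symmetric] by measurable
  qed (simp add: norm_mult mult_ac)
  have inner1: "(LINT p|lborel. H (\<xi>, p)) = complex_of_real ((norm (fourier_integral f \<xi>))\<^sup>2 * exp (- s\<^sup>2 * (norm \<xi>)\<^sup>2 / 2))" for \<xi>
  proof -
    let ?k = "\<lambda>x. fourier_kernel x \<xi> * f x"
    have k: "integrable lborel ?k" by (rule integrable_fourier_integral_kernel[OF f])
    then have ck: "integrable lborel (\<lambda>x. cnj (?k x))" by (rule integrable_cnj)
    have "exp (\<i> * complex_of_real (- (a - b) \<bullet> \<xi>))
        = fourier_kernel a \<xi> * cnj (fourier_kernel b \<xi>)" for a b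
      by (simp add: exp_cnj exp_add[symmetric] inner_diff_left algebra_simps)
    then have "H (\<xi>, p) = ?k (fst p) * cnj (?k (snd p)) * ?g \<xi>" for p
      unfolding H_def fst_conv snd_conv by (simp only: complex_cnj_mult mult_ac)
    then have "(LINT p|lborel. H (\<xi>, p)) = (LINT p|lborel. ?k (fst p) * cnj (?k (snd p))) * ?g \<xi>"
      by (simp only: integral_mult_left_zero)
    also have "(LINT p|lborel. ?k (fst p) * cnj (?k (snd p))) = fourier_integral f \<xi> * cnj (fourier_integral f \<xi>)"
      unfolding integral_lborel_prod[OF k ck] fourier_integral_def
      by (rule arg_cong[OF Bochner_Integration.integral_cnj[of lborel ?k]])
    finally show ?thesis by (simp only: complex_norm_square of_real_mult)
  qed
  have inner2: "(LINT \<xi>|lborel. H (\<xi>, p)) = f (fst p) * cnj (f (snd p)) * complex_of_real (gauss_kernel s (fst p - snd p))" for p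
  proof -
    have "(LINT \<xi>|lborel. H (\<xi>, p)) = f (fst p) * cnj (f (snd p)) *
       (LINT \<xi>|lborel. exp (\<i> * complex_of_real (- (fst p - snd p) \<bullet> \<xi>)) * ?g \<xi>)"
      unfolding H_def fst_conv snd_conv by (rule integral_mult_right_zero)
    then show ?thesis unfolding gaussian_fourier(1)[OF s] by (simp add: gauss_kernel_def norm_minus_commute)
  qed
  show "(LINT \<xi>|lborel. complex_of_real ((norm (fourier_integral f \<xi>))\<^sup>2 * exp (- s\<^sup>2 * (norm \<xi>)\<^sup>2 / 2)))
     = (LINT p|lborel. f (fst p) * cnj (f (snd p)) * complex_of_real (gauss_kernel s (fst p - snd p)))"
    using Fubini_lborel(1)[OF H] unfolding inner1 inner2 .
  have "integrable lborel (\<lambda>p. LINT \<xi>|lborel. H (\<xi>, p))"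
    using lborel_pair.integrable_snd[of "\<lambda>\<xi> p. H (\<xi>, p)"] H by (simp add: lborel_prod)
  then show "integrable lborel (\<lambda>p. f (fst p) * cnj (f (snd p)) * complex_of_real (gauss_kernel s (fst p - snd p)))"
    unfolding inner2 .
qed

text \<open>
  Schur's test: \<open>|f x f y| \<le> (|f x|\<^sup>2 + |f y|\<^sup>2) / 2\<close>, and the
  Gaussian kernel has the same mass in each variable.
\<close>

lemma bessel_regularized:
  fixes f :: "'a::euclidean_space \<Rightarrow> complex"
  assumes f: "integrable lborel f" and s: "s > 0"
  shows "(\<integral>\<^sup>+\<xi>. ennreal ((norm (fourier_integral f \<xi>))\<^sup>2 * exp (- s\<^sup>2 * (norm \<xi>)\<^sup>2 / 2)) \<partial>lborel)
     \<le> ennreal ((2 * pi) ^ DIM('a)) * (\<integral>\<^sup>+x. ennreal ((norm (f x))\<^sup>2) \<partial>lborel)"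
proof -
  have [measurable]: "f \<in> borel_measurable borel" using f by auto
  let ?I = "\<integral>\<^sup>+x. ennreal ((norm (f x))\<^sup>2) \<partial>lborel"
  let ?c = "ennreal ((2 * pi) ^ DIM('a))"
  have h: "ennreal (c * (a * g) + c * (b * g)) = ennreal c * (ennreal a * ennreal g) + ennreal c * (ennreal b * ennreal g)"
    if "0 \<le> a" "0 \<le> b" "0 \<le> c" "0 \<le> g" for a b c g :: real
    using that by (simp add: ennreal_plus ennreal_mult)
  define B where "B = (LINT x|lborel. norm (f x))"
  have ftB: "norm (fourier_integral f \<xi>) \<le> B" for \<xi>
  proof -
    have "norm (fourier_integral f \<xi>) \<le> (LINT x|lborel. norm (fourier_kernel x \<xi> * f x))"
      unfolding fourier_integral_def by (rule integral_norm_bound)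
    then show ?thesis by (simp add: norm_mult B_def)
  qed
  have i: "integrable lborel (\<lambda>\<xi>. (norm (fourier_integral f \<xi>))\<^sup>2 * exp (- s\<^sup>2 * (norm \<xi>)\<^sup>2 / 2))"
  proof (rule Bochner_Integration.integrable_bound)
    show "integrable lborel (\<lambda>\<xi>::'a. B\<^sup>2 * exp (- s\<^sup>2 * (norm \<xi>)\<^sup>2 / 2))"
      using gaussian_fourier(2)[OF s] by (intro integrable_mult_right)
    show "AE \<xi> in lborel. norm ((norm (fourier_integral f \<xi>))\<^sup>2 * exp (- s\<^sup>2 * (norm \<xi>)\<^sup>2 / 2)) \<le> norm (B\<^sup>2 * exp (- s\<^sup>2 * (norm (\<xi>::'a))\<^sup>2 / 2))"
      using power_mono[OF ftB norm_ge_zero, where n = 2] by (intro AE_I2) (simp add: abs_mult)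
  qed measurable
  have "(\<integral>\<^sup>+\<xi>. ennreal ((norm (fourier_integral f \<xi>))\<^sup>2 * exp (- s\<^sup>2 * (norm \<xi>)\<^sup>2 / 2)) \<partial>lborel)
     = ennreal (LINT \<xi>|lborel. (norm (fourier_integral f \<xi>))\<^sup>2 * exp (- s\<^sup>2 * (norm \<xi>)\<^sup>2 / 2))"
    by (rule nn_integral_eq_integral[OF i]) simp
  also have "(LINT \<xi>|lborel. (norm (fourier_integral f \<xi>))\<^sup>2 * exp (- s\<^sup>2 * (norm \<xi>)\<^sup>2 / 2))
     = norm (LINT p|lborel. f (fst p) * cnj (f (snd p)) * complex_of_real (gauss_kernel s (fst p - snd p)))"
    unfolding regularized_parseval(1)[OF f s, symmetric] integral_complex_of_real norm_of_real
    by (rule abs_of_nonneg[symmetric]) (simp add: integral_nonneg_AE)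
  also have "ennreal \<dots> \<le> (\<integral>\<^sup>+p. norm (f (fst p) * cnj (f (snd p)) * complex_of_real (gauss_kernel s (fst p - snd p))) \<partial>lborel)"
    by (rule integral_norm_bound_ennreal[OF regularized_parseval(2)[OF f s]])
  also have "(\<integral>\<^sup>+p. norm (f (fst p) * cnj (f (snd p)) * complex_of_real (gauss_kernel s (fst p - snd p))) \<partial>lborel)
    \<le> (\<integral>\<^sup>+p. ennreal (1/2) * (ennreal ((norm (f (fst p)))\<^sup>2) * ennreal (gauss_kernel s (fst p - snd p)))
        + ennreal (1/2) * (ennreal ((norm (f (snd p)))\<^sup>2) * ennreal (gauss_kernel s (snd p - fst p))) \<partial>lborel)"
  proof (rule nn_integral_mono)
    fix p :: "'a \<times> 'a"
    let ?x = "fst p" and ?y = "snd p"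
    have g: "gauss_kernel s (?y - ?x) = gauss_kernel s (?x - ?y)" by (simp add: gauss_kernel_def norm_minus_commute)
    have "norm (f ?x) * norm (f ?y) \<le> 1/2 * (norm (f ?x))\<^sup>2 + 1/2 * (norm (f ?y))\<^sup>2"
      using sum_squares_bound[of "norm (f ?x)" "norm (f ?y)"] by simp
    then have "norm (f ?x) * norm (f ?y) * gauss_kernel s (?x - ?y) \<le> (1/2 * (norm (f ?x))\<^sup>2 + 1/2 * (norm (f ?y))\<^sup>2) * gauss_kernel s (?x - ?y)"
      by (intro mult_right_mono gauss_kernel_nonneg s)
    then have "ennreal (norm (f ?x) * norm (f ?y) * gauss_kernel s (?x - ?y))
       \<le> ennreal (1/2 * ((norm (f ?x))\<^sup>2 * gauss_kernel s (?x - ?y)) + 1/2 * ((norm (f ?y))\<^sup>2 * gauss_kernel s (?x - ?y)))"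
      by (intro ennreal_leI) (simp add: algebra_simps)
    also have "\<dots> = ennreal (1/2) * (ennreal ((norm (f ?x))\<^sup>2) * ennreal (gauss_kernel s (?x - ?y)))
        + ennreal (1/2) * (ennreal ((norm (f ?y))\<^sup>2) * ennreal (gauss_kernel s (?y - ?x)))"
      unfolding g by (rule h) (auto simp: gauss_kernel_nonneg s)
    finally show "ennreal (norm (f ?x * cnj (f ?y) * complex_of_real (gauss_kernel s (?x - ?y)))) \<le> \<dots>"
      by (simp add: norm_mult gauss_kernel_nonneg s)
  qed
  also have "\<dots> = ennreal (1/2) * (\<integral>\<^sup>+p. (ennreal ((norm (f (fst p)))\<^sup>2) * ennreal (gauss_kernel s (fst p - snd p))) \<partial>lborel)
        + ennreal (1/2) * (\<integral>\<^sup>+p. (ennreal ((norm (f (snd p)))\<^sup>2) * ennreal (gauss_kernel s (snd p - fst p))) \<partial>lborel)"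
    unfolding lborel_prod[symmetric] by (subst nn_integral_add) (auto simp: nn_integral_cmult)
  also have "(\<integral>\<^sup>+p. (ennreal ((norm (f (fst p)))\<^sup>2) * ennreal (gauss_kernel s (fst p - snd p))) \<partial>lborel) = ?c * ?I"
    unfolding lborel_prod[symmetric]
    by (subst lborel.nn_integral_fst[symmetric])
       (auto simp: nn_integral_cmult nn_integral_multc nn_integral_gauss_kernel s mult.commute)
  also have "(\<integral>\<^sup>+p. (ennreal ((norm (f (snd p)))\<^sup>2) * ennreal (gauss_kernel s (snd p - fst p))) \<partial>lborel) = ?c * ?I"
    unfolding lborel_prod[symmetric]
    by (subst lborel_pair.nn_integral_snd[symmetric])
       (auto simp: nn_integral_cmult nn_integral_multc nn_integral_gauss_kernel s mult.commute)
  also have "ennreal (1/2) * (?c * ?I) + ennreal (1/2) * (?c * ?I) = ?c * ?I"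
  proof -
    have "ennreal (1/2) + ennreal (1/2) = 1" by (subst ennreal_plus[symmetric]) auto
    then show ?thesis unfolding distrib_right[symmetric] by (simp only: mult_1)
  qed
  finally show ?thesis .
qed

text \<open>
  Fatou's lemma removes the damping in \<open>bessel_regularized\<close>.
\<close>

lemma bessel_nn_integral:
  fixes f :: "'a::euclidean_space \<Rightarrow> complex"
  assumes f: "integrable lborel f"
  shows "(\<integral>\<^sup>+\<xi>. ennreal ((norm (fourier_integral f \<xi>))\<^sup>2) \<partial>lborel)
     \<le> ennreal ((2 * pi) ^ DIM('a)) * (\<integral>\<^sup>+x. ennreal ((norm (f x))\<^sup>2) \<partial>lborel)"
proof -
  have [measurable]: "f \<in> borel_measurable borel" using f by auto
  define s where "s k = inverse (real (Suc k))" for k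
  have s: "s k > 0" for k by (simp add: s_def)
  have s0: "s \<longlonglongrightarrow> 0" unfolding s_def by (rule LIMSEQ_inverse_real_of_nat)
  have "(\<integral>\<^sup>+\<xi>. ennreal ((norm (fourier_integral f \<xi>))\<^sup>2) \<partial>lborel)
     = (\<integral>\<^sup>+\<xi>. liminf (\<lambda>k. ennreal ((norm (fourier_integral f \<xi>))\<^sup>2 * exp (- (s k)\<^sup>2 * (norm \<xi>)\<^sup>2 / 2))) \<partial>lborel)"
  proof (rule nn_integral_cong)
    fix \<xi> :: 'a
    have "(\<lambda>k. (norm (fourier_integral f \<xi>))\<^sup>2 * exp (- (s k)\<^sup>2 * (norm \<xi>)\<^sup>2 / 2)) \<longlonglongrightarrow> (norm (fourier_integral f \<xi>))\<^sup>2 * exp (- 0\<^sup>2 * (norm \<xi>)\<^sup>2 / 2)"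
      by (intro tendsto_intros s0) simp
    then have "(\<lambda>k. ennreal ((norm (fourier_integral f \<xi>))\<^sup>2 * exp (- (s k)\<^sup>2 * (norm \<xi>)\<^sup>2 / 2))) \<longlonglongrightarrow> ennreal ((norm (fourier_integral f \<xi>))\<^sup>2)"
      by (intro tendsto_ennrealI) simp
    from lim_imp_Liminf[OF sequentially_bot this]
    show "ennreal ((norm (fourier_integral f \<xi>))\<^sup>2) = liminf (\<lambda>k. ennreal ((norm (fourier_integral f \<xi>))\<^sup>2 * exp (- (s k)\<^sup>2 * (norm \<xi>)\<^sup>2 / 2)))"
      by simp
  qed
  also have "\<dots> \<le> liminf (\<lambda>k. \<integral>\<^sup>+\<xi>. ennreal ((norm (fourier_integral f \<xi>))\<^sup>2 * exp (- (s k)\<^sup>2 * (norm \<xi>)\<^sup>2 / 2)) \<partial>lborel)"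
    by (rule nn_integral_liminf) measurable
  also have "\<dots> \<le> liminf (\<lambda>k::nat. ennreal ((2 * pi) ^ DIM('a)) * (\<integral>\<^sup>+x. ennreal ((norm (f x))\<^sup>2) \<partial>lborel))"
    by (intro Liminf_mono always_eventually allI bessel_regularized f s)
  finally show ?thesis by (simp add: Liminf_const)
qed

lemma bessel:
  fixes f :: "'a::euclidean_space \<Rightarrow> complex"
  assumes f: "integrable lborel f" "square_integrable lborel f"
  shows "square_integrable lborel (fourier_integral f)" "l2norm lborel (fourier_integral f) \<le> sqrt ((2 * pi) ^ DIM('a)) * l2norm lborel f"
proof -
  have [measurable]: "f \<in> borel_measurable borel" using f by auto
  have b: "(\<integral>\<^sup>+\<xi>. ennreal ((norm (fourier_integral f \<xi>))\<^sup>2) \<partial>lborel) \<le> ennreal ((2 * pi) ^ DIM('a) * (l2norm lborel f)\<^sup>2)"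
    using bessel_nn_integral[OF f(1)] unfolding nn_integral_eq_l2norm[OF f(2)] by (simp add: ennreal_mult)
  show 1: "square_integrable lborel (fourier_integral f)"
    by (subst square_integrable_iff_nn_integral) (use b in \<open>auto intro: order_le_less_trans\<close>)
  have "(l2norm lborel (fourier_integral f))\<^sup>2 \<le> (2 * pi) ^ DIM('a) * (l2norm lborel f)\<^sup>2"
    using b unfolding nn_integral_eq_l2norm[OF 1] by (subst (asm) ennreal_le_iff) auto
  also have "\<dots> = (sqrt ((2 * pi) ^ DIM('a)) * l2norm lborel f)\<^sup>2"
    by (simp add: power_mult_distrib)
  finally show "l2norm lborel (fourier_integral f) \<le> sqrt ((2 * pi) ^ DIM('a)) * l2norm lborel f"
    by (rule power2_le_imp_le) (intro mult_nonneg_nonneg real_sqrt_ge_zero zero_le_power l2norm_nonneg pi_ge_zero, auto)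
qed

section \<open>Parseval's identity\<close>

text \<open>
  A dense class of functions on which all integrals below converge absolutely.
\<close>

definition bounded_compact :: "('a::euclidean_space \<Rightarrow> complex) \<Rightarrow> bool" where
  "bounded_compact f \<longleftrightarrow> f \<in> borel_measurable borel \<and> (\<exists>M. \<forall>x. norm (f x) \<le> M) \<and> (\<exists>R. \<forall>x. R < norm x \<longrightarrow> f x = 0)"

lemma finite_cball[simp]: "emeasure lborel (cball (a::'a::euclidean_space) r) < top"
  using emeasure_bounded_finite[of "cball a r"] by simp

lemma integrable_bounded_support:
  fixes f :: "'a::euclidean_space \<Rightarrow> 'b::euclidean_space"
  assumes [measurable]: "f \<in> borel_measurable borel" and M: "\<And>x. norm (f x) \<le> M" and R: "\<And>x. R < norm x \<Longrightarrow> f x = 0"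
  shows "integrable lborel f" "square_integrable lborel f"
proof -
  have bound: "norm (f x) \<le> norm (M * indicator (cball 0 R) x)" for x
    using M[of x] R[of x] norm_ge_zero[of "f x"] by (auto simp: indicator_def)
  have i: "integrable lborel (\<lambda>x::'a. c * indicator (cball 0 R) x :: real)" for c
    by (intro integrable_mult_right) (auto intro!: integrable_real_indicator)
  show "integrable lborel f"
    by (rule Bochner_Integration.integrable_bound[OF i[of M]]) (use bound in auto)
  have "square_integrable lborel (\<lambda>x::'a. M * indicator (cball 0 R) x :: real)"
  proof -
    have "(\<lambda>x::'a. (norm (M * indicator (cball 0 R) x :: real))\<^sup>2) = (\<lambda>x. M\<^sup>2 * indicator (cball 0 R) x)"
      by (auto simp: indicator_def)
    moreover have "(\<lambda>x::'a. M * indicator (cball 0 R) x :: real) \<in> borel_measurable lborel"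
      by (intro borel_measurable_times borel_measurable_const borel_measurable_indicator) simp
    ultimately show ?thesis unfolding square_integrable_def using i[of "M\<^sup>2"] by simp
  qed
  then show "square_integrable lborel f"
    by (rule square_integrable_mono) (use bound in auto)
qed

lemma bounded_compact_integrable: "bounded_compact f \<Longrightarrow> integrable lborel f"
  and bounded_compact_square_integrable: "bounded_compact f \<Longrightarrow> square_integrable lborel f"
  and bounded_compact_measurable[measurable_dest]: "bounded_compact f \<Longrightarrow> f \<in> borel_measurable borel"
  unfolding bounded_compact_def using integrable_bounded_support by blast+

lemma lborel_affine_integral:
  fixes h :: "'a::euclidean_space \<Rightarrow> complex"
  assumes s: "s > 0" and [measurable]: "h \<in> borel_measurable borel"
  shows "(LINT y|lborel. h y) = s ^ DIM('a) *\<^sub>R (LINT z|lborel. h (t + s *\<^sub>R z))"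
proof -
  have "(LINT y|lborel. h y) = (LINT y|density (distr lborel borel (\<lambda>x. t + s *\<^sub>R x)) (\<lambda>_. ennreal (\<bar>s\<bar> ^ DIM('a))). h y)"
    using s lborel_affine[of s t] by simp
  also have "\<dots> = (LINT y|distr lborel borel (\<lambda>x. t + s *\<^sub>R x). s ^ DIM('a) *\<^sub>R h y)"
    using s by (subst integral_density) auto
  also have "\<dots> = s ^ DIM('a) *\<^sub>R (LINT z|lborel. h (t + s *\<^sub>R z))"
    by (subst integral_distr) auto
  finally show ?thesis .
qed

text \<open>
  Gaussian averages of a continuous function converge to its values, so the regularized identity
  yields the lower bound in the limit; Bessel's inequality is the upper bound.
\<close>

lemma parseval_continuous:
  fixes f :: "'a::euclidean_space \<Rightarrow> complex"
  assumes cont: "continuous_on UNIV f" and M: "\<And>x. norm (f x) \<le> M" and R: "\<And>x. R < norm x \<Longrightarrow> f x = 0"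
  shows "l2norm lborel (fourier_integral f) = sqrt ((2 * pi) ^ DIM('a)) * l2norm lborel f"
proof -
  have fm[measurable]: "f \<in> borel_measurable borel" using cont by (rule borel_measurable_continuous_onI)
  have f: "integrable lborel f" "square_integrable lborel f" using integrable_bounded_support[OF fm M R] by blast+
  define s where "s k = inverse (real (Suc k))" for k
  have s: "s k > 0" for k by (simp add: s_def)
  have s0: "s \<longlonglongrightarrow> 0" unfolding s_def by (rule LIMSEQ_inverse_real_of_nat)
  let ?c = "sqrt (2 * pi) ^ DIM('a)"
  let ?g = "\<lambda>z::'a. exp (- 1\<^sup>2 * (norm z)\<^sup>2 / 2)"
  have g: "integrable lborel ?g" by (rule gaussian_fourier(2)) simp
  have gi: "(LINT z|lborel. ?g z) = ?c" by (subst gaussian_fourier(3)) auto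
  (* The average of the conjugate of f around x at scale s k, rescaled to a fixed Gaussian. *)
  define J where "J k x = (LINT z|lborel. cnj (f (x + s k *\<^sub>R z)) * complex_of_real (?g z))" for k and x :: 'a
  define A where "A k = (LINT \<xi>|lborel. (norm (fourier_integral f \<xi>))\<^sup>2 * exp (- (s k)\<^sup>2 * (norm (\<xi>::'a))\<^sup>2 / 2))" for k
  have A: "complex_of_real (A k) = ?c * (LINT x|lborel. f x * J k x)" for k
  proof -
    have "complex_of_real (A k) = (LINT p|lborel. f (fst p) * cnj (f (snd p)) * complex_of_real (gauss_kernel (s k) (fst p - snd p)))"
      unfolding A_def integral_complex_of_real[symmetric] by (rule regularized_parseval(1)[OF f(1) s])
    also have "\<dots> = (LINT x|lborel. LINT y|lborel. f x * cnj (f y) * complex_of_real (gauss_kernel (s k) (x - y)))"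
      using Fubini_lborel(2)[OF regularized_parseval(2)[OF f(1) s]] by simp
    also have "(\<lambda>x. LINT y|lborel. f x * cnj (f y) * complex_of_real (gauss_kernel (s k) (x - y))) = (\<lambda>x. ?c * (f x * J k x))"
    proof
      fix x
      have "(LINT y|lborel. f x * cnj (f y) * complex_of_real (gauss_kernel (s k) (x - y)))
        = (s k) ^ DIM('a) *\<^sub>R (LINT z|lborel. f x * cnj (f (x + s k *\<^sub>R z)) * complex_of_real (gauss_kernel (s k) (x - (x + s k *\<^sub>R z))))"
        by (rule lborel_affine_integral[OF s]) measurable
      also have "(\<lambda>z. f x * cnj (f (x + s k *\<^sub>R z)) * complex_of_real (gauss_kernel (s k) (x - (x + s k *\<^sub>R z))))
        = (\<lambda>z. (f x * (?c / (s k) ^ DIM('a))) * (cnj (f (x + s k *\<^sub>R z)) * complex_of_real (?g z)))"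
        using s[of k] by (simp add: gauss_kernel_def fun_eq_iff power_mult_distrib power_divide field_simps del: of_real_exp)
      also have "(LINT z|lborel. (f x * (?c / (s k) ^ DIM('a))) * (cnj (f (x + s k *\<^sub>R z)) * complex_of_real (?g z)))
        = (f x * (?c / (s k) ^ DIM('a))) * J k x"
        unfolding J_def by (rule integral_mult_right_zero)
      finally show "(LINT y|lborel. f x * cnj (f y) * complex_of_real (gauss_kernel (s k) (x - y))) = ?c * (f x * J k x)"
        using s[of k] by (simp add: scaleR_conv_of_real)
    qed
    finally show ?thesis by simp
  qed
  have Jlim: "(\<lambda>k. J k x) \<longlonglongrightarrow> cnj (f x) * ?c" for x
  proof -
    have "(\<lambda>k. J k x) \<longlonglongrightarrow> (LINT z|lborel. cnj (f x) * complex_of_real (?g z))"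
      unfolding J_def
    proof (rule integral_dominated_convergence[where w = "\<lambda>z. M * ?g z"])
      show "integrable lborel (\<lambda>z. M * ?g z)" using g by (intro integrable_mult_right)
      show "AE z in lborel. (\<lambda>k. cnj (f (x + s k *\<^sub>R z)) * complex_of_real (?g z)) \<longlonglongrightarrow> cnj (f x) * complex_of_real (?g z)"
      proof (intro AE_I2 tendsto_intros)
        fix z
        have "isCont f x" using cont by (simp add: continuous_on_eq_continuous_at)
        moreover have "(\<lambda>k. x + s k *\<^sub>R z) \<longlonglongrightarrow> x + 0 *\<^sub>R z" by (intro tendsto_intros s0)
        ultimately show "(\<lambda>k. f (x + s k *\<^sub>R z)) \<longlonglongrightarrow> f x"
          using isCont_tendsto_compose[of x f "\<lambda>k. x + s k *\<^sub>R z"] by simp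
      qed
      show "AE z in lborel. norm (cnj (f (x + s k *\<^sub>R z)) * complex_of_real (?g z)) \<le> M * ?g z" for k
        using M by (intro AE_I2) (simp add: norm_mult mult_right_mono)
      show "(\<lambda>z. cnj (f (x + s k *\<^sub>R z)) * complex_of_real (?g z)) \<in> borel_measurable lborel" for k by measurable
      show "(\<lambda>z. cnj (f x) * complex_of_real (?g z)) \<in> borel_measurable lborel" by measurable
    qed
    also have "(LINT z|lborel. cnj (f x) * complex_of_real (?g z)) = cnj (f x) * ?c"
      unfolding integral_mult_right_zero integral_complex_of_real gi by simp
    finally show ?thesis .
  qed
  have Jb: "norm (J k x) \<le> M * ?c" for k x
  proof -
    have "norm (J k x) \<le> (LINT z|lborel. M * ?g z)"
      unfolding J_def
    proof (rule Bochner_Integration.integral_norm_bound_integral)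
      show "integrable lborel (\<lambda>z. M * ?g z)" using g by (intro integrable_mult_right)
      show b: "norm (cnj (f (x + s k *\<^sub>R z)) * complex_of_real (?g z)) \<le> M * ?g z" for z
        using M by (simp add: norm_mult mult_right_mono)
      show "integrable lborel (\<lambda>z. cnj (f (x + s k *\<^sub>R z)) * complex_of_real (?g z))"
      proof (rule Bochner_Integration.integrable_bound[of _ "\<lambda>z. M * ?g z"])
        show "AE z in lborel. norm (cnj (f (x + s k *\<^sub>R z)) * complex_of_real (?g z)) \<le> norm (M * ?g z)"
          using b by (intro AE_I2 order_trans[OF b]) simp
      qed (use g in \<open>auto intro!: integrable_mult_right\<close>)
    qed
    then show ?thesis unfolding integral_mult_right_zero gi .
  qed
  have [measurable]: "J k \<in> borel_measurable borel" for k
    unfolding J_def by measurable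
  have "(\<lambda>k. LINT x|lborel. f x * J k x) \<longlonglongrightarrow> (LINT x|lborel. f x * (cnj (f x) * ?c))"
  proof (rule integral_dominated_convergence[where w = "\<lambda>x. norm (f x) * (M * ?c)"])
    show "(\<lambda>x. f x * (cnj (f x) * ?c)) \<in> borel_measurable lborel" by measurable
    show "(\<lambda>x. f x * J k x) \<in> borel_measurable lborel" for k by measurable
    show "integrable lborel (\<lambda>x. norm (f x) * (M * ?c))" using f(1) by (intro integrable_mult_left integrable_norm)
    show "AE x in lborel. (\<lambda>k. f x * J k x) \<longlonglongrightarrow> f x * (cnj (f x) * ?c)"
      by (intro AE_I2 tendsto_intros Jlim)
    show "AE x in lborel. norm (f x * J k x) \<le> norm (f x) * (M * ?c)" for k
      using Jb by (intro AE_I2) (simp add: norm_mult mult_left_mono)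
  qed
  also have "(\<lambda>x. f x * (cnj (f x) * ?c)) = (\<lambda>x. complex_of_real ((norm (f x))\<^sup>2) * ?c)"
    by (simp only: mult.assoc[symmetric] complex_norm_square)
  also have "(LINT x|lborel. complex_of_real ((norm (f x))\<^sup>2) * ?c) = complex_of_real ((l2norm lborel f)\<^sup>2) * ?c"
    unfolding integral_mult_left_zero integral_complex_of_real l2norm_sq ..
  finally have "(\<lambda>k. ?c * (LINT x|lborel. f x * J k x)) \<longlonglongrightarrow> ?c * (complex_of_real ((l2norm lborel f)\<^sup>2) * ?c)"
    by (intro tendsto_intros)
  then have "(\<lambda>k. complex_of_real (A k)) \<longlonglongrightarrow> complex_of_real (?c * ((l2norm lborel f)\<^sup>2 * ?c))"
    unfolding A by simp
  then have Alim: "A \<longlonglongrightarrow> ?c * ((l2norm lborel f)\<^sup>2 * ?c)"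
    using tendsto_of_real_iff by blast
  have sq: "square_integrable lborel (fourier_integral f)" by (rule bessel(1)[OF f])
  have "A k \<le> (l2norm lborel (fourier_integral f))\<^sup>2" for k
    unfolding A_def l2norm_sq
  proof (rule integral_mono)
    show i: "integrable lborel (\<lambda>\<xi>. (norm (fourier_integral f \<xi>))\<^sup>2)" using sq by (simp add: square_integrable_def)
    show le: "(norm (fourier_integral f \<xi>))\<^sup>2 * exp (- (s k)\<^sup>2 * (norm \<xi>)\<^sup>2 / 2) \<le> (norm (fourier_integral f \<xi>))\<^sup>2" for \<xi>
      by (rule mult_right_le_one_le) auto
    show "integrable lborel (\<lambda>\<xi>. (norm (fourier_integral f \<xi>))\<^sup>2 * exp (- (s k)\<^sup>2 * (norm \<xi>)\<^sup>2 / 2))"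
      by (rule Bochner_Integration.integrable_bound[OF i]) (use le in auto)
  qed
  then have "?c * ((l2norm lborel f)\<^sup>2 * ?c) \<le> (l2norm lborel (fourier_integral f))\<^sup>2"
    by (intro LIMSEQ_le_const2[OF Alim]) auto
  also have "?c * ((l2norm lborel f)\<^sup>2 * ?c) = (?c * l2norm lborel f)\<^sup>2" by (simp add: power2_eq_square)
  finally have "?c * l2norm lborel f \<le> l2norm lborel (fourier_integral f)" by (rule power2_le_imp_le) simp
  moreover have "sqrt ((2 * pi) ^ DIM('a)) = ?c" by (rule real_sqrt_power)
  ultimately show ?thesis using bessel(2)[OF f] by simp
qed

text \<open>
  A Borel function is the limit, off a null set, of continuous functions \<open>h n\<close>.
  Capping their modulus at \<open>M\<close> and multiplying by a cut-off \<open>chi\<close> makes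
  the convergence dominated.
\<close>

lemma continuous_approximation:
  fixes f :: "'a::euclidean_space \<Rightarrow> complex"
  assumes "bounded_compact f"
  obtains g :: "nat \<Rightarrow> 'a \<Rightarrow> complex" and M R where "\<And>k. continuous_on UNIV (g k)" "\<And>k x. norm (g k x) \<le> M"
    "\<And>k x. R < norm x \<Longrightarrow> g k x = 0" "(\<lambda>k. l2norm lborel (\<lambda>x. g k x - f x)) \<longlonglongrightarrow> 0"
proof -
  obtain M0 R where fm[measurable]: "f \<in> borel_measurable borel" and M0: "\<And>x. norm (f x) \<le> M0" and R: "\<And>x. R < norm x \<Longrightarrow> f x = 0"
    using assms unfolding bounded_compact_def by auto
  define M where "M = \<bar>M0\<bar> + 1"
  have M: "M > 0" "norm (f x) \<le> M" for x using M0[of x] by (auto simp: M_def)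
  have "f \<in> borel_measurable (lebesgue_on UNIV)"
    using measurable_completion[of f lborel borel] fm by simp
  then have "f measurable_on UNIV" by (subst measurable_on_iff_borel_measurable) auto
  then obtain N h where N: "negligible N" and h: "\<And>n. continuous_on UNIV (h n)" and lim: "\<And>x. x \<notin> N \<Longrightarrow> (\<lambda>n. h n x) \<longlonglongrightarrow> f x"
    unfolding measurable_on_def by auto
  define chi where "chi x = max 0 (min 1 (R + 1 - norm x))" for x :: 'a
  define g where "g n x = complex_of_real (chi x * (M / max M (norm (h n x)))) * h n x" for n x
  have chi: "0 \<le> chi x" "chi x \<le> 1" for x by (auto simp: chi_def)
  have gb: "norm (g n x) \<le> M" for n x
  proof -
    have "norm (g n x) = chi x * (M * norm (h n x) / max M (norm (h n x)))"
    proof -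
      have "0 \<le> chi x * (M / max M (norm (h n x)))" using chi[of x] M(1) by simp
      from abs_of_nonneg[OF this] show ?thesis
        unfolding g_def norm_mult norm_of_real by (simp only:) simp
    qed
    also have "\<dots> \<le> 1 * M"
      using M(1) chi by (intro mult_mono) (auto simp: divide_le_eq)
    finally show ?thesis by simp
  qed
  have gR: "g n x = 0" if "R + 1 < norm x" for n x using that by (simp add: g_def chi_def)
  have gc: "continuous_on UNIV (g n)" for n
    unfolding g_def chi_def using M(1) h[of n]
    by (intro continuous_intros continuous_on_norm) auto
  have glim: "(\<lambda>n. g n x) \<longlonglongrightarrow> f x" if "x \<notin> N" for x
  proof -
    have "(\<lambda>n. g n x) \<longlonglongrightarrow> complex_of_real (chi x * (M / max M (norm (f x)))) * f x"
      unfolding g_def using M(1) by (intro tendsto_intros lim[OF that]) auto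
    also have "complex_of_real (chi x * (M / max M (norm (f x)))) * f x = f x"
    proof (cases "R < norm x")
      case False
      then have "chi x = 1" by (simp add: chi_def)
      moreover have "max M (norm (f x)) = M" using M(2)[of x] by simp
      ultimately show ?thesis using M(1) by simp
    qed (simp add: R)
    finally show ?thesis .
  qed
  have gm[measurable]: "g n \<in> borel_measurable borel" for n using gc by (rule borel_measurable_continuous_onI)
  have "AE x in lebesgue. x \<notin> N"
    using N by (intro AE_not_in) (simp add: negligible_iff_null_sets)
  then have ae: "AE x in lborel. x \<notin> N" by (simp add: AE_completion_iff)
  have hs: "square_integrable lborel (\<lambda>x::'a. 2 * M * indicator (cball 0 (R + 1)) x :: real)"
    by (rule integrable_bounded_support(2)[where M = "2 * M" and R = "R + 1"])
       (use M(1) in \<open>auto simp: indicator_def intro!: borel_measurable_times borel_measurable_indicator\<close>)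
  have "(\<lambda>n. l2norm lborel (\<lambda>x. g n x - f x)) \<longlonglongrightarrow> 0"
  proof (rule l2norm_dominated[OF _ _ hs])
    show "AE x in lborel. (\<lambda>n. g n x) \<longlonglongrightarrow> f x" using ae by eventually_elim (rule glim)
    show "norm (g n x - f x) \<le> norm (2 * M * indicator (cball 0 (R + 1)) x :: real)" for n x
    proof (cases "R + 1 < norm x")
      case True then show ?thesis using gR[of x n] R[of x] by simp
    next
      case False
      then show ?thesis using norm_triangle_ineq4[of "g n x" "f x"] gb[of n x] M(2)[of x] M(1) by simp
    qed
  qed measurable
  then show thesis using that[of g M "R + 1"] gc gb gR by blast
qed

text \<open>
  Bessel's inequality for \<open>g k - f\<close> makes both sides continuous for convergence in
  the mean.
\<close>

lemma parseval_limit: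
  fixes f :: "'a::euclidean_space \<Rightarrow> complex" and g :: "nat \<Rightarrow> 'a \<Rightarrow> complex"
  assumes g: "\<And>k. integrable lborel (g k)" "\<And>k. square_integrable lborel (g k)"
    and par: "\<And>k. l2norm lborel (fourier_integral (g k)) = sqrt ((2 * pi) ^ DIM('a)) * l2norm lborel (g k)"
    and f: "integrable lborel f" "square_integrable lborel f" and lim: "(\<lambda>k. l2norm lborel (\<lambda>x. g k x - f x)) \<longlonglongrightarrow> 0"
  shows "l2norm lborel (fourier_integral f) = sqrt ((2 * pi) ^ DIM('a)) * l2norm lborel f"
proof -
  let ?c = "sqrt ((2 * pi) ^ DIM('a))"
  have l1: "(\<lambda>k. l2norm lborel (g k)) \<longlonglongrightarrow> l2norm lborel f"
  proof (rule LIM_zero_cancel, rule Lim_null_comparison[OF _ lim])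
    show "\<forall>\<^sub>F k in sequentially. norm (l2norm lborel (g k) - l2norm lborel f) \<le> l2norm lborel (\<lambda>x. g k x - f x)"
      using l2norm_diff_abs[OF g(2) f(2)] by simp
  qed
  have l2: "(\<lambda>k. l2norm lborel (fourier_integral (g k))) \<longlonglongrightarrow> l2norm lborel (fourier_integral f)"
  proof (rule LIM_zero_cancel, rule Lim_null_comparison)
    show "(\<lambda>k. ?c * l2norm lborel (\<lambda>x. g k x - f x)) \<longlonglongrightarrow> 0" using lim by (intro tendsto_mult_right_zero)
    show "\<forall>\<^sub>F k in sequentially. norm (l2norm lborel (fourier_integral (g k)) - l2norm lborel (fourier_integral f)) \<le> ?c * l2norm lborel (\<lambda>x. g k x - f x)"
    proof (intro always_eventually allI)
      fix k
      have "norm (l2norm lborel (fourier_integral (g k)) - l2norm lborel (fourier_integral f)) \<le> l2norm lborel (\<lambda>x. fourier_integral (g k) x - fourier_integral f x)"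
        using l2norm_diff_abs[OF bessel(1)[OF g] bessel(1)[OF f]] by simp
      also have "(\<lambda>x. fourier_integral (g k) x - fourier_integral f x) = fourier_integral (\<lambda>x. g k x - f x)"
        using fourier_integral_diff[OF g(1) f(1)] by auto
      also have "l2norm lborel \<dots> \<le> ?c * l2norm lborel (\<lambda>x. g k x - f x)"
        by (intro bessel square_integrable_diff Bochner_Integration.integrable_diff g f)
      finally show "norm (l2norm lborel (fourier_integral (g k)) - l2norm lborel (fourier_integral f)) \<le> ?c * l2norm lborel (\<lambda>x. g k x - f x)" .
    qed
  qed
  have "(\<lambda>k. l2norm lborel (fourier_integral (g k))) \<longlonglongrightarrow> ?c * l2norm lborel f"
    unfolding par using l1 by (intro tendsto_intros)
  then show ?thesis using l2 LIMSEQ_unique by blast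
qed

lemma parseval:
  fixes f :: "'a::euclidean_space \<Rightarrow> complex"
  assumes f: "bounded_compact f"
  shows "l2norm lborel (fourier_integral f) = sqrt ((2 * pi) ^ DIM('a)) * l2norm lborel f"
proof -
  obtain g :: "nat \<Rightarrow> 'a \<Rightarrow> complex" and M R where g: "\<And>k. continuous_on UNIV (g k)" "\<And>k x. norm (g k x) \<le> M"
    "\<And>k x. R < norm x \<Longrightarrow> g k x = 0" and lim: "(\<lambda>k. l2norm lborel (\<lambda>x. g k x - f x)) \<longlonglongrightarrow> 0"
    using continuous_approximation[OF f] by blast
  have tg: "bounded_compact (g k)" for k
    unfolding bounded_compact_def using g borel_measurable_continuous_onI[OF g(1)] by blast
  show ?thesis
    by (rule parseval_limit[OF bounded_compact_integrable[OF tg] bounded_compact_square_integrable[OF tg] _ bounded_compact_integrable[OF f] bounded_compact_square_integrable[OF f] lim])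
       (rule parseval_continuous[where M = M and R = R], use g in auto)
qed

section \<open>Fourier inversion\<close>

definition inv_fourier_integral :: "('a::euclidean_space \<Rightarrow> complex) \<Rightarrow> 'a \<Rightarrow> complex" where
  "inv_fourier_integral h x = (LINT \<xi>|lborel. exp (\<i> * complex_of_real (x \<bullet> \<xi>)) * h \<xi>)"

lemma inv_fourier_integral_eq_cnj: "inv_fourier_integral h x = cnj (fourier_integral (\<lambda>\<xi>. cnj (h \<xi>)) x)"
proof -
  have "cnj (fourier_integral (\<lambda>\<xi>. cnj (h \<xi>)) x) = (LINT \<xi>|lborel. cnj (fourier_kernel \<xi> x * cnj (h \<xi>)))"
    unfolding fourier_integral_def by (rule Bochner_Integration.integral_cnj[symmetric])
  also have "\<dots> = inv_fourier_integral h x"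
    unfolding inv_fourier_integral_def by (intro Bochner_Integration.integral_cong) (auto simp: exp_cnj inner_commute)
  finally show ?thesis ..
qed

lemma bounded_compact_cnj: "bounded_compact h \<Longrightarrow> bounded_compact (\<lambda>x. cnj (h x))"
  unfolding bounded_compact_def by auto

lemma parseval_inv_fourier_integral:
  fixes h :: "'a::euclidean_space \<Rightarrow> complex"
  assumes h: "bounded_compact h"
  shows "l2norm lborel (inv_fourier_integral h) = sqrt ((2 * pi) ^ DIM('a)) * l2norm lborel h" "square_integrable lborel (inv_fourier_integral h)"
proof -
  have e: "inv_fourier_integral h = (\<lambda>x. cnj (fourier_integral (\<lambda>\<xi>. cnj (h \<xi>)) x))" using inv_fourier_integral_eq_cnj by blast
  have s: "square_integrable lborel (fourier_integral (\<lambda>\<xi>. cnj (h \<xi>)))"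
    by (intro bessel bounded_compact_integrable bounded_compact_square_integrable bounded_compact_cnj h)
  show "l2norm lborel (inv_fourier_integral h) = sqrt ((2 * pi) ^ DIM('a)) * l2norm lborel h"
    unfolding e using parseval[OF bounded_compact_cnj[OF h]] by (simp add: l2norm_def)
  show "square_integrable lborel (inv_fourier_integral h)" unfolding e using s by (auto simp: square_integrable_def)
qed

lemma inv_fourier_integral_bounded:
  fixes h :: "'a::euclidean_space \<Rightarrow> complex"
  assumes "bounded_compact h"
  shows "norm (inv_fourier_integral h x) \<le> (LINT \<xi>|lborel. norm (h \<xi>))"
proof -
  have "norm (inv_fourier_integral h x) \<le> (LINT \<xi>|lborel. norm (exp (\<i> * complex_of_real (x \<bullet> \<xi>)) * h \<xi>))"
    unfolding inv_fourier_integral_def by (rule integral_norm_bound)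
  then show ?thesis by (simp add: norm_mult)
qed

lemma fourier_integral_adjoint:
  fixes h v :: "'a::euclidean_space \<Rightarrow> complex"
  assumes h: "integrable lborel h" and v: "integrable lborel v"
  shows "(LINT \<xi>|lborel. fourier_integral v \<xi> * cnj (h \<xi>)) = (LINT x|lborel. v x * cnj (inv_fourier_integral h x))"
proof -
  have [measurable]: "h \<in> borel_measurable borel" "v \<in> borel_measurable borel" using h v by auto
  define F where "F = (\<lambda>q::'a \<times> 'a. v (fst q) * cnj (h (snd q)) * fourier_kernel (fst q) (snd q))"
  have F: "integrable lborel F"
    unfolding F_def
  proof (rule Bochner_Integration.integrable_bound[OF integrable_lborel_prod[OF v integrable_cnj[OF h]]])
    show "(\<lambda>q::'a \<times> 'a. v (fst q) * cnj (h (snd q)) * fourier_kernel (fst q) (snd q)) \<in> borel_measurable lborel"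
      unfolding measurable_lborel2 borel_prod[symmetric] by measurable
  qed (simp add: norm_mult)
  have 1: "(LINT x|lborel. F (x, \<xi>)) = fourier_integral v \<xi> * cnj (h \<xi>)" for \<xi>
  proof -
    have "(LINT x|lborel. F (x, \<xi>)) = (LINT x|lborel. (fourier_kernel x \<xi> * v x) * cnj (h \<xi>))"
      by (simp add: F_def mult_ac)
    also have "\<dots> = fourier_integral v \<xi> * cnj (h \<xi>)" unfolding fourier_integral_def by (rule integral_mult_left_zero)
    finally show ?thesis .
  qed
  have 2: "(LINT \<xi>|lborel. F (x, \<xi>)) = v x * cnj (inv_fourier_integral h x)" for x
  proof -
    have "(LINT \<xi>|lborel. F (x, \<xi>)) = (LINT \<xi>|lborel. v x * cnj (exp (\<i> * complex_of_real (x \<bullet> \<xi>)) * h \<xi>))"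
      by (simp add: F_def mult_ac exp_cnj)
    also have "\<dots> = v x * (LINT \<xi>|lborel. cnj (exp (\<i> * complex_of_real (x \<bullet> \<xi>)) * h \<xi>))"
      by (rule integral_mult_right_zero)
    also have "(LINT \<xi>|lborel. cnj (exp (\<i> * complex_of_real (x \<bullet> \<xi>)) * h \<xi>)) = cnj (inv_fourier_integral h x)"
      unfolding inv_fourier_integral_def by (rule Bochner_Integration.integral_cnj)
    finally show ?thesis .
  qed
  show ?thesis using Fubini_lborel(1)[OF F] unfolding 1 2 by simp
qed

lemma norm_sq_diff_complex: "(norm (a - b))\<^sup>2 = (norm a)\<^sup>2 + (norm b)\<^sup>2 - 2 * Re (a * cnj b)" for a b :: complex
  unfolding cmod_power2 by (simp add: power2_eq_square algebra_simps)

text \<open>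
  Let \<open>a R\<close> be the normalized transform of \<open>u\<close> restricted to the ball of
  radius \<open>R\<close>. By duality its inner product with \<open>h\<close> is the integral
  \<open>I R\<close> of \<open>|u|\<^sup>2\<close> over that ball, and its norm is at most that of
  \<open>h\<close> by Bessel. Expanding the square gives \<open>2 (|h|\<^sup>2 - I R)\<close> as a
  bound for the squared distance of \<open>a R\<close> and \<open>h\<close>, and this tends to
  zero by Parseval's identity for \<open>u\<close>.
\<close>

lemma inversion:
  fixes h :: "'a::euclidean_space \<Rightarrow> complex"
  assumes h: "bounded_compact h"
  defines "c \<equiv> 1 / sqrt ((2 * pi) ^ DIM('a))"
  defines "u \<equiv> (\<lambda>x. c *\<^sub>R inv_fourier_integral h x)"
  shows "((\<lambda>R. l2norm lborel (\<lambda>\<xi>. c *\<^sub>R fourier_integral (\<lambda>x. indicator (cball 0 R) x *\<^sub>R u x) \<xi> - h \<xi>)) \<longlongrightarrow> 0) at_top"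
proof -
  have [measurable]: "h \<in> borel_measurable borel" using h by (rule bounded_compact_measurable)
  have hi: "integrable lborel h" "square_integrable lborel h" using h by (auto intro: bounded_compact_integrable bounded_compact_square_integrable)
  have P: "(2 * pi) ^ DIM('a) > 0" by simp
  have c: "c > 0" unfolding c_def using P by simp
  have cc: "c * sqrt ((2 * pi) ^ DIM('a)) = 1" unfolding c_def using P by simp
  have u: "square_integrable lborel u" unfolding u_def by (intro square_integrable_scaleR parseval_inv_fourier_integral h)
  have [measurable]: "u \<in> borel_measurable borel" using u by (auto simp: square_integrable_def)
  have nu: "l2norm lborel u = l2norm lborel h"
    unfolding u_def l2norm_scaleR parseval_inv_fourier_integral(1)[OF h] using cc c by (simp add: mult.assoc[symmetric])
  define v where "v R x = indicator (cball 0 R) x *\<^sub>R u x" for R x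
  have cbm[measurable]: "(\<lambda>x::'a. indicator (cball 0 R) x :: real) \<in> borel_measurable borel" for R
    by (rule borel_measurable_indicator) simp
  have vm[measurable]: "v R \<in> borel_measurable borel" for R unfolding v_def by measurable
  have v: "integrable lborel (v R)" "square_integrable lborel (v R)" for R
  proof -
    have b: "norm (v R x) \<le> c * (LINT \<xi>|lborel. norm (h \<xi>))" for x
      using inv_fourier_integral_bounded[OF h, of x] c by (auto simp: v_def u_def indicator_def mult_left_mono)
    have z: "v R x = 0" if "R < norm x" for x using that by (simp add: v_def)
    show "integrable lborel (v R)" "square_integrable lborel (v R)"
      using integrable_bounded_support[OF vm b z] by auto
  qed
  define a where "a R \<xi> = c *\<^sub>R fourier_integral (v R) \<xi>" for R \<xi>
  have a: "square_integrable lborel (a R)" for R unfolding a_def by (intro square_integrable_scaleR bessel v)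
  have na: "l2norm lborel (a R) \<le> l2norm lborel h" for R
  proof -
    have "l2norm lborel (a R) \<le> c * (sqrt ((2 * pi) ^ DIM('a)) * l2norm lborel (v R))"
      unfolding a_def l2norm_scaleR using c bessel(2)[OF v, of R] by simp
    also have "\<dots> = l2norm lborel (v R)" using cc by (simp add: mult.assoc[symmetric])
    also have "\<dots> \<le> l2norm lborel u"
      by (intro l2norm_mono u) (auto simp: v_def indicator_def)
    finally show ?thesis using nu by simp
  qed
  define I where "I R = (LINT x|lborel. indicator (cball 0 R) x * (norm (u x))\<^sup>2)" for R
  have ah_int: "integrable lborel (\<lambda>\<xi>. a R \<xi> * cnj (h \<xi>))" for R
  proof (rule Bochner_Integration.integrable_bound)
    show "integrable lborel (\<lambda>\<xi>. (norm (a R \<xi>))\<^sup>2 + (norm (h \<xi>))\<^sup>2)" using a hi(2) by (simp add: square_integrable_def)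
    show "AE \<xi> in lborel. norm (a R \<xi> * cnj (h \<xi>)) \<le> norm ((norm (a R \<xi>))\<^sup>2 + (norm (h \<xi>))\<^sup>2)"
    proof (rule AE_I2)
      fix \<xi>
      have "0 \<le> norm (a R \<xi>) * norm (h \<xi>)" by simp
      then show "norm (a R \<xi> * cnj (h \<xi>)) \<le> norm ((norm (a R \<xi>))\<^sup>2 + (norm (h \<xi>))\<^sup>2)"
        using sum_squares_bound[of "norm (a R \<xi>)" "norm (h \<xi>)"]
        unfolding norm_mult complex_mod_cnj real_norm_def by linarith
    qed
    have [measurable]: "a R \<in> borel_measurable borel" using a[of R] by (simp add: square_integrable_def)
    show "(\<lambda>\<xi>. a R \<xi> * cnj (h \<xi>)) \<in> borel_measurable lborel" by measurable
  qed
  have ah: "(LINT \<xi>|lborel. a R \<xi> * cnj (h \<xi>)) = complex_of_real (I R)" for R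
  proof -
    have "(LINT \<xi>|lborel. a R \<xi> * cnj (h \<xi>)) = c *\<^sub>R (LINT \<xi>|lborel. fourier_integral (v R) \<xi> * cnj (h \<xi>))"
      by (simp add: a_def)
    also have "\<dots> = (LINT x|lborel. c *\<^sub>R (v R x * cnj (inv_fourier_integral h x)))"
      unfolding fourier_integral_adjoint[OF hi(1) v(1)] by (rule integral_scaleR_right[symmetric])
    also have "(\<lambda>x. c *\<^sub>R (v R x * cnj (inv_fourier_integral h x))) = (\<lambda>x. complex_of_real (indicator (cball 0 R) x * (norm (u x))\<^sup>2))"
    proof
      fix x
      have "c *\<^sub>R (v R x * cnj (inv_fourier_integral h x)) = complex_of_real (indicator (cball 0 R) x) * (u x * cnj (u x))"
        by (simp add: v_def u_def scaleR_conv_of_real)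
      then show "c *\<^sub>R (v R x * cnj (inv_fourier_integral h x)) = complex_of_real (indicator (cball 0 R) x * (norm (u x))\<^sup>2)"
        by (simp only: complex_norm_square of_real_mult)
    qed
    finally show ?thesis unfolding I_def integral_complex_of_real .
  qed
  have nd: "(l2norm lborel (\<lambda>\<xi>. a R \<xi> - h \<xi>))\<^sup>2 \<le> 2 * ((l2norm lborel h)\<^sup>2 - I R)" for R
  proof -
    have "(l2norm lborel (\<lambda>\<xi>. a R \<xi> - h \<xi>))\<^sup>2 = (LINT \<xi>|lborel. (norm (a R \<xi>))\<^sup>2 + (norm (h \<xi>))\<^sup>2 - 2 * Re (a R \<xi> * cnj (h \<xi>)))"
      unfolding l2norm_sq norm_sq_diff_complex ..
    also have "\<dots> = (l2norm lborel (a R))\<^sup>2 + (l2norm lborel h)\<^sup>2 - 2 * Re (LINT \<xi>|lborel. a R \<xi> * cnj (h \<xi>))"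
    proof -
      have "integrable lborel (\<lambda>\<xi>. Re (a R \<xi> * cnj (h \<xi>)))" by (rule integrable_Re[OF ah_int])
      then show ?thesis using a[of R] hi(2) integral_Re[OF ah_int, of R]
        by (simp add: l2norm_sq square_integrable_def del: times_complex.simps)
    qed
    also have "\<dots> \<le> (l2norm lborel h)\<^sup>2 + (l2norm lborel h)\<^sup>2 - 2 * I R"
      unfolding ah using power_mono[OF na l2norm_nonneg, of R 2] by simp
    finally show ?thesis by simp
  qed
  have "(I \<longlongrightarrow> (LINT x|lborel. (norm (u x))\<^sup>2)) at_top"
    unfolding I_def
  proof (rule integral_dominated_convergence_at_top[where w = "\<lambda>x. (norm (u x))\<^sup>2"])
    show "integrable lborel (\<lambda>x. (norm (u x))\<^sup>2)" using u by (simp add: square_integrable_def)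
    show "\<forall>\<^sub>F R in at_top. AE x in lborel. norm (indicator (cball 0 R) x * (norm (u x))\<^sup>2) \<le> (norm (u x))\<^sup>2"
      by (auto simp: indicator_def)
    show "AE x in lborel. ((\<lambda>R. indicator (cball 0 R) x * (norm (u x))\<^sup>2) \<longlongrightarrow> (norm (u x))\<^sup>2) at_top"
    proof (rule AE_I2, rule tendsto_eventually)
      fix x
      show "\<forall>\<^sub>F R in at_top. indicator (cball 0 R) x * (norm (u x))\<^sup>2 = (norm (u x))\<^sup>2"
        using eventually_ge_at_top[of "norm x"] by eventually_elim simp
    qed
  qed measurable
  then have Il: "(I \<longlongrightarrow> (l2norm lborel h)\<^sup>2) at_top" unfolding l2norm_sq[symmetric] nu .
  have lim0: "((\<lambda>R. 2 * ((l2norm lborel h)\<^sup>2 - I R)) \<longlongrightarrow> 2 * ((l2norm lborel h)\<^sup>2 - (l2norm lborel h)\<^sup>2)) at_top"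
    by (intro tendsto_intros Il)
  have "((\<lambda>R. (l2norm lborel (\<lambda>\<xi>. a R \<xi> - h \<xi>))\<^sup>2) \<longlongrightarrow> 0) at_top"
  proof (rule tendsto_sandwich)
    show "\<forall>\<^sub>F R in at_top. 0 \<le> (l2norm lborel (\<lambda>\<xi>. a R \<xi> - h \<xi>))\<^sup>2" by simp
    show "\<forall>\<^sub>F R in at_top. (l2norm lborel (\<lambda>\<xi>. a R \<xi> - h \<xi>))\<^sup>2 \<le> 2 * ((l2norm lborel h)\<^sup>2 - I R)"
      by (rule always_eventually, rule allI, rule nd)
    show "((\<lambda>R. 2 * ((l2norm lborel h)\<^sup>2 - I R)) \<longlongrightarrow> 0) at_top" using lim0 by simp
  qed simp
  then have "((\<lambda>R. sqrt ((l2norm lborel (\<lambda>\<xi>. a R \<xi> - h \<xi>))\<^sup>2)) \<longlongrightarrow> sqrt 0) at_top"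
    by (rule tendsto_real_sqrt)
  then show ?thesis
    unfolding a_def v_def[abs_def] real_sqrt_abs abs_of_nonneg[OF l2norm_nonneg] real_sqrt_zero .
qed

definition cutoff :: "nat \<Rightarrow> ('a::euclidean_space \<Rightarrow> complex) \<Rightarrow> 'a \<Rightarrow> complex" where
  "cutoff n f x = (if norm (f x) \<le> real n \<and> norm x \<le> real n then f x else 0)"

lemma bounded_compact_cutoff:
  assumes [measurable]: "f \<in> borel_measurable borel" shows "bounded_compact (cutoff n f)"
  unfolding bounded_compact_def
proof (intro conjI exI[of _ "real n"] allI impI)
  show "cutoff n f \<in> borel_measurable borel" unfolding cutoff_def by measurable
qed (auto simp: cutoff_def)

lemma cutoff_tendsto:
  assumes f: "square_integrable lborel f" shows "(\<lambda>n. l2norm lborel (\<lambda>x. cutoff n f x - f x)) \<longlonglongrightarrow> 0"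
proof (rule l2norm_dominated[OF _ _ f])
  have [measurable]: "f \<in> borel_measurable borel" using f by (simp add: square_integrable_def)
  show "cutoff n f \<in> borel_measurable lborel" for n
    using bounded_compact_measurable[OF bounded_compact_cutoff, of f n] by simp
  show "f \<in> borel_measurable lborel" by simp
  show "norm (cutoff n f x - f x) \<le> norm (f x)" for n x by (simp add: cutoff_def)
  show "AE x in lborel. (\<lambda>n. cutoff n f x) \<longlonglongrightarrow> f x"
  proof (rule AE_I2, rule tendsto_eventually)
    fix x
    obtain N where N: "max (norm (f x)) (norm x) \<le> real N" using real_arch_simple by blast
    show "\<forall>\<^sub>F n in sequentially. cutoff n f x = f x"
      using eventually_ge_at_top[of N] by eventually_elim (use N in \<open>auto simp: cutoff_def\<close>)
  qed
qed

lemma parseval_L1_L2: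
  fixes f :: "'a::euclidean_space \<Rightarrow> complex"
  assumes f: "integrable lborel f" "square_integrable lborel f"
  shows "l2norm lborel (fourier_integral f) = sqrt ((2 * pi) ^ DIM('a)) * l2norm lborel f"
proof -
  have [measurable]: "f \<in> borel_measurable borel" using f by auto
  note t = bounded_compact_cutoff[of f]
  show ?thesis
    by (rule parseval_limit[OF bounded_compact_integrable[OF t] bounded_compact_square_integrable[OF t] parseval[OF t] f cutoff_tendsto[OF f(2)]]) simp_all
qed

section \<open>The Fourier transform of square-integrable functions\<close>

definition fourier_const :: "'a::euclidean_space itself \<Rightarrow> real" where
  "fourier_const _ = 1 / sqrt ((2 * pi) ^ DIM('a))"

lemma fourier_const: "fourier_const TYPE('a::euclidean_space) > 0" "fourier_const TYPE('a) * sqrt ((2 * pi) ^ DIM('a)) = 1"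
  by (simp_all add: fourier_const_def)

text \<open>
  The scalar analogue of \<open>truncated_fourier\<close>, on any Euclidean space.
\<close>

definition truncated_transform :: "real \<Rightarrow> ('a::euclidean_space \<Rightarrow> complex) \<Rightarrow> 'a \<Rightarrow> complex" where
  "truncated_transform R f \<xi> = fourier_const TYPE('a) *\<^sub>R (LINT x:cball 0 R|lebesgue. fourier_kernel x \<xi> * f x)"

definition has_scalar_fourier :: "('a::euclidean_space \<Rightarrow> complex) \<Rightarrow> ('a \<Rightarrow> complex) \<Rightarrow> bool" where
  "has_scalar_fourier f F \<longleftrightarrow> square_integrable lebesgue f \<and> square_integrable lebesgue F \<and> ((\<lambda>R. l2norm lebesgue (\<lambda>\<xi>. F \<xi> - truncated_transform R f \<xi>)) \<longlongrightarrow> 0) at_top"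

lemma square_integrable_lborel_lebesgue: "square_integrable lborel f \<Longrightarrow> square_integrable lebesgue f"
  unfolding square_integrable_def by (auto simp: integrable_completion intro: measurable_completion)

lemma l2norm_lborel_lebesgue: "f \<in> borel_measurable borel \<Longrightarrow> l2norm lebesgue f = l2norm lborel f"
  unfolding l2norm_def by (subst integral_completion) auto

lemma borel_representative:
  fixes f :: "'a::euclidean_space \<Rightarrow> complex"
  assumes f: "f \<in> borel_measurable lebesgue"
  obtains f' where "f' \<in> borel_measurable borel" "AE x in lborel. f x = f' x"
proof -
  have "(\<lambda>x. Re (f x)) \<in> borel_measurable lebesgue" "(\<lambda>x. Im (f x)) \<in> borel_measurable lebesgue" using f by auto
  note c = this[THEN completion_ex_borel_measurable_real]
  obtain a where [measurable]: "a \<in> borel_measurable lborel" and ae1: "AE x in lborel. Re (f x) = a x"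
    using c(1) by blast
  obtain b where [measurable]: "b \<in> borel_measurable lborel" and ae2: "AE x in lborel. Im (f x) = b x"
    using c(2) by blast
  have 1: "(\<lambda>x. complex_of_real (a x) + \<i> * complex_of_real (b x)) \<in> borel_measurable borel" by measurable
  have 2: "AE x in lborel. f x = complex_of_real (a x) + \<i> * complex_of_real (b x)"
    using ae1 ae2 by eventually_elim (simp add: complex_eq_iff)
  show thesis by (rule that[OF 1 2])
qed

lemma square_integrable_representative:
  fixes f :: "'a::euclidean_space \<Rightarrow> complex"
  assumes f: "square_integrable lebesgue f"
  obtains f' where "square_integrable lborel f'" "AE x in lborel. f x = f' x"
proof -
  have fm: "f \<in> borel_measurable lebesgue" using f by (simp add: square_integrable_def)
  obtain f' where f'[measurable]: "f' \<in> borel_measurable borel" and ae: "AE x in lborel. f x = f' x"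
    using borel_representative[OF fm] by blast
  have "square_integrable lebesgue f'"
    using AE_completion[OF ae] f by (rule square_integrable_cong_AE) (auto intro: measurable_completion)
  then have "square_integrable lborel f'"
    unfolding square_integrable_def by (auto simp: integrable_completion)
  then show thesis using ae that by blast
qed

definition restrict_ball :: "real \<Rightarrow> ('a::euclidean_space \<Rightarrow> complex) \<Rightarrow> 'a \<Rightarrow> complex" where
  "restrict_ball R f x = indicator (cball 0 R) x *\<^sub>R f x"

lemma norm_le_1_plus_sq: "norm (z::complex) \<le> 1 + (norm z)\<^sup>2"
proof -
  have "2 * norm z \<le> 1 + (norm z)\<^sup>2" using sum_squares_bound[of 1 "norm z"] by simp
  then show ?thesis using norm_ge_zero[of z] by linarith
qed

lemma restrict_ball_L1_L2:
  fixes f :: "'a::euclidean_space \<Rightarrow> complex"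
  assumes f: "square_integrable lborel f"
  shows "integrable lborel (restrict_ball R f)" "square_integrable lborel (restrict_ball R f)"
proof -
  have [measurable]: "f \<in> borel_measurable borel" using f by (simp add: square_integrable_def)
  have [measurable]: "(\<lambda>x::'a. indicator (cball 0 R) x :: real) \<in> borel_measurable borel"
    by (rule borel_measurable_indicator) simp
  have m: "restrict_ball R f \<in> borel_measurable lborel" unfolding restrict_ball_def by measurable
  show "square_integrable lborel (restrict_ball R f)"
    by (rule square_integrable_mono[OF f m]) (auto simp: restrict_ball_def indicator_def)
  have "integrable lborel (\<lambda>x. indicator (cball 0 R) x + (norm (f x))\<^sup>2)"
    using f by (intro Bochner_Integration.integrable_add) (auto simp: square_integrable_def intro!: integrable_real_indicator)
  then show "integrable lborel (restrict_ball R f)"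
  proof (rule Bochner_Integration.integrable_bound[OF _ m], intro AE_I2)
    fix x
    have "norm (f x) \<le> 1 + (norm (f x))\<^sup>2" by (rule norm_le_1_plus_sq)
    then show "norm (restrict_ball R f x) \<le> norm (indicator (cball 0 R) x + (norm (f x))\<^sup>2)"
      by (auto simp: restrict_ball_def indicator_def)
  qed
qed

lemma truncated_transform_eq:
  fixes f :: "'a::euclidean_space \<Rightarrow> complex"
  assumes fm: "f \<in> borel_measurable lebesgue" and f': "f' \<in> borel_measurable borel" and ae: "AE x in lborel. f x = f' x"
  shows "truncated_transform R f \<xi> = fourier_const TYPE('a) *\<^sub>R fourier_integral (restrict_ball R f') \<xi>"
proof -
  have [measurable]: "(\<lambda>x::'a. indicator (cball 0 R) x :: real) \<in> borel_measurable borel"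
    by (rule borel_measurable_indicator) simp
  have cm: "(\<lambda>x. indicator (cball 0 R) x *\<^sub>R (fourier_kernel x \<xi> * f' x)) \<in> borel_measurable borel"
    using f' by measurable
  have em: "(\<lambda>x. fourier_kernel x \<xi>) \<in> borel_measurable lebesgue"
    by (rule measurable_completion) measurable
  have "(LINT x:cball 0 R|lebesgue. fourier_kernel x \<xi> * f x)
    = (LINT x|lebesgue. indicator (cball 0 R) x *\<^sub>R (fourier_kernel x \<xi> * f' x))"
    unfolding set_lebesgue_integral_def
  proof (rule integral_cong_AE)
    show "AE x in lebesgue. indicator (cball 0 R) x *\<^sub>R (fourier_kernel x \<xi> * f x)
       = indicator (cball 0 R) x *\<^sub>R (fourier_kernel x \<xi> * f' x)"
      using AE_completion[OF ae] by eventually_elim simp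
    show "(\<lambda>x. indicator (cball 0 R) x *\<^sub>R (fourier_kernel x \<xi> * f x)) \<in> borel_measurable lebesgue"
      by (intro borel_measurable_scaleR borel_measurable_indicator borel_measurable_times em fm) simp
    show "(\<lambda>x. indicator (cball 0 R) x *\<^sub>R (fourier_kernel x \<xi> * f' x)) \<in> borel_measurable lebesgue"
      using cm by (intro measurable_completion) simp
  qed
  also have "\<dots> = (LINT x|lborel. indicator (cball 0 R) x *\<^sub>R (fourier_kernel x \<xi> * f' x))"
    using cm by (intro integral_completion) simp
  also have "\<dots> = fourier_integral (restrict_ball R f') \<xi>" unfolding fourier_integral_def restrict_ball_def by simp
  finally show ?thesis by (simp add: truncated_transform_def)
qed

text \<open>
  A restriction of \<open>f\<close> to a ball is integrable as well as square integrable, so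
  Parseval's identity applies to it and the norm of the truncated transform is the norm of the
  restriction.
\<close>

lemma truncated_transform_square_integrable_l2norm:
  fixes f :: "'a::euclidean_space \<Rightarrow> complex"
  assumes f: "square_integrable lebesgue f"
  shows "square_integrable lebesgue (truncated_transform R f)" "l2norm lebesgue (truncated_transform R f) \<le> l2norm lebesgue f"
    "((\<lambda>R. l2norm lebesgue (truncated_transform R f)) \<longlongrightarrow> l2norm lebesgue f) at_top"
proof -
  have fm: "f \<in> borel_measurable lebesgue" using f by (simp add: square_integrable_def)
  obtain f' where f': "square_integrable lborel f'" and ae: "AE x in lborel. f x = f' x"
    using square_integrable_representative[OF f] by blast
  have [measurable]: "f' \<in> borel_measurable borel" using f' by (simp add: square_integrable_def)
  have [measurable]: "(\<lambda>x::'a. indicator (cball 0 R) x :: real) \<in> borel_measurable borel" for R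
    by (rule borel_measurable_indicator) simp
  have e: "truncated_transform R f = (\<lambda>\<xi>. fourier_const TYPE('a) *\<^sub>R fourier_integral (restrict_ball R f') \<xi>)" for R
    using truncated_transform_eq[OF fm _ ae] by auto
  have s: "square_integrable lborel (truncated_transform R f)" for R
    unfolding e by (intro square_integrable_scaleR bessel restrict_ball_L1_L2 f')
  show "square_integrable lebesgue (truncated_transform R f)" by (rule square_integrable_lborel_lebesgue[OF s])
  have n: "l2norm lebesgue (truncated_transform R f) = l2norm lborel (restrict_ball R f')" for R
  proof -
    have "l2norm lebesgue (truncated_transform R f) = l2norm lborel (truncated_transform R f)"
      using s[of R] by (intro l2norm_lborel_lebesgue) (simp add: square_integrable_def)
    also have "\<dots> = fourier_const TYPE('a) * (sqrt ((2 * pi) ^ DIM('a)) * l2norm lborel (restrict_ball R f'))"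
      unfolding e l2norm_scaleR parseval_L1_L2[OF restrict_ball_L1_L2[OF f']] using fourier_const(1)[where 'a='a] by simp
    also have "\<dots> = l2norm lborel (restrict_ball R f')"
      unfolding mult.assoc[symmetric] fourier_const(2) by simp
    finally show ?thesis .
  qed
  have ff': "l2norm lebesgue f = l2norm lborel f'"
  proof -
    have "l2norm lebesgue f = l2norm lebesgue f'"
      using AE_completion[OF ae] fm by (rule l2norm_cong_AE) (auto intro: measurable_completion)
    then show ?thesis by (simp add: l2norm_lborel_lebesgue)
  qed
  show "l2norm lebesgue (truncated_transform R f) \<le> l2norm lebesgue f"
    unfolding n ff' using restrict_ball_L1_L2(2)[OF f', of R]
    by (intro l2norm_mono f') (auto simp: square_integrable_def restrict_ball_def indicator_def)
  have "((\<lambda>R. LINT x|lborel. (norm (restrict_ball R f' x))\<^sup>2) \<longlongrightarrow> (LINT x|lborel. (norm (f' x))\<^sup>2)) at_top"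
  proof (rule integral_dominated_convergence_at_top[where w = "\<lambda>x. (norm (f' x))\<^sup>2"])
    show "integrable lborel (\<lambda>x. (norm (f' x))\<^sup>2)" using f' by (simp add: square_integrable_def)
    show "\<forall>\<^sub>F R in at_top. AE x in lborel. norm ((norm (restrict_ball R f' x))\<^sup>2) \<le> (norm (f' x))\<^sup>2"
      by (auto simp: restrict_ball_def indicator_def)
    show "AE x in lborel. ((\<lambda>R. (norm (restrict_ball R f' x))\<^sup>2) \<longlongrightarrow> (norm (f' x))\<^sup>2) at_top"
    proof (rule AE_I2, rule tendsto_eventually)
      fix x
      show "\<forall>\<^sub>F R in at_top. (norm (restrict_ball R f' x))\<^sup>2 = (norm (f' x))\<^sup>2"
        using eventually_ge_at_top[of "norm x"] by eventually_elim (simp add: restrict_ball_def)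
    qed
    show "(\<lambda>x. (norm (restrict_ball R f' x))\<^sup>2) \<in> borel_measurable lborel" for R
      unfolding restrict_ball_def by measurable
  qed measurable
  then have "((\<lambda>R. l2norm lborel (restrict_ball R f')) \<longlongrightarrow> l2norm lborel f') at_top"
    unfolding l2norm_def by (rule tendsto_real_sqrt)
  then show "((\<lambda>R. l2norm lebesgue (truncated_transform R f)) \<longlongrightarrow> l2norm lebesgue f) at_top"
    unfolding n ff' .
qed

lemma set_integrable_kernel:
  fixes f :: "'a::euclidean_space \<Rightarrow> complex"
  assumes f: "square_integrable lebesgue f"
  shows "set_integrable lebesgue (cball 0 R) (\<lambda>x. fourier_kernel x \<xi> * f x)"
proof -
  have fm: "f \<in> borel_measurable lebesgue" using f by (simp add: square_integrable_def)
  have em: "(\<lambda>x. fourier_kernel x \<xi>) \<in> borel_measurable lebesgue"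
    by (rule measurable_completion) measurable
  have i: "integrable lebesgue (\<lambda>x. indicator (cball 0 R) x + (norm (f x))\<^sup>2)"
  proof (intro Bochner_Integration.integrable_add)
    have "integrable lborel (\<lambda>x::'a. indicator (cball 0 R) x :: real)" by (auto intro!: integrable_real_indicator)
    then show "integrable lebesgue (\<lambda>x::'a. indicator (cball 0 R) x :: real)"
      by (subst integrable_completion) (auto intro!: borel_measurable_indicator)
  qed (use f in \<open>simp add: square_integrable_def\<close>)
  show ?thesis unfolding set_integrable_def
  proof (rule Bochner_Integration.integrable_bound[OF i])
    show "(\<lambda>x. indicator (cball 0 R) x *\<^sub>R (fourier_kernel x \<xi> * f x)) \<in> borel_measurable lebesgue"
      by (intro borel_measurable_scaleR borel_measurable_indicator borel_measurable_times em fm) simp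
    show "AE x in lebesgue. norm (indicator (cball 0 R) x *\<^sub>R (fourier_kernel x \<xi> * f x))
        \<le> norm (indicator (cball 0 R) x + (norm (f x))\<^sup>2)"
    proof (rule AE_I2)
      fix x
      have "norm (f x) \<le> 1 + (norm (f x))\<^sup>2" by (rule norm_le_1_plus_sq)
      then show "norm (indicator (cball 0 R) x *\<^sub>R (fourier_kernel x \<xi> * f x))
        \<le> norm (indicator (cball 0 R) x + (norm (f x))\<^sup>2)"
        by (auto simp: indicator_def norm_mult)
    qed
  qed
qed

lemma truncated_transform_diff:
  assumes "square_integrable lebesgue f" "square_integrable lebesgue g"
  shows "truncated_transform R (\<lambda>x. f x - g x) \<xi> = truncated_transform R f \<xi> - truncated_transform R g \<xi>"
  unfolding truncated_transform_def using set_integral_diff(2)[OF set_integrable_kernel[OF assms(1)] set_integrable_kernel[OF assms(2)]]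
  by (simp add: right_diff_distrib scaleR_right_diff_distrib)

lemma tendsto_l2norm_of_diff:
  assumes "\<And>R. square_integrable M (s R)" "square_integrable M F" "((\<lambda>R. l2norm M (\<lambda>\<xi>. F \<xi> - s R \<xi>)) \<longlongrightarrow> 0) at_top"
  shows "((\<lambda>R::real. l2norm M (s R)) \<longlongrightarrow> l2norm M F) at_top"
proof (rule LIM_zero_cancel, rule Lim_null_comparison[OF _ assms(3)])
  show "\<forall>\<^sub>F R in at_top. norm (l2norm M (s R) - l2norm M F) \<le> l2norm M (\<lambda>\<xi>. F \<xi> - s R \<xi>)"
    using l2norm_diff_abs[OF assms(2,1)] by (simp add: abs_minus_commute)
qed

lemma has_scalar_fourier_isometry:
  assumes "has_scalar_fourier f F" shows "l2norm lebesgue f = l2norm lebesgue F"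
proof -
  have f: "square_integrable lebesgue f" and F: "square_integrable lebesgue F" and l: "((\<lambda>R. l2norm lebesgue (\<lambda>\<xi>. F \<xi> - truncated_transform R f \<xi>)) \<longlongrightarrow> 0) at_top"
    using assms by (auto simp: has_scalar_fourier_def)
  have "((\<lambda>R. l2norm lebesgue (truncated_transform R f)) \<longlongrightarrow> l2norm lebesgue F) at_top"
    by (rule tendsto_l2norm_of_diff[OF truncated_transform_square_integrable_l2norm(1)[OF f] F l])
  from tendsto_unique[OF _ truncated_transform_square_integrable_l2norm(3)[OF f] this] show ?thesis by simp
qed

lemma has_scalar_fourier_diff:
  assumes "has_scalar_fourier f F" "has_scalar_fourier g G" shows "has_scalar_fourier (\<lambda>x. f x - g x) (\<lambda>\<xi>. F \<xi> - G \<xi>)"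
proof -
  have f: "square_integrable lebesgue f" "square_integrable lebesgue F" and g: "square_integrable lebesgue g" "square_integrable lebesgue G"
    and lf: "((\<lambda>R. l2norm lebesgue (\<lambda>\<xi>. F \<xi> - truncated_transform R f \<xi>)) \<longlongrightarrow> 0) at_top"
    and lg: "((\<lambda>R. l2norm lebesgue (\<lambda>\<xi>. G \<xi> - truncated_transform R g \<xi>)) \<longlongrightarrow> 0) at_top"
    using assms by (auto simp: has_scalar_fourier_def)
  have "((\<lambda>R. l2norm lebesgue (\<lambda>\<xi>. F \<xi> - G \<xi> - truncated_transform R (\<lambda>x. f x - g x) \<xi>)) \<longlongrightarrow> 0) at_top"
  proof (rule Lim_null_comparison)
    show "((\<lambda>R. l2norm lebesgue (\<lambda>\<xi>. F \<xi> - truncated_transform R f \<xi>) + l2norm lebesgue (\<lambda>\<xi>. G \<xi> - truncated_transform R g \<xi>)) \<longlongrightarrow> 0) at_top"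
      using tendsto_add[OF lf lg] by simp
    show "\<forall>\<^sub>F R in at_top. norm (l2norm lebesgue (\<lambda>\<xi>. F \<xi> - G \<xi> - truncated_transform R (\<lambda>x. f x - g x) \<xi>))
       \<le> l2norm lebesgue (\<lambda>\<xi>. F \<xi> - truncated_transform R f \<xi>) + l2norm lebesgue (\<lambda>\<xi>. G \<xi> - truncated_transform R g \<xi>)"
    proof (intro always_eventually allI)
      fix R
      have e: "F \<xi> - G \<xi> - truncated_transform R (\<lambda>x. f x - g x) \<xi> = (F \<xi> - truncated_transform R f \<xi>) + (truncated_transform R g \<xi> - G \<xi>)" for \<xi>
        using truncated_transform_diff[OF f(1) g(1), of R \<xi>] by simp
      have "l2norm lebesgue (\<lambda>\<xi>. F \<xi> - G \<xi> - truncated_transform R (\<lambda>x. f x - g x) \<xi>)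
         \<le> l2norm lebesgue (\<lambda>\<xi>. F \<xi> - truncated_transform R f \<xi>) + l2norm lebesgue (\<lambda>\<xi>. truncated_transform R g \<xi> - G \<xi>)"
        unfolding e by (intro l2norm_triangle square_integrable_diff f g truncated_transform_square_integrable_l2norm)
      then show "norm (l2norm lebesgue (\<lambda>\<xi>. F \<xi> - G \<xi> - truncated_transform R (\<lambda>x. f x - g x) \<xi>))
       \<le> l2norm lebesgue (\<lambda>\<xi>. F \<xi> - truncated_transform R f \<xi>) + l2norm lebesgue (\<lambda>\<xi>. G \<xi> - truncated_transform R g \<xi>)"
        using l2norm_commute[of lebesgue "truncated_transform R g" G] by simp
    qed
  qed
  then show ?thesis unfolding has_scalar_fourier_def using square_integrable_diff[OF f(1) g(1)] square_integrable_diff[OF f(2) g(2)] by simp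
qed

text \<open>
  The difference of two transforms of \<open>f\<close> is a transform of zero, to which the
  isometry applies.
\<close>

lemma has_scalar_fourier_unique:
  assumes "has_scalar_fourier f F" "has_scalar_fourier f G" shows "AE \<xi> in lebesgue. F \<xi> = G \<xi>"
proof -
  have "has_scalar_fourier (\<lambda>x. f x - f x) (\<lambda>\<xi>. F \<xi> - G \<xi>)" by (rule has_scalar_fourier_diff[OF assms])
  note z = this
  have "l2norm lebesgue (\<lambda>\<xi>. F \<xi> - G \<xi>) = 0"
    using has_scalar_fourier_isometry[OF z] by (simp add: l2norm_def)
  moreover have "square_integrable lebesgue (\<lambda>\<xi>. F \<xi> - G \<xi>)" using z by (simp add: has_scalar_fourier_def)
  ultimately show ?thesis using l2norm_eq_0_AE by fastforce
qed

lemma has_scalar_fourier_bounded_compact: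
  fixes h :: "'a::euclidean_space \<Rightarrow> complex"
  assumes h: "bounded_compact h"
  shows "has_scalar_fourier (\<lambda>x. fourier_const TYPE('a) *\<^sub>R inv_fourier_integral h x) h"
proof -
  let ?u = "\<lambda>x. fourier_const TYPE('a) *\<^sub>R inv_fourier_integral h x"
  have u: "square_integrable lborel ?u" by (intro square_integrable_scaleR parseval_inv_fourier_integral h)
  have um: "?u \<in> borel_measurable borel" using u by (simp add: square_integrable_def)
  have uml: "?u \<in> borel_measurable lebesgue" by (rule measurable_completion) (use um in simp)
  have hb: "h \<in> borel_measurable borel" using h by (rule bounded_compact_measurable)
  have e: "truncated_transform R ?u = (\<lambda>\<xi>. fourier_const TYPE('a) *\<^sub>R fourier_integral (restrict_ball R ?u) \<xi>)" for R
    using truncated_transform_eq[OF uml um, of R] by (auto simp: fun_eq_iff)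
  have s: "square_integrable lborel (truncated_transform R ?u)" for R
    unfolding e by (intro square_integrable_scaleR bessel restrict_ball_L1_L2 u)
  have "l2norm lebesgue (\<lambda>\<xi>. h \<xi> - truncated_transform R ?u \<xi>) = l2norm lborel (\<lambda>\<xi>. fourier_const TYPE('a) *\<^sub>R fourier_integral (\<lambda>x. indicator (cball 0 R) x *\<^sub>R ?u x) \<xi> - h \<xi>)" for R
  proof -
    have "l2norm lebesgue (\<lambda>\<xi>. h \<xi> - truncated_transform R ?u \<xi>) = l2norm lborel (\<lambda>\<xi>. h \<xi> - truncated_transform R ?u \<xi>)"
      using s[of R] hb by (intro l2norm_lborel_lebesgue borel_measurable_diff) (auto simp: square_integrable_def)
    also have "\<dots> = l2norm lborel (\<lambda>\<xi>. truncated_transform R ?u \<xi> - h \<xi>)" by (rule l2norm_commute)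
    finally show ?thesis unfolding e restrict_ball_def[abs_def] .
  qed
  then have "((\<lambda>R. l2norm lebesgue (\<lambda>\<xi>. h \<xi> - truncated_transform R ?u \<xi>)) \<longlongrightarrow> 0) at_top"
    using inversion[OF h] by (simp add: fourier_const_def)
  then show ?thesis
    unfolding has_scalar_fourier_def using square_integrable_lborel_lebesgue[OF u] square_integrable_lborel_lebesgue[OF bounded_compact_square_integrable[OF h]] by simp
qed

text \<open>
  The truncated transforms are contractions, uniformly in the radius; hence the relation is
  closed.
\<close>

lemma has_scalar_fourier_closed:
  assumes h: "\<And>n. has_scalar_fourier (u n) (h n)" and g: "square_integrable lebesgue g" and G: "square_integrable lebesgue G"
    and lu: "(\<lambda>n. l2norm lebesgue (\<lambda>x. u n x - g x)) \<longlonglongrightarrow> 0" and lh: "(\<lambda>n. l2norm lebesgue (\<lambda>x. h n x - G x)) \<longlonglongrightarrow> 0"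
  shows "has_scalar_fourier g G"
proof -
  have u: "square_integrable lebesgue (u n)" "square_integrable lebesgue (h n)" for n using h[of n] by (auto simp: has_scalar_fourier_def)
  have "((\<lambda>R. l2norm lebesgue (\<lambda>\<xi>. G \<xi> - truncated_transform R g \<xi>)) \<longlongrightarrow> 0) at_top"
  proof (rule tendstoI)
    fix e :: real assume e: "e > 0"
    have "\<forall>\<^sub>F n in sequentially. l2norm lebesgue (\<lambda>x. u n x - g x) < e / 3 \<and> l2norm lebesgue (\<lambda>x. h n x - G x) < e / 3"
      using order_tendstoD(2)[OF lu, of "e/3"] order_tendstoD(2)[OF lh, of "e/3"] e by (simp add: eventually_conj)
    then obtain n where n: "l2norm lebesgue (\<lambda>x. u n x - g x) < e / 3" "l2norm lebesgue (\<lambda>x. h n x - G x) < e / 3"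
      by (auto simp: eventually_sequentially)
    have l: "((\<lambda>R. l2norm lebesgue (\<lambda>\<xi>. h n \<xi> - truncated_transform R (u n) \<xi>)) \<longlongrightarrow> 0) at_top"
      using h[of n] by (simp add: has_scalar_fourier_def)
    have "\<forall>\<^sub>F R in at_top. l2norm lebesgue (\<lambda>\<xi>. h n \<xi> - truncated_transform R (u n) \<xi>) < e / 3"
      using order_tendstoD(2)[OF l, of "e/3"] e by simp
    then show "\<forall>\<^sub>F R in at_top. dist (l2norm lebesgue (\<lambda>\<xi>. G \<xi> - truncated_transform R g \<xi>)) 0 < e"
    proof eventually_elim
      case (elim R)
      have "l2norm lebesgue (\<lambda>\<xi>. G \<xi> - truncated_transform R g \<xi>) \<le> l2norm lebesgue (\<lambda>\<xi>. G \<xi> - h n \<xi>) + l2norm lebesgue (\<lambda>\<xi>. h n \<xi> - truncated_transform R g \<xi>)"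
        by (intro l2norm_triangle_diff G u truncated_transform_square_integrable_l2norm g)
      also have "l2norm lebesgue (\<lambda>\<xi>. h n \<xi> - truncated_transform R g \<xi>)
         \<le> l2norm lebesgue (\<lambda>\<xi>. h n \<xi> - truncated_transform R (u n) \<xi>) + l2norm lebesgue (\<lambda>\<xi>. truncated_transform R (u n) \<xi> - truncated_transform R g \<xi>)"
        by (intro l2norm_triangle_diff u truncated_transform_square_integrable_l2norm g)
      also have "l2norm lebesgue (\<lambda>\<xi>. truncated_transform R (u n) \<xi> - truncated_transform R g \<xi>) = l2norm lebesgue (truncated_transform R (\<lambda>x. u n x - g x))"
        using truncated_transform_diff[OF u(1)[of n] g, of R] by (intro arg_cong[of _ _ "l2norm lebesgue"]) (auto simp: fun_eq_iff)
      also have "\<dots> \<le> l2norm lebesgue (\<lambda>x. u n x - g x)"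
        by (intro truncated_transform_square_integrable_l2norm square_integrable_diff u g)
      finally have "l2norm lebesgue (\<lambda>\<xi>. G \<xi> - truncated_transform R g \<xi>) < e"
        using n elim l2norm_commute[of lebesgue G "h n"] by simp
      then show ?case by simp
    qed
  qed
  then show ?thesis using g G by (simp add: has_scalar_fourier_def)
qed

text \<open>
  Cut-offs of \<open>G\<close> are transforms by \<open>inversion\<close>. Their preimages form a
  Cauchy sequence by the isometry, and the limit has transform \<open>G\<close> because the
  relation is closed.
\<close>

lemma has_scalar_fourier_surj:
  fixes G :: "'a::euclidean_space \<Rightarrow> complex"
  assumes G: "square_integrable lebesgue G"
  shows "\<exists>g. has_scalar_fourier g G"
proof -
  obtain G' where G': "square_integrable lborel G'" and ae: "AE x in lborel. G x = G' x"
    using square_integrable_representative[OF G] by blast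
  have [measurable]: "G' \<in> borel_measurable borel" using G' by (simp add: square_integrable_def)
  have "\<forall>n. \<exists>k. l2norm lborel (\<lambda>x. cutoff k G' x - G' x) < (1/2)^(n+2)"
  proof
    fix n
    have "\<forall>\<^sub>F k in sequentially. l2norm lborel (\<lambda>x. cutoff k G' x - G' x) < (1/2)^(n+2)"
      by (rule order_tendstoD(2)[OF cutoff_tendsto[OF G']]) simp
    then show "\<exists>k. l2norm lborel (\<lambda>x. cutoff k G' x - G' x) < (1/2)^(n+2)"
      by (auto simp: eventually_sequentially)
  qed
  then obtain r where r: "\<And>n. l2norm lborel (\<lambda>x. cutoff (r n) G' x - G' x) < (1/2)^(n+2)" by metis
  define h where "h n = cutoff (r n) G'" for n
  have th: "bounded_compact (h n)" for n unfolding h_def by (rule bounded_compact_cutoff) simp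
  define u where "u n x = fourier_const TYPE('a) *\<^sub>R inv_fourier_integral (h n) x" for n x
  have hu: "has_scalar_fourier (u n) (h n)" for n unfolding u_def by (rule has_scalar_fourier_bounded_compact[OF th])
  have us: "square_integrable lborel (u n)" for n unfolding u_def by (intro square_integrable_scaleR parseval_inv_fourier_integral th)
  have um[measurable]: "u n \<in> borel_measurable borel" and hm[measurable]: "h n \<in> borel_measurable borel" for n
    using us[of n] bounded_compact_measurable[OF th] by (auto simp: square_integrable_def)
  have cau: "l2norm lborel (\<lambda>x. u (Suc n) x - u n x) \<le> (1/2)^n" for n
  proof -
    have "l2norm lborel (\<lambda>x. u (Suc n) x - u n x) = l2norm lebesgue (\<lambda>x. u (Suc n) x - u n x)"
      by (rule l2norm_lborel_lebesgue[symmetric]) measurable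
    also have "\<dots> = l2norm lebesgue (\<lambda>x. h (Suc n) x - h n x)"
      by (rule has_scalar_fourier_isometry[OF has_scalar_fourier_diff[OF hu hu]])
    also have "\<dots> = l2norm lborel (\<lambda>x. h (Suc n) x - h n x)"
      by (rule l2norm_lborel_lebesgue) measurable
    also have "\<dots> \<le> l2norm lborel (\<lambda>x. h (Suc n) x - G' x) + l2norm lborel (\<lambda>x. G' x - h n x)"
      by (intro l2norm_triangle_diff bounded_compact_square_integrable th G')
    also have "\<dots> \<le> (1/2)^(Suc n+2) + (1/2)^(n+2)"
      using r[of "Suc n"] r[of n] l2norm_commute[of lborel G' "h n"] by (simp add: h_def)
    also have "\<dots> \<le> (1/2)^n" by (simp add: power_add)
    finally show ?thesis .
  qed
  obtain g where g: "square_integrable lborel g" and lg: "(\<lambda>n. l2norm lborel (\<lambda>x. u n x - g x)) \<longlonglongrightarrow> 0"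
    using L2_complete[OF us cau] by blast
  have [measurable]: "g \<in> borel_measurable borel" using g by (simp add: square_integrable_def)
  have "has_scalar_fourier g G"
  proof (rule has_scalar_fourier_closed[OF hu square_integrable_lborel_lebesgue[OF g] G])
    have "l2norm lebesgue (\<lambda>x. u n x - g x) = l2norm lborel (\<lambda>x. u n x - g x)" for n
      by (rule l2norm_lborel_lebesgue) measurable
    then show "(\<lambda>n. l2norm lebesgue (\<lambda>x. u n x - g x)) \<longlonglongrightarrow> 0" using lg by simp
    have e: "l2norm lebesgue (\<lambda>x. h n x - G x) = l2norm lborel (\<lambda>x. h n x - G' x)" for n
    proof -
      have "l2norm lebesgue (\<lambda>x. h n x - G x) = l2norm lebesgue (\<lambda>x. h n x - G' x)"
      proof (rule l2norm_cong_AE)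
        show "AE x in lebesgue. h n x - G x = h n x - G' x" using AE_completion[OF ae] by eventually_elim simp
        have hl: "h n \<in> borel_measurable lebesgue" by (rule measurable_completion) simp
        then show "(\<lambda>x. h n x - G x) \<in> borel_measurable lebesgue" using G by (auto simp: square_integrable_def)
        have "G' \<in> borel_measurable lebesgue" by (rule measurable_completion) simp
        then show "(\<lambda>x. h n x - G' x) \<in> borel_measurable lebesgue" using hl by auto
      qed
      also have "\<dots> = l2norm lborel (\<lambda>x. h n x - G' x)" by (rule l2norm_lborel_lebesgue) measurable
      finally show ?thesis .
    qed
    show "(\<lambda>n. l2norm lebesgue (\<lambda>x. h n x - G x)) \<longlonglongrightarrow> 0"
      unfolding e
    proof (rule Lim_null_comparison)
      show "\<forall>\<^sub>F n in sequentially. norm (l2norm lborel (\<lambda>x. h n x - G' x)) \<le> (1/2)^(n+2)"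
        using r by (auto simp: h_def less_imp_le)
      show "(\<lambda>n. (1/2)^(n+2) :: real) \<longlonglongrightarrow> 0"
        by (rule LIMSEQ_ignore_initial_segment[OF LIMSEQ_realpow_zero]) auto
    qed
  qed
  then show ?thesis by blast
qed

section \<open>The Fourier transform of vector-valued functions\<close>

lemma L2_iff_square_integrable: "f \<in> L2 \<longleftrightarrow> square_integrable lebesgue f" by (simp add: L2_def square_integrable_def)

lemma L2_norm_eq: "L2_norm f = l2norm lebesgue f" by (simp add: L2_norm_def l2norm_def)

lemma norm_vec_sq: "(norm (x :: complex^'n))\<^sup>2 = (\<Sum>i\<in>UNIV. (norm (x $ i))\<^sup>2)"
  by (simp add: norm_vec_def L2_set_def sum_nonneg)

lemma borel_measurable_vec_iff:
  "f \<in> borel_measurable M \<longleftrightarrow> (\<forall>i. (\<lambda>x. f x $ i) \<in> borel_measurable M)" for f :: "'x \<Rightarrow> complex^'n"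
proof
  assume "f \<in> borel_measurable M"
  then show "\<forall>i. (\<lambda>x. f x $ i) \<in> borel_measurable M"
    by (auto intro!: measurable_compose[of f M borel] borel_measurable_continuous_onI continuous_intros)
next
  assume a: "\<forall>i. (\<lambda>x. f x $ i) \<in> borel_measurable M"
  have "f = (\<lambda>x. \<Sum>i\<in>UNIV. axis i (f x $ i))"
    by (auto simp: fun_eq_iff vec_eq_iff axis_def if_distrib cong: if_cong)
  moreover have "(\<lambda>x. axis i (f x $ i)) \<in> borel_measurable M" for i
  proof -
    have "continuous_on UNIV (\<lambda>z::complex. axis i z :: complex^'n)"
    proof -
      have "continuous_on UNIV (\<lambda>z::complex. if j = i then z else 0)" for j by (cases "j = i") simp_all
      then show ?thesis unfolding axis_def by (rule continuous_on_vec_lambda)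
    qed
    from measurable_compose[OF a[rule_format, of i] borel_measurable_continuous_onI[OF this]] show ?thesis .
  qed
  then have "(\<lambda>x. \<Sum>i\<in>UNIV. axis i (f x $ i)) \<in> borel_measurable M" by (rule borel_measurable_sum)
  ultimately show "f \<in> borel_measurable M" by simp
qed

lemma square_integrable_vec_iff: "square_integrable M f \<longleftrightarrow> (\<forall>i. square_integrable M (\<lambda>x. f x $ i))" for f :: "'x \<Rightarrow> complex^'n"
proof
  assume f: "square_integrable M f"
  then have m: "(\<lambda>x. f x $ i) \<in> borel_measurable M" for i
    using borel_measurable_vec_iff[of f M] by (auto simp: square_integrable_def)
  show "\<forall>i. square_integrable M (\<lambda>x. f x $ i)"
    using square_integrable_mono[OF f m] Finite_Cartesian_Product.norm_nth_le by blast
next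
  assume "\<forall>i. square_integrable M (\<lambda>x. f x $ i)"
  then show "square_integrable M f"
    unfolding square_integrable_def norm_vec_sq using borel_measurable_vec_iff[of f M] by auto
qed

lemma l2norm_vec:
  fixes f :: "'x \<Rightarrow> complex^'n"
  assumes "square_integrable M f"
  shows "(l2norm M f)\<^sup>2 = (\<Sum>i\<in>UNIV. (l2norm M (\<lambda>x. f x $ i))\<^sup>2)"
proof -
  have "integrable M (\<lambda>x. (norm (f x $ i))\<^sup>2)" for i using assms square_integrable_vec_iff[of M f] by (auto simp: square_integrable_def)
  then show ?thesis unfolding l2norm_sq norm_vec_sq by (simp add: Bochner_Integration.integral_sum)
qed

lemma fourier_const_3: "(2 * pi) powr (-3/2) = fourier_const TYPE(real^3)"
proof -
  have p: "(2 * pi) ^ 3 = (2 * pi) powr 3"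
    by (rule powr_numeral[symmetric]) simp
  have "sqrt ((2 * pi) ^ 3) = ((2 * pi) ^ 3) powr (1/2)"
    by (rule powr_half_sqrt[symmetric]) simp
  also have "\<dots> = ((2 * pi) powr 3) powr (1/2)" by (simp only: p)
  also have "\<dots> = (2 * pi) powr (3/2)" by (simp only: powr_powr) simp
  finally have e: "sqrt ((2 * pi) ^ 3) = (2 * pi) powr (3/2)" .
  have "(2 * pi) powr (- (3/2)) = 1 / (2 * pi) powr (3/2)" by (rule powr_minus_divide)
  then show ?thesis unfolding fourier_const_def using e by simp
qed

lemma truncated_fourier_nth:
  assumes f: "square_integrable lebesgue f"
  shows "truncated_fourier R f \<xi> $ i = truncated_transform R (\<lambda>x. f x $ i) \<xi>"
proof -
  have fi: "square_integrable lebesgue (\<lambda>x. f x $ i)" for i using f square_integrable_vec_iff[of lebesgue f] by auto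
  let ?g = "\<lambda>x. indicator (cball 0 R) x *\<^sub>R (fourier_kernel x \<xi> *s f x)"
  have gi: "integrable lebesgue (\<lambda>x. ?g x $ i)" for i
    using set_integrable_kernel[OF fi, of R \<xi> i] unfolding set_integrable_def by (simp add: vector_scaleR_component)
  have "integrable lebesgue ?g"
  proof (rule Bochner_Integration.integrable_bound)
    show "integrable lebesgue (\<lambda>x. \<Sum>i\<in>UNIV. norm (?g x $ i))"
      by (intro Bochner_Integration.integrable_sum integrable_norm gi)
    show "AE x in lebesgue. norm (?g x) \<le> norm (\<Sum>i\<in>UNIV. norm (?g x $ i))"
    proof (rule AE_I2)
      fix x
      have "norm (?g x) \<le> (\<Sum>i\<in>UNIV. norm (?g x $ i))"
        unfolding norm_vec_def by (rule L2_set_le_sum) simp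
      then show "norm (?g x) \<le> norm (\<Sum>i\<in>UNIV. norm (?g x $ i))"
        unfolding real_norm_def by linarith
    qed
    show "?g \<in> borel_measurable lebesgue"
      using gi by (subst borel_measurable_vec_iff) auto
  qed
  then have "(LINT x|lebesgue. ?g x) $ i = (LINT x|lebesgue. ?g x $ i)"
    by (rule integral_bounded_linear[OF bounded_linear_vec_nth, symmetric])
  then show ?thesis
    unfolding truncated_fourier_def truncated_transform_def set_lebesgue_integral_def fourier_const_3
    by (simp add: vector_scaleR_component)
qed

text \<open>
  Squared norms add up over components, so convergence in the mean is componentwise.
\<close>

lemma has_fourier_iff: "has_fourier f F \<longleftrightarrow> (\<forall>i. has_scalar_fourier (\<lambda>x. f x $ i) (\<lambda>\<xi>. F \<xi> $ i))"
proof (cases "square_integrable lebesgue f \<and> square_integrable lebesgue F")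
  case False
  then show ?thesis
    unfolding has_fourier_def L2_iff_square_integrable has_scalar_fourier_def square_integrable_vec_iff[of lebesgue f] square_integrable_vec_iff[of lebesgue F] by blast
next
  case True
  then have f: "square_integrable lebesgue f" and F: "square_integrable lebesgue F" by auto
  have fi: "square_integrable lebesgue (\<lambda>x. f x $ i)" "square_integrable lebesgue (\<lambda>x. F x $ i)" for i
    using f F square_integrable_vec_iff[of lebesgue f] square_integrable_vec_iff[of lebesgue F] by auto
  let ?d = "\<lambda>R \<xi>. F \<xi> - truncated_fourier R f \<xi>"
  let ?e = "\<lambda>i R. l2norm lebesgue (\<lambda>\<xi>. F \<xi> $ i - truncated_transform R (\<lambda>x. f x $ i) \<xi>)"
  have d: "square_integrable lebesgue (?d R)" for R
    unfolding square_integrable_vec_iff[of lebesgue "?d R"] vector_minus_component truncated_fourier_nth[OF f]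
    by (auto intro!: square_integrable_diff fi truncated_transform_square_integrable_l2norm)
  have eq: "(\<integral>\<^sup>+\<xi>. ennreal ((norm (?d R \<xi>))\<^sup>2) \<partial>lebesgue) = ennreal (\<Sum>i\<in>UNIV. (?e i R)\<^sup>2)" for R
    unfolding nn_integral_eq_l2norm[OF d] l2norm_vec[OF d] vector_minus_component truncated_fourier_nth[OF f] ..
  have "((\<lambda>R. \<integral>\<^sup>+\<xi>. ennreal ((norm (?d R \<xi>))\<^sup>2) \<partial>lebesgue) \<longlongrightarrow> 0) at_top
    \<longleftrightarrow> ((\<lambda>R. \<Sum>i\<in>UNIV. (?e i R)\<^sup>2) \<longlongrightarrow> 0) at_top"
    unfolding eq by (subst ennreal_0[symmetric], subst tendsto_ennreal_iff) (auto intro!: sum_nonneg always_eventually)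
  also have "\<dots> \<longleftrightarrow> (\<forall>i. (?e i \<longlongrightarrow> 0) at_top)"
  proof
    assume l: "((\<lambda>R. \<Sum>i\<in>UNIV. (?e i R)\<^sup>2) \<longlongrightarrow> 0) at_top"
    show "\<forall>i. (?e i \<longlongrightarrow> 0) at_top"
    proof
      fix i
      have "((\<lambda>R. (?e i R)\<^sup>2) \<longlongrightarrow> 0) at_top"
        by (rule Lim_null_comparison[OF _ l]) (auto intro!: always_eventually member_le_sum)
      then have "((\<lambda>R. sqrt ((?e i R)\<^sup>2)) \<longlongrightarrow> sqrt 0) at_top" by (rule tendsto_real_sqrt)
      then show "(?e i \<longlongrightarrow> 0) at_top" by simp
    qed
  next
    assume "\<forall>i. (?e i \<longlongrightarrow> 0) at_top"
    then have "((\<lambda>R. \<Sum>i\<in>UNIV. (?e i R)\<^sup>2) \<longlongrightarrow> (\<Sum>i\<in>(UNIV::4 set). 0\<^sup>2)) at_top"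
      by (intro tendsto_intros) auto
    then show "((\<lambda>R. \<Sum>i\<in>UNIV. (?e i R)\<^sup>2) \<longlongrightarrow> 0) at_top" by simp
  qed
  finally show ?thesis unfolding has_fourier_def L2_iff_square_integrable has_scalar_fourier_def using f F fi by simp
qed

lemma has_fourier_square_integrable: "has_fourier f F \<Longrightarrow> square_integrable lebesgue f" "has_fourier f F \<Longrightarrow> square_integrable lebesgue F"
  by (auto simp: has_fourier_def L2_iff_square_integrable)

lemma has_fourier_isometry: assumes "has_fourier f F" shows "l2norm lebesgue f = l2norm lebesgue F"
proof -
  have "(l2norm lebesgue f)\<^sup>2 = (l2norm lebesgue F)\<^sup>2"
    using assms has_scalar_fourier_isometry unfolding has_fourier_iff l2norm_vec[OF has_fourier_square_integrable(1)[OF assms]] l2norm_vec[OF has_fourier_square_integrable(2)[OF assms]]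
    by (metis (no_types, lifting))
  then show ?thesis by simp
qed

lemma has_fourier_diff: "has_fourier f F \<Longrightarrow> has_fourier g G \<Longrightarrow> has_fourier (\<lambda>x. f x - g x) (\<lambda>x. F x - G x)"
  unfolding has_fourier_iff using has_scalar_fourier_diff by (simp add: has_scalar_fourier_diff)

lemma has_fourier_unique: assumes "has_fourier f F" "has_fourier f G" shows "AE \<xi> in lebesgue. F \<xi> = G \<xi>"
proof -
  have "AE \<xi> in lebesgue. \<forall>i\<in>UNIV. F \<xi> $ i = G \<xi> $ i"
    using assms unfolding has_fourier_iff by (intro AE_finite_allI) (auto intro: has_scalar_fourier_unique)
  then show ?thesis by (simp add: vec_eq_iff)
qed

lemma has_fourier_surj: assumes "square_integrable lebesgue G" shows "\<exists>g. has_fourier g G"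
proof -
  have "\<forall>i. \<exists>g. has_scalar_fourier g (\<lambda>\<xi>. G \<xi> $ i)" using assms square_integrable_vec_iff[of lebesgue G] has_scalar_fourier_surj by blast
  then obtain g where "\<And>i. has_scalar_fourier (g i) (\<lambda>\<xi>. G \<xi> $ i)" by metis
  then have "has_fourier (\<lambda>x. \<chi> i. g i x) G" unfolding has_fourier_iff by simp
  then show ?thesis by blast
qed

section \<open>Fourier transforms of radial functions on three-space\<close>

lemma lborel_distr_orthogonal:
  fixes T :: "real^'n::{finite,wellorder} \<Rightarrow> real^'n::{finite,wellorder}"
  assumes T: "orthogonal_transformation T"
  shows "distr lborel borel T = lborel"
proof (rule lborel_eqI[symmetric])
  have lin: "linear T" and bij: "bij T"
    using T orthogonal_transformation_bij by (auto simp: orthogonal_transformation_linear)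
  have [measurable]: "T \<in> borel \<rightarrow>\<^sub>M borel"
    by (intro borel_measurable_continuous_onI linear_continuous_on linear_conv_bounded_linear[THEN iffD1] lin)
  have i: "orthogonal_transformation (inv T)" by (rule orthogonal_transformation_inv[OF T])
  fix l u :: "real^'n::{finite,wellorder}" assume le: "\<And>b. b \<in> Basis \<Longrightarrow> l \<bullet> b \<le> u \<bullet> b"
  have vim: "T -` box l u = inv T ` box l u" using bij by (simp add: bij_vimage_eq_inv_image)
  have bm: "box l u \<in> lmeasurable" by simp
  have im: "inv T ` box l u \<in> lmeasurable" by (rule measurable_orthogonal_image[OF i bm])
  have vs: "T -` box l u \<in> sets borel" using measurable_sets[of T borel borel "box l u"] by simp
  have "emeasure (distr lborel borel T) (box l u) = emeasure lborel (T -` box l u)"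
    by (subst emeasure_distr) auto
  also have "\<dots> = emeasure lebesgue (T -` box l u)" using vs by (simp add: emeasure_completion)
  also have "\<dots> = ennreal (measure lebesgue (inv T ` box l u))"
    unfolding vim using im by (intro emeasure_eq_measure2) (simp add: fmeasurableD)
  also have "measure lebesgue (inv T ` box l u) = measure lebesgue (box l u)"
    by (rule measure_orthogonal_image[OF i bm])
  also have "\<dots> = prod ((\<bullet>) (u - l)) Basis" using le by (simp add: measure_lborel_box_eq)
  finally show "emeasure (distr lborel borel T) (box l u) = ennreal (prod ((\<bullet>) (u - l)) Basis)" .
qed simp

lemma emeasure_box_cart:
  fixes l u :: "real^'n"
  assumes "\<And>i. l $ i \<le> u $ i"
  shows "emeasure lborel (box l u) = ennreal (\<Prod>i\<in>UNIV. u $ i - l $ i)"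
proof -
  have "(\<Prod>b\<in>Basis. (u - l) \<bullet> b) = (\<Prod>i\<in>UNIV. u $ i - l $ i)"
  proof -
    have B: "Basis = range (\<lambda>i. axis i (1::real) :: real^'n)" by (auto simp: Basis_vec_def)
    have inj: "inj (\<lambda>i. axis i (1::real) :: real^'n)" by (auto simp: inj_def axis_eq_axis)
    have "prod ((\<bullet>) (u - l)) (range (\<lambda>i. axis i 1)) = prod ((\<bullet>) (u - l) \<circ> (\<lambda>i. axis i 1)) UNIV"
      by (rule prod.reindex[OF inj])
    then have "(\<Prod>b\<in>Basis. (u - l) \<bullet> b) = (\<Prod>i\<in>UNIV. (u - l) \<bullet> axis i 1)"
      unfolding B o_def .
    then show ?thesis by (simp add: inner_axis)
  qed
  moreover have "l \<bullet> b \<le> u \<bullet> b" if "b \<in> Basis" for b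
    using that assms by (auto simp: Basis_vec_def inner_axis)
  ultimately show ?thesis by (subst emeasure_lborel_box) auto
qed

text \<open>
  Splits three-space into an axis and the orthogonal plane.
\<close>

definition join3 :: "real \<times> (real^2) \<Rightarrow> real^3" where
  "join3 q = vector [fst q, snd q $ 1, snd q $ 2]"

lemma join3_nth: "join3 q $ 1 = fst q" "join3 q $ 2 = snd q $ 1" "join3 q $ 3 = snd q $ 2"
  by (simp_all add: join3_def)

lemma norm_join3: "(norm (join3 q))\<^sup>2 = (fst q)\<^sup>2 + (norm (snd q))\<^sup>2"
  by (simp add: norm_vec_def L2_set_def sum_nonneg sum_3 sum_2 join3_nth)

lemma measurable_join3[measurable]: "join3 \<in> borel \<rightarrow>\<^sub>M borel"
proof -
  have "continuous_on UNIV (\<lambda>q. join3 q $ i)" for i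
    using exhaust_3[of i] by (elim disjE; simp add: join3_nth; intro continuous_intros)
  then have "continuous_on UNIV (\<lambda>q. \<chi> i. join3 q $ i)" by (rule continuous_on_vec_lambda)
  then show ?thesis by (intro borel_measurable_continuous_onI) simp
qed

lemma lborel_distr_join3: "distr lborel borel join3 = lborel"
proof (rule lborel_eqI[symmetric])
  fix l u :: "real^3" assume le: "\<And>b. b \<in> Basis \<Longrightarrow> l \<bullet> b \<le> u \<bullet> b"
  have le': "l $ i \<le> u $ i" for i
    using le[of "axis i 1"] by (simp add: inner_axis axis_in_Basis_iff)
  let ?B = "box (vector [l $ 2, l $ 3]) (vector [u $ 2, u $ 3]) :: (real^2) set"
  have vim: "join3 -` box l u = {l $ 1 <..< u $ 1} \<times> ?B"
    by (auto simp: mem_box_cart forall_3 forall_2 join3_nth)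
  have "emeasure (distr lborel borel join3) (box l u) = emeasure lborel ({l $ 1 <..< u $ 1} \<times> ?B)"
    by (subst emeasure_distr) (auto simp: vim)
  also have "\<dots> = emeasure (lborel \<Otimes>\<^sub>M lborel) ({l $ 1 <..< u $ 1} \<times> ?B)" by (simp add: lborel_prod)
  also have "\<dots> = emeasure lborel {l $ 1 <..< u $ 1} * emeasure lborel ?B"
    by (rule lborel.emeasure_pair_measure_Times) auto
  also have "emeasure lborel ?B = ennreal ((u $ 2 - l $ 2) * (u $ 3 - l $ 3))"
  proof -
    have "\<forall>i. (vector [l $ 2, l $ 3] :: real^2) $ i \<le> (vector [u $ 2, u $ 3] :: real^2) $ i"
      by (simp add: forall_2 le')
    then show ?thesis by (subst emeasure_box_cart) (auto simp: UNIV_2)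
  qed
  also have "emeasure lborel {l $ 1 <..< u $ 1} = ennreal (u $ 1 - l $ 1)"
    by (rule emeasure_lborel_Ioo[OF le'])
  also have "ennreal (u $ 1 - l $ 1) * ennreal ((u $ 2 - l $ 2) * (u $ 3 - l $ 3)) = ennreal ((u $ 1 - l $ 1) * ((u $ 2 - l $ 2) * (u $ 3 - l $ 3)))"
    by (rule ennreal_mult[symmetric]) (simp_all add: le')
  also have "(u $ 1 - l $ 1) * ((u $ 2 - l $ 2) * (u $ 3 - l $ 3)) = (\<Prod>i\<in>UNIV. u $ i - l $ i)"
    unfolding UNIV_3 by (simp add: ac_simps)
  also have "ennreal (\<Prod>i\<in>UNIV. u $ i - l $ i) = emeasure lborel (box l u)" by (rule emeasure_box_cart[symmetric]) (rule le')
  also have "\<dots> = ennreal (prod ((\<bullet>) (u - l)) Basis)" using le by (subst emeasure_lborel_box) auto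
  finally show "emeasure (distr lborel borel join3) (box l u) = ennreal (prod ((\<bullet>) (u - l)) Basis)" .
qed simp

text \<open>
  A disc of squared radius \<open>r\<close> has area \<open>pi * r\<close>. The sign is chosen
  because measures on the line are compared here on the half-lines \<open>{x<..}\<close>, which
  must have finite measure.
\<close>

lemma distr_norm_sq_plane:
  "distr lborel borel (\<lambda>p::real^2. - (norm p)\<^sup>2) = density lborel (\<lambda>y. ennreal (pi * indicator {..0} y))"
proof (rule measure_eqI_lessThan)
  fix x :: real
  have "emeasure (distr lborel borel (\<lambda>p::real^2. - (norm p)\<^sup>2)) {x<..} = emeasure lborel (ball (0::real^2) (sqrt (max 0 (- x))))"
  proof -
    have "(\<lambda>p::real^2. - (norm p)\<^sup>2) -` {x<..} = ball 0 (sqrt (max 0 (- x)))"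
    proof (cases "x < 0")
      case True
      have "(- (norm p)\<^sup>2 > x) = (norm p < sqrt (- x))" for p :: "real^2"
        using real_less_rsqrt[of "norm p" "- x"] real_sqrt_less_iff[of "(norm p)\<^sup>2" "- x"] by auto
      then show ?thesis using True by auto
    next
      case False
      have "\<not> x < - (norm p)\<^sup>2" for p :: "real^2" using False by (simp add: not_less) (metis neg_le_0_iff_le order_trans zero_le_power2)
      then show ?thesis using False by auto
    qed
    then show ?thesis by (subst emeasure_distr) auto
  qed
  also have "\<dots> = ennreal (pi * max 0 (- x))"
    by (subst emeasure_ball) (auto simp: unit_ball_vol_2)
  finally have 1: "emeasure (distr lborel borel (\<lambda>p::real^2. - (norm p)\<^sup>2)) {x<..} = ennreal (pi * max 0 (- x))" .
  have "emeasure (density lborel (\<lambda>y. ennreal (pi * indicator {..0} y))) {x<..} = (\<integral>\<^sup>+y. ennreal pi * indicator {x<..0} y \<partial>lborel)"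
    by (subst emeasure_density) (auto intro!: nn_integral_cong split: split_indicator)
  also have "\<dots> = ennreal (pi * max 0 (- x))"
    by (cases "x \<le> 0") (simp_all add: nn_integral_cmult_indicator ennreal_mult[symmetric] max_def)
  finally have 2: "emeasure (density lborel (\<lambda>y. ennreal (pi * indicator {..0} y))) {x<..} = ennreal (pi * max 0 (- x))" .
  show "emeasure (distr lborel borel (\<lambda>p::real^2. - (norm p)\<^sup>2)) {x<..} < \<infinity>" unfolding 1 by simp
  show "emeasure (distr lborel borel (\<lambda>p::real^2. - (norm p)\<^sup>2)) {x<..} = emeasure (density lborel (\<lambda>y. ennreal (pi * indicator {..0} y))) {x<..}"
    unfolding 1 2 ..
qed simp_all

lemma plane_radial_integral:
  fixes k :: "real \<Rightarrow> complex"
  assumes [measurable]: "k \<in> borel_measurable borel"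
  shows "(LINT p|lborel. k (a + (norm (p::real^2))\<^sup>2)) = pi *\<^sub>R (LINT r|lborel. indicator {a..} r *\<^sub>R k r)"
proof -
  have "(LINT p|lborel. k (a + (norm (p::real^2))\<^sup>2)) = (LINT y|distr lborel borel (\<lambda>p::real^2. - (norm p)\<^sup>2). k (a - y))"
    by (subst integral_distr) auto
  also have "\<dots> = (LINT y|lborel. (pi * indicator {..0} y) *\<^sub>R k (a - y))"
    unfolding distr_norm_sq_plane by (subst integral_density) auto
  also have "\<dots> = (LINT r|lborel. (pi * indicator {..0} (a + (-1) * r)) *\<^sub>R k (a - (a + (-1) * r)))"
    by (subst lborel_integral_real_affine[where c = "-1" and t = a]) auto
  also have "\<dots> = (LINT r|lborel. pi *\<^sub>R (indicator {a..} r *\<^sub>R k r))"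
    by (intro Bochner_Integration.integral_cong) (auto split: split_indicator)
  also have "\<dots> = pi *\<^sub>R (LINT r|lborel. indicator {a..} r *\<^sub>R k r)" by (rule integral_scaleR_right)
  finally show ?thesis .
qed

text \<open>
  Integrate explicitly; the bound is uniform in the length of the interval.
\<close>

lemma interval_exponential_bound:
  assumes b: "b > 0"
  shows "norm (LINT s|lborel. indicator {s. s\<^sup>2 \<le> r} s *\<^sub>R exp (- \<i> * complex_of_real (b * s))) \<le> 2 / b"
proof (cases "r < 0")
  case True
  then have "{s. s\<^sup>2 \<le> r} = {}" by (auto simp: not_le intro: less_le_trans)
  then show ?thesis using b by simp
next
  case False
  then have S: "{s. s\<^sup>2 \<le> r} = {- sqrt r .. sqrt r}"
  proof -
    have e: "s\<^sup>2 \<le> r \<longleftrightarrow> \<bar>s\<bar> \<le> sqrt r" for s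
      using abs_le_square_iff[of s "sqrt r"] False by simp
    have "s \<in> {s. s\<^sup>2 \<le> r} \<longleftrightarrow> s \<in> {- sqrt r .. sqrt r}" for s
      unfolding mem_Collect_eq e atLeastAtMost_iff by linarith
    then show ?thesis by blast
  qed
  let ?F = "\<lambda>s. exp (- \<i> * complex_of_real (b * s)) / (- \<i> * complex_of_real b)"
  have i: "(LINT s|lborel. indicator {- sqrt r .. sqrt r} s *\<^sub>R exp (- \<i> * complex_of_real (b * s))) = ?F (sqrt r) - ?F (- sqrt r)"
  proof (rule integral_FTC_atLeastAtMost)
    show "- sqrt r \<le> sqrt r" using False by simp
    show "(?F has_vector_derivative exp (- \<i> * complex_of_real (b * s))) (at s within {- sqrt r .. sqrt r})" for s
    proof -
      let ?G = "\<lambda>z. exp (- \<i> * complex_of_real b * z) / (- \<i> * complex_of_real b)"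
      have c: "- \<i> * complex_of_real b \<noteq> 0" using b by simp
      have "((\<lambda>z. - \<i> * complex_of_real b * z) has_field_derivative - \<i> * complex_of_real b) (at (complex_of_real s))"
        by (rule DERIV_cmult_Id)
      from DERIV_cdivide[OF DERIV_fun_exp[OF this], of "- \<i> * complex_of_real b"]
      have "(?G has_field_derivative exp (- \<i> * complex_of_real b * complex_of_real s)) (at (complex_of_real s))"
        unfolding nonzero_mult_div_cancel_right[OF c] .
      from has_vector_derivative_real_field[OF this, of "{- sqrt r .. sqrt r}"]
      show ?thesis by (simp only: mult.assoc of_real_mult)
    qed
    show "continuous_on {- sqrt r..sqrt r} (\<lambda>s. exp (- \<i> * complex_of_real (b * s)))"
      by (intro continuous_intros)
  qed
  have n: "norm (?F s) = 1 / b" for s using b by (simp add: norm_divide norm_mult)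
  have "norm (?F (sqrt r) - ?F (- sqrt r)) \<le> 1 / b + 1 / b"
    using norm_triangle_ineq4[of "?F (sqrt r)" "?F (- sqrt r)"] unfolding n .
  also have "1 / b + 1 / b = 2 / b" by simp
  finally have "norm (?F (sqrt r) - ?F (- sqrt r)) \<le> 2 / b" .
  then show ?thesis unfolding S i .
qed

text \<open>
  Rotate \<open>z\<close> to the first axis and integrate over the orthogonal plane: with
  \<open>s\<close> the first coordinate this replaces \<open>k\<close> by \<open>pi\<close> times
  its integral over \<open>{s\<^sup>2..}\<close>. Exchanging the two remaining integrals leaves
  the exponential over the interval \<open>s\<^sup>2 \<le> r\<close>, which
  \<open>interval_exponential_bound\<close> controls. In dimension three the result is the
  Newtonian kernel times the \<open>L\<^sup>1\<close> norm of the profile in the variable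
  \<open>|\<xi>|\<^sup>2\<close>.
\<close>

lemma radial_fourier_bound:
  fixes k :: "real \<Rightarrow> complex" and z :: "real^3"
  assumes k[measurable]: "k \<in> borel_measurable borel" and M: "\<And>r. norm (k r) \<le> M" and R: "\<And>r. R < r \<Longrightarrow> k r = 0" and z: "z \<noteq> 0"
  shows "norm (LINT \<xi>|lborel. fourier_kernel z \<xi> * k ((norm \<xi>)\<^sup>2))
    \<le> 2 * pi / norm z * (LINT r|lborel. indicator {0..} r * norm (k r))"
proof -
  define b where "b = norm z"
  have b: "b > 0" using z by (simp add: b_def)
  have M0: "0 \<le> M" using order_trans[OF norm_ge_zero M] .
  obtain T :: "real^3 \<Rightarrow> real^3" where T: "orthogonal_transformation T" "T (axis 1 b) = z"
  proof -
    have "norm (axis 1 b :: real^3) = b"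
      using b by (simp add: norm_eq_sqrt_inner inner_axis_axis)
    then have "norm (axis 1 b :: real^3) = norm z" by (simp only: b_def)
    then obtain f :: "real^3 \<Rightarrow> real^3" where "orthogonal_transformation f" "f (axis 1 b) = z"
      by (rule orthogonal_transformation_exists)
    then show thesis by (rule that)
  qed
  have lin: "linear T" using T(1) by (rule orthogonal_transformation_linear)
  have Tm[measurable]: "T \<in> borel \<rightarrow>\<^sub>M borel"
    by (intro borel_measurable_continuous_onI linear_continuous_on linear_conv_bounded_linear[THEN iffD1] lin)
  let ?e = "\<lambda>s. exp (- \<i> * complex_of_real (b * s))"
  have "(LINT \<xi>|lborel. fourier_kernel z \<xi> * k ((norm \<xi>)\<^sup>2))
    = (LINT \<xi>|distr lborel borel T. fourier_kernel z \<xi> * k ((norm \<xi>)\<^sup>2))"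
    unfolding lborel_distr_orthogonal[OF T(1)] ..
  also have "\<dots> = (LINT \<xi>|lborel. fourier_kernel z (T \<xi>) * k ((norm (T \<xi>))\<^sup>2))"
    by (subst integral_distr) auto
  also have "\<dots> = (LINT \<xi>|lborel. ?e (\<xi> $ 1) * k ((norm (\<xi>::real^3))\<^sup>2))"
  proof -
    have "z \<bullet> T \<xi> = b * \<xi> $ 1" for \<xi>
    proof -
      have "z \<bullet> T \<xi> = T (axis 1 b) \<bullet> T \<xi>" by (simp only: T(2))
      also have "\<dots> = axis 1 b \<bullet> \<xi>" using T(1) by (simp add: orthogonal_transformation_def)
      finally show ?thesis by (simp add: inner_axis')
    qed
    then show ?thesis using orthogonal_transformation_norm[OF T(1)] by simp
  qed
  also have "\<dots> = (LINT \<xi>|distr lborel borel join3. ?e (\<xi> $ 1) * k ((norm (\<xi>::real^3))\<^sup>2))"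
    unfolding lborel_distr_join3 ..
  also have "\<dots> = (LINT q|lborel. ?e (fst q) * k ((fst q)\<^sup>2 + (norm (snd q :: real^2))\<^sup>2))"
    by (subst integral_distr) (auto simp: join3_nth norm_join3)
  also have "\<dots> = (LINT s|lborel. LINT p|lborel. ?e s * k (s\<^sup>2 + (norm (p::real^2))\<^sup>2))"
  proof -
    define F where "F = (\<lambda>q::real \<times> (real^2). ?e (fst q) * k ((fst q)\<^sup>2 + (norm (snd q))\<^sup>2))"
    have "integrable lborel F"
    proof (rule integrable_bounded_support(1)[where M = M and R = "sqrt (max 0 R)"])
      show "F \<in> borel_measurable borel" unfolding F_def borel_prod[symmetric] by measurable
      show "norm (F q) \<le> M" for q using M by (simp add: F_def norm_mult)
      show "F q = 0" if "sqrt (max 0 R) < norm q" for q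
      proof -
        have "max 0 R < (norm q)\<^sup>2" using that real_sqrt_less_iff[of "max 0 R" "(norm q)\<^sup>2"] by simp
        also have "(norm q)\<^sup>2 = (fst q)\<^sup>2 + (norm (snd q))\<^sup>2" by (simp add: norm_prod_def)
        finally show ?thesis by (simp add: F_def R)
      qed
    qed
    from Fubini_lborel(2)[OF this] show ?thesis by (simp add: F_def)
  qed
  also have "\<dots> = (LINT s|lborel. ?e s * (pi *\<^sub>R (LINT r|lborel. indicator {s\<^sup>2..} r *\<^sub>R k r)))"
    by (simp add: plane_radial_integral)
  also have "\<dots> = (LINT s|lborel. LINT r|lborel. pi *\<^sub>R (?e s * (indicator {s\<^sup>2..} r *\<^sub>R k r)))"
  proof (intro Bochner_Integration.integral_cong refl)
    fix s :: real
    let ?X = "\<lambda>r. indicator {s\<^sup>2..} r *\<^sub>R k r"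
    have "(LINT r|lborel. pi *\<^sub>R (?e s * ?X r)) = pi *\<^sub>R (LINT r|lborel. ?e s * ?X r)" by (rule integral_scaleR_right)
    also have "(LINT r|lborel. ?e s * ?X r) = ?e s * (LINT r|lborel. ?X r)" by (rule integral_mult_right_zero)
    finally show "?e s * (pi *\<^sub>R (LINT r|lborel. ?X r)) = (LINT r|lborel. pi *\<^sub>R (?e s * ?X r))"
      by (simp only: mult_scaleR_right)
  qed
  also have "\<dots> = (LINT r|lborel. LINT s|lborel. pi *\<^sub>R (?e s * (indicator {s\<^sup>2..} r *\<^sub>R k r)))"
  proof -
    define F where "F = (\<lambda>q::real \<times> real. pi *\<^sub>R (?e (fst q) * (indicator {q. (fst q)\<^sup>2 \<le> snd q} q *\<^sub>R k (snd q))))"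
    have "integrable lborel F"
    proof (rule integrable_bounded_support(1)[where M = "pi * M" and R = "sqrt (max 0 R) + \<bar>R\<bar>"])
      have "{q \<in> space (borel \<Otimes>\<^sub>M borel). (fst q)\<^sup>2 \<le> (snd q :: real)} \<in> sets (borel \<Otimes>\<^sub>M borel)" by measurable
      then have [measurable]: "{q::real \<times> real. (fst q)\<^sup>2 \<le> snd q} \<in> sets (borel \<Otimes>\<^sub>M borel)" by (simp add: space_pair_measure)
      show "F \<in> borel_measurable borel" unfolding F_def borel_prod[symmetric] by measurable
      show "norm (F q) \<le> pi * M" for q using M M0 by (auto simp: F_def norm_mult indicator_def mult_left_mono)
      show "F q = 0" if "sqrt (max 0 R) + \<bar>R\<bar> < norm q" for q
      proof (rule ccontr)
        assume "F q \<noteq> 0"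
        then have a: "(fst q)\<^sup>2 \<le> snd q" "snd q \<le> R" using R[of "snd q"] by (auto simp: F_def indicator_def split: if_splits) (meson not_le)
        then have "0 \<le> snd q" "(fst q)\<^sup>2 \<le> max 0 R" using order_trans[OF zero_le_power2 a(1)] by auto
        then have "\<bar>snd q\<bar> \<le> \<bar>R\<bar>" "\<bar>fst q\<bar> \<le> sqrt (max 0 R)" using a real_sqrt_le_mono[of "(fst q)\<^sup>2" "max 0 R"] by auto
        moreover have "norm q \<le> \<bar>fst q\<bar> + \<bar>snd q\<bar>" using norm_Pair_le[of "fst q" "snd q"] by simp
        ultimately show False using that by linarith
      qed
    qed
    from Fubini_lborel(1)[OF this] show ?thesis by (simp add: F_def indicator_def)
  qed
  also have "\<dots> = (LINT r|lborel. (pi *\<^sub>R k r) * (LINT s|lborel. indicator {s. s\<^sup>2 \<le> r} s *\<^sub>R ?e s))"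
  proof (intro Bochner_Integration.integral_cong refl)
    fix r
    have "(LINT s|lborel. pi *\<^sub>R (?e s * (indicator {s\<^sup>2..} r *\<^sub>R k r))) = (LINT s|lborel. (pi *\<^sub>R k r) * (indicator {s. s\<^sup>2 \<le> r} s *\<^sub>R ?e s))"
      by (intro Bochner_Integration.integral_cong) (auto simp: indicator_def)
    then show "(LINT s|lborel. pi *\<^sub>R (?e s * (indicator {s\<^sup>2..} r *\<^sub>R k r))) = (pi *\<^sub>R k r) * (LINT s|lborel. indicator {s. s\<^sup>2 \<le> r} s *\<^sub>R ?e s)"
      by (simp only: integral_mult_right_zero)
  qed
  finally have eq: "(LINT \<xi>|lborel. fourier_kernel z \<xi> * k ((norm \<xi>)\<^sup>2))
     = (LINT r|lborel. (pi *\<^sub>R k r) * (LINT s|lborel. indicator {s. s\<^sup>2 \<le> r} s *\<^sub>R ?e s))" .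
  have ki: "integrable lborel (\<lambda>r. indicator {0..} r * norm (k r))"
  proof (rule integrable_bounded_support(1)[where M = M and R = "\<bar>R\<bar>"])
    show "norm (indicator {0..} r * norm (k r)) \<le> M" for r using M[of r] M0 by (auto simp: indicator_def)
    show "indicator {0..} r * norm (k r) = 0" if "\<bar>R\<bar> < norm r" for r
      using that R[of r] by (auto simp: indicator_def)
  qed measurable
  have "norm (LINT r|lborel. (pi *\<^sub>R k r) * (LINT s|lborel. indicator {s. s\<^sup>2 \<le> r} s *\<^sub>R ?e s))
     \<le> (LINT r|lborel. 2 * pi / b * (indicator {0..} r * norm (k r)))"
  proof (rule order_trans[OF integral_norm_bound integral_mono'])
    show "integrable lborel (\<lambda>r. 2 * pi / b * (indicator {0..} r * norm (k r)))" by (intro integrable_mult_right ki)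
    fix r
    show "norm ((pi *\<^sub>R k r) * (LINT s|lborel. indicator {s. s\<^sup>2 \<le> r} s *\<^sub>R ?e s)) \<le> 2 * pi / b * (indicator {0..} r * norm (k r))"
    proof (cases "r < 0")
      case True
      then have "{s. s\<^sup>2 \<le> r} = {}" by (auto simp: not_le intro: less_le_trans)
      then show ?thesis using True by simp
    next
      case False
      have "norm ((pi *\<^sub>R k r) * (LINT s|lborel. indicator {s. s\<^sup>2 \<le> r} s *\<^sub>R ?e s)) \<le> (pi * norm (k r)) * (2 / b)"
        using interval_exponential_bound[OF b, of r] by (simp only: norm_mult norm_scaleR) (intro mult_mono, auto)
      then show ?thesis using False by (simp add: mult_ac)
    qed
    show "0 \<le> 2 * pi / b * (indicator {0..} r * norm (k r))" using b by simp
  qed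
  also have "\<dots> = 2 * pi / b * (LINT r|lborel. indicator {0..} r * norm (k r))" by (rule integral_mult_right_zero)
  finally show ?thesis unfolding eq b_def .
qed

section \<open>The dual estimate on the mass shell\<close>

text \<open>
  Substitute \<open>r = \<tau>\<^sup>2 - m\<^sup>2\<close>: the factor
  \<open>1 / sqrt (r + m\<^sup>2)\<close> cancels the Jacobian up to a factor 2.
\<close>

lemma nn_integral_mass_shell:
  fixes f :: "real \<Rightarrow> real" and m :: real
  assumes m: "m > 0" and f[measurable]: "f \<in> borel_measurable borel" and f0: "\<And>x. 0 \<le> f x"
  shows "(\<integral>\<^sup>+r. ennreal (indicator {0..R} r * (f (sqrt (r + m\<^sup>2)) / sqrt (r + m\<^sup>2))) \<partial>lborel)
    \<le> 2 * (\<integral>\<^sup>+\<tau>. ennreal (f \<tau>) \<partial>lborel)"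
proof (cases "0 \<le> R")
  case True
  let ?b = "sqrt (R + m\<^sup>2)"
  define F where "F r = f (sqrt (r + m\<^sup>2)) / sqrt (r + m\<^sup>2)" for r
  have [measurable]: "F \<in> borel_measurable borel" unfolding F_def by measurable
  have mb: "m \<le> ?b" using True m by (intro real_le_rsqrt) simp
  have g: "m\<^sup>2 - m\<^sup>2 = 0" "?b\<^sup>2 - m\<^sup>2 = R" using True by auto
  have "(\<integral>\<^sup>+r. ennreal (F r * indicator {m\<^sup>2 - m\<^sup>2 .. ?b\<^sup>2 - m\<^sup>2} r) \<partial>lborel)
     = (\<integral>\<^sup>+\<tau>. ennreal (F (\<tau>\<^sup>2 - m\<^sup>2) * (2 * \<tau>) * indicator {m..?b} \<tau>) \<partial>lborel)"
  proof (rule nn_integral_substitution[where g = "\<lambda>\<tau>. \<tau>\<^sup>2 - m\<^sup>2" and g' = "\<lambda>\<tau>. 2 * \<tau>"])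
    show "set_borel_measurable borel {m\<^sup>2 - m\<^sup>2 .. ?b\<^sup>2 - m\<^sup>2} F" unfolding set_borel_measurable_def by measurable
    show "((\<lambda>\<tau>. \<tau>\<^sup>2 - m\<^sup>2) has_real_derivative 2 * \<tau>) (at \<tau>)" for \<tau> :: real
      by (auto intro!: derivative_eq_intros)
    show "continuous_on {m..?b} (\<lambda>\<tau>. 2 * \<tau>)" by (intro continuous_intros)
    show "0 \<le> 2 * \<tau>" if "\<tau> \<in> {m..?b}" for \<tau> using that m by simp
    show "m \<le> ?b" by (rule mb)
  qed
  also have "\<dots> \<le> (\<integral>\<^sup>+\<tau>. ennreal (2 * f \<tau>) \<partial>lborel)"
  proof (intro nn_integral_mono ennreal_leI)
    fix \<tau> :: real
    show "F (\<tau>\<^sup>2 - m\<^sup>2) * (2 * \<tau>) * indicator {m..?b} \<tau> \<le> 2 * f \<tau>"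
      using m f0[of \<tau>] by (auto simp: F_def indicator_def)
  qed
  also have "\<dots> = 2 * (\<integral>\<^sup>+\<tau>. ennreal (f \<tau>) \<partial>lborel)"
    by (simp add: ennreal_mult f0 nn_integral_cmult)
  finally show ?thesis unfolding g F_def by (simp add: mult.commute)
qed simp

definition dirac_energy :: "real \<Rightarrow> real^3 \<Rightarrow> real" where
  "dirac_energy m \<xi> = sqrt ((norm \<xi>)\<^sup>2 + m\<^sup>2)"

lemma dirac_energy_measurable[measurable]: "dirac_energy m \<in> borel_measurable borel"
  unfolding dirac_energy_def by measurable

lemma dirac_energy_pos: "0 < m \<Longrightarrow> 0 < dirac_energy m \<xi>"
  by (simp add: dirac_energy_def add_nonneg_pos)

abbreviation wave_energy :: "(real^3) measure \<Rightarrow> real \<Rightarrow> (real^3 \<Rightarrow> 'b::real_normed_vector) \<Rightarrow> ennreal" where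
  "wave_energy M m h \<equiv> \<integral>\<^sup>+\<xi>. ennreal (dirac_energy m \<xi> * (norm (h \<xi>))\<^sup>2) \<partial>M"

text \<open>
  A weight whose Newtonian energy form is dominated by its \<open>L\<^sup>2\<close> form with
  constant \<open>B\<close>. Boundedness and bounded support make all integrals absolutely
  convergent; the estimates depend on \<open>B\<close> alone.
\<close>

locale weighted_kernel =
  fixes m B r C :: real and W :: "real^3 \<Rightarrow> real"
  assumes m: "0 < m" and B: "0 < B" and W[measurable]: "W \<in> borel_measurable borel" and W0: "\<And>x. 0 \<le> W x"
    and WC: "\<And>x. W x \<le> C" and Wr: "\<And>x. r < norm x \<Longrightarrow> W x = 0"
    and energy: "\<And>\<psi> b. \<lbrakk>\<psi> \<in> borel_measurable borel; \<And>x. 0 \<le> \<psi> x; \<And>x. \<psi> x \<le> b\<rbrakk> \<Longrightarrow>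
      (\<integral>\<^sup>+x. \<integral>\<^sup>+y. ennreal (\<psi> x * W x) * ennreal (\<psi> y * W y) * newton_kernel x y \<partial>lborel \<partial>lborel)
      \<le> ennreal B * (\<integral>\<^sup>+x. ennreal ((\<psi> x)\<^sup>2 * W x) \<partial>lborel)"
begin

abbreviation "lam \<equiv> dirac_energy m"

lemma lam_pos: "0 < lam \<xi>" by (rule dirac_energy_pos[OF m])

context
  fixes G :: "real \<Rightarrow> real^3 \<Rightarrow> complex" and M T :: real
  assumes G: "(\<lambda>q. G (fst q) (snd q)) \<in> borel_measurable borel" and GM: "\<And>t x. norm (G t x) \<le> M"
    and GT: "\<And>t x. T < \<bar>t\<bar> \<Longrightarrow> G t x = 0"
begin

text \<open>
  The Fourier transform of \<open>G\<close> in time, and the space-time Fourier transform of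
  \<open>W G\<close> on the mass shell, where the dual variable of time is the energy of
  \<open>\<xi>\<close>.
\<close>

definition time_transform :: "real \<Rightarrow> real^3 \<Rightarrow> complex" where "time_transform \<tau> x = fourier_integral (\<lambda>t. G t x) \<tau>"
definition shell_transform :: "real^3 \<Rightarrow> complex" where "shell_transform \<xi> = (LINT x|lborel. fourier_kernel x \<xi> * (complex_of_real (W x) * time_transform (lam \<xi>) x))"

lemma G_measurable:
  assumes [measurable]: "f \<in> N \<rightarrow>\<^sub>M borel" "g \<in> N \<rightarrow>\<^sub>M borel" shows "(\<lambda>z. G (f z) (g z)) \<in> borel_measurable N"
proof -
  have [measurable]: "(\<lambda>q. G (fst q) (snd q)) \<in> borel_measurable (borel \<Otimes>\<^sub>M borel)" using G by (simp add: borel_prod)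
  have "(\<lambda>z. (\<lambda>q. G (fst q) (snd q)) (f z, g z)) \<in> borel_measurable N" by measurable
  then show ?thesis by simp
qed

lemma G_slice: "integrable lborel (\<lambda>t. G t x)" "square_integrable lborel (\<lambda>t. G t x)"
proof -
  note [measurable (raw)] = G_measurable
  have "(\<lambda>t. G t x) \<in> borel_measurable borel" by measurable
  then show "integrable lborel (\<lambda>t. G t x)" "square_integrable lborel (\<lambda>t. G t x)"
    by (rule integrable_bounded_support[where M = M and R = T]; use GM GT in simp)+
qed

lemma time_transform_measurable:
  assumes [measurable]: "f \<in> N \<rightarrow>\<^sub>M borel" "g \<in> N \<rightarrow>\<^sub>M borel" shows "(\<lambda>z. time_transform (f z) (g z)) \<in> borel_measurable N"
proof -
  note [measurable (raw)] = G_measurable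
  show ?thesis unfolding time_transform_def fourier_integral_def by measurable
qed

definition time_bound :: real where "time_bound = (LINT t|lborel. M * indicator {-\<bar>T\<bar>..\<bar>T\<bar>} t)"

lemma time_transform_bound: "norm (time_transform \<tau> x) \<le> time_bound"
proof -
  have "norm (time_transform \<tau> x) \<le> (LINT t|lborel. norm (fourier_kernel t \<tau> * G t x))"
    unfolding time_transform_def fourier_integral_def by (rule integral_norm_bound)
  also have "\<dots> \<le> time_bound"
    unfolding time_bound_def
  proof (rule integral_mono')
    show "integrable lborel (\<lambda>t. M * indicator {-\<bar>T\<bar>..\<bar>T\<bar>} t)"
      by (intro integrable_mult_right) (auto intro!: integrable_real_indicator)
    show "norm (fourier_kernel t \<tau> * G t x) \<le> M * indicator {-\<bar>T\<bar>..\<bar>T\<bar>} t" for t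
      using GM[of t x] GT[of t x] by (auto simp: norm_mult indicator_def)
    show "0 \<le> M * indicator {-\<bar>T\<bar>..\<bar>T\<bar>} t" for t :: real
      using order_trans[OF norm_ge_zero GM] by simp
  qed
  finally show ?thesis .
qed

lemma time_bound_nonneg: "0 \<le> time_bound" using order_trans[OF norm_ge_zero time_transform_bound] .

lemma shell_transform_integrable: "integrable lborel (\<lambda>x. fourier_kernel x \<xi> * (complex_of_real (W x) * time_transform (lam \<xi>) x))"
proof (rule integrable_bounded_support(1)[where M = "C * time_bound" and R = r])
  show "norm (fourier_kernel x \<xi> * (complex_of_real (W x) * time_transform (lam \<xi>) x)) \<le> C * time_bound" for x
    using W0[of x] order_trans[OF W0 WC] by (simp add: norm_mult) (intro mult_mono WC time_transform_bound, auto)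
  note [measurable (raw)] = time_transform_measurable
  show "(\<lambda>x. fourier_kernel x \<xi> * (complex_of_real (W x) * time_transform (lam \<xi>) x)) \<in> borel_measurable borel" by measurable
qed (auto simp: Wr)

lemma shell_transform_measurable: "shell_transform \<in> borel_measurable borel"
proof -
  note [measurable (raw)] = time_transform_measurable
  show ?thesis unfolding shell_transform_def by measurable
qed

text \<open>
  Expanding the square as a double integral over \<open>x\<close> and \<open>y\<close> and
  integrating over \<open>\<xi>\<close> first leaves the Fourier transform at \<open>x - y\<close>
  of a radial function. By \<open>radial_fourier_bound\<close> it is at most the Newtonian kernel
  times an integral which \<open>nn_integral_mass_shell\<close> turns into an integral over the
  frequency \<open>\<tau>\<close>. For each \<open>\<tau>\<close> there remains the energy of
  \<open>|time_transform \<tau>|\<close>; the energy inequality and then Bessel's inequality in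
  time conclude. The radial bound, the substitution and Bessel's inequality contribute the factors
  \<open>2 pi\<close>, 2 and \<open>2 pi\<close>.
\<close>

lemma dual_estimate:
  "(\<integral>\<^sup>+\<xi>. ennreal (indicator (cball 0 R) \<xi> * ((norm (shell_transform \<xi>))\<^sup>2 / lam \<xi>)) \<partial>lborel)
    \<le> ennreal (8 * pi\<^sup>2 * B) * (\<integral>\<^sup>+x. \<integral>\<^sup>+t. ennreal ((norm (G t x))\<^sup>2 * W x) \<partial>lborel \<partial>lborel)"
proof -
  note [measurable (raw)] = G_measurable time_transform_measurable
  note [measurable] = shell_transform_measurable
  (* The profile, as a function of the square of the norm of \<xi>. *)
  define k where "k x y \<rho> = complex_of_real (indicator {0..R\<^sup>2} \<rho> / sqrt (\<rho> + m\<^sup>2)) * (time_transform (sqrt (\<rho> + m\<^sup>2)) x * cnj (time_transform (sqrt (\<rho> + m\<^sup>2)) y))" for x y \<rho>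
  (* The integrand before any integration, with \<xi> first, then x and y. *)
  define H where "H = (\<lambda>q::(real^3) \<times> ((real^3) \<times> (real^3)). fourier_kernel (fst (snd q) - snd (snd q)) (fst q) *
     (complex_of_real (W (fst (snd q)) * W (snd (snd q))) * k (fst (snd q)) (snd (snd q)) ((norm (fst q))\<^sup>2)))"
  have kb: "norm (k x y \<rho>) \<le> (1 / m) * (time_bound * time_bound)" for x y \<rho>
  proof (cases "\<rho> \<in> {0..R\<^sup>2}")
    case True
    have "m \<le> sqrt (\<rho> + m\<^sup>2)" using True by (intro real_le_rsqrt) simp
    then have "1 / sqrt (\<rho> + m\<^sup>2) \<le> 1 / m" using m by (intro frac_le) auto
    moreover have "0 \<le> 1 / sqrt (\<rho> + m\<^sup>2)" using True by simp
    ultimately show ?thesis using True m time_bound_nonneg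
      unfolding k_def norm_mult complex_mod_cnj norm_of_real
      by (intro mult_mono time_transform_bound) auto
  qed (use m time_bound_nonneg in \<open>simp add: k_def\<close>)
  have CC: "0 \<le> C" using order_trans[OF W0 WC] .
  have Hi: "integrable lborel H"
  proof (rule integrable_bounded_support(1)[where M = "(C * C) * ((1 / m) * (time_bound * time_bound))" and R = "\<bar>R\<bar> + (\<bar>r\<bar> + \<bar>r\<bar>)"])
    show "H \<in> borel_measurable borel"
      unfolding H_def k_def borel_prod[symmetric] by measurable
    show "norm (H q) \<le> (C * C) * ((1 / m) * (time_bound * time_bound))" for q
    proof -
      have "norm (H q) = norm (complex_of_real (W (fst (snd q)) * W (snd (snd q)))) * norm (k (fst (snd q)) (snd (snd q)) ((norm (fst q))\<^sup>2))"
        by (simp add: H_def norm_mult)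
      also have "\<dots> \<le> (C * C) * ((1 / m) * (time_bound * time_bound))"
      proof (intro mult_mono kb)
        show "norm (complex_of_real (W (fst (snd q)) * W (snd (snd q)))) \<le> C * C"
          unfolding norm_of_real using W0 WC CC by (simp only: abs_mult abs_of_nonneg) (intro mult_mono; simp)
      qed (use CC in auto)
      finally show ?thesis .
    qed
    show "H q = 0" if "\<bar>R\<bar> + (\<bar>r\<bar> + \<bar>r\<bar>) < norm q" for q
    proof (rule ccontr)
      assume "H q \<noteq> 0"
      then have "W (fst (snd q)) \<noteq> 0" "W (snd (snd q)) \<noteq> 0" "(norm (fst q))\<^sup>2 \<in> {0..R\<^sup>2}"
        by (auto simp: H_def k_def indicator_def split: if_splits)
      then have "norm (fst (snd q)) \<le> r" "norm (snd (snd q)) \<le> r" "norm (fst q) \<le> \<bar>R\<bar>"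
        using Wr[of "fst (snd q)"] Wr[of "snd (snd q)"] abs_le_square_iff[of "norm (fst q)" R] by (auto simp: not_less[symmetric])
      moreover have "norm q \<le> norm (fst q) + (norm (fst (snd q)) + norm (snd (snd q)))"
        using norm_Pair_le[of "fst q" "snd q"] norm_Pair_le[of "fst (snd q)" "snd (snd q)"] by simp
      ultimately show False using that by linarith
    qed
  qed
  have in1: "(LINT p|lborel. H (\<xi>, p)) = complex_of_real (indicator (cball 0 R) \<xi> * ((norm (shell_transform \<xi>))\<^sup>2 / lam \<xi>))" if R: "0 \<le> R" for \<xi>
  proof -
    let ?j = "\<lambda>x. fourier_kernel x \<xi> * (complex_of_real (W x) * time_transform (lam \<xi>) x)"
    let ?c = "complex_of_real (indicator (cball 0 R) \<xi> / lam \<xi>)"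
    have ex: "fourier_kernel (a - b) \<xi>
        = fourier_kernel a \<xi> * cnj (fourier_kernel b \<xi>)" for a b
      by (simp add: exp_cnj exp_add[symmetric] inner_diff_left algebra_simps)
    have ind: "indicator {0..R\<^sup>2} ((norm \<xi>)\<^sup>2) = (indicator (cball 0 R) \<xi> :: real)"
      using abs_le_square_iff[of "norm \<xi>" R] R by (auto simp: indicator_def)
    have "H (\<xi>, p) = ?c * (?j (fst p) * cnj (?j (snd p)))" for p
      unfolding H_def k_def fst_conv snd_conv ex ind dirac_energy_def[symmetric] by (simp add: mult_ac)
    then have "(LINT p|lborel. H (\<xi>, p)) = ?c * (LINT p|lborel. ?j (fst p) * cnj (?j (snd p)))"
      by (simp only: integral_mult_right_zero)
    also have "(LINT p|lborel. ?j (fst p) * cnj (?j (snd p))) = shell_transform \<xi> * cnj (shell_transform \<xi>)"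
      unfolding integral_lborel_prod[OF shell_transform_integrable integrable_cnj[OF shell_transform_integrable]] shell_transform_def
      by (rule arg_cong[OF Bochner_Integration.integral_cnj])
    also have "?c * (shell_transform \<xi> * cnj (shell_transform \<xi>)) = complex_of_real (indicator (cball 0 R) \<xi> * ((norm (shell_transform \<xi>))\<^sup>2 / lam \<xi>))"
      unfolding complex_norm_square[symmetric] by simp
    finally show ?thesis .
  qed
  define Q where "Q p = (LINT \<xi>|lborel. H (\<xi>, p))" for p
  have Qi: "integrable lborel Q"
    using lborel_pair.integrable_snd[of "\<lambda>\<xi> p. H (\<xi>, p)"] Hi by (simp add: lborel_prod Q_def[abs_def])
  have Qb: "ennreal (norm (Q (x, y))) \<le> ennreal (4 * pi) *
     (\<integral>\<^sup>+\<tau>. ennreal (norm (time_transform \<tau> x) * W x) * ennreal (norm (time_transform \<tau> y) * W y) * newton_kernel x y \<partial>lborel)"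
     if xy: "x \<noteq> y" for x y
  proof -
    have km: "k x y \<in> borel_measurable borel" unfolding k_def by measurable
    have np: "norm (x - y) > 0" using xy by simp
    have kR: "k x y \<rho> = 0" if "R\<^sup>2 < \<rho>" for \<rho> using that by (simp add: k_def)
    have "Q (x, y) = (LINT \<xi>|lborel. complex_of_real (W x * W y) * (fourier_kernel (x - y) \<xi> * k x y ((norm \<xi>)\<^sup>2)))"
      unfolding Q_def H_def by (intro Bochner_Integration.integral_cong) auto
    also have "\<dots> = complex_of_real (W x * W y) * (LINT \<xi>|lborel. fourier_kernel (x - y) \<xi> * k x y ((norm \<xi>)\<^sup>2))"
      by (rule integral_mult_right_zero)
    finally have "norm (Q (x, y)) = (W x * W y) * norm (LINT \<xi>|lborel. fourier_kernel (x - y) \<xi> * k x y ((norm \<xi>)\<^sup>2))"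
      using W0 by (simp add: norm_mult abs_mult)
    also have "\<dots> \<le> (W x * W y) * (2 * pi / norm (x - y) * (LINT \<rho>|lborel. indicator {0..} \<rho> * norm (k x y \<rho>)))"
      using xy W0 by (intro mult_left_mono radial_fourier_bound[OF km kb kR]) auto
    finally have 1: "norm (Q (x, y)) \<le> (W x * W y) * (2 * pi / norm (x - y) * (LINT \<rho>|lborel. indicator {0..} \<rho> * norm (k x y \<rho>)))" .
    have ki: "integrable lborel (\<lambda>\<rho>. indicator {0..} \<rho> * norm (k x y \<rho>))"
      by (rule integrable_bounded_support(1)[where M = "(1 / m) * (time_bound * time_bound)" and R = "R\<^sup>2"])
         (use km kb m time_bound_nonneg kR in \<open>auto simp: indicator_def\<close>)
    have "ennreal (LINT \<rho>|lborel. indicator {0..} \<rho> * norm (k x y \<rho>)) = (\<integral>\<^sup>+\<rho>. ennreal (indicator {0..} \<rho> * norm (k x y \<rho>)) \<partial>lborel)"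
      by (rule nn_integral_eq_integral[OF ki, symmetric]) simp
    also have "\<dots> = (\<integral>\<^sup>+\<rho>. ennreal (indicator {0..R\<^sup>2} \<rho> * ((\<lambda>\<tau>. norm (time_transform \<tau> x) * norm (time_transform \<tau> y)) (sqrt (\<rho> + m\<^sup>2)) / sqrt (\<rho> + m\<^sup>2))) \<partial>lborel)"
      using m by (intro nn_integral_cong) (auto simp: k_def norm_mult norm_divide indicator_def)
    also have "\<dots> \<le> 2 * (\<integral>\<^sup>+\<tau>. ennreal (norm (time_transform \<tau> x) * norm (time_transform \<tau> y)) \<partial>lborel)"
      by (rule nn_integral_mass_shell[OF m]) auto
    finally have 2: "ennreal (LINT \<rho>|lborel. indicator {0..} \<rho> * norm (k x y \<rho>)) \<le> 2 * (\<integral>\<^sup>+\<tau>. ennreal (norm (time_transform \<tau> x) * norm (time_transform \<tau> y)) \<partial>lborel)" .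
    let ?c = "W x * W y * (2 * pi / norm (x - y))"
    have c0: "0 \<le> ?c" using W0 by simp
    have "ennreal (norm (Q (x, y))) \<le> ennreal (?c * (LINT \<rho>|lborel. indicator {0..} \<rho> * norm (k x y \<rho>)))"
      using 1 by (intro ennreal_leI) (simp add: mult.assoc)
    also have "\<dots> \<le> ennreal ?c * (2 * (\<integral>\<^sup>+\<tau>. ennreal (norm (time_transform \<tau> x) * norm (time_transform \<tau> y)) \<partial>lborel))"
      unfolding ennreal_mult'[OF c0] by (intro mult_left_mono 2) simp
    also have "\<dots> = (\<integral>\<^sup>+\<tau>. ennreal ?c * (2 * ennreal (norm (time_transform \<tau> x) * norm (time_transform \<tau> y))) \<partial>lborel)"
      by (simp add: nn_integral_cmult)
    also have "\<dots> = (\<integral>\<^sup>+\<tau>. ennreal (4 * pi) * (ennreal (norm (time_transform \<tau> x) * W x) * ennreal (norm (time_transform \<tau> y) * W y) * newton_kernel x y) \<partial>lborel)"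
    proof (intro nn_integral_cong)
      fix \<tau>
      have "ennreal c * (2 * ennreal a) = ennreal (c * (2 * a))" if "0 \<le> c" "0 \<le> a" for c a :: real
        using that by (simp add: ennreal_mult)
      from this[OF c0, of "norm (time_transform \<tau> x) * norm (time_transform \<tau> y)"]
      have "ennreal ?c * (2 * ennreal (norm (time_transform \<tau> x) * norm (time_transform \<tau> y))) = ennreal (?c * (2 * (norm (time_transform \<tau> x) * norm (time_transform \<tau> y))))"
        by simp
      also have "?c * (2 * (norm (time_transform \<tau> x) * norm (time_transform \<tau> y))) = 4 * pi * ((norm (time_transform \<tau> x) * W x) * (norm (time_transform \<tau> y) * W y) * inverse (norm (x - y)))"
        by (simp add: divide_inverse)
      also have "ennreal \<dots> = ennreal (4 * pi) * (ennreal (norm (time_transform \<tau> x) * W x) * ennreal (norm (time_transform \<tau> y) * W y) * newton_kernel x y)"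
        using W0 np by (simp add: ennreal_mult inverse_ennreal)
      finally show "ennreal ?c * (2 * ennreal (norm (time_transform \<tau> x) * norm (time_transform \<tau> y))) = ennreal (4 * pi) * (ennreal (norm (time_transform \<tau> x) * W x) * ennreal (norm (time_transform \<tau> y) * W y) * newton_kernel x y)" .
    qed
    finally show ?thesis by (simp add: nn_integral_cmult)
  qed
  show ?thesis
  proof (cases "0 \<le> R")
    case False
    then show ?thesis by simp
  next
    case True
    let ?Y = "\<lambda>\<xi>. indicator (cball 0 R) \<xi> * ((norm (shell_transform \<xi>))\<^sup>2 / lam \<xi>)"
    let ?f = "\<lambda>x y \<tau>. ennreal (norm (time_transform \<tau> x) * W x) * ennreal (norm (time_transform \<tau> y) * W y) * newton_kernel x y"
    have "integrable lborel (\<lambda>\<xi>. LINT p|lborel. H (\<xi>, p))"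
      using Hi lborel_pair.integrable_fst'[of H] by (simp add: lborel_prod)
    then have "integrable lborel (\<lambda>\<xi>. Re (complex_of_real (?Y \<xi>)))" unfolding in1[OF True] by (rule integrable_Re)
    then have Yi: "integrable lborel ?Y" unfolding Re_complex_of_real .
    have Y0: "0 \<le> ?Y \<xi>" for \<xi> using lam_pos[of \<xi>] by simp
    have "(\<integral>\<^sup>+\<xi>. ennreal (?Y \<xi>) \<partial>lborel) = ennreal (LINT \<xi>|lborel. ?Y \<xi>)"
      by (rule nn_integral_eq_integral[OF Yi]) (use Y0 in simp)
    also have "(LINT \<xi>|lborel. ?Y \<xi>) = norm (complex_of_real (LINT \<xi>|lborel. ?Y \<xi>))"
      unfolding norm_of_real by (rule abs_of_nonneg[symmetric]) (use Y0 in \<open>simp add: integral_nonneg_AE\<close>)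
    also have "complex_of_real (LINT \<xi>|lborel. ?Y \<xi>) = (LINT p|lborel. Q p)"
      using Fubini_lborel(1)[OF Hi] unfolding in1[OF True] Q_def integral_complex_of_real .
    also have "ennreal (norm (LINT p|lborel. Q p)) \<le> (\<integral>\<^sup>+p. norm (Q p) \<partial>lborel)"
      by (rule integral_norm_bound_ennreal[OF Qi])
    also have "\<dots> = (\<integral>\<^sup>+x. \<integral>\<^sup>+y. ennreal (norm (Q (x, y))) \<partial>lborel \<partial>lborel)"
    proof -
      have "Q \<in> borel_measurable (lborel \<Otimes>\<^sub>M lborel)" using Qi by (simp add: lborel_prod)
      then show ?thesis by (subst lborel.nn_integral_fst) (simp_all add: lborel_prod)
    qed
    also have "\<dots> \<le> (\<integral>\<^sup>+x. \<integral>\<^sup>+y. ennreal (4 * pi) * (\<integral>\<^sup>+\<tau>. ?f x y \<tau> \<partial>lborel) \<partial>lborel \<partial>lborel)"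
    proof (rule nn_integral_mono, rule nn_integral_mono_AE)
      fix x :: "real^3"
      have "AE y in lborel. y \<noteq> x" by (rule AE_lborel_singleton)
      then show "AE y in lborel. ennreal (norm (Q (x, y))) \<le> ennreal (4 * pi) * (\<integral>\<^sup>+\<tau>. ?f x y \<tau> \<partial>lborel)"
        by eventually_elim (intro Qb, auto)
    qed
    also have "\<dots> = ennreal (4 * pi) * (\<integral>\<^sup>+x. \<integral>\<^sup>+y. \<integral>\<^sup>+\<tau>. ?f x y \<tau> \<partial>lborel \<partial>lborel \<partial>lborel)"
      by (simp add: nn_integral_cmult)
    also have "(\<integral>\<^sup>+x. \<integral>\<^sup>+y. \<integral>\<^sup>+\<tau>. ?f x y \<tau> \<partial>lborel \<partial>lborel \<partial>lborel) = (\<integral>\<^sup>+x. \<integral>\<^sup>+\<tau>. \<integral>\<^sup>+y. ?f x y \<tau> \<partial>lborel \<partial>lborel \<partial>lborel)"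
      by (intro nn_integral_cong lborel_pair.Fubini') measurable
    also have "\<dots> = (\<integral>\<^sup>+\<tau>. \<integral>\<^sup>+x. \<integral>\<^sup>+y. ?f x y \<tau> \<partial>lborel \<partial>lborel \<partial>lborel)"
      by (intro lborel_pair.Fubini') measurable
    finally have "(\<integral>\<^sup>+\<xi>. ennreal (?Y \<xi>) \<partial>lborel) \<le> ennreal (4 * pi) * (\<integral>\<^sup>+\<tau>. \<integral>\<^sup>+x. \<integral>\<^sup>+y. ?f x y \<tau> \<partial>lborel \<partial>lborel \<partial>lborel)" .
    also have "(\<integral>\<^sup>+\<tau>. \<integral>\<^sup>+x. \<integral>\<^sup>+y. ?f x y \<tau> \<partial>lborel \<partial>lborel \<partial>lborel) \<le> (\<integral>\<^sup>+\<tau>. ennreal B * (\<integral>\<^sup>+x. ennreal ((norm (time_transform \<tau> x))\<^sup>2 * W x) \<partial>lborel) \<partial>lborel)"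
      by (intro nn_integral_mono energy[where b = time_bound] time_transform_bound) auto
    also have "\<dots> = ennreal B * (\<integral>\<^sup>+\<tau>. \<integral>\<^sup>+x. ennreal ((norm (time_transform \<tau> x))\<^sup>2 * W x) \<partial>lborel \<partial>lborel)"
      by (rule nn_integral_cmult) measurable
    also have "(\<integral>\<^sup>+\<tau>. \<integral>\<^sup>+x. ennreal ((norm (time_transform \<tau> x))\<^sup>2 * W x) \<partial>lborel \<partial>lborel) = (\<integral>\<^sup>+x. \<integral>\<^sup>+\<tau>. ennreal ((norm (time_transform \<tau> x))\<^sup>2 * W x) \<partial>lborel \<partial>lborel)"
      by (intro lborel_pair.Fubini') measurable
    also have "\<dots> \<le> (\<integral>\<^sup>+x. ennreal (2 * pi) * (\<integral>\<^sup>+t. ennreal ((norm (G t x))\<^sup>2 * W x) \<partial>lborel) \<partial>lborel)"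
    proof (intro nn_integral_mono)
      fix x
      have "(\<integral>\<^sup>+\<tau>. ennreal ((norm (time_transform \<tau> x))\<^sup>2 * W x) \<partial>lborel) = (\<integral>\<^sup>+\<tau>. ennreal ((norm (time_transform \<tau> x))\<^sup>2) \<partial>lborel) * ennreal (W x)"
        using W0 by (simp add: ennreal_mult nn_integral_multc)
      also have "(\<integral>\<^sup>+\<tau>. ennreal ((norm (time_transform \<tau> x))\<^sup>2) \<partial>lborel) \<le> ennreal (2 * pi) * (\<integral>\<^sup>+t. ennreal ((norm (G t x))\<^sup>2) \<partial>lborel)"
        unfolding time_transform_def using bessel_nn_integral[OF G_slice(1)[of x]] by simp
      also have "ennreal (2 * pi) * (\<integral>\<^sup>+t. ennreal ((norm (G t x))\<^sup>2) \<partial>lborel) * ennreal (W x)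
         = ennreal (2 * pi) * (\<integral>\<^sup>+t. ennreal ((norm (G t x))\<^sup>2 * W x) \<partial>lborel)"
        using W0 by (simp add: ennreal_mult nn_integral_multc mult.assoc)
      finally show "(\<integral>\<^sup>+\<tau>. ennreal ((norm (time_transform \<tau> x))\<^sup>2 * W x) \<partial>lborel) \<le> ennreal (2 * pi) * (\<integral>\<^sup>+t. ennreal ((norm (G t x))\<^sup>2 * W x) \<partial>lborel)"
        by (simp add: mult_right_mono)
    qed
    also have "\<dots> = ennreal (2 * pi) * (\<integral>\<^sup>+x. \<integral>\<^sup>+t. ennreal ((norm (G t x))\<^sup>2 * W x) \<partial>lborel \<partial>lborel)"
      by (rule nn_integral_cmult) measurable
    finally have "(\<integral>\<^sup>+\<xi>. ennreal (?Y \<xi>) \<partial>lborel)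
       \<le> ennreal (4 * pi) * (ennreal B * (ennreal (2 * pi) * (\<integral>\<^sup>+x. \<integral>\<^sup>+t. ennreal ((norm (G t x))\<^sup>2 * W x) \<partial>lborel \<partial>lborel)))"
      by (simp add: mult_left_mono)
    also have "\<dots> = (ennreal (4 * pi) * ennreal B * ennreal (2 * pi)) * (\<integral>\<^sup>+x. \<integral>\<^sup>+t. ennreal ((norm (G t x))\<^sup>2 * W x) \<partial>lborel \<partial>lborel)"
      by (simp only: mult.assoc)
    also have "ennreal (4 * pi) * ennreal B * ennreal (2 * pi) = ennreal (8 * pi\<^sup>2 * B)"
      using B by (simp add: ennreal_mult[symmetric] power2_eq_square mult_ac)
    finally show ?thesis .
  qed
qed

end

end

section \<open>Local smoothing for a half-wave\<close>

text \<open>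
  The half-wave \<open>exp (i t \<lambda>(D))\<close> with
  \<open>\<lambda> = dirac_energy m\<close>, applied to the function with transform
  \<open>h\<close>.
\<close>

definition wave :: "real \<Rightarrow> (real^3 \<Rightarrow> complex) \<Rightarrow> real \<Rightarrow> real^3 \<Rightarrow> complex" where
  "wave m h t x = fourier_const TYPE(real^3) *\<^sub>R inv_fourier_integral (\<lambda>\<xi>. exp (\<i> * complex_of_real (t * dirac_energy m \<xi>)) * h \<xi>) x"

lemma bounded_compact_phase:
  assumes "bounded_compact h" shows "bounded_compact (\<lambda>\<xi>. exp (\<i> * complex_of_real (t * dirac_energy m \<xi>)) * h \<xi>)"
proof -
  have [measurable]: "h \<in> borel_measurable borel" using assms by (rule bounded_compact_measurable)
  have n: "norm (exp (\<i> * complex_of_real (t * dirac_energy m \<xi>)) * h \<xi>) = norm (h \<xi>)" for \<xi>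
    by (simp only: norm_mult norm_expi mult_1)
  have "(\<lambda>\<xi>. exp (\<i> * complex_of_real (t * dirac_energy m \<xi>)) * h \<xi>) \<in> borel_measurable borel" by measurable
  moreover have "\<exists>M. \<forall>\<xi>. norm (h \<xi>) \<le> M" "\<exists>R. \<forall>\<xi>. R < norm \<xi> \<longrightarrow> h \<xi> = 0"
    using assms unfolding bounded_compact_def by blast+
  ultimately show ?thesis unfolding bounded_compact_def n mult_eq_0_iff by blast
qed

lemma wave_measurable:
  assumes "bounded_compact h" shows "(\<lambda>q. wave m h (fst q) (snd q)) \<in> borel_measurable (borel \<Otimes>\<^sub>M borel)"
proof -
  have [measurable]: "h \<in> borel_measurable borel" using assms by (rule bounded_compact_measurable)
  show ?thesis unfolding wave_def inv_fourier_integral_def by measurable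
qed

lemma wave_measurable_compose:
  assumes h: "bounded_compact h" and [measurable]: "f \<in> N \<rightarrow>\<^sub>M borel" "g \<in> N \<rightarrow>\<^sub>M borel"
  shows "(\<lambda>z. wave m h (f z) (g z)) \<in> borel_measurable N"
proof -
  note [measurable] = wave_measurable[OF h, of m]
  have "(\<lambda>z. (\<lambda>q. wave m h (fst q) (snd q)) (f z, g z)) \<in> borel_measurable N" by measurable
  then show ?thesis by simp
qed

lemma fourier_const_3_sq: "(fourier_const TYPE(real^3))\<^sup>2 = 1 / (2 * pi) ^ 3"
  by (simp add: fourier_const_def power_divide)

context weighted_kernel
begin

text \<open>
  Duality and absorption. With \<open>G\<close> the half-wave restricted to the time window, the
  left-hand side \<open>I\<close> equals \<open>c\<close> times the pairing of \<open>h\<close>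
  with the shell transform of \<open>G\<close>. Splitting the product by the inequality of
  arithmetic and geometric means, with weights \<open>\<lambda>\<close> and
  \<open>1 / \<lambda>\<close>, the second part is at most a multiple of \<open>I\<close> by
  \<open>dual_estimate\<close>. The parameter \<open>s\<close> is chosen to make this multiple one
  half, and \<open>I\<close> is finite.
\<close>

lemma local_smoothing:
  assumes h: "bounded_compact h"
  shows "(\<integral>\<^sup>+x. \<integral>\<^sup>+t. ennreal ((norm (indicator {-T..T} t *\<^sub>R wave m h t x))\<^sup>2 * W x) \<partial>lborel \<partial>lborel)
    \<le> ennreal B * wave_energy lborel m h"
proof -
  obtain Mh R where hm[measurable]: "h \<in> borel_measurable borel" and Mh: "\<And>x. norm (h x) \<le> Mh" and R: "\<And>x. R < norm x \<Longrightarrow> h x = 0"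
    using h by (auto simp: bounded_compact_def)
  define c where "c = fourier_const TYPE(real^3)"
  have c: "c > 0" unfolding c_def by (rule fourier_const)
  define G where "G t x = indicator {-T..T} t *\<^sub>R wave m h t x" for t x
  define M where "M = c * (LINT \<xi>|lborel. norm (h \<xi>))"
  have GM: "norm (G t x) \<le> M" for t x
  proof -
    have "norm (inv_fourier_integral (\<lambda>\<xi>. exp (\<i> * complex_of_real (t * lam \<xi>)) * h \<xi>) x) \<le> (LINT \<xi>|lborel. norm (exp (\<i> * complex_of_real (t * lam \<xi>)) * h \<xi>))"
      by (rule inv_fourier_integral_bounded[OF bounded_compact_phase[OF h]])
    then have "norm (wave m h t x) \<le> M" unfolding wave_def M_def c_def[symmetric] using c by (simp add: norm_mult)
    then show ?thesis using order_trans[OF norm_ge_zero] by (auto simp: G_def indicator_def)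
  qed
  have M0: "0 \<le> M" using order_trans[OF norm_ge_zero GM] .
  have GT: "G t x = 0" if "\<bar>T\<bar> < \<bar>t\<bar>" for t x using that by (auto simp: G_def indicator_def)
  have Gm: "(\<lambda>q. G (fst q) (snd q)) \<in> borel_measurable borel"
    unfolding G_def borel_prod[symmetric] using wave_measurable[OF h] by measurable
  note Gmeas[measurable (raw)] = G_measurable[OF Gm GM GT]
  have dual: "(\<integral>\<^sup>+\<xi>. ennreal (indicator (cball 0 R) \<xi> * ((norm (shell_transform G \<xi>))\<^sup>2 / lam \<xi>)) \<partial>lborel)
    \<le> ennreal (8 * pi\<^sup>2 * B) * (\<integral>\<^sup>+x. \<integral>\<^sup>+t. ennreal ((norm (G t x))\<^sup>2 * W x) \<partial>lborel \<partial>lborel)" for R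
    by (rule dual_estimate[OF Gm GM GT])
  let ?J = "shell_transform G"
  have Jm[measurable]: "?J \<in> borel_measurable borel" by (rule shell_transform_measurable[OF Gm GM GT])
  have CC: "0 \<le> C" using order_trans[OF W0 WC] .
  define I where "I = (LINT q|lborel. (norm (G (fst q) (snd q)))\<^sup>2 * W (snd q))"
  have outside: "G (fst q) (snd q) = 0 \<or> W (snd q) = 0" if "\<bar>T\<bar> + \<bar>r\<bar> < norm q" for q :: "real \<times> (real^3)"
  proof (rule ccontr)
    assume "\<not> ?thesis"
    then have "\<bar>fst q\<bar> \<le> \<bar>T\<bar>" "norm (snd q) \<le> \<bar>r\<bar>" using GT[of "fst q" "snd q"] Wr[of "snd q"] by force+
    then show False using that norm_Pair_le[of "fst q" "snd q"] by simp
  qed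
  have Ii: "integrable lborel (\<lambda>q. (norm (G (fst q) (snd q)))\<^sup>2 * W (snd q))"
  proof (rule integrable_bounded_support(1)[where M = "M\<^sup>2 * C" and R = "\<bar>T\<bar> + \<bar>r\<bar>"])
    show "(\<lambda>q. (norm (G (fst q) (snd q)))\<^sup>2 * W (snd q)) \<in> borel_measurable borel" unfolding borel_prod[symmetric] by measurable
    show "norm ((norm (G (fst q) (snd q)))\<^sup>2 * W (snd q)) \<le> M\<^sup>2 * C" for q
      using W0 by (simp add: abs_mult) (intro mult_mono power_mono GM WC, auto)
    show "(norm (G (fst q) (snd q)))\<^sup>2 * W (snd q) = 0" if "\<bar>T\<bar> + \<bar>r\<bar> < norm q" for q using outside[OF that] by auto
  qed
  have I0: "0 \<le> I" unfolding I_def using W0 by (simp add: integral_nonneg_AE)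
  have nnI: "(\<integral>\<^sup>+x. \<integral>\<^sup>+t. ennreal ((norm (G t x))\<^sup>2 * W x) \<partial>lborel \<partial>lborel) = ennreal I"
  proof -
    have "ennreal I = (\<integral>\<^sup>+q. ennreal ((norm (G (fst q) (snd q)))\<^sup>2 * W (snd q)) \<partial>lborel)"
      unfolding I_def using W0 by (intro nn_integral_eq_integral[OF Ii, symmetric]) simp
    also have "\<dots> = (\<integral>\<^sup>+q. ennreal ((norm (G (fst q) (snd q)))\<^sup>2 * W (snd q)) \<partial>(lborel \<Otimes>\<^sub>M lborel))" by (simp add: lborel_prod)
    also have "\<dots> = (\<integral>\<^sup>+x. \<integral>\<^sup>+t. ennreal ((norm (G t x))\<^sup>2 * W x) \<partial>lborel \<partial>lborel)"
      by (subst lborel_pair.nn_integral_snd[symmetric]) simp_all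
    finally show ?thesis ..
  qed
  (* Integrating K over \<xi> gives the integrand of I, integrating it over time and space gives
     the pairing. *)
  define K where "K = (\<lambda>z::(real \<times> (real^3)) \<times> (real^3). (complex_of_real (c * W (snd (fst z))) * cnj (G (fst (fst z)) (snd (fst z)))) *
     (exp (\<i> * complex_of_real (snd (fst z) \<bullet> snd z)) * (exp (\<i> * complex_of_real (fst (fst z) * lam (snd z))) * h (snd z))))"
  have Ki: "integrable lborel K"
  proof (rule integrable_bounded_support(1)[where M = "(c * C * M) * Mh" and R = "(\<bar>T\<bar> + \<bar>r\<bar>) + \<bar>R\<bar>"])
    show "K \<in> borel_measurable borel" unfolding K_def borel_prod[symmetric] by measurable
    show "norm (K z) \<le> (c * C * M) * Mh" for z
    proof -
      have "norm (K z) = (c * W (snd (fst z)) * norm (G (fst (fst z)) (snd (fst z)))) * norm (h (snd z))"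
        using W0 c by (simp add: K_def norm_mult abs_mult)
      also have "\<dots> \<le> (c * C * M) * Mh"
        using W0 c CC M0 by (intro mult_mono GM WC Mh) auto
      finally show ?thesis .
    qed
    show "K z = 0" if "(\<bar>T\<bar> + \<bar>r\<bar>) + \<bar>R\<bar> < norm z" for z
    proof (rule ccontr)
      assume nz: "K z \<noteq> 0"
      then have "\<not> (\<bar>T\<bar> + \<bar>r\<bar> < norm (fst z))" using outside[of "fst z"] by (auto simp: K_def)
      moreover have "\<not> (\<bar>R\<bar> < norm (snd z))" using nz R[of "snd z"] by (auto simp: K_def dest: order_le_less_trans[OF abs_ge_self])
      ultimately show False using that norm_Pair_le[of "fst z" "snd z"] by simp
    qed
  qed
  have K1: "(LINT \<xi>|lborel. K (q, \<xi>)) = complex_of_real ((norm (G (fst q) (snd q)))\<^sup>2 * W (snd q))" for q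
  proof -
    have "(LINT \<xi>|lborel. K (q, \<xi>)) = (complex_of_real (c * W (snd q)) * cnj (G (fst q) (snd q))) *
      inv_fourier_integral (\<lambda>\<xi>. exp (\<i> * complex_of_real (fst q * lam \<xi>)) * h \<xi>) (snd q)"
      unfolding K_def fst_conv snd_conv inv_fourier_integral_def by (rule integral_mult_right_zero)
    also have "\<dots> = complex_of_real (W (snd q)) * (wave m h (fst q) (snd q) * cnj (G (fst q) (snd q)))"
      by (simp add: wave_def c_def scaleR_conv_of_real)
    also have "wave m h (fst q) (snd q) * cnj (G (fst q) (snd q)) = G (fst q) (snd q) * cnj (G (fst q) (snd q))"
      by (simp add: G_def indicator_def)
    also have "complex_of_real (W (snd q)) * \<dots> = complex_of_real ((norm (G (fst q) (snd q)))\<^sup>2 * W (snd q))"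
      unfolding complex_norm_square[symmetric] by simp
    finally show ?thesis .
  qed
  have K2: "(LINT q|lborel. K (q, \<xi>)) = complex_of_real c * h \<xi> * cnj (?J \<xi>)" for \<xi>
  proof -
    define L where "L = (\<lambda>q::real \<times> (real^3). fourier_kernel (snd q) \<xi> * (complex_of_real (W (snd q)) *
       (fourier_kernel (fst q) (lam \<xi>) * G (fst q) (snd q))))"
    have Li: "integrable lborel L"
    proof (rule integrable_bounded_support(1)[where M = "C * M" and R = "\<bar>T\<bar> + \<bar>r\<bar>"])
      show "L \<in> borel_measurable borel" unfolding L_def borel_prod[symmetric] by measurable
      show "norm (L q) \<le> C * M" for q
        using W0 CC by (simp add: L_def norm_mult) (intro mult_mono GM WC, auto)
      show "L q = 0" if "\<bar>T\<bar> + \<bar>r\<bar> < norm q" for q using outside[OF that] by (auto simp: L_def)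
    qed
    have "(LINT q|lborel. L q) = (LINT x|lborel. LINT t|lborel. L (t, x))"
      using Fubini_lborel[OF Li] by simp
    also have "\<dots> = ?J \<xi>"
      by (simp only: shell_transform_def[OF Gm GM GT] time_transform_def[OF Gm GM GT] fourier_integral_def L_def fst_conv snd_conv integral_mult_right_zero)
    finally have L: "(LINT q|lborel. L q) = ?J \<xi>" .
    have "K (q, \<xi>) = (complex_of_real c * h \<xi>) * cnj (L q)" for q
      by (simp add: K_def L_def exp_cnj mult_ac)
    then have "(LINT q|lborel. K (q, \<xi>)) = (complex_of_real c * h \<xi>) * (LINT q|lborel. cnj (L q))"
      by (simp only: integral_mult_right_zero)
    then show ?thesis unfolding Bochner_Integration.integral_cnj L .
  qed
  have IJ: "complex_of_real I = (LINT \<xi>|lborel. complex_of_real c * h \<xi> * cnj (?J \<xi>))"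
    using Fubini_lborel(1)[OF Ki] unfolding K1 K2 I_def integral_complex_of_real .
  define Eh where "Eh = (LINT \<xi>|lborel. lam \<xi> * (norm (h \<xi>))\<^sup>2)"
  have lamb: "lam \<xi> \<le> sqrt (R\<^sup>2 + m\<^sup>2)" if "norm \<xi> \<le> R" for \<xi>
    unfolding dirac_energy_def using that by (intro real_sqrt_le_mono add_right_mono power_mono) auto
  have Ei: "integrable lborel (\<lambda>\<xi>. lam \<xi> * (norm (h \<xi>))\<^sup>2)"
  proof (rule integrable_bounded_support(1)[where M = "sqrt (R\<^sup>2 + m\<^sup>2) * Mh\<^sup>2" and R = R])
    show "norm (lam \<xi> * (norm (h \<xi>))\<^sup>2) \<le> sqrt (R\<^sup>2 + m\<^sup>2) * Mh\<^sup>2" for \<xi>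
    proof (cases "R < norm \<xi>")
      case False
      then show ?thesis using lamb[of \<xi>] lam_pos[of \<xi>] by (simp add: abs_mult) (intro mult_mono power_mono Mh, auto)
    qed (simp add: R)
  qed (auto simp: R)
  define Y where "Y \<xi> = indicator (cball 0 R) \<xi> * ((norm (?J \<xi>))\<^sup>2 / lam \<xi>)" for \<xi>
  have Y0: "0 \<le> Y \<xi>" for \<xi> using lam_pos[of \<xi>] by (simp add: Y_def)
  have Yle: "(\<integral>\<^sup>+\<xi>. ennreal (Y \<xi>) \<partial>lborel) \<le> ennreal (8 * pi\<^sup>2 * B * I)"
    using dual[of R] B I0 unfolding nnI Y_def by (simp add: ennreal_mult)
  have Ym: "Y \<in> borel_measurable borel"
  proof -
    have [measurable]: "(\<lambda>x::real^3. indicator (cball 0 R) x :: real) \<in> borel_measurable borel"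
      by (rule borel_measurable_indicator) simp
    show ?thesis unfolding Y_def by measurable
  qed
  have Yi: "integrable lborel Y"
    using Yle Y0 Ym by (subst integrable_iff_bounded) (auto intro: order_le_less_trans)
  have YI: "(LINT \<xi>|lborel. Y \<xi>) \<le> 8 * pi\<^sup>2 * B * I"
    using Yle B I0 Y0 unfolding nn_integral_eq_integral[OF Yi AE_I2[OF Y0]] by (subst (asm) ennreal_le_iff) auto
  define s where "s = 8 * pi\<^sup>2 * B * c"
  have s: "s > 0" using B c by (simp add: s_def)
  have "I = norm (complex_of_real I)" using I0 by simp
  also have "\<dots> \<le> (LINT \<xi>|lborel. norm (complex_of_real c * h \<xi> * cnj (?J \<xi>)))"
    unfolding IJ by (rule integral_norm_bound)
  also have "\<dots> \<le> (LINT \<xi>|lborel. c * (s / 2 * (lam \<xi> * (norm (h \<xi>))\<^sup>2) + 1 / (2 * s) * Y \<xi>))"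
  proof (rule integral_mono')
    show "integrable lborel (\<lambda>\<xi>. c * (s / 2 * (lam \<xi> * (norm (h \<xi>))\<^sup>2) + 1 / (2 * s) * Y \<xi>))"
      by (intro integrable_mult_right Bochner_Integration.integrable_add Ei Yi)
    fix \<xi>
    show nn: "0 \<le> c * (s / 2 * (lam \<xi> * (norm (h \<xi>))\<^sup>2) + 1 / (2 * s) * Y \<xi>)"
      using c s Y0[of \<xi>] lam_pos[of \<xi>] by (intro mult_nonneg_nonneg add_nonneg_nonneg) auto
    show "norm (complex_of_real c * h \<xi> * cnj (?J \<xi>)) \<le> c * (s / 2 * (lam \<xi> * (norm (h \<xi>))\<^sup>2) + 1 / (2 * s) * Y \<xi>)"
    proof (cases "R < norm \<xi>")
      case True
      then show ?thesis using nn by (simp add: R)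
    next
      case False
      let ?l = "lam \<xi>" and ?a = "norm (h \<xi>)" and ?b = "norm (?J \<xi>)"
      have l: "?l > 0" by (rule lam_pos)
      have "0 \<le> (s * ?l * ?a - ?b)\<^sup>2 / (2 * s * ?l)" using s l by simp
      also have "\<dots> = s / 2 * (?l * ?a\<^sup>2) + 1 / (2 * s) * (?b\<^sup>2 / ?l) - ?a * ?b"
        using s l by (simp add: power2_eq_square field_simps)
      finally have "?a * ?b \<le> s / 2 * (?l * ?a\<^sup>2) + 1 / (2 * s) * Y \<xi>"
        using False by (simp add: Y_def)
      then show ?thesis using c by (simp add: norm_mult)
    qed
  qed
  also have "\<dots> = c * (s / 2 * Eh + 1 / (2 * s) * (LINT \<xi>|lborel. Y \<xi>))"
    unfolding Eh_def using Ei Yi by simp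
  also have "\<dots> \<le> c * (s / 2 * Eh + 1 / (2 * s) * (8 * pi\<^sup>2 * B * I))"
    using c s by (intro mult_left_mono add_left_mono YI) auto
  also have "\<dots> = c * s / 2 * Eh + I / 2"
    using c B pi_gt_zero by (simp add: s_def field_simps)
  finally have "I \<le> c * s * Eh" by simp
  also have "c * s = 8 * pi\<^sup>2 * B * c\<^sup>2" by (simp add: s_def power2_eq_square)
  also have "\<dots> = B / pi" unfolding c_def fourier_const_3_sq by (simp add: power2_eq_square power3_eq_cube field_simps)
  also have "B / pi * Eh \<le> B * Eh"
  proof (rule mult_right_mono)
    show "B / pi \<le> B" using B pi_gt3 by (simp add: divide_le_eq)
    show "0 \<le> Eh" unfolding Eh_def using lam_pos by (simp add: integral_nonneg_AE less_imp_le)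
  qed
  finally have "ennreal I \<le> ennreal (B * Eh)" by (rule ennreal_leI)
  also have "\<dots> = ennreal B * wave_energy lborel m h"
    using B lam_pos unfolding Eh_def by (subst nn_integral_eq_integral[OF Ei]) (auto simp: ennreal_mult' less_imp_le)
  finally show ?thesis unfolding nnI[symmetric] G_def .
qed

end

section \<open>The Dirac propagator\<close>

lemma vector_4 [simp]:
  "(vector [a, b, c, d] :: 'a::zero^4) $ 1 = a" "(vector [a, b, c, d] :: 'a^4) $ 2 = b"
  "(vector [a, b, c, d] :: 'a^4) $ 3 = c" "(vector [a, b, c, d] :: 'a^4) $ 4 = d"
  unfolding vector_def by simp_all

lemma dirac_symbol_nth:
  fixes \<xi> :: "real^3" and m :: real
  defines "S \<equiv> dirac_symbol m \<xi>" and "a \<equiv> complex_of_real (\<xi> $ 1)" and "b \<equiv> complex_of_real (\<xi> $ 2)" and "c \<equiv> complex_of_real (\<xi> $ 3)"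
  shows "S $ 1 $ 1 = m" "S $ 1 $ 2 = 0" "S $ 1 $ 3 = c" "S $ 1 $ 4 = a - \<i> * b"
    "S $ 2 $ 1 = 0" "S $ 2 $ 2 = m" "S $ 2 $ 3 = a + \<i> * b" "S $ 2 $ 4 = - c"
    "S $ 3 $ 1 = c" "S $ 3 $ 2 = a - \<i> * b" "S $ 3 $ 3 = - m" "S $ 3 $ 4 = 0"
    "S $ 4 $ 1 = a + \<i> * b" "S $ 4 $ 2 = - c" "S $ 4 $ 3 = 0" "S $ 4 $ 4 = - m"
  unfolding S_def a_def b_def c_def dirac_symbol_def dirac_alpha_def dirac_beta_def block_matrix_def pauli_def mat_def sum_3
  by (simp_all add: scaleR_conv_of_real[where 'a = complex])

text \<open>
  The anticommutation relations of the Dirac matrices, checked in coordinates.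
\<close>

lemma dirac_symbol_square: "dirac_symbol m \<xi> ** dirac_symbol m \<xi> = mat (complex_of_real ((norm \<xi>)\<^sup>2 + m\<^sup>2))"
proof -
  have n: "(norm \<xi>)\<^sup>2 = (\<xi> $ 1)\<^sup>2 + (\<xi> $ 2)\<^sup>2 + (\<xi> $ 3)\<^sup>2"
    by (simp add: norm_vec_def L2_set_def sum_3)
  show ?thesis
    unfolding vec_eq_iff forall_4 matrix_matrix_mult_def mat_def n
    by (simp add: sum_4 dirac_symbol_nth, simp add: algebra_simps power2_eq_square)
qed

lemma norm_dirac_symbol_nth: "norm (dirac_symbol m \<xi> $ i $ j) \<le> dirac_energy m \<xi>"
proof -
  have n: "(norm \<xi>)\<^sup>2 = (\<xi> $ 1)\<^sup>2 + (\<xi> $ 2)\<^sup>2 + (\<xi> $ 3)\<^sup>2"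
    by (simp add: norm_vec_def L2_set_def sum_3)
  have e: "norm z \<le> dirac_energy m \<xi>" if "(norm z)\<^sup>2 \<le> (\<xi> $ 1)\<^sup>2 + (\<xi> $ 2)\<^sup>2 + (\<xi> $ 3)\<^sup>2 + m\<^sup>2" for z :: complex
    unfolding dirac_energy_def n using that by (rule real_le_rsqrt)
  have "\<forall>i j. norm (dirac_symbol m \<xi> $ i $ j) \<le> dirac_energy m \<xi>"
    unfolding forall_4 by (intro conjI e; simp add: dirac_symbol_nth cmod_power2)
  then show ?thesis by blast
qed

text \<open>
  For \<open>s = 1\<close> and \<open>s = -1\<close> these are the entries of the projection onto
  the eigenspace of the symbol with eigenvalue \<open>s * dirac_energy m \<xi>\<close>.
\<close>

definition dirac_projection :: "real \<Rightarrow> real \<Rightarrow> real^3 \<Rightarrow> 4 \<Rightarrow> 4 \<Rightarrow> complex" where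
  "dirac_projection s m \<xi> i j =
    ((if i = j then 1 else 0) + complex_of_real (s / dirac_energy m \<xi>) * dirac_symbol m \<xi> $ i $ j) / 2"

text \<open>
  The symbol acts on the ranges of the two projections as plus and minus the energy, so the powers
  of its multiples are explicit and the exponential series can be summed entry by entry.
\<close>

lemma dirac_propagator_eq:
  assumes m: "0 < m"
  defines "\<theta> \<equiv> \<lambda>t \<xi>. complex_of_real (t * dirac_energy m \<xi>)"
  shows "dirac_propagator m t \<xi> $ i $ j = exp (- \<i> * \<theta> t \<xi>) * dirac_projection 1 m \<xi> i j + exp (\<i> * \<theta> t \<xi>) * dirac_projection (-1) m \<xi> i j"
proof -
  define A where "A = (\<chi> i j. - \<i> * complex_of_real t * dirac_symbol m \<xi> $ i $ j)"
  let ?S = "dirac_symbol m \<xi>"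
  let ?P = "dirac_projection 1 m \<xi>" and ?Q = "dirac_projection (-1) m \<xi>"
  define l where "l = complex_of_real (dirac_energy m \<xi>)"
  have l: "l \<noteq> 0" using dirac_energy_pos[OF m, of \<xi>] by (simp add: l_def)
  have ll: "l * l = complex_of_real ((norm \<xi>)\<^sup>2 + m\<^sup>2)"
    unfolding l_def of_real_mult[symmetric] dirac_energy_def by simp
  have th: "\<theta> t \<xi> = complex_of_real t * l" by (simp add: \<theta>_def l_def)
  have P: "?P i j = ((if i = j then 1 else 0) + ?S $ i $ j / l) / 2"
    and Q: "?Q i j = ((if i = j then 1 else 0) - ?S $ i $ j / l) / 2" for i j
    by (simp_all add: dirac_projection_def l_def)
  have SS: "(\<Sum>k\<in>UNIV. ?S $ i $ k * ?S $ k $ j) = (if i = j then l * l else 0)" for i j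
    using arg_cong[OF dirac_symbol_square[of m \<xi>], of "\<lambda>M. M $ i $ j"]
    unfolding matrix_matrix_mult_def mat_def ll by simp
  have pow: "matrix_pow A n $ i $ j = (- \<i> * \<theta> t \<xi>) ^ n * ?P i j + (\<i> * \<theta> t \<xi>) ^ n * ?Q i j" for n i j
  proof (induction n arbitrary: i j)
    case 0
    show ?case by (simp add: P Q mat_def field_simps)
  next
    case (Suc n)
    define a b where "a = (- \<i> * \<theta> t \<xi>) ^ n" and "b = (\<i> * \<theta> t \<xi>) ^ n"
    have X: "a * ?P k j + b * ?Q k j = (a + b) / 2 * (if k = j then 1 else 0) + (a - b) / (2 * l) * ?S $ k $ j" for k
      unfolding P Q using l by (simp add: field_simps)
    have "matrix_pow A (Suc n) $ i $ j = (\<Sum>k\<in>UNIV. A $ i $ k * (a * ?P k j + b * ?Q k j))"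
      by (simp only: matrix_pow.simps matrix_matrix_mult_def vec_lambda_beta Suc a_def b_def)
    also have "\<dots> = (\<Sum>k\<in>UNIV. (- \<i> * complex_of_real t * ((a + b) / 2)) * (?S $ i $ k * (if k = j then 1 else 0))
        + (- \<i> * complex_of_real t * ((a - b) / (2 * l))) * (?S $ i $ k * ?S $ k $ j))"
      unfolding X A_def by (intro sum.cong refl) (simp only: vec_lambda_beta ring_distribs mult_ac)
    also have "\<dots> = (- \<i> * complex_of_real t * ((a + b) / 2)) * (\<Sum>k\<in>UNIV. ?S $ i $ k * (if k = j then 1 else 0))
        + (- \<i> * complex_of_real t * ((a - b) / (2 * l))) * (\<Sum>k\<in>UNIV. ?S $ i $ k * ?S $ k $ j)"
      by (simp only: sum.distrib sum_distrib_left)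
    also have "(\<Sum>k\<in>UNIV. ?S $ i $ k * (if k = j then 1 else 0)) = ?S $ i $ j"
      by (simp add: if_distrib cong: if_cong)
    also have "(- \<i> * complex_of_real t * ((a + b) / 2)) * ?S $ i $ j
        + (- \<i> * complex_of_real t * ((a - b) / (2 * l))) * (\<Sum>k\<in>UNIV. ?S $ i $ k * ?S $ k $ j)
       = (- \<i> * \<theta> t \<xi> * a) * ?P i j + (\<i> * \<theta> t \<xi> * b) * ?Q i j"
      unfolding SS P Q th using l by (cases "i = j") (simp_all add: field_simps)
    finally show ?case by (simp add: a_def b_def mult.assoc)
  qed
  let ?L = "\<chi> i j. exp (- \<i> * \<theta> t \<xi>) * ?P i j + exp (\<i> * \<theta> t \<xi>) * ?Q i j"
  have "(\<lambda>n. inverse (fact n) *\<^sub>R matrix_pow A n) sums ?L"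
    unfolding sums_def
  proof (intro vec_tendstoI)
    fix i j
    have "(\<lambda>n. ((- \<i> * \<theta> t \<xi>) ^ n /\<^sub>R fact n) * ?P i j + ((\<i> * \<theta> t \<xi>) ^ n /\<^sub>R fact n) * ?Q i j) sums
      (exp (- \<i> * \<theta> t \<xi>) * ?P i j + exp (\<i> * \<theta> t \<xi>) * ?Q i j)"
      by (intro sums_add sums_mult2 exp_converges)
    moreover have "(inverse (fact n) *\<^sub>R matrix_pow A n) $ i $ j
      = ((- \<i> * \<theta> t \<xi>) ^ n /\<^sub>R fact n) * ?P i j + ((\<i> * \<theta> t \<xi>) ^ n /\<^sub>R fact n) * ?Q i j" for n
      by (simp only: vector_scaleR_component pow scaleR_right_distrib mult_scaleR_left)
    ultimately show "(\<lambda>N. (\<Sum>n<N. inverse (fact n) *\<^sub>R matrix_pow A n) $ i $ j) \<longlonglongrightarrow> ?L $ i $ j"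
      by (simp add: sums_def sum_component)
  qed
  then have "matrix_exp A = ?L" unfolding matrix_exp_def by (rule sums_unique[symmetric])
  then show ?thesis by (simp add: dirac_propagator_def A_def)
qed

lemma norm_dirac_projection:
  assumes m: "0 < m" and s: "\<bar>s\<bar> = 1" shows "norm (dirac_projection s m \<xi> i j) \<le> 1"
proof -
  have l: "dirac_energy m \<xi> > 0" by (rule dirac_energy_pos[OF m])
  have "norm (complex_of_real (s / dirac_energy m \<xi>) * dirac_symbol m \<xi> $ i $ j) \<le> 1"
    using norm_dirac_symbol_nth[of m \<xi> i j] l s by (simp add: norm_mult norm_divide field_simps)
  moreover have "norm (if i = j then 1 else 0 :: complex) \<le> 1" by simp
  ultimately have "norm ((if i = j then 1 else 0) + complex_of_real (s / dirac_energy m \<xi>) * dirac_symbol m \<xi> $ i $ j) \<le> 2"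
    by (intro order_trans[OF norm_triangle_ineq]) linarith
  then show ?thesis unfolding dirac_projection_def by (simp add: norm_divide)
qed

lemma dirac_projection_measurable[measurable]: "(\<lambda>\<xi>. dirac_projection s m \<xi> i j) \<in> borel_measurable borel"
proof -
  have "\<forall>i j. (\<lambda>\<xi>. dirac_symbol m \<xi> $ i $ j) \<in> borel_measurable borel"
    unfolding forall_4 dirac_symbol_nth by (intro conjI; measurable)
  then have [measurable]: "(\<lambda>\<xi>. dirac_symbol m \<xi> $ i $ j) \<in> borel_measurable borel" by blast
  show ?thesis unfolding dirac_projection_def by measurable
qed

section \<open>Sobolev norm, existence and continuity of the solution\<close>

lemma borel_measurable_lebesgueI: "f \<in> borel_measurable borel \<Longrightarrow> f \<in> borel_measurable lebesgue"
  by (rule measurable_completion) simp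

lemma has_scalar_fourier_cong_AE:
  assumes fF: "has_scalar_fourier f F" and ae: "AE \<xi> in lebesgue. F \<xi> = G \<xi>" and G: "G \<in> borel_measurable lebesgue"
  shows "has_scalar_fourier f G"
proof -
  have f: "square_integrable lebesgue f" and F: "square_integrable lebesgue F" using fF by (auto simp: has_scalar_fourier_def)
  have sG: "square_integrable lebesgue G" by (rule square_integrable_cong_AE[OF ae F G])
  have "l2norm lebesgue (\<lambda>\<xi>. G \<xi> - truncated_transform R f \<xi>) = l2norm lebesgue (\<lambda>\<xi>. F \<xi> - truncated_transform R f \<xi>)" for R
  proof (rule l2norm_cong_AE)
    show "AE \<xi> in lebesgue. G \<xi> - truncated_transform R f \<xi> = F \<xi> - truncated_transform R f \<xi>" using ae by eventually_elim simp
  qed (use G F truncated_transform_square_integrable_l2norm(1)[OF f, of R] in \<open>auto simp: square_integrable_def\<close>)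
  then show ?thesis using fF sG by (simp add: has_scalar_fourier_def)
qed

lemma has_fourier_cong_AE:
  assumes "has_fourier f F" "AE \<xi> in lebesgue. F \<xi> = G \<xi>" "G \<in> borel_measurable lebesgue"
  shows "has_fourier f G"
  unfolding has_fourier_iff
proof
  fix i
  show "has_scalar_fourier (\<lambda>x. f x $ i) (\<lambda>\<xi>. G \<xi> $ i)"
  proof (rule has_scalar_fourier_cong_AE)
    show "has_scalar_fourier (\<lambda>x. f x $ i) (\<lambda>\<xi>. F \<xi> $ i)" using assms(1) by (simp add: has_fourier_iff)
    show "AE \<xi> in lebesgue. F \<xi> $ i = G \<xi> $ i" using assms(2) by eventually_elim simp
    show "(\<lambda>\<xi>. G \<xi> $ i) \<in> borel_measurable lebesgue" using assms(3) borel_measurable_vec_iff[of G lebesgue] by blast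
  qed
qed

text \<open>
  Weighting by the square root of \<open>japanese\<close> on the Fourier side carries
  \<open>H_half\<close> isometrically into \<open>L2\<close>.
\<close>

definition sobolev_half :: "(real^3 \<Rightarrow> complex^4) \<Rightarrow> real^3 \<Rightarrow> complex^4" where
  "sobolev_half F \<xi> = (japanese \<xi> powr (1/2)) *\<^sub>R F \<xi>"

lemma japanese_ge_1: "1 \<le> japanese \<xi>" by (simp add: japanese_def)

lemma japanese_measurable[measurable]: "japanese \<in> borel_measurable borel" unfolding japanese_def by measurable

lemma mat_vec: "mat (complex_of_real c) *v x = c *\<^sub>R x"
  by (simp add: vec_eq_iff matrix_vector_mult_def mat_def scaleR_conv_of_real[where 'a = complex] if_distrib if_distribR cong: if_cong)

lemma sobolev_half_measurable:
  assumes F: "F \<in> borel_measurable lebesgue" shows "sobolev_half F \<in> borel_measurable lebesgue"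
proof -
  have "(\<lambda>\<xi>. japanese \<xi> powr (1/2)) \<in> borel_measurable lebesgue"
    by (rule borel_measurable_lebesgueI) measurable
  from borel_measurable_scaleR[OF this F] show ?thesis unfolding sobolev_half_def[abs_def] .
qed

lemma norm_sobolev_half_sq: "(norm (sobolev_half F \<xi>))\<^sup>2 = japanese \<xi> * (norm (F \<xi>))\<^sup>2"
proof -
  have "(japanese \<xi> powr (1/2))\<^sup>2 = japanese \<xi>"
    using japanese_ge_1[of \<xi>] by (simp add: powr_half_sqrt)
  then show ?thesis by (simp add: sobolev_half_def power_mult_distrib)
qed

lemma half_bessel_iff:
  assumes F: "has_fourier f F"
  shows "half_bessel f g \<longleftrightarrow> has_fourier g (sobolev_half F)"
proof
  assume "half_bessel f g"
  then obtain F1 G where h: "has_fourier f F1" "has_fourier g G" "AE \<xi> in lebesgue. G \<xi> = sobolev_half F1 \<xi>"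
    unfolding half_bessel_def fourier_multiplier_def mat_vec sobolev_half_def by blast
  have "AE \<xi> in lebesgue. G \<xi> = sobolev_half F \<xi>"
    using h(3) has_fourier_unique[OF h(1) F] by eventually_elim (simp add: sobolev_half_def)
  then show "has_fourier g (sobolev_half F)"
    using has_fourier_square_integrable(2)[OF F] by (intro has_fourier_cong_AE[OF h(2)] sobolev_half_measurable) (auto simp: square_integrable_def)
next
  assume "has_fourier g (sobolev_half F)"
  then show "half_bessel f g"
    unfolding half_bessel_def fourier_multiplier_def mat_vec using F by (auto simp: sobolev_half_def[abs_def])
qed

lemma H_half_iff:
  assumes F: "has_fourier f F"
  shows "f \<in> H_half \<longleftrightarrow> square_integrable lebesgue (sobolev_half F)"
  unfolding H_half_def using half_bessel_iff[OF F] has_fourier_surj has_fourier_square_integrable(2) by blast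

lemma H_half_norm_eq:
  assumes F: "has_fourier f F" and f: "f \<in> H_half"
  shows "H_half_norm f = l2norm lebesgue (sobolev_half F)"
proof -
  have "\<exists>g. half_bessel f g" using f by (simp add: H_half_def)
  then have "half_bessel f (SOME g. half_bessel f g)" by (rule someI_ex)
  then have "has_fourier (SOME g. half_bessel f g) (sobolev_half F)" using half_bessel_iff[OF F] by blast
  then show ?thesis unfolding H_half_norm_def L2_norm_eq by (rule has_fourier_isometry)
qed

definition propagate :: "real \<Rightarrow> (real^3 \<Rightarrow> complex^4) \<Rightarrow> real \<Rightarrow> real^3 \<Rightarrow> complex^4" where
  "propagate m F t \<xi> = dirac_propagator m t \<xi> *v F \<xi>"

text \<open>
  A component of the part of \<open>F\<close> in the eigenspace of sign \<open>s\<close>; it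
  evolves by a scalar phase.
\<close>

definition half_wave :: "real \<Rightarrow> real \<Rightarrow> (real^3 \<Rightarrow> complex^4) \<Rightarrow> 4 \<Rightarrow> real^3 \<Rightarrow> complex" where
  "half_wave s m F i \<xi> = (\<Sum>j\<in>UNIV. dirac_projection s m \<xi> i j * F \<xi> $ j)"

lemma propagate_nth:
  assumes m: "0 < m"
  shows "propagate m F t \<xi> $ i = exp (- \<i> * complex_of_real (t * dirac_energy m \<xi>)) * half_wave 1 m F i \<xi>
    + exp (\<i> * complex_of_real (t * dirac_energy m \<xi>)) * half_wave (-1) m F i \<xi>"
  unfolding propagate_def matrix_vector_mult_def vec_lambda_beta dirac_propagator_eq[OF m] half_wave_def
  by (simp only: sum_distrib_left distrib_right sum.distrib mult.assoc)

lemma norm_half_wave: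
  assumes m: "0 < m" and s: "\<bar>s\<bar> = 1"
  shows "norm (half_wave s m F i \<xi>) \<le> 4 * norm (F \<xi>)"
proof -
  have "norm (half_wave s m F i \<xi>) \<le> (\<Sum>j\<in>(UNIV::4 set). norm (F \<xi>))"
    unfolding half_wave_def
  proof (intro order_trans[OF norm_sum] sum_mono)
    fix j
    have "norm (dirac_projection s m \<xi> i j * F \<xi> $ j) \<le> 1 * norm (F \<xi>)"
      unfolding norm_mult by (intro mult_mono norm_dirac_projection[OF m s] Finite_Cartesian_Product.norm_nth_le) auto
    then show "norm (dirac_projection s m \<xi> i j * F \<xi> $ j) \<le> norm (F \<xi>)" by simp
  qed
  then show ?thesis by simp
qed

lemma half_wave_measurable:
  assumes F: "F \<in> borel_measurable lebesgue" shows "half_wave s m F i \<in> borel_measurable lebesgue"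
proof -
  have "(\<lambda>\<xi>. F \<xi> $ j) \<in> borel_measurable lebesgue" for j using F borel_measurable_vec_iff[of F lebesgue] by blast
  moreover have "(\<lambda>\<xi>. dirac_projection s m \<xi> i j) \<in> borel_measurable lebesgue" for j
    by (rule borel_measurable_lebesgueI) measurable
  ultimately show ?thesis unfolding half_wave_def[abs_def] by (intro borel_measurable_sum borel_measurable_times)
qed

lemma half_wave_square_integrable:
  assumes m: "0 < m" and s: "\<bar>s\<bar> = 1" and F: "square_integrable lebesgue F" shows "square_integrable lebesgue (half_wave s m F i)"
proof -
  have F4: "square_integrable lebesgue (\<lambda>\<xi>. 4 *\<^sub>R F \<xi>)" by (rule square_integrable_scaleR[OF F])
  show ?thesis
    by (rule square_integrable_mono[OF F4 half_wave_measurable]) (use F norm_half_wave[OF m s, of F i] in \<open>auto simp: square_integrable_def\<close>)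
qed

lemma norm_propagate:
  assumes m: "0 < m"
  shows "norm (propagate m F t \<xi>) \<le> 32 * norm (F \<xi>)"
proof -
  have "norm (propagate m F t \<xi> $ i) \<le> 8 * norm (F \<xi>)" for i
  proof -
    have n: "norm (exp (- \<i> * complex_of_real (t * dirac_energy m \<xi>))) = 1" "norm (exp (\<i> * complex_of_real (t * dirac_energy m \<xi>))) = 1"
      by simp_all
    have "norm (propagate m F t \<xi> $ i) \<le> norm (half_wave 1 m F i \<xi>) + norm (half_wave (-1) m F i \<xi>)"
      unfolding propagate_nth[OF m] by (rule order_trans[OF norm_triangle_ineq]) (simp only: norm_mult n mult_1 order_refl)
    then show ?thesis using norm_half_wave[OF m, of 1 F i \<xi>] norm_half_wave[OF m, of "-1" F i \<xi>] by simp
  qed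
  then have "(\<Sum>i\<in>(UNIV::4 set). norm (propagate m F t \<xi> $ i)) \<le> (\<Sum>i\<in>(UNIV::4 set). 8 * norm (F \<xi>))"
    by (intro sum_mono)
  moreover have "norm (propagate m F t \<xi>) \<le> (\<Sum>i\<in>(UNIV::4 set). norm (propagate m F t \<xi> $ i))"
    unfolding norm_vec_def[of "propagate m F t \<xi>"] by (rule L2_set_le_sum) simp
  ultimately show ?thesis by simp
qed

lemma propagate_measurable:
  assumes m: "0 < m" and F: "F \<in> borel_measurable lebesgue" shows "propagate m F t \<in> borel_measurable lebesgue"
  unfolding borel_measurable_vec_iff[of "propagate m F t"] propagate_nth[OF m]
proof (intro allI borel_measurable_add borel_measurable_times half_wave_measurable F)
  show "(\<lambda>\<xi>. exp (- \<i> * complex_of_real (t * dirac_energy m \<xi>))) \<in> borel_measurable lebesgue"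
    by (rule borel_measurable_lebesgueI) measurable
  show "(\<lambda>\<xi>. exp (\<i> * complex_of_real (t * dirac_energy m \<xi>))) \<in> borel_measurable lebesgue"
    by (rule borel_measurable_lebesgueI) measurable
qed

lemma propagate_square_integrable:
  assumes m: "0 < m" and F: "square_integrable lebesgue F"
  shows "square_integrable lebesgue (propagate m F t)"
proof -
  have F32: "square_integrable lebesgue (\<lambda>\<xi>. 32 *\<^sub>R F \<xi>)" by (rule square_integrable_scaleR[OF F])
  show ?thesis
    by (rule square_integrable_mono[OF F32 propagate_measurable[OF m]]) (use F norm_propagate[OF m, of F t] in \<open>auto simp: square_integrable_def\<close>)
qed

lemma sobolev_half_propagate: "sobolev_half (propagate m F t) = propagate m (sobolev_half F) t"
  by (rule ext) (simp add: sobolev_half_def propagate_def matrix_vector_mult_def vec_eq_iff sum_distrib_left scaleR_sum_right mult_scaleR_right)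

lemma dirac_solution_exists:
  assumes m: "0 < m" and F: "has_fourier f F"
  shows "\<exists>u. dirac_solution m f u"
proof -
  have "\<forall>t. \<exists>g. has_fourier g (propagate m F t)"
    using has_fourier_surj propagate_square_integrable[OF m has_fourier_square_integrable(2)[OF F]] by blast
  then obtain u where "\<And>t. has_fourier (u t) (propagate m F t)" by metis
  then have "dirac_solution m f u"
    unfolding dirac_solution_def fourier_multiplier_def
    by (intro allI exI[of _ F] exI[of _ "propagate m F _"] conjI F) (auto simp: propagate_def)
  then show ?thesis by blast
qed

lemma dirac_solution_fourier:
  assumes m: "0 < m" and F: "has_fourier f F" and u: "dirac_solution m f u"
  shows "has_fourier (u t) (propagate m F t)"
proof -
  obtain F1 G where h: "has_fourier f F1" "has_fourier (u t) G" "AE \<xi> in lebesgue. G \<xi> = dirac_propagator m t \<xi> *v F1 \<xi>"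
    using u unfolding dirac_solution_def fourier_multiplier_def by blast
  have "AE \<xi> in lebesgue. G \<xi> = propagate m F t \<xi>"
    using h(3) has_fourier_unique[OF h(1) F] by eventually_elim (simp add: propagate_def)
  then show ?thesis
    using has_fourier_square_integrable(2)[OF F] by (intro has_fourier_cong_AE[OF h(2)] propagate_measurable m) (auto simp: square_integrable_def)
qed

lemma propagate_tendsto:
  assumes m: "0 < m" and X: "X \<longlonglongrightarrow> t" shows "(\<lambda>n. propagate m F (X n) \<xi>) \<longlonglongrightarrow> propagate m F t \<xi>"
proof (rule vec_tendstoI)
  fix i
  show "(\<lambda>n. propagate m F (X n) \<xi> $ i) \<longlonglongrightarrow> propagate m F t \<xi> $ i"
    unfolding propagate_nth[OF m] by (intro tendsto_intros X)
qed

text \<open>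
  The propagator is bounded, continuous in time at every frequency and commutes with the Sobolev
  weight, so dominated convergence applies on the Fourier side.
\<close>

lemma dirac_solution_continuous:
  assumes m: "0 < m" and F: "has_fourier f F" and f: "f \<in> H_half" and u: "dirac_solution m f u"
  shows "continuous_into_H_half T u"
  unfolding continuous_into_H_half_def
proof (intro ballI conjI)
  note ut = dirac_solution_fourier[OF m F u]
  let ?b = "sobolev_half F"
  have b: "square_integrable lebesgue ?b" using H_half_iff[OF F] f by blast
  have bt: "square_integrable lebesgue (sobolev_half (propagate m F t))" for t
    unfolding sobolev_half_propagate by (rule propagate_square_integrable[OF m b])
  fix t assume "t \<in> T"
  show "u t \<in> H_half" using H_half_iff[OF ut] bt by blast
  have norm_eq: "H_half_norm (\<lambda>x. u s x - u t x) = l2norm lebesgue (\<lambda>\<xi>. propagate m ?b s \<xi> - propagate m ?b t \<xi>)" for s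
  proof -
    have d: "has_fourier (\<lambda>x. u s x - u t x) (\<lambda>\<xi>. propagate m F s \<xi> - propagate m F t \<xi>)"
      by (rule has_fourier_diff[OF ut ut])
    have e: "sobolev_half (\<lambda>\<xi>. propagate m F s \<xi> - propagate m F t \<xi>) = (\<lambda>\<xi>. propagate m ?b s \<xi> - propagate m ?b t \<xi>)"
      unfolding sobolev_half_propagate[symmetric] by (rule ext) (simp add: sobolev_half_def scaleR_right_diff_distrib)
    have "(\<lambda>x. u s x - u t x) \<in> H_half"
      unfolding H_half_iff[OF d] e by (intro square_integrable_diff propagate_square_integrable m b)
    from H_half_norm_eq[OF d this] show ?thesis unfolding e .
  qed
  show "((\<lambda>s. H_half_norm (\<lambda>x. u s x - u t x)) \<longlongrightarrow> 0) (at t within T)"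
    unfolding tendsto_at_iff_sequentially
  proof (intro allI impI)
    fix X :: "nat \<Rightarrow> real" assume X: "X \<longlonglongrightarrow> t"
    (* 64 = 2 * 32: the bound of norm_propagate at both times. *)
    have h: "square_integrable lebesgue (\<lambda>\<xi>. 64 *\<^sub>R ?b \<xi>)" by (rule square_integrable_scaleR[OF b])
    have "(\<lambda>n. l2norm lebesgue (\<lambda>\<xi>. propagate m ?b (X n) \<xi> - propagate m ?b t \<xi>)) \<longlonglongrightarrow> 0"
    proof (rule l2norm_dominated[OF _ _ h])
      show "propagate m ?b (X n) \<in> borel_measurable lebesgue" "propagate m ?b t \<in> borel_measurable lebesgue" for n
        using propagate_square_integrable[OF m b] by (auto simp: square_integrable_def)
      show "AE \<xi> in lebesgue. (\<lambda>n. propagate m ?b (X n) \<xi>) \<longlonglongrightarrow> propagate m ?b t \<xi>"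
        by (intro AE_I2 propagate_tendsto m X)
      show "norm (propagate m ?b (X n) \<xi> - propagate m ?b t \<xi>) \<le> norm (64 *\<^sub>R ?b \<xi>)" for n \<xi>
        using norm_triangle_ineq4[of "propagate m ?b (X n) \<xi>" "propagate m ?b t \<xi>"]
          norm_propagate[OF m, of ?b "X n" \<xi>] norm_propagate[OF m, of ?b t \<xi>] by simp
    qed
    then show "((\<lambda>s. H_half_norm (\<lambda>x. u s x - u t x)) \<circ> X) \<longlonglongrightarrow> 0" unfolding norm_eq o_def .
  qed
qed

section \<open>Approximation by half-waves with bounded data\<close>

lemma has_scalar_fourier_add:
  assumes "has_scalar_fourier f F" "has_scalar_fourier g G" shows "has_scalar_fourier (\<lambda>x. f x + g x) (\<lambda>\<xi>. F \<xi> + G \<xi>)"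
  using has_scalar_fourier_diff[OF assms(1) has_scalar_fourier_diff[OF has_scalar_fourier_diff[OF assms(2,2)] assms(2)]] by simp

lemma has_scalar_fourier_wave: assumes "bounded_compact h" shows "has_scalar_fourier (wave m h t) (\<lambda>\<xi>. exp (\<i> * complex_of_real (t * dirac_energy m \<xi>)) * h \<xi>)"
  using has_scalar_fourier_bounded_compact[OF bounded_compact_phase[OF assms, of t m]] unfolding wave_def[abs_def] .

text \<open>
  The phases have modulus one, so the isometry makes the error bound uniform in time. The
  positive-energy part carries the phase \<open>exp (- i t \<lambda>)\<close> and is therefore a
  half-wave at time \<open>- t\<close>.
\<close>

lemma wave_approximation:
  assumes m: "0 < m" and F: "has_fourier f F" and ut: "has_fourier g (propagate m F t)"
    and p: "square_integrable lborel p" "AE \<xi> in lborel. half_wave 1 m F i \<xi> = p \<xi>" and q: "square_integrable lborel q" "AE \<xi> in lborel. half_wave (-1) m F i \<xi> = q \<xi>"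
    and P: "bounded_compact P" and Q: "bounded_compact Q"
  shows "l2norm lebesgue (\<lambda>x. g x $ i - (wave m Q t x + wave m P (- t) x)) \<le> l2norm lborel (\<lambda>\<xi>. P \<xi> - p \<xi>) + l2norm lborel (\<lambda>\<xi>. Q \<xi> - q \<xi>)"
proof -
  let ?e = "\<lambda>s \<xi>. exp (\<i> * complex_of_real (s * dirac_energy m \<xi>))"
  have em[measurable]: "?e s \<in> borel_measurable borel" for s by measurable
  have [measurable]: "p \<in> borel_measurable borel" "q \<in> borel_measurable borel" "P \<in> borel_measurable borel" "Q \<in> borel_measurable borel"
    using p q bounded_compact_measurable[OF P] bounded_compact_measurable[OF Q] by (auto simp: square_integrable_def)
  have hg: "has_scalar_fourier (\<lambda>x. g x $ i) (\<lambda>\<xi>. propagate m F t \<xi> $ i)" using ut by (simp add: has_fourier_iff)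
  have hv: "has_scalar_fourier (\<lambda>x. wave m Q t x + wave m P (- t) x) (\<lambda>\<xi>. ?e t \<xi> * Q \<xi> + ?e (- t) \<xi> * P \<xi>)"
    by (rule has_scalar_fourier_add[OF has_scalar_fourier_wave[OF Q] has_scalar_fourier_wave[OF P]])
  note hd = has_scalar_fourier_diff[OF hg hv]
  have s1: "square_integrable lborel (\<lambda>\<xi>. ?e s \<xi> * (a \<xi> - b \<xi>))" and n1: "l2norm lborel (\<lambda>\<xi>. ?e s \<xi> * (a \<xi> - b \<xi>)) = l2norm lborel (\<lambda>\<xi>. a \<xi> - b \<xi>)"
    if "square_integrable lborel a" "square_integrable lborel b" for a b s
  proof -
    have [measurable]: "a \<in> borel_measurable borel" "b \<in> borel_measurable borel" using that by (auto simp: square_integrable_def)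
    have n: "norm (?e s \<xi> * (a \<xi> - b \<xi>)) = norm (a \<xi> - b \<xi>)" for \<xi> by (simp only: norm_mult norm_expi mult_1)
    show "l2norm lborel (\<lambda>\<xi>. ?e s \<xi> * (a \<xi> - b \<xi>)) = l2norm lborel (\<lambda>\<xi>. a \<xi> - b \<xi>)" unfolding l2norm_def n ..
    have "(\<lambda>\<xi>. ?e s \<xi> * (a \<xi> - b \<xi>)) \<in> borel_measurable lborel" by measurable
    then show "square_integrable lborel (\<lambda>\<xi>. ?e s \<xi> * (a \<xi> - b \<xi>))"
      using square_integrable_diff[OF that] unfolding square_integrable_def n by simp
  qed
  have "l2norm lebesgue (\<lambda>x. g x $ i - (wave m Q t x + wave m P (- t) x))
     = l2norm lebesgue (\<lambda>\<xi>. propagate m F t \<xi> $ i - (?e t \<xi> * Q \<xi> + ?e (- t) \<xi> * P \<xi>))"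
    by (rule has_scalar_fourier_isometry[OF hd])
  also have "\<dots> = l2norm lebesgue (\<lambda>\<xi>. ?e (- t) \<xi> * (p \<xi> - P \<xi>) + ?e t \<xi> * (q \<xi> - Q \<xi>))"
  proof (rule l2norm_cong_AE)
    show "AE \<xi> in lebesgue. propagate m F t \<xi> $ i - (?e t \<xi> * Q \<xi> + ?e (- t) \<xi> * P \<xi>) = ?e (- t) \<xi> * (p \<xi> - P \<xi>) + ?e t \<xi> * (q \<xi> - Q \<xi>)"
      using AE_completion[OF p(2)] AE_completion[OF q(2)]
      by eventually_elim (simp add: propagate_nth[OF m] right_diff_distrib)
    show "(\<lambda>\<xi>. propagate m F t \<xi> $ i - (?e t \<xi> * Q \<xi> + ?e (- t) \<xi> * P \<xi>)) \<in> borel_measurable lebesgue"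
      using hd by (simp add: has_scalar_fourier_def square_integrable_def)
    show "(\<lambda>\<xi>. ?e (- t) \<xi> * (p \<xi> - P \<xi>) + ?e t \<xi> * (q \<xi> - Q \<xi>)) \<in> borel_measurable lebesgue"
      by (rule borel_measurable_lebesgueI) measurable
  qed
  also have "\<dots> = l2norm lborel (\<lambda>\<xi>. ?e (- t) \<xi> * (p \<xi> - P \<xi>) + ?e t \<xi> * (q \<xi> - Q \<xi>))"
    by (rule l2norm_lborel_lebesgue) measurable
  also have "\<dots> \<le> l2norm lborel (\<lambda>\<xi>. p \<xi> - P \<xi>) + l2norm lborel (\<lambda>\<xi>. q \<xi> - Q \<xi>)"
    using l2norm_triangle[OF s1[OF p(1) bounded_compact_square_integrable[OF P], of "- t"] s1[OF q(1) bounded_compact_square_integrable[OF Q], of t]]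
    unfolding n1[OF p(1) bounded_compact_square_integrable[OF P]] n1[OF q(1) bounded_compact_square_integrable[OF Q]] .
  finally show ?thesis using l2norm_commute[of lborel p P] l2norm_commute[of lborel q Q] by simp
qed

definition weight_cutoff :: "(real^3 \<Rightarrow> real) \<Rightarrow> nat \<Rightarrow> real^3 \<Rightarrow> real" where
  "weight_cutoff w n x = (if norm x \<le> real n then min (w x) (real n) else 0)"

lemma weight_cutoff_kernel:
  fixes w :: "real^3 \<Rightarrow> real"
  assumes m: "0 < m" and w[measurable]: "w \<in> borel_measurable borel" and w0: "\<And>x. 0 \<le> w x"
    and fin: "\<And>k n. (\<integral>\<^sup>+x\<in>dyadic_cube k n. w x \<partial>lborel) < \<infinity>" and K: "0 < K"
    and test: "\<And>k n. (\<integral>\<^sup>+x\<in>dyadic_cube k n. (\<integral>\<^sup>+y\<in>dyadic_cube k n. w x * w y * newton_kernel x y \<partial>lborel) \<partial>lborel)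
      \<le> ennreal K * (\<integral>\<^sup>+x\<in>dyadic_cube k n. w x \<partial>lborel)"
  shows "weighted_kernel m (1728 * K) (real n) (real n) (weight_cutoff w n)"
proof
  show W[measurable]: "weight_cutoff w n \<in> borel_measurable borel" unfolding weight_cutoff_def by measurable
  show "0 \<le> weight_cutoff w n x" "weight_cutoff w n x \<le> real n" for x using w0 by (auto simp: weight_cutoff_def)
  show Wr: "weight_cutoff w n x = 0" if "real n < norm x" for x using that by (simp add: weight_cutoff_def)
  fix \<psi> :: "real^3 \<Rightarrow> real" and b
  assume psi: "\<psi> \<in> borel_measurable borel" "\<And>x. 0 \<le> \<psi> x" "\<And>x. \<psi> x \<le> b"
  show "(\<integral>\<^sup>+x. \<integral>\<^sup>+y. ennreal (\<psi> x * weight_cutoff w n x) * ennreal (\<psi> y * weight_cutoff w n y) * newton_kernel x y \<partial>lborel \<partial>lborel)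
      \<le> ennreal (1728 * K) * (\<integral>\<^sup>+x. ennreal ((\<psi> x)\<^sup>2 * weight_cutoff w n x) \<partial>lborel)"
    by (rule weighted_energy[OF w w0 fin K test W _ _ Wr psi]) (use w0 in \<open>auto simp: weight_cutoff_def\<close>)
qed (use m K in auto)

lemma cutoff_energy_le:
  "wave_energy lborel m (cutoff n q) \<le> wave_energy lborel m q"
  by (intro nn_integral_mono ennreal_leI mult_left_mono) (auto simp: cutoff_def dirac_energy_def)

text \<open>
  Tonelli's theorem, and the symmetry of the time window for the reflected wave.
\<close>

lemma (in weighted_kernel) smoothing_time_first:
  assumes h: "bounded_compact h"
  shows "(\<integral>\<^sup>+t. indicator {-T..T} t * (\<integral>\<^sup>+x. ennreal ((norm (wave m h t x))\<^sup>2 * W x) \<partial>lborel) \<partial>lborel)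
    \<le> ennreal B * wave_energy lborel m h"
   and "(\<integral>\<^sup>+t. indicator {-T..T} t * (\<integral>\<^sup>+x. ennreal ((norm (wave m h (- t) x))\<^sup>2 * W x) \<partial>lborel) \<partial>lborel)
    \<le> ennreal B * wave_energy lborel m h"
proof -
  note [measurable (raw)] = wave_measurable_compose[OF h]
  have wm1: "(\<lambda>(x, t). indicator {-T..T} t * ennreal ((norm (wave m h t x))\<^sup>2 * W x)) \<in> borel_measurable (lborel \<Otimes>\<^sub>M lborel)"
    by measurable
  have wx: "(\<lambda>x. ennreal ((norm (wave m h t x))\<^sup>2 * W x)) \<in> borel_measurable lborel" for t
    by measurable
  let ?F = "\<lambda>t. indicator {-T..T} t * (\<integral>\<^sup>+x. ennreal ((norm (wave m h t x))\<^sup>2 * W x) \<partial>lborel)"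
  have eq: "?F t = (\<integral>\<^sup>+x. indicator {-T..T} t * ennreal ((norm (wave m h t x))\<^sup>2 * W x) \<partial>lborel)" for t
    by (rule nn_integral_cmult[OF wx, symmetric])
  have "(\<integral>\<^sup>+t. ?F t \<partial>lborel) = (\<integral>\<^sup>+x. \<integral>\<^sup>+t. indicator {-T..T} t * ennreal ((norm (wave m h t x))\<^sup>2 * W x) \<partial>lborel \<partial>lborel)"
    unfolding eq by (rule lborel_pair.Fubini'[OF wm1])
  also have "\<dots> = (\<integral>\<^sup>+x. \<integral>\<^sup>+t. ennreal ((norm (indicator {-T..T} t *\<^sub>R wave m h t x))\<^sup>2 * W x) \<partial>lborel \<partial>lborel)"
    by (intro nn_integral_cong) (auto simp: indicator_def)
  also have "\<dots> \<le> ennreal B * wave_energy lborel m h"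
    by (rule local_smoothing[OF h])
  finally show 1: "(\<integral>\<^sup>+t. ?F t \<partial>lborel) \<le> ennreal B * wave_energy lborel m h" .
  have Fm: "?F \<in> borel_measurable borel"
    by measurable
  have "(\<integral>\<^sup>+t. ?F t \<partial>lborel) = (\<integral>\<^sup>+t. ?F t \<partial>distr lborel borel uminus)" by (simp add: lborel_distr_uminus)
  also have "\<dots> = (\<integral>\<^sup>+t. ?F (- t) \<partial>lborel)" by (rule nn_integral_distr) (use Fm in auto)
  also have "\<dots> = (\<integral>\<^sup>+t. indicator {-T..T} t * (\<integral>\<^sup>+x. ennreal ((norm (wave m h (- t) x))\<^sup>2 * W x) \<partial>lborel) \<partial>lborel)"
    by (intro nn_integral_cong) (auto simp: indicator_def)
  finally show "(\<integral>\<^sup>+t. indicator {-T..T} t * (\<integral>\<^sup>+x. ennreal ((norm (wave m h (- t) x))\<^sup>2 * W x) \<partial>lborel) \<partial>lborel)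
    \<le> ennreal B * wave_energy lborel m h"
    using 1 by simp
qed

section \<open>The weighted estimate for real-valued weights\<close>

lemma half_wave_energy:
  assumes m: "0 < m" and s: "\<bar>s\<bar> = 1" and F: "square_integrable lebesgue F" and p: "AE \<xi> in lborel. half_wave s m F i \<xi> = p \<xi>"
  shows "wave_energy lborel m p \<le> 16 * wave_energy lebesgue m F"
proof -
  have Fm: "F \<in> borel_measurable lebesgue" using F by (simp add: square_integrable_def)
  have nm: "(\<lambda>\<xi>. norm (F \<xi>)) \<in> borel_measurable lebesgue" using Fm by measurable
  have dm: "dirac_energy m \<in> borel_measurable lebesgue" by (rule borel_measurable_lebesgueI) measurable
  have "wave_energy lborel m p = wave_energy lborel m (half_wave s m F i)"
  proof (rule nn_integral_cong_AE)
    show "AE \<xi> in lborel. ennreal (dirac_energy m \<xi> * (norm (p \<xi>))\<^sup>2) = ennreal (dirac_energy m \<xi> * (norm (half_wave s m F i \<xi>))\<^sup>2)"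
      using p by eventually_elim simp
  qed
  also have "\<dots> = wave_energy lebesgue m (half_wave s m F i)"
    by (simp add: nn_integral_completion)
  also have "\<dots> \<le> (\<integral>\<^sup>+\<xi>. 16 * ennreal (dirac_energy m \<xi> * (norm (F \<xi>))\<^sup>2) \<partial>lebesgue)"
  proof (rule nn_integral_mono)
    fix \<xi>
    have "(norm (half_wave s m F i \<xi>))\<^sup>2 \<le> (4 * norm (F \<xi>))\<^sup>2" by (rule power_mono[OF norm_half_wave[OF m s]]) simp
    then have "dirac_energy m \<xi> * (norm (half_wave s m F i \<xi>))\<^sup>2 \<le> dirac_energy m \<xi> * (4 * norm (F \<xi>))\<^sup>2"
      using dirac_energy_pos[OF m, of \<xi>] by (intro mult_left_mono) auto
    also have "\<dots> = 16 * (dirac_energy m \<xi> * (norm (F \<xi>))\<^sup>2)" by (simp add: power_mult_distrib)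
    finally have "ennreal (dirac_energy m \<xi> * (norm (half_wave s m F i \<xi>))\<^sup>2) \<le> ennreal (16 * (dirac_energy m \<xi> * (norm (F \<xi>))\<^sup>2))"
      by (rule ennreal_leI)
    then show "ennreal (dirac_energy m \<xi> * (norm (half_wave s m F i \<xi>))\<^sup>2) \<le> 16 * ennreal (dirac_energy m \<xi> * (norm (F \<xi>))\<^sup>2)"
      by (simp add: ennreal_mult')
  qed
  also have "\<dots> = 16 * wave_energy lebesgue m F"
    by (intro nn_integral_cmult measurable_compose[OF _ measurable_ennreal] borel_measurable_times borel_measurable_power dm nm)
  finally show ?thesis .
qed

lemma (in weighted_kernel) two_waves:
  assumes P: "bounded_compact P" and Q: "bounded_compact Q"
    and eP: "wave_energy lborel m P \<le> X"
    and eQ: "wave_energy lborel m Q \<le> X"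
  shows "(\<integral>\<^sup>+t. indicator {-T..T} t * (\<integral>\<^sup>+x. ennreal ((norm (wave m Q t x + wave m P (- t) x))\<^sup>2 * W x) \<partial>lborel) \<partial>lborel) \<le> 4 * (ennreal B * X)"
proof -
  note [measurable (raw)] = wave_measurable_compose[OF P] wave_measurable_compose[OF Q]
  let ?q = "\<lambda>t. \<integral>\<^sup>+x. ennreal ((norm (wave m Q t x))\<^sup>2 * W x) \<partial>lborel"
  let ?p = "\<lambda>t. \<integral>\<^sup>+x. ennreal ((norm (wave m P (- t) x))\<^sup>2 * W x) \<partial>lborel"
  have "(\<integral>\<^sup>+x. ennreal ((norm (wave m Q t x + wave m P (- t) x))\<^sup>2 * W x) \<partial>lborel) \<le> 2 * ?q t + 2 * ?p t" for t
  proof -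
    have "(\<integral>\<^sup>+x. ennreal ((norm (wave m Q t x + wave m P (- t) x))\<^sup>2 * W x) \<partial>lborel)
       \<le> (\<integral>\<^sup>+x. 2 * ennreal ((norm (wave m Q t x))\<^sup>2 * W x) + 2 * ennreal ((norm (wave m P (- t) x))\<^sup>2 * W x) \<partial>lborel)"
    proof (rule nn_integral_mono)
      fix x
      have "(norm (wave m Q t x + wave m P (- t) x))\<^sup>2 * W x \<le> (2 * (norm (wave m Q t x))\<^sup>2 + 2 * (norm (wave m P (- t) x))\<^sup>2) * W x"
        by (intro mult_right_mono norm_sq_split2 W0)
      then have "ennreal ((norm (wave m Q t x + wave m P (- t) x))\<^sup>2 * W x) \<le> ennreal (2 * ((norm (wave m Q t x))\<^sup>2 * W x) + 2 * ((norm (wave m P (- t) x))\<^sup>2 * W x))"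
        by (intro ennreal_leI) (simp add: algebra_simps)
      also have "\<dots> = 2 * ennreal ((norm (wave m Q t x))\<^sup>2 * W x) + 2 * ennreal ((norm (wave m P (- t) x))\<^sup>2 * W x)"
        using W0[of x] by (simp add: ennreal_plus ennreal_mult')
      finally show "ennreal ((norm (wave m Q t x + wave m P (- t) x))\<^sup>2 * W x) \<le> \<dots>" .
    qed
    also have "\<dots> = 2 * ?q t + 2 * ?p t"
      by (subst nn_integral_add) (auto simp: nn_integral_cmult)
    finally show ?thesis .
  qed
  then have "(\<integral>\<^sup>+t. indicator {-T..T} t * (\<integral>\<^sup>+x. ennreal ((norm (wave m Q t x + wave m P (- t) x))\<^sup>2 * W x) \<partial>lborel) \<partial>lborel)
     \<le> (\<integral>\<^sup>+t. indicator {-T..T} t * (2 * ?q t + 2 * ?p t) \<partial>lborel)"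
    by (intro nn_integral_mono mult_left_mono) auto
  also have "\<dots> = (\<integral>\<^sup>+t. 2 * (indicator {-T..T} t * ?q t) + 2 * (indicator {-T..T} t * ?p t) \<partial>lborel)"
    by (intro nn_integral_cong) (simp only: distrib_left mult.left_commute)
  also have "\<dots> = 2 * (\<integral>\<^sup>+t. indicator {-T..T} t * ?q t \<partial>lborel) + 2 * (\<integral>\<^sup>+t. indicator {-T..T} t * ?p t \<partial>lborel)"
  proof -
    have [measurable]: "(\<lambda>t. indicator {-T..T} t * ?q t) \<in> borel_measurable lborel" by measurable
    have [measurable]: "(\<lambda>t. indicator {-T..T} t * ?p t) \<in> borel_measurable lborel" by measurable
    show ?thesis by (subst nn_integral_add) (measurable, simp add: nn_integral_cmult)
  qed
  also have "\<dots> \<le> 2 * (ennreal B * X) + 2 * (ennreal B * X)"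
    by (intro add_mono mult_left_mono order_trans[OF smoothing_time_first(1)[OF Q]] order_trans[OF smoothing_time_first(2)[OF P]] eP eQ) auto
  also have "\<dots> = 4 * (ennreal B * X)" by (simp add: distrib_right[symmetric])
  finally show ?thesis .
qed

text \<open>
  Cut the weight off at height \<open>n\<close> and radius \<open>n\<close>, restrict time to
  \<open>{-n..n}\<close>, and replace both half-waves of every component by half-waves
  \<open>v n i\<close> with bounded, boundedly supported data. The error in the mean is at most
  \<open>d n\<close> at every time, so its contribution, at most a multiple of
  \<open>n * n * (d n)\<^sup>2\<close>, vanishes in the limit. The functions \<open>H n\<close>
  are measurable in time and their lower limit dominates the spatial integral, so Fatou's lemma
  applies first in space and then, to \<open>H n\<close>, in time.

  The constant collects 4 components, a factor 2 for the approximation error, a factor 4 for the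
  sum of two half-waves, and 16 from the bound of each half-wave by the datum.
\<close>

lemma weighted_estimate:
  fixes w :: "real^3 \<Rightarrow> real"
  assumes m: "0 < m" and w[measurable]: "w \<in> borel_measurable borel" and w0: "\<And>x. 0 \<le> w x"
    and fin: "\<And>k n. (\<integral>\<^sup>+x\<in>dyadic_cube k n. w x \<partial>lborel) < \<infinity>" and K: "0 < K"
    and test: "\<And>k n. (\<integral>\<^sup>+x\<in>dyadic_cube k n. (\<integral>\<^sup>+y\<in>dyadic_cube k n. w x * w y * newton_kernel x y \<partial>lborel) \<partial>lborel)
      \<le> ennreal K * (\<integral>\<^sup>+x\<in>dyadic_cube k n. w x \<partial>lborel)"
    and F: "has_fourier f F" and u: "\<And>t. has_fourier (u t) (propagate m F t)"
  shows "(\<integral>\<^sup>+t. (\<integral>\<^sup>+x. ennreal ((norm (u t x))\<^sup>2) * ennreal (w x) \<partial>lebesgue) \<partial>lebesgue)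
    \<le> ennreal (512 * (1728 * K)) * wave_energy lebesgue m F"
proof -
  have Fs: "square_integrable lebesgue F" by (rule has_fourier_square_integrable(2)[OF F])
  define X where "X = wave_energy lebesgue m F"
  define B where "B = 1728 * K"
  define W where "W = weight_cutoff w"
  have W0: "0 \<le> W n x" and Wn: "W n x \<le> real n" for n x using w0 by (auto simp: W_def weight_cutoff_def)
  have [measurable]: "W n \<in> borel_measurable borel" for n unfolding W_def weight_cutoff_def by measurable
  have rep: "\<exists>p. square_integrable lborel p \<and> (AE \<xi> in lborel. half_wave s m F i \<xi> = p \<xi>)" if "\<bar>s\<bar> = 1" for s i
    using square_integrable_representative[OF half_wave_square_integrable[OF m that Fs, of i]] by blast
  (* Borel representatives of the two half-waves of each component. *)
  obtain p where p: "\<And>i. square_integrable lborel (p i)" "\<And>i. AE \<xi> in lborel. half_wave 1 m F i \<xi> = p i \<xi>"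
    using rep[of 1] by (metis abs_one)
  obtain q where q: "\<And>i. square_integrable lborel (q i)" "\<And>i. AE \<xi> in lborel. half_wave (-1) m F i \<xi> = q i \<xi>"
    using rep[of "-1"] by (metis abs_minus_cancel abs_one)
  have [measurable]: "p i \<in> borel_measurable borel" "q i \<in> borel_measurable borel" for i
    using p(1)[of i] q(1)[of i] by (auto simp: square_integrable_def)
  define D where "D k = (\<Sum>i\<in>UNIV. l2norm lborel (\<lambda>\<xi>. cutoff k (p i) \<xi> - p i \<xi>) + l2norm lborel (\<lambda>\<xi>. cutoff k (q i) \<xi> - q i \<xi>))" for k
  have "D \<longlonglongrightarrow> (\<Sum>i\<in>(UNIV::4 set). 0 + 0)"
    unfolding D_def by (intro tendsto_intros cutoff_tendsto p q)
  then have Dlim: "D \<longlonglongrightarrow> 0" by simp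
  (* Errors of this size survive multiplication by the height n of the weight and the length 2 n
     of the window. *)
  define d where "d n = (inverse (real (Suc n)))\<^sup>2" for n
  have d0: "d n > 0" for n by (simp add: d_def)
  have "\<forall>n. \<exists>k. D k < d n"
  proof
    fix n
    have "\<forall>\<^sub>F k in sequentially. D k < d n" by (rule order_tendstoD(2)[OF Dlim d0])
    then show "\<exists>k. D k < d n" by (auto simp: eventually_sequentially)
  qed
  then obtain r where r: "\<And>n. D (r n) < d n" by metis
  define P where "P n i = cutoff (r n) (p i)" for n i
  define Q where "Q n i = cutoff (r n) (q i)" for n i
  have P: "bounded_compact (P n i)" and Q: "bounded_compact (Q n i)" for n i
    unfolding P_def Q_def by (rule bounded_compact_cutoff, simp)+
  define v where "v n i t x = wave m (Q n i) t x + wave m (P n i) (- t) x" for n i t x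
  have wm: "(\<lambda>z. v n i (a z) (b z)) \<in> borel_measurable N"
    if [measurable]: "a \<in> N \<rightarrow>\<^sub>M borel" "b \<in> N \<rightarrow>\<^sub>M borel" for a b n i and N :: "'z measure"
  proof -
    note [measurable (raw)] = wave_measurable_compose[OF P] wave_measurable_compose[OF Q]
    show ?thesis unfolding v_def by measurable
  qed
  note [measurable (raw)] = wm
  have approx: "l2norm lebesgue (\<lambda>x. u t x $ i - v n i t x) \<le> d n" for t n i
  proof -
    have "l2norm lebesgue (\<lambda>x. u t x $ i - v n i t x) \<le> l2norm lborel (\<lambda>\<xi>. P n i \<xi> - p i \<xi>) + l2norm lborel (\<lambda>\<xi>. Q n i \<xi> - q i \<xi>)"
      unfolding v_def by (rule wave_approximation[OF m F u p q P Q])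
    also have "\<dots> \<le> D (r n)"
      unfolding D_def P_def Q_def by (rule member_le_sum) auto
    finally show ?thesis using r[of n] by linarith
  qed
  have diffs: "square_integrable lebesgue (\<lambda>x. u t x $ i - v n i t x)" for t n i
    using has_scalar_fourier_diff[of "\<lambda>x. u t x $ i" "\<lambda>\<xi>. propagate m F t \<xi> $ i", OF _ has_scalar_fourier_add[OF has_scalar_fourier_wave[OF Q[of n i], of m t] has_scalar_fourier_wave[OF P[of n i], of m "- t"]]]
      u[of t] unfolding has_fourier_iff v_def by (simp add: has_scalar_fourier_def)
  let ?A = "\<lambda>n i t. \<integral>\<^sup>+x. ennreal ((norm (v n i t x))\<^sup>2 * W n x) \<partial>lborel"
  define H where "H n t = indicator {- real n..real n} t * (\<Sum>i\<in>UNIV. 2 * ?A n i t + ennreal (2 * real n * (d n)\<^sup>2))" for n t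
  have step: "(\<integral>\<^sup>+x. ennreal ((norm (u t x))\<^sup>2) * ennreal (W n x) \<partial>lebesgue) \<le> (\<Sum>i\<in>UNIV. 2 * ?A n i t + ennreal (2 * real n * (d n)\<^sup>2))" for n t
  proof -
    let ?V = "\<lambda>i x. ennreal ((norm (v n i t x))\<^sup>2 * W n x)" and ?R = "\<lambda>i x. ennreal ((norm (u t x $ i - v n i t x))\<^sup>2)"
    have Vm: "?V i \<in> borel_measurable lebesgue" for i by (rule measurable_completion) measurable
    have Rm: "?R i \<in> borel_measurable lebesgue" for i using diffs[of t i n] by (auto simp: square_integrable_def)
    have "(\<integral>\<^sup>+x. ennreal ((norm (u t x))\<^sup>2) * ennreal (W n x) \<partial>lebesgue) \<le> (\<integral>\<^sup>+x. (\<Sum>i\<in>UNIV. 2 * ?V i x + ennreal (2 * real n) * ?R i x) \<partial>lebesgue)"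
    proof (rule nn_integral_mono)
      fix x
      have "(norm (u t x $ i))\<^sup>2 * W n x \<le> 2 * ((norm (v n i t x))\<^sup>2 * W n x) + 2 * real n * (norm (u t x $ i - v n i t x))\<^sup>2" for i
      proof -
        have "(norm (u t x $ i))\<^sup>2 * W n x \<le> (2 * (norm (v n i t x))\<^sup>2 + 2 * (norm (u t x $ i - v n i t x))\<^sup>2) * W n x"
          using norm_sq_split2[of "v n i t x" "u t x $ i - v n i t x"] by (intro mult_right_mono W0) simp
        also have "\<dots> = 2 * ((norm (v n i t x))\<^sup>2 * W n x) + 2 * (norm (u t x $ i - v n i t x))\<^sup>2 * W n x"
          by (simp add: algebra_simps)
        also have "2 * (norm (u t x $ i - v n i t x))\<^sup>2 * W n x \<le> 2 * (norm (u t x $ i - v n i t x))\<^sup>2 * real n"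
          by (intro mult_left_mono Wn) auto
        finally show ?thesis by (simp add: mult_ac)
      qed
      then have "(norm (u t x))\<^sup>2 * W n x \<le> (\<Sum>i\<in>UNIV. 2 * ((norm (v n i t x))\<^sup>2 * W n x) + 2 * real n * (norm (u t x $ i - v n i t x))\<^sup>2)"
        unfolding norm_vec_sq sum_distrib_right by (intro sum_mono)
      then have "ennreal ((norm (u t x))\<^sup>2 * W n x) \<le> ennreal (\<Sum>i\<in>UNIV. 2 * ((norm (v n i t x))\<^sup>2 * W n x) + 2 * real n * (norm (u t x $ i - v n i t x))\<^sup>2)"
        by (rule ennreal_leI)
      also have "\<dots> = (\<Sum>i\<in>UNIV. ennreal (2 * ((norm (v n i t x))\<^sup>2 * W n x) + 2 * real n * (norm (u t x $ i - v n i t x))\<^sup>2))"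
        using W0 by (intro sum_ennreal[symmetric]) simp
      also have "\<dots> = (\<Sum>i\<in>UNIV. 2 * ?V i x + ennreal (2 * real n) * ?R i x)"
      proof (intro sum.cong refl)
        fix i
        have "ennreal (2 * a + b * c) = 2 * ennreal a + ennreal b * ennreal c" if "0 \<le> a" "0 \<le> b" "0 \<le> c" for a b c :: real
          using that by (simp add: ennreal_plus ennreal_mult)
        then show "ennreal (2 * ((norm (v n i t x))\<^sup>2 * W n x) + 2 * real n * (norm (u t x $ i - v n i t x))\<^sup>2) = 2 * ?V i x + ennreal (2 * real n) * ?R i x"
          using W0 by simp
      qed
      finally show "ennreal ((norm (u t x))\<^sup>2) * ennreal (W n x) \<le> (\<Sum>i\<in>UNIV. 2 * ?V i x + ennreal (2 * real n) * ?R i x)"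
        using W0 by (simp add: ennreal_mult)
    qed
    also have "\<dots> = (\<Sum>i\<in>UNIV. \<integral>\<^sup>+x. 2 * ?V i x + ennreal (2 * real n) * ?R i x \<partial>lebesgue)"
      by (rule nn_integral_sum) (intro borel_measurable_add borel_measurable_times_ennreal borel_measurable_const Vm Rm)
    also have "\<dots> = (\<Sum>i\<in>UNIV. 2 * (\<integral>\<^sup>+x. ?V i x \<partial>lebesgue) + ennreal (2 * real n) * (\<integral>\<^sup>+x. ?R i x \<partial>lebesgue))"
    proof (intro sum.cong refl)
      fix i
      have "(\<integral>\<^sup>+x. 2 * ?V i x + ennreal (2 * real n) * ?R i x \<partial>lebesgue) = (\<integral>\<^sup>+x. 2 * ?V i x \<partial>lebesgue) + (\<integral>\<^sup>+x. ennreal (2 * real n) * ?R i x \<partial>lebesgue)"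
        by (rule nn_integral_add) (intro borel_measurable_times_ennreal borel_measurable_const Vm Rm)+
      then show "(\<integral>\<^sup>+x. 2 * ?V i x + ennreal (2 * real n) * ?R i x \<partial>lebesgue) = 2 * (\<integral>\<^sup>+x. ?V i x \<partial>lebesgue) + ennreal (2 * real n) * (\<integral>\<^sup>+x. ?R i x \<partial>lebesgue)"
        unfolding nn_integral_cmult[OF Vm] nn_integral_cmult[OF Rm] .
    qed
    also have "\<dots> \<le> (\<Sum>i\<in>UNIV. 2 * ?A n i t + ennreal (2 * real n * (d n)\<^sup>2))"
    proof (intro sum_mono add_mono)
      fix i
      show "2 * (\<integral>\<^sup>+x. ?V i x \<partial>lebesgue) \<le> 2 * ?A n i t" by (simp add: nn_integral_completion)
      have "(\<integral>\<^sup>+x. ?R i x \<partial>lebesgue) \<le> ennreal ((d n)\<^sup>2)"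
        unfolding nn_integral_eq_l2norm[OF diffs] by (intro ennreal_leI power_mono approx) simp
      then have "ennreal (2 * real n) * (\<integral>\<^sup>+x. ?R i x \<partial>lebesgue) \<le> ennreal (2 * real n) * ennreal ((d n)\<^sup>2)"
        by (rule mult_left_mono) simp
      then show "ennreal (2 * real n) * (\<integral>\<^sup>+x. ?R i x \<partial>lebesgue) \<le> ennreal (2 * real n * (d n)\<^sup>2)"
        by (simp add: ennreal_mult)
    qed
    finally show ?thesis .
  qed
  have Hm[measurable]: "H n \<in> borel_measurable lborel" for n unfolding H_def by measurable
  have um: "u t \<in> borel_measurable lebesgue" for t using has_fourier_square_integrable(1)[OF u[of t]] by (simp add: square_integrable_def)
  have lower: "(\<integral>\<^sup>+x. ennreal ((norm (u t x))\<^sup>2) * ennreal (w x) \<partial>lebesgue) \<le> liminf (\<lambda>n. H n t)" for t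
  proof -
    have "(\<integral>\<^sup>+x. ennreal ((norm (u t x))\<^sup>2) * ennreal (w x) \<partial>lebesgue) = (\<integral>\<^sup>+x. liminf (\<lambda>n. ennreal ((norm (u t x))\<^sup>2) * ennreal (W n x)) \<partial>lebesgue)"
    proof (rule nn_integral_cong)
      fix x
      obtain n0 where n0: "max (norm x) (w x) \<le> real n0" using real_arch_simple by blast
      have "\<forall>\<^sub>F n in sequentially. ennreal ((norm (u t x))\<^sup>2) * ennreal (W n x) = ennreal ((norm (u t x))\<^sup>2) * ennreal (w x)"
        using eventually_ge_at_top[of n0] by eventually_elim (use n0 in \<open>auto simp: W_def weight_cutoff_def min_def\<close>)
      then have "(\<lambda>n. ennreal ((norm (u t x))\<^sup>2) * ennreal (W n x)) \<longlonglongrightarrow> ennreal ((norm (u t x))\<^sup>2) * ennreal (w x)"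
        by (rule tendsto_eventually)
      from lim_imp_Liminf[OF sequentially_bot this]
      show "ennreal ((norm (u t x))\<^sup>2) * ennreal (w x) = liminf (\<lambda>n. ennreal ((norm (u t x))\<^sup>2) * ennreal (W n x))" by simp
    qed
    also have "\<dots> \<le> liminf (\<lambda>n. \<integral>\<^sup>+x. ennreal ((norm (u t x))\<^sup>2) * ennreal (W n x) \<partial>lebesgue)"
    proof (rule nn_integral_liminf)
      fix n
      have "(\<lambda>x. ennreal (W n x)) \<in> borel_measurable lebesgue" by (rule measurable_completion) measurable
      then show "(\<lambda>x. ennreal ((norm (u t x))\<^sup>2) * ennreal (W n x)) \<in> borel_measurable lebesgue"
        using um[of t] by (intro borel_measurable_times_ennreal) auto
    qed
    also have "\<dots> \<le> liminf (\<lambda>n. H n t)"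
    proof (rule Liminf_mono)
      obtain n0 where n0: "\<bar>t\<bar> \<le> real n0" using real_arch_simple by blast
      show "\<forall>\<^sub>F n in sequentially. (\<integral>\<^sup>+x. ennreal ((norm (u t x))\<^sup>2) * ennreal (W n x) \<partial>lebesgue) \<le> H n t"
        using eventually_ge_at_top[of n0]
      proof eventually_elim
        case (elim n)
        then have "\<bar>t\<bar> \<le> real n" using n0 by linarith
        then have "t \<in> {- real n..real n}" by auto
        then show ?case using step[of t n] by (simp add: H_def)
      qed
    qed
    finally show ?thesis .
  qed
  have B: "ennreal B = 1728 * ennreal K" using K by (simp add: B_def ennreal_mult')
  have HI: "(\<integral>\<^sup>+t. H n t \<partial>lborel) \<le> 512 * (ennreal B * X) + ennreal (16 * inverse (real (Suc n)))" for n
  proof -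
    interpret weighted_kernel m B "real n" "real n" "W n"
      unfolding B_def W_def by (rule weight_cutoff_kernel[OF m w w0 fin K test])
    let ?c = "ennreal (2 * real n * (d n)\<^sup>2)" and ?ind = "\<lambda>t. indicator {- real n..real n} t :: ennreal"
    have Am: "(\<lambda>t. ?ind t * ?A n i t) \<in> borel_measurable lborel" for i by measurable
    have A: "(\<integral>\<^sup>+t. ?ind t * ?A n i t \<partial>lborel) \<le> 64 * (ennreal B * X)" for i
    proof -
      have "wave_energy lborel m (P n i) \<le> 16 * X"
        unfolding P_def X_def by (rule order_trans[OF cutoff_energy_le half_wave_energy[OF m _ Fs p(2)]]) simp
      moreover have "wave_energy lborel m (Q n i) \<le> 16 * X"
        unfolding Q_def X_def by (rule order_trans[OF cutoff_energy_le half_wave_energy[OF m _ Fs q(2)]]) simp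
      ultimately have "(\<integral>\<^sup>+t. ?ind t * ?A n i t \<partial>lborel) \<le> 4 * (ennreal B * (16 * X))"
        unfolding v_def by (rule two_waves[OF P Q])
      also have "\<dots> = (4 * 16) * (ennreal B * X)" by (simp only: mult_ac)
      also have "\<dots> = 64 * (ennreal B * X)" by simp
      finally show ?thesis .
    qed
    have "(\<integral>\<^sup>+t. H n t \<partial>lborel) = (\<integral>\<^sup>+t. (\<Sum>i\<in>(UNIV::4 set). 2 * (?ind t * ?A n i t) + ?c * ?ind t) \<partial>lborel)"
      unfolding H_def by (intro nn_integral_cong) (simp only: sum_distrib_left distrib_left mult.left_commute mult.commute)
    also have "\<dots> = (\<Sum>i\<in>(UNIV::4 set). \<integral>\<^sup>+t. 2 * (?ind t * ?A n i t) + ?c * ?ind t \<partial>lborel)"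
      by (rule nn_integral_sum) measurable
    also have "\<dots> = (\<Sum>i\<in>(UNIV::4 set). 2 * (\<integral>\<^sup>+t. ?ind t * ?A n i t \<partial>lborel) + ?c * ennreal (2 * real n))"
    proof (intro sum.cong refl)
      fix i
      have "(\<integral>\<^sup>+t. 2 * (?ind t * ?A n i t) + ?c * ?ind t \<partial>lborel) = (\<integral>\<^sup>+t. 2 * (?ind t * ?A n i t) \<partial>lborel) + (\<integral>\<^sup>+t. ?c * ?ind t \<partial>lborel)"
        by (rule nn_integral_add) measurable
      also have "(\<integral>\<^sup>+t. 2 * (?ind t * ?A n i t) \<partial>lborel) = 2 * (\<integral>\<^sup>+t. ?ind t * ?A n i t \<partial>lborel)"
        by (rule nn_integral_cmult[OF Am])
      also have "(\<integral>\<^sup>+t. ?c * ?ind t \<partial>lborel) = ?c * ennreal (2 * real n)"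
        by (subst nn_integral_cmult_indicator) auto
      finally show "(\<integral>\<^sup>+t. 2 * (?ind t * ?A n i t) + ?c * ?ind t \<partial>lborel) = 2 * (\<integral>\<^sup>+t. ?ind t * ?A n i t \<partial>lborel) + ?c * ennreal (2 * real n)" .
    qed
    also have "\<dots> \<le> (\<Sum>i\<in>(UNIV::4 set). 2 * (64 * (ennreal B * X)) + ?c * ennreal (2 * real n))"
      by (intro sum_mono add_mono mult_left_mono A) auto
    also have "\<dots> = 4 * (2 * (64 * (ennreal B * X))) + 4 * (?c * ennreal (2 * real n))"
      by (simp add: distrib_left)
    also have "4 * (2 * (64 * (ennreal B * X))) = (4 * 2 * 64) * (ennreal B * X)" by (simp only: mult.assoc)
    also have "(4 * 2 * 64) * (ennreal B * X) = 512 * (ennreal B * X)" by simp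
    also have "4 * (?c * ennreal (2 * real n)) = ennreal (4 * (2 * real n * (d n)\<^sup>2 * (2 * real n)))"
    proof -
      have "4 * (ennreal a * ennreal b) = ennreal (4 * (a * b))" if "0 \<le> a" "0 \<le> b" for a b
        using that by (simp add: ennreal_mult)
      then show ?thesis by simp
    qed
    also have "\<dots> \<le> ennreal (16 * inverse (real (Suc n)))"
    proof (rule ennreal_leI)
      let ?s = "inverse (real (Suc n))"
      have "real n * ?s \<le> 1" by (simp add: field_simps)
      then have "(real n * ?s)\<^sup>2 \<le> 1" by (simp add: power_le_one)
      moreover have "?s\<^sup>2 \<le> ?s"
      proof -
        have "?s \<le> 1" by (simp add: field_simps)
        then have "?s * ?s \<le> 1 * ?s" by (rule mult_right_mono) simp
        then show ?thesis by (simp add: power2_eq_square)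
      qed
      ultimately have "(real n * ?s)\<^sup>2 * ?s\<^sup>2 \<le> 1 * ?s" by (intro mult_mono) auto
      moreover have "4 * (2 * real n * (d n)\<^sup>2 * (2 * real n)) = 16 * ((real n * ?s)\<^sup>2 * ?s\<^sup>2)"
        by (simp add: d_def power2_eq_square mult_ac)
      ultimately show "4 * (2 * real n * (d n)\<^sup>2 * (2 * real n)) \<le> 16 * ?s" by simp
    qed
    finally show ?thesis by (simp add: add_left_mono)
  qed
  have "(\<integral>\<^sup>+t. (\<integral>\<^sup>+x. ennreal ((norm (u t x))\<^sup>2) * ennreal (w x) \<partial>lebesgue) \<partial>lebesgue) \<le> (\<integral>\<^sup>+t. liminf (\<lambda>n. H n t) \<partial>lebesgue)"
    by (intro nn_integral_mono lower)
  also have "\<dots> = (\<integral>\<^sup>+t. liminf (\<lambda>n. H n t) \<partial>lborel)" by (rule nn_integral_completion)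
  also have "\<dots> \<le> liminf (\<lambda>n. \<integral>\<^sup>+t. H n t \<partial>lborel)" by (rule nn_integral_liminf) measurable
  also have "\<dots> \<le> liminf (\<lambda>n. 512 * (ennreal B * X) + ennreal (16 * inverse (real (Suc n))))"
    by (intro Liminf_mono always_eventually allI HI)
  also have "\<dots> = 512 * (ennreal B * X) + ennreal (16 * 0)"
    by (intro lim_imp_Liminf sequentially_bot tendsto_add tendsto_const tendsto_ennrealI tendsto_mult LIMSEQ_inverse_real_of_nat)
  also have "\<dots> = ennreal (512 * (1728 * K)) * X"
    using K by (simp add: B ennreal_mult' mult.assoc[symmetric])
  finally show ?thesis unfolding X_def .
qed

section \<open>Weights of Kerman--Sawyer class\<close>

lemma dyadic_cube_finite_integral:
  assumes w: "weight w"
  shows "(\<integral>\<^sup>+x\<in>dyadic_cube k n. w x \<partial>lebesgue) < \<infinity>"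
proof -
  let ?C = "cbox (\<chi> i. 2 powi k * real_of_int (n $ i)) (\<chi> i. 2 powi k * (real_of_int (n $ i) + 1)) :: (real^3) set"
  have "(\<integral>\<^sup>+x\<in>dyadic_cube k n. w x \<partial>lebesgue) \<le> (\<integral>\<^sup>+x\<in>?C. w x \<partial>lebesgue)"
    by (intro nn_integral_mono mult_left_mono) (auto simp: dyadic_cube_def mem_box_cart indicator_def less_imp_le)
  also have "\<dots> < \<infinity>" using w unfolding weight_def by (meson compact_cbox)
  finally show ?thesis .
qed

text \<open>
  Local integrability makes the weight finite almost everywhere on each of countably many balls.
\<close>

lemma real_representative_of_weight:
  assumes w: "weight w"
  obtains v :: "real^3 \<Rightarrow> real" where "v \<in> borel_measurable borel" "\<And>x. 0 \<le> v x" "AE x in lborel. w x = ennreal (v x)"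
proof -
  have "w \<in> borel_measurable lebesgue" using w by (simp add: weight_def)
  then obtain w1 where w1[measurable]: "w1 \<in> borel_measurable lborel" and ae: "AE x in lborel. w x = w1 x"
    using completion_ex_borel_measurable by blast
  have "AE x in lborel. w1 x * indicator (cball 0 (real n)) x \<noteq> \<infinity>" for n
  proof (rule nn_integral_noteq_infinite)
    show "(\<lambda>x. w1 x * indicator (cball 0 (real n)) x) \<in> borel_measurable lborel"
      by (intro borel_measurable_times_ennreal borel_measurable_indicator w1) simp
    have "(\<integral>\<^sup>+x. w1 x * indicator (cball 0 (real n)) x \<partial>lborel) = (\<integral>\<^sup>+x. w x * indicator (cball 0 (real n)) x \<partial>lborel)"
    proof (rule nn_integral_cong_AE)
      show "AE x in lborel. w1 x * indicator (cball 0 (real n)) x = w x * indicator (cball 0 (real n)) x"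
        using ae by eventually_elim simp
    qed
    also have "\<dots> = (\<integral>\<^sup>+x\<in>cball 0 (real n). w x \<partial>lebesgue)" by (simp add: nn_integral_completion)
    also have "\<dots> < \<infinity>" using w unfolding weight_def by (meson compact_cball)
    finally show "(\<integral>\<^sup>+x. w1 x * indicator (cball 0 (real n)) x \<partial>lborel) \<noteq> \<infinity>" by simp
  qed
  then have "AE x in lborel. \<forall>n. w1 x * indicator (cball 0 (real n)) x \<noteq> \<infinity>"
    by (simp add: AE_all_countable)
  then have fin: "AE x in lborel. w1 x \<noteq> \<infinity>"
  proof eventually_elim
    case (elim x)
    obtain n where "norm x \<le> real n" using real_arch_simple by blast
    then show ?case using elim[rule_format, of n] by simp
  qed
  show thesis
  proof (rule that[of "\<lambda>x. enn2real (w1 x)"])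
    show "(\<lambda>x. enn2real (w1 x)) \<in> borel_measurable borel" using w1 by simp
    show "AE x in lborel. w x = ennreal (enn2real (w1 x))"
      using ae fin by eventually_elim (simp add: less_top)
  qed simp
qed

text \<open>
  On a cube of mass zero the energy vanishes as well, in agreement with the convention in
  \<open>KS_norm\<close>.
\<close>

lemma KS_test:
  assumes w: "weight w" and K: "KS_norm w \<le> ennreal K"
  shows "(\<integral>\<^sup>+x\<in>dyadic_cube k n. (\<integral>\<^sup>+y\<in>dyadic_cube k n. w x * w y * newton_kernel x y \<partial>lebesgue) \<partial>lebesgue)
    \<le> ennreal K * (\<integral>\<^sup>+x\<in>dyadic_cube k n. w x \<partial>lebesgue)"
proof -
  let ?I = "\<integral>\<^sup>+x\<in>dyadic_cube k n. (\<integral>\<^sup>+y\<in>dyadic_cube k n. w x * w y * newton_kernel x y \<partial>lebesgue) \<partial>lebesgue"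
  let ?m = "\<integral>\<^sup>+x\<in>dyadic_cube k n. w x \<partial>lebesgue"
  have Q: "dyadic_cube k n \<in> sets lebesgue" by (simp add: sets_completionI_sets)
  have wm: "w \<in> borel_measurable lebesgue" using w by (simp add: weight_def)
  show ?thesis
  proof (cases "?m = 0")
    case True
    have "AE x in lebesgue. w x * indicator (dyadic_cube k n) x = 0"
      using True by (subst (asm) nn_integral_0_iff_AE) (intro borel_measurable_times_ennreal borel_measurable_indicator wm Q, simp)
    then have "?I = (\<integral>\<^sup>+x. 0 \<partial>(lebesgue :: (real^3) measure))"
    proof (intro nn_integral_cong_AE, eventually_elim)
      case (elim x)
      show ?case
      proof (cases "x \<in> dyadic_cube k n")
        case True
        then have "w x = 0" using elim by simp
        then show ?thesis by simp
      qed simp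
    qed
    then show ?thesis by simp
  next
    case False
    have fin: "?m < \<infinity>" by (rule dyadic_cube_finite_integral[OF w])
    have "inverse ?m * ?I \<le> KS_norm w"
      unfolding KS_norm_def by (rule SUP_upper2[of "(k, n)"]) (use False in \<open>auto simp: Let_def\<close>)
    then have "inverse ?m * ?I \<le> ennreal K" using K by (rule order_trans)
    then have "?m * (inverse ?m * ?I) \<le> ?m * ennreal K" by (rule mult_left_mono) simp
    moreover have "?m * (inverse ?m * ?I) = ?I"
    proof -
      have "?m * inverse ?m = 1" using ennreal_divide_self[of ?m] False fin by (simp add: divide_ennreal_def)
      then show ?thesis unfolding mult.assoc[symmetric] by simp
    qed
    ultimately show ?thesis by (simp add: mult.commute)
  qed
qed

lemma dirac_energy_le_japanese: "0 < m \<Longrightarrow> dirac_energy m \<xi> \<le> max 1 m * japanese \<xi>"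
proof -
  assume m: "0 < m"
  have "(norm \<xi>)\<^sup>2 + m\<^sup>2 \<le> (max 1 m)\<^sup>2 * (norm \<xi>)\<^sup>2 + (max 1 m)\<^sup>2 * 1"
  proof (rule add_mono)
    have "1 * (norm \<xi>)\<^sup>2 \<le> (max 1 m)\<^sup>2 * (norm \<xi>)\<^sup>2" by (intro mult_right_mono) (auto simp: one_le_power)
    then show "(norm \<xi>)\<^sup>2 \<le> (max 1 m)\<^sup>2 * (norm \<xi>)\<^sup>2" by simp
    show "m\<^sup>2 \<le> (max 1 m)\<^sup>2 * 1" using m by (simp add: power_mono)
  qed
  also have "\<dots> = (max 1 m * japanese \<xi>)\<^sup>2" by (simp add: japanese_def power_mult_distrib distrib_left)
  finally have "sqrt ((norm \<xi>)\<^sup>2 + m\<^sup>2) \<le> sqrt ((max 1 m * japanese \<xi>)\<^sup>2)" by (rule real_sqrt_le_mono)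
  then show ?thesis using m japanese_ge_1[of \<xi>] by (simp add: dirac_energy_def abs_mult)
qed

lemma energy_le_H_half:
  assumes m: "0 < m" and F: "has_fourier f F" and f: "f \<in> H_half"
  shows "wave_energy lebesgue m F \<le> ennreal (max 1 m * (H_half_norm f)\<^sup>2)"
proof -
  have b: "square_integrable lebesgue (sobolev_half F)" using H_half_iff[OF F] f by blast
  have bm: "(\<lambda>\<xi>. ennreal ((norm (sobolev_half F \<xi>))\<^sup>2)) \<in> borel_measurable lebesgue" using b by (auto simp: square_integrable_def)
  have "wave_energy lebesgue m F \<le> (\<integral>\<^sup>+\<xi>. ennreal (max 1 m) * ennreal ((norm (sobolev_half F \<xi>))\<^sup>2) \<partial>lebesgue)"
  proof (rule nn_integral_mono)
    fix \<xi>
    have "dirac_energy m \<xi> * (norm (F \<xi>))\<^sup>2 \<le> (max 1 m * japanese \<xi>) * (norm (F \<xi>))\<^sup>2"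
      by (intro mult_right_mono dirac_energy_le_japanese m) simp
    also have "\<dots> = max 1 m * (norm (sobolev_half F \<xi>))\<^sup>2" by (simp add: norm_sobolev_half_sq)
    finally have "ennreal (dirac_energy m \<xi> * (norm (F \<xi>))\<^sup>2) \<le> ennreal (max 1 m * (norm (sobolev_half F \<xi>))\<^sup>2)" by (rule ennreal_leI)
    also have "\<dots> = ennreal (max 1 m) * ennreal ((norm (sobolev_half F \<xi>))\<^sup>2)" by (rule ennreal_mult) auto
    finally show "ennreal (dirac_energy m \<xi> * (norm (F \<xi>))\<^sup>2) \<le> ennreal (max 1 m) * ennreal ((norm (sobolev_half F \<xi>))\<^sup>2)" .
  qed
  also have "\<dots> = ennreal (max 1 m) * ennreal ((H_half_norm f)\<^sup>2)"
    unfolding nn_integral_cmult[OF bm] nn_integral_eq_l2norm[OF b] H_half_norm_eq[OF F f] ..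
  also have "\<dots> = ennreal (max 1 m * (H_half_norm f)\<^sup>2)" by (rule ennreal_mult[symmetric]) auto
  finally show ?thesis .
qed

lemma H_half_norm_nonneg: "0 \<le> H_half_norm f" by (simp add: H_half_norm_def L2_norm_def)

text \<open>
  The weight is replaced by a real-valued representative, which changes neither the testing
  condition nor the norm of \<open>u\<close>. As \<open>weighted_estimate\<close> requires a
  positive constant, it is applied with \<open>K + e\<close>, and \<open>e\<close> tends to 0;
  this includes the case \<open>KS_norm w = 0\<close>.
\<close>

lemma dirac_weighted_bound:
  assumes m: "0 < m" and w: "w \<in> KS" and f: "f \<in> H_half" and u: "dirac_solution m f u"
  shows "weighted_L2_norm w u \<le> ennreal (sqrt (512 * 1728 * max 1 m)) * ennsqrt (KS_norm w) * ennreal (H_half_norm f)"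
proof -
  have wt: "weight w" and KSfin: "KS_norm w < \<infinity>" using w by (auto simp: KS_def)
  obtain F where F: "has_fourier f F"
    using f unfolding H_half_def half_bessel_def fourier_multiplier_def by blast
  obtain v :: "real^3 \<Rightarrow> real" where v[measurable]: "v \<in> borel_measurable borel" and v0: "\<And>x. 0 \<le> v x" and ae: "AE x in lborel. w x = ennreal (v x)"
    using real_representative_of_weight[OF wt] by blast
  define K where "K = enn2real (KS_norm w)"
  have K: "KS_norm w = ennreal K" "0 \<le> K" using KSfin by (simp_all add: K_def less_top)
  have mass: "(\<integral>\<^sup>+x\<in>dyadic_cube k n. v x \<partial>lborel) = (\<integral>\<^sup>+x\<in>dyadic_cube k n. w x \<partial>lebesgue)" for k n
    unfolding nn_integral_completion
  proof (rule nn_integral_cong_AE)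
    show "AE x in lborel. ennreal (v x) * indicator (dyadic_cube k n) x = w x * indicator (dyadic_cube k n) x"
      using ae by eventually_elim simp
  qed
  have energy: "(\<integral>\<^sup>+x\<in>dyadic_cube k n. (\<integral>\<^sup>+y\<in>dyadic_cube k n. v x * v y * newton_kernel x y \<partial>lborel) \<partial>lborel)
     = (\<integral>\<^sup>+x\<in>dyadic_cube k n. (\<integral>\<^sup>+y\<in>dyadic_cube k n. w x * w y * newton_kernel x y \<partial>lebesgue) \<partial>lebesgue)" for k n
    unfolding nn_integral_completion
  proof (rule nn_integral_cong_AE)
    show "AE x in lborel. (\<integral>\<^sup>+y\<in>dyadic_cube k n. v x * v y * newton_kernel x y \<partial>lborel) * indicator (dyadic_cube k n) x
      = (\<integral>\<^sup>+y\<in>dyadic_cube k n. w x * w y * newton_kernel x y \<partial>lborel) * indicator (dyadic_cube k n) x"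
      using ae
    proof eventually_elim
      case (elim x)
      have "(\<integral>\<^sup>+y\<in>dyadic_cube k n. v x * v y * newton_kernel x y \<partial>lborel)
        = (\<integral>\<^sup>+y\<in>dyadic_cube k n. w x * w y * newton_kernel x y \<partial>lborel)"
      proof (rule nn_integral_cong_AE)
        show "AE y in lborel. ennreal (v x * v y) * newton_kernel x y * indicator (dyadic_cube k n) y
          = w x * w y * newton_kernel x y * indicator (dyadic_cube k n) y"
          using ae by eventually_elim (simp add: elim ennreal_mult v0)
      qed
      then show ?case by simp
    qed
  qed
  define H where "H = H_half_norm f"
  let ?X = "\<integral>\<^sup>+t. (\<integral>\<^sup>+x. ennreal ((norm (u t x))\<^sup>2) * w x \<partial>lebesgue) \<partial>lebesgue"
  have X: "?X = (\<integral>\<^sup>+t. (\<integral>\<^sup>+x. ennreal ((norm (u t x))\<^sup>2) * ennreal (v x) \<partial>lebesgue) \<partial>lebesgue)"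
  proof (rule nn_integral_cong, rule nn_integral_cong_AE)
    fix t
    show "AE x in lebesgue. ennreal ((norm (u t x))\<^sup>2) * w x = ennreal ((norm (u t x))\<^sup>2) * ennreal (v x)"
      using AE_completion[OF ae] by eventually_elim simp
  qed
  have bound: "?X \<le> ennreal (512 * 1728 * max 1 m * H\<^sup>2 * (K + e))" if e: "e > 0" for e
  proof -
    have Ke: "0 < K + e" using K(2) e by linarith
    have "KS_norm w \<le> ennreal (K + e)" unfolding K(1) using e by (intro ennreal_leI) simp
    note test = KS_test[OF wt this]
    have "?X \<le> ennreal (512 * (1728 * (K + e))) * wave_energy lebesgue m F"
      unfolding X
    proof (rule weighted_estimate[OF m v v0 _ Ke _ F])
      show "(\<integral>\<^sup>+x\<in>dyadic_cube k n. v x \<partial>lborel) < \<infinity>" for k n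
        unfolding mass by (rule dyadic_cube_finite_integral[OF wt])
      show "(\<integral>\<^sup>+x\<in>dyadic_cube k n. (\<integral>\<^sup>+y\<in>dyadic_cube k n. v x * v y * newton_kernel x y \<partial>lborel) \<partial>lborel)
        \<le> ennreal (K + e) * (\<integral>\<^sup>+x\<in>dyadic_cube k n. v x \<partial>lborel)" for k n
        unfolding mass energy by (rule test)
      show "has_fourier (u t) (propagate m F t)" for t by (rule dirac_solution_fourier[OF m F u])
    qed
    also have "\<dots> \<le> ennreal (512 * (1728 * (K + e))) * ennreal (max 1 m * H\<^sup>2)"
      unfolding H_def by (intro mult_left_mono energy_le_H_half m F f) simp
    also have "\<dots> = ennreal (512 * (1728 * (K + e)) * (max 1 m * H\<^sup>2))"
      using Ke by (intro ennreal_mult[symmetric]) auto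
    also have "512 * (1728 * (K + e)) * (max 1 m * H\<^sup>2) = 512 * 1728 * max 1 m * H\<^sup>2 * (K + e)" by (simp only: mult_ac)
    finally show ?thesis .
  qed
  let ?c = "512 * 1728 * max 1 m * H\<^sup>2"
  have c0: "0 \<le> ?c" by simp
  have Xfin: "?X \<noteq> \<infinity>" using bound[of 1] by (auto simp: top_unique)
  define Y where "Y = enn2real ?X"
  have Y: "?X = ennreal Y" "0 \<le> Y" using Xfin by (simp_all add: Y_def less_top)
  have Yle: "Y \<le> ?c * (K + e)" if "e > 0" for e
    using bound[OF that] c0 K(2) that unfolding Y(1) by (subst (asm) ennreal_le_iff) auto
  have "((\<lambda>e. ?c * (K + e)) \<longlongrightarrow> ?c * (K + 0)) (at_right 0)"
    by (intro tendsto_intros)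
  moreover have "\<forall>\<^sub>F e in at_right 0. Y \<le> ?c * (K + e)"
    using eventually_at_right_less[of "0::real"] by eventually_elim (rule Yle)
  ultimately have "Y \<le> ?c * (K + 0)"
    by (rule tendsto_lowerbound) simp
  then have YK: "Y \<le> 512 * 1728 * max 1 m * K * H\<^sup>2" by (simp add: mult_ac)
  have "weighted_L2_norm w u = ennreal (sqrt Y)"
    unfolding weighted_L2_norm_def ennsqrt_def Y(1) using Y(2) by simp
  also have "\<dots> \<le> ennreal (sqrt (512 * 1728 * max 1 m * K * H\<^sup>2))"
    by (intro ennreal_leI real_sqrt_le_mono YK)
  also have "sqrt (512 * 1728 * max 1 m * K * H\<^sup>2) = sqrt (512 * 1728 * max 1 m) * sqrt K * H"
    using H_half_norm_nonneg[of f] unfolding real_sqrt_mult H_def by simp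
  also have "ennreal \<dots> = ennreal (sqrt (512 * 1728 * max 1 m)) * ennreal (sqrt K) * ennreal H"
  proof -
    have "ennreal (a * b * c) = ennreal a * ennreal b * ennreal c" if "0 \<le> a" "0 \<le> b" "0 \<le> c" for a b c :: real
      using that by (simp add: ennreal_mult)
    from this[of _ "sqrt K" H] show ?thesis using H_half_norm_nonneg[of f] K(2) unfolding H_def by simp
  qed
  also have "ennreal (sqrt K) = ennsqrt (KS_norm w)"
    unfolding K(1) ennsqrt_def using K(2) by simp
  finally show ?thesis unfolding H_def .
qed

theorem theorem1p1:
  fixes m :: real
  assumes "m > 0"
  shows "\<exists>C::real. C > 0 \<and>
    (\<forall>w\<in>KS. \<forall>f\<in>H_half.
      (\<exists>u. dirac_solution m f u) \<and>
      (\<forall>u. dirac_solution m f u \<longrightarrow>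
        continuous_into_H_half {0..} u \<and>
        weighted_L2_norm w u \<le> ennreal C * ennsqrt (KS_norm w) * ennreal (H_half_norm f)))"
proof (intro exI[of _ "sqrt (512 * 1728 * max 1 m)"] conjI ballI allI impI)
  show "0 < sqrt (512 * 1728 * max 1 m)" by simp
  fix w f assume w: "w \<in> KS" and f: "f \<in> H_half"
  obtain F where F: "has_fourier f F"
    using f unfolding H_half_def half_bessel_def fourier_multiplier_def by blast
  show "\<exists>u. dirac_solution m f u" by (rule dirac_solution_exists[OF assms F])
  fix u assume u: "dirac_solution m f u"
  show "continuous_into_H_half {0..} u" by (rule dirac_solution_continuous[OF assms F f u])
  show "weighted_L2_norm w u \<le> ennreal (sqrt (512 * 1728 * max 1 m)) * ennsqrt (KS_norm w) * ennreal (H_half_norm f)"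
    by (rule dirac_weighted_bound[OF assms w f u])
qed

end
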